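(* Let $f:\mathbb{T}\to\mathbb{R}$ be a continuous function on the circle $\mathbb{T}=\mathbb{R}/\mathbb{Z}$. Then there exists an absolutely continuous homeomorphism $\phi:\mathbb{T}\to\mathbb{T}$ such that the Fourier series of $f\circ\phi$ converges uniformly on $\mathbb{T}$. Further, for any $p<\infty$ the homeomorphism $\phi$ can be chosen so that, in addition, $\phi'\in L^{p}(\mathbb{T})$.
   Context: The Fourier series of $g$ converges uniformly if its symmetric partial sums $S_r(g)(x)=\sum_{|k|\le r}\widehat g(k)e^{2\pi i kx}$ converge uniformly in $x$ as $r\to\infty$. *)

theory Defs
  imports "HOL-Analysis.Analysis"
begin

text \<open>The circle \<open>\<real>/\<int>\<close>, with the quotient map \<open>to_circle\<close> and the quotient topology.\<close>

quotient_type circle = real / "\<lambda>x y :: real. x - y \<in> \<int>"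
  morphisms rep_circle to_circle
proof (rule equivpI)
  show "reflp (\<lambda>x y :: real. x - y \<in> \<int>)"
    by (simp add: reflp_def)
  show "symp (\<lambda>x y :: real. x - y \<in> \<int>)"
    by (metis (no_types, lifting) Ints_minus minus_diff_eq sympI)
  show "transp (\<lambda>x y :: real. x - y \<in> \<int>)"
    by (rule transpI) (metis Ints_add diff_add_cancel add_diff_eq)
qed

instantiation circle :: topological_space
begin

definition open_circle :: "circle set \<Rightarrow> bool"
  where "open_circle U \<longleftrightarrow> open (to_circle -` U)"

instance
proof
  show "open (UNIV :: circle set)"
    by (simp add: open_circle_def)
  show "open (S \<inter> T)" if "open S" "open T" for S T :: "circle set"
    using that by (simp add: open_circle_def open_Int)
  show "open (\<Union> K)" if "\<forall>S\<in>K. open S" for K :: "circle set set"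
    using that by (simp add: open_circle_def vimage_Union open_UN)
qed

end

lift_definition circle_char :: "int \<Rightarrow> circle \<Rightarrow> complex"
  is "\<lambda>k x. exp (2 * of_real pi * \<i> * of_int k * of_real x)"
proof -
  fix k :: int and x y :: real
  assume "x - y \<in> \<int>"
  then obtain n where "x = y + of_int n"
    by (metis Ints_cases add.commute diff_add_cancel)
  then have "2 * of_real pi * \<i> * of_int k * of_real x
      = 2 * of_real pi * \<i> * of_int k * of_real y + of_real (of_int (2 * (k * n)) * pi) * \<i>"
    by (simp add: algebra_simps)
  then show "exp (2 * of_real pi * \<i> * of_int k * of_real x)
      = exp (2 * of_real pi * \<i> * of_int k * of_real y)"
    unfolding exp_eq by blast
qed

definition fourier_coeff :: "(circle \<Rightarrow> complex) \<Rightarrow> int \<Rightarrow> complex" where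
  "fourier_coeff g k =
     (LINT x:{0..1}|lebesgue. g (to_circle x) * circle_char (- k) (to_circle x))"

definition fourier_partial_sum :: "(circle \<Rightarrow> complex) \<Rightarrow> nat \<Rightarrow> circle \<Rightarrow> complex" where
  "fourier_partial_sum g r t = (\<Sum>k\<in>{- int r..int r}. fourier_coeff g k * circle_char k t)"

definition fourier_series_converges_uniformly :: "(circle \<Rightarrow> complex) \<Rightarrow> bool" where
  "fourier_series_converges_uniformly g \<longleftrightarrow>
     uniformly_convergent_on UNIV (fourier_partial_sum g)"

text \<open>Absolute continuity in the classical sense. A finite family of non-overlapping intervals
  is given by the set \<open>D\<close> of the pairs of their endpoints.\<close>

definition absolutely_continuous_on :: "real set \<Rightarrow> (real \<Rightarrow> real) \<Rightarrow> bool" where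
  "absolutely_continuous_on S F \<longleftrightarrow>
     (\<forall>\<epsilon>>0. \<exists>\<delta>>0. \<forall>D :: (real \<times> real) set.
        finite D \<longrightarrow>
        (\<forall>(a, b)\<in>D. a \<le> b \<and> {a..b} \<subseteq> S) \<longrightarrow>
        pairwise (\<lambda>(a, b) (c, d). {a<..<b} \<inter> {c<..<d} = {}) D \<longrightarrow>
        (\<Sum>(a, b)\<in>D. b - a) < \<delta> \<longrightarrow>
        (\<Sum>(a, b)\<in>D. \<bar>F b - F a\<bar>) < \<epsilon>)"

definition is_circle_lift :: "(real \<Rightarrow> real) \<Rightarrow> (circle \<Rightarrow> circle) \<Rightarrow> bool" where
  "is_circle_lift F \<phi> \<longleftrightarrow>
     continuous_on UNIV F \<and> (\<forall>x. \<phi> (to_circle x) = to_circle (F x))"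

text \<open>Two lifts of the same map differ by an integer constant, so neither absolute continuity
  nor the derivative depends on the choice of the lift. For a lift \<open>F\<close> of \<open>\<phi>\<close> the difference
  \<open>F (x + 1) - F x\<close> is constant, so one period determines both.\<close>

definition circle_absolutely_continuous :: "(circle \<Rightarrow> circle) \<Rightarrow> bool" where
  "circle_absolutely_continuous \<phi> \<longleftrightarrow>
     (\<exists>F. is_circle_lift F \<phi> \<and> absolutely_continuous_on {0..1} F)"

definition in_Lp :: "real \<Rightarrow> real measure \<Rightarrow> (real \<Rightarrow> real) \<Rightarrow> bool" where
  "in_Lp p M g \<longleftrightarrow> g \<in> borel_measurable M \<and> integrable M (\<lambda>x. \<bar>g x\<bar> powr p)"

text \<open>The derivative of \<open>\<phi>\<close> exists almost everywhere and lies in \<open>L\<^sup>p\<close>. The values of \<open>deriv F\<close>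
  at points where \<open>F\<close> is not differentiable are irrelevant, as these form a null set.\<close>

definition circle_deriv_in_Lp :: "real \<Rightarrow> (circle \<Rightarrow> circle) \<Rightarrow> bool" where
  "circle_deriv_in_Lp p \<phi> \<longleftrightarrow>
     (\<exists>F. is_circle_lift F \<phi> \<and>
          (AE x in lebesgue_on {0..1}. F differentiable (at x)) \<and>
          in_Lp p (lebesgue_on {0..1}) (deriv F))"

end

theory Submission
  imports Defs "HOL-Complex_Analysis.Great_Picard"
begin

text \<open>The homeomorphism is the inverse of a limit of piecewise linear maps \<open>u\<close>. On every dyadic interval
  \<open>u\<close> splits the image in a ratio \<open>p\<close> close to \<open>1 / 2\<close>, the ratio being selected from an equidistributed set
  around \<open>1 / 2\<close> whose width is proportional to the local oscillation of \<open>f\<close>.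
  Averaging over the ratios makes the oscillatory integrals of \<open>f \<circ> u\<^sup>-\<^sup>1\<close> decay like a power of the
  frequency; an exponential-moment argument, applied to the dyadic levels one after another, selects ratios
  for which the deviation from this average is small for all frequencies and all dyadic blocks at once.
  The resulting estimate \<open>\<bar>\<integral>\<^sub>I g(y) e(\<mu> y) dy\<bar> \<le> K (\<mu> \<bar>I\<bar>)\<^sup>-\<^sup>1\<^sup>/\<^sup>3\<^sup>2 \<bar>I\<bar>\<close> on the image \<open>I\<close> of every dyadic interval, where
  \<open>g = f \<circ> u\<^sup>-\<^sup>1\<close>, implies uniform convergence: one decomposes the circle into such intervals whose length is adapted to
  their distance from the singularity of the Dirichlet kernel and freezes the factor \<open>1 / sin\<close> on each of them.
  The widths are square summable against the energy of \<open>f\<close> along the dyadic tree, which bounds the \<open>L\<^sup>p\<close> norms of the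
  difference quotients of \<open>u\<^sup>-\<^sup>1\<close> on the dyadic grids; Fatou's lemma passes to the derivative.\<close>

section \<open>Exponentials and oscillatory averages\<close>

text \<open>Two demands compete. Ratios of a fixed width would give decay at all frequencies but no
  control of the densities, while the ratio 1/2 keeps the map trivial and gains nothing. Tying the
  width at a node to \<open>amp\<close> resolves this: where the values below a node hardly vary,
  the transform is close to that of a constant and decays by itself; where they vary much, the
  ratios are spread widely; and the Haar energy of a bounded function pays for all squared widths.
  The second obstacle is that one choice of ratios must serve all frequencies on blocks of all
  heights, and a choice made for large blocks must not spoil the small ones. Hence the choices are
  shifts in a cyclic group and all estimates hold uniformly under common shifts of a block, so that
  a larger block may shift its parts as wholes. The exponents are 1/6 for averaged transforms, 1/8
  for selection at heights that are powers of two, 1/16 at all heights, and 1/32 because frequencies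
  are measured by powers of 4. The widths are computed from the leaves upwards, so grids of
  different depths are not nested and the limit needs compactness.\<close>

definition ee :: "real \<Rightarrow> complex" where
  "ee x = cis (2 * pi * x)"

lemma ee_add: "ee (x + y) = ee x * ee y"
  by (simp add: ee_def cis_mult distrib_left)

lemma norm_ee [simp]: "norm (ee x) = 1"
  by (simp add: ee_def)

lemma ee_0 [simp]: "ee 0 = 1"
  by (simp add: ee_def)

lemma ee_nonzero [simp]: "ee x \<noteq> 0"
  by (simp add: ee_def)

lemma ee_minus: "ee (- x) = cnj (ee x)"
  by (simp add: ee_def cis_cnj)

lemma ee_power: "ee x ^ n = ee (real n * x)"
  by (simp add: ee_def Complex.DeMoivre mult_ac)

lemma continuous_on_ee [continuous_intros]:
  "continuous_on S f \<Longrightarrow> continuous_on S (\<lambda>x. ee (f x))"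
  unfolding ee_def by (intro continuous_intros)

lemma norm_ee_diff: "norm (ee x - ee y) = 2 * \<bar>sin (pi * (x - y))\<bar>"
proof -
  have "(norm (ee x - ee y))\<^sup>2
      = (cos (2*pi*x) - cos (2*pi*y))\<^sup>2 + (sin (2*pi*x) - sin (2*pi*y))\<^sup>2"
    by (simp add: ee_def cmod_power2)
  also have "\<dots> = ((sin (2*pi*x))\<^sup>2 + (cos (2*pi*x))\<^sup>2) + ((sin (2*pi*y))\<^sup>2 + (cos (2*pi*y))\<^sup>2)
      - 2 * (cos (2*pi*x) * cos (2*pi*y) + sin (2*pi*x) * sin (2*pi*y))"
    by (simp only: power2_eq_square) (simp add: algebra_simps)
  also have "\<dots> = 2 - 2 * cos (2*pi*x - 2*pi*y)"
    by (simp only: sin_cos_squared_add cos_diff)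
  also have "2*pi*x - 2*pi*y = 2 * (pi * (x - y))"
    by (simp add: algebra_simps)
  also have "2 - 2 * cos (2 * (pi * (x - y))) = (2 * \<bar>sin (pi * (x - y))\<bar>)\<^sup>2"
    by (simp only: cos_double_sin power_mult_distrib power2_abs) simp
  finally show ?thesis
    by (metis norm_ge_zero power2_eq_imp_eq abs_ge_zero mult_nonneg_nonneg zero_le_numeral)
qed

lemma ee_lipschitz: "norm (ee x - ee y) \<le> 2 * pi * \<bar>x - y\<bar>"
  using abs_sin_x_le_abs_x[of "pi * (x - y)"] by (simp add: norm_ee_diff abs_mult)

lemma ee_int [simp]: "ee (of_int k) = 1"
  by (simp add: ee_def cis_multiple_2pi)

lemma has_integral_affine:
  fixes f :: "real \<Rightarrow> 'a::banach"
  assumes "continuous_on {a..b} f" "a \<le> b"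
  shows "integral {a..b} f = (b - a) *\<^sub>R integral {0..1} (\<lambda>t. f (a + (b - a) * t))"
proof (cases "a = b")
  case False
  with assms have ab: "a < b" by simp
  have "(f has_integral integral {a..b} f) {a..b}"
    using assms(1) by (simp add: integrable_integral integrable_continuous_interval)
  then have "((\<lambda>x. f ((b - a) *\<^sub>R x + a)) has_integral
      (1 / \<bar>b - a\<bar> ^ DIM(real)) *\<^sub>R integral {a..b} f)
      ((\<lambda>x. (1 / (b - a)) *\<^sub>R x + - ((1 / (b - a)) *\<^sub>R a)) ` cbox a b)"
    using ab by (intro has_integral_affinity) auto
  moreover have "(\<lambda>x. (1 / (b - a)) *\<^sub>R x + - ((1 / (b - a)) *\<^sub>R a)) ` cbox a b = {0..1}"
    using ab image_affinity_atLeastAtMost[of "1 / (b - a)" "- (a / (b - a))" a b]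
    by (simp add: divide_simps)
  ultimately have "((\<lambda>x. f ((b - a) *\<^sub>R x + a)) has_integral
      (1 / \<bar>b - a\<bar> ^ DIM(real)) *\<^sub>R integral {a..b} f) {0..1}"
    by simp
  then have "integral {0..1} (\<lambda>x. f (a + (b - a) * x)) = (1 / (b - a)) *\<^sub>R integral {a..b} f"
    using ab by (intro integral_unique) (simp add: add.commute)
  then show ?thesis
    using ab by simp
qed simp

lemma integral_split_affine:
  fixes f :: "real \<Rightarrow> 'a::banach"
  assumes f: "continuous_on {0..1} f" and p: "0 \<le> p" "p \<le> 1"
  shows "integral {0..1} f =
    p *\<^sub>R integral {0..1} (\<lambda>t. f (p * t)) + (1 - p) *\<^sub>R integral {0..1} (\<lambda>t. f (p + (1 - p) * t))"
proof -
  have "integral {0..1} f = integral {0..p} f + integral {p..1} f"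
    using p f Henstock_Kurzweil_Integration.integral_combine[of 0 p 1 f]
    by (simp add: integrable_continuous_interval)
  also have "integral {0..p} f = p *\<^sub>R integral {0..1} (\<lambda>t. f (p * t))"
    using has_integral_affine[of 0 p f] p continuous_on_subset[OF f] by auto
  also have "integral {p..1} f = (1 - p) *\<^sub>R integral {0..1} (\<lambda>t. f (p + (1 - p) * t))"
    using has_integral_affine[of p 1 f] p continuous_on_subset[OF f] by auto
  finally show ?thesis .
qed

lemma integral_reflect_unit:
  fixes f :: "real \<Rightarrow> 'a::euclidean_space"
  shows "integral {0..1} (\<lambda>t. f (1 - t)) = integral {0..1} f"
  using integral_shift_real_ivl[of "-1" "-1" 0 "\<lambda>x. f (- x)"] Henstock_Kurzweil_Integration.integral_reflect_real[of 1 0 f]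
  by (simp add: algebra_simps)

text \<open>Functions dominated in this dual sense by exponentials on the unit interval form a class closed under
  \<open>glue\<close> and averages, so uniform bounds and Lipschitz bounds hold for the whole cascade at once.\<close>

definition fbound :: "(real \<Rightarrow> complex) \<Rightarrow> bool" where
  "fbound M \<longleftrightarrow> (\<forall>m (\<beta>::nat \<Rightarrow> complex) \<omega>.
     norm (\<Sum>k<m. \<beta> k * M (\<omega> k)) \<le> integral {0..1} (\<lambda>t. norm (\<Sum>k<m. \<beta> k * ee (\<omega> k * t))))"

definition unit_ft :: "real \<Rightarrow> complex" where
  "unit_ft \<omega> = integral {0..1} (\<lambda>t. ee (\<omega> * t))"

text \<open>If \<open>A\<close> and \<open>B\<close> are the transforms of two functions on [0, 1],
  this is the transform of the function obtained by squeezing them into [0, p] and [p, 1]; the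
  factor \<open>ee (p * \<omega>)\<close> comes from the left end of the second piece.\<close>

definition glue :: "real \<Rightarrow> (real \<Rightarrow> complex) \<Rightarrow> (real \<Rightarrow> complex) \<Rightarrow> real \<Rightarrow> complex" where
  "glue p A B \<omega> = of_real p * A (p * \<omega>) + ee (p * \<omega>) * (of_real (1 - p) * B ((1 - p) * \<omega>))"

lemma integrable_trig [intro]:
  "(\<lambda>t. \<Sum>k<m. \<beta> k * ee (\<omega> k * t)) integrable_on {a..b}"
  "(\<lambda>t. norm (\<Sum>k<m. \<beta> k * ee (\<omega> k * t))) integrable_on {a..b}"
  by (intro integrable_continuous_interval continuous_intros)+

lemma fbound_unit_ft:
  assumes "\<bar>v\<bar> \<le> 1"
  shows "fbound (\<lambda>\<omega>. of_real v * unit_ft \<omega>)"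
  unfolding fbound_def
proof (intro allI)
  fix m :: nat and \<beta> :: "nat \<Rightarrow> complex" and \<omega>
  have "(\<Sum>k<m. \<beta> k * (of_real v * unit_ft (\<omega> k)))
      = of_real v * (\<Sum>k<m. integral {0..1} (\<lambda>t. \<beta> k * ee (\<omega> k * t)))"
    by (simp add: unit_ft_def sum_distrib_left mult_ac)
  also have "(\<Sum>k<m. integral {0..1} (\<lambda>t. \<beta> k * ee (\<omega> k * t)))
      = integral {0..1} (\<lambda>t. \<Sum>k<m. \<beta> k * ee (\<omega> k * t))"
    by (rule integral_sum[symmetric]) (auto intro!: integrable_continuous_interval continuous_intros)
  finally have "norm (\<Sum>k<m. \<beta> k * (of_real v * unit_ft (\<omega> k)))
      \<le> 1 * norm (integral {0..1} (\<lambda>t. \<Sum>k<m. \<beta> k * ee (\<omega> k * t)))"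
    using assms by (auto simp: norm_mult intro!: mult_left_le_one_le)
  also have "\<dots> \<le> integral {0..1} (\<lambda>t. norm (\<Sum>k<m. \<beta> k * ee (\<omega> k * t)))"
    by (simp, rule integral_norm_bound_integral) auto
  finally show "norm (\<Sum>k<m. \<beta> k * (of_real v * unit_ft (\<omega> k)))
      \<le> integral {0..1} (\<lambda>t. norm (\<Sum>k<m. \<beta> k * ee (\<omega> k * t)))" .
qed

lemma fbound_avg:
  fixes M :: "nat \<Rightarrow> real \<Rightarrow> complex"
  assumes "\<And>j. j < n \<Longrightarrow> fbound (M j)" "n > 0"
  shows "fbound (\<lambda>\<omega>. (\<Sum>j<n. M j \<omega>) / of_nat n)"
  unfolding fbound_def
proof (intro allI)
  fix m :: nat and \<beta> :: "nat \<Rightarrow> complex" and \<omega>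
  let ?I = "integral {0..1} (\<lambda>t. norm (\<Sum>k<m. \<beta> k * ee (\<omega> k * t)))"
  have "(\<Sum>k<m. \<beta> k * ((\<Sum>j<n. M j (\<omega> k)) / of_nat n))
      = (\<Sum>j<n. \<Sum>k<m. \<beta> k * M j (\<omega> k)) / of_nat n"
    by (subst sum.swap) (simp add: sum_distrib_left sum_divide_distrib)
  also have "norm \<dots> \<le> (\<Sum>j<n. norm (\<Sum>k<m. \<beta> k * M j (\<omega> k))) / real n"
    by (simp add: norm_divide divide_right_mono norm_sum)
  also have "\<dots> \<le> (\<Sum>j<n. ?I) / real n"
    using assms(1) by (intro divide_right_mono sum_mono) (auto simp: fbound_def)
  also have "\<dots> = ?I"
    using assms(2) by simp
  finally show "norm (\<Sum>k<m. \<beta> k * ((\<Sum>j<n. M j (\<omega> k)) / of_nat n)) \<le> ?I" .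
qed

text \<open>Cutting the dominating integral at p gives the integrals needed for \<open>A\<close> and
  \<open>B\<close>. The phase \<open>ee (p * \<omega>)\<close> is moved into the coefficients of
  \<open>B\<close>, which is why \<open>fbound\<close> allows arbitrary complex
  coefficients.\<close>

lemma fbound_glue:
  assumes A: "fbound A" and B: "fbound B" and p: "0 \<le> p" "p \<le> 1"
  shows "fbound (glue p A B)"
  unfolding fbound_def
proof (intro allI)
  fix m :: nat and \<beta> :: "nat \<Rightarrow> complex" and \<omega> :: "nat \<Rightarrow> real"
  let ?f = "\<lambda>t. norm (\<Sum>k<m. \<beta> k * ee (\<omega> k * t))"
  have eq: "(\<Sum>k<m. \<beta> k * glue p A B (\<omega> k)) = of_real p * (\<Sum>k<m. \<beta> k * A (p * \<omega> k))
     + of_real (1 - p) * (\<Sum>k<m. (\<beta> k * ee (p * \<omega> k)) * B ((1 - p) * \<omega> k))"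
    by (simp add: glue_def sum_distrib_left sum.distrib[symmetric] algebra_simps)
  have "norm (\<Sum>k<m. \<beta> k * glue p A B (\<omega> k)) \<le> p * norm (\<Sum>k<m. \<beta> k * A (p * \<omega> k))
      + (1 - p) * norm (\<Sum>k<m. (\<beta> k * ee (p * \<omega> k)) * B ((1 - p) * \<omega> k))"
    unfolding eq using p by (intro norm_triangle_le) (simp add: norm_mult del: of_real_diff)
  also have "\<dots> \<le> p * integral {0..1} (\<lambda>t. norm (\<Sum>k<m. \<beta> k * ee ((p * \<omega> k) * t)))
      + (1 - p) * integral {0..1} (\<lambda>t. norm (\<Sum>k<m. (\<beta> k * ee (p * \<omega> k)) * ee (((1 - p) * \<omega> k) * t)))"
    using p A[unfolded fbound_def, rule_format, where \<beta> = \<beta> and \<omega> = "\<lambda>k. p * \<omega> k"]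
      B[unfolded fbound_def, rule_format, where \<beta> = "\<lambda>k. \<beta> k * ee (p * \<omega> k)" and \<omega> = "\<lambda>k. (1 - p) * \<omega> k"]
    by (intro add_mono mult_left_mono) auto
  also have "\<dots> = p * integral {0..1} (\<lambda>t. ?f (p * t)) + (1 - p) * integral {0..1} (\<lambda>t. ?f (p + (1 - p) * t))"
    by (simp add: ee_add[symmetric] mult.assoc algebra_simps)
  also have "\<dots> = integral {0..1} ?f"
    using integral_split_affine[of ?f p] p by (simp add: continuous_intros)
  finally show "norm (\<Sum>k<m. \<beta> k * glue p A B (\<omega> k)) \<le> integral {0..1} ?f" .
qed

lemma fbound_bounded:
  assumes "fbound M" shows "norm (M \<omega>) \<le> 1"
proof -
  have "norm (\<Sum>k<1::nat. 1 * M \<omega>) \<le> integral {0..1} (\<lambda>t. norm (\<Sum>k<1::nat. 1 * ee (\<omega> * t)))"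
    using assms unfolding fbound_def by (rule allE[of _ 1]) (drule spec[of _ "\<lambda>_. 1"], drule spec[of _ "\<lambda>_. \<omega>"], simp)
  then show ?thesis by simp
qed

text \<open>\<open>fbound\<close> is tested with two frequencies and the coefficients 1 and -1,
  after which the Lipschitz bound of \<open>ee\<close> applies under the integral. Testing with one
  frequency gives \<open>fbound_bounded\<close>.\<close>

lemma fbound_lipschitz:
  assumes "fbound M" shows "norm (M \<omega> - M \<omega>') \<le> 2 * pi * \<bar>\<omega> - \<omega>'\<bar>"
proof -
  define b :: "nat \<Rightarrow> complex" where "b = (\<lambda>k. if k = 0 then 1 else -1)"
  define w where "w = (\<lambda>k::nat. if k = 0 then \<omega> else \<omega>')"
  have "norm (\<Sum>k<2::nat. b k * M (w k)) \<le> integral {0..1} (\<lambda>t. norm (\<Sum>k<2::nat. b k * ee (w k * t)))"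
    using assms unfolding fbound_def by blast
  also have "\<dots> \<le> integral {0..1} (\<lambda>t::real. 2 * pi * \<bar>\<omega> - \<omega>'\<bar>)"
  proof (rule integral_le)
    fix t :: real assume t: "t \<in> {0..1}"
    have "norm (\<Sum>k<2::nat. b k * ee (w k * t)) \<le> 2 * pi * \<bar>\<omega> * t - \<omega>' * t\<bar>"
      using ee_lipschitz[of "\<omega> * t" "\<omega>' * t"] by (simp add: b_def w_def numeral_2_eq_2)
    also have "\<dots> = 2 * pi * (\<bar>\<omega> - \<omega>'\<bar> * t)"
      using t by (simp add: abs_mult left_diff_distrib[symmetric])
    also have "\<dots> \<le> 2 * pi * (\<bar>\<omega> - \<omega>'\<bar> * 1)"
      using t by (intro mult_left_mono) auto
    finally show "norm (\<Sum>k<2::nat. b k * ee (w k * t)) \<le> 2 * pi * \<bar>\<omega> - \<omega>'\<bar>" by simp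
  qed auto
  finally show ?thesis by (simp add: b_def w_def numeral_2_eq_2)
qed

lemma ee_vector_derivative:
  "((\<lambda>t. ee (\<omega> * t)) has_vector_derivative (2 * of_real pi * \<i> * of_real \<omega>) * ee (\<omega> * t)) (at t within S)"
proof -
  have "((\<lambda>z. exp (2 * of_real pi * \<i> * of_real \<omega> * z)) has_field_derivative
      (2 * of_real pi * \<i> * of_real \<omega>) * exp (2 * of_real pi * \<i> * of_real \<omega> * of_real t)) (at (of_real t))"
    by (auto intro!: derivative_eq_intros)
  from has_vector_derivative_real_field[OF this, of S] show ?thesis
    by (simp add: ee_def cis_conv_exp mult_ac)
qed

lemma norm_unit_ft_le: "\<omega> > 0 \<Longrightarrow> norm (unit_ft \<omega>) \<le> 1 / \<omega>"
proof -
  assume w: "\<omega> > 0"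
  let ?F = "\<lambda>t. ee (\<omega> * t) / (2 * of_real pi * \<i> * of_real \<omega>)"
  have "((\<lambda>t. ee (\<omega> * t)) has_integral (?F 1 - ?F 0)) {0..1}"
  proof (rule fundamental_theorem_of_calculus)
    fix t :: real assume "t \<in> {0..1}"
    show "(?F has_vector_derivative ee (\<omega> * t)) (at t within {0..1})"
      using has_vector_derivative_mult_right[OF ee_vector_derivative[of \<omega> t "{0..1}"], of "1 / (2 * of_real pi * \<i> * of_real \<omega>)"]
        w by (simp add: divide_simps mult_ac)
  qed simp
  then have "unit_ft \<omega> = ?F 1 - ?F 0"
    unfolding unit_ft_def by (rule integral_unique)
  also have "norm \<dots> = norm (ee \<omega> - 1) / (2 * pi * \<omega>)"
    using w by (simp add: diff_divide_distrib[symmetric] norm_divide norm_mult)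
  also have "\<dots> \<le> 2 / (2 * pi * \<omega>)"
    using w norm_triangle_ineq4[of "ee \<omega>" 1] by (intro divide_right_mono) auto
  also have "\<dots> \<le> 1 / \<omega>"
    using w pi_gt3 by (simp add: field_simps)
  finally show "norm (unit_ft \<omega>) \<le> 1 / \<omega>" .
qed

text \<open>The constant 1/3 is not the sharp 2/pi, but together with pi > 3 it yields sin (pi u)
  \<ge> u on [0, 1/2], the form in which it is used.\<close>

lemma sin_ge_third:
  assumes "0 \<le> x" "x \<le> pi / 2" shows "x / 3 \<le> sin (x::real)"
proof -
  have "\<bar>sin x - (\<Sum>m<3. sin_coeff m * x ^ m)\<bar> \<le> inverse (fact 3) * \<bar>x\<bar> ^ 3"
    by (rule Maclaurin_sin_bound)
  then have "\<bar>sin x - x\<bar> \<le> x ^ 3 / 6"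
    using assms by (simp add: sin_coeff_def eval_nat_numeral)
  moreover have "x ^ 3 \<le> 4 * x"
  proof -
    have "x \<le> 2" using assms pi_less_4 by simp
    then have "x * x \<le> 2 * 2" using assms(1) by (intro mult_mono) auto
    then have "(x * x) * x \<le> 4 * x" using assms(1) by (intro mult_right_mono) auto
    then show ?thesis by (simp add: power3_eq_cube)
  qed
  ultimately show ?thesis by linarith
qed

lemma norm_one_minus_ee_ge:
  assumes "0 \<le> x" "x \<le> 1 / 2" shows "2 * x \<le> norm (1 - ee x)"
proof -
  have "pi * x / 3 \<le> sin (pi * x)"
    using assms mult_left_mono[of x "1/2" pi] by (intro sin_ge_third) auto
  moreover have "3 * x \<le> pi * x"
    using assms pi_gt3 by (intro mult_right_mono) auto
  moreover have "norm (1 - ee x) = 2 * \<bar>sin (pi * x)\<bar>"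
    using norm_ee_diff[of x 0] by (simp add: norm_minus_commute)
  ultimately show ?thesis by linarith
qed

text \<open>Summation by parts for linearly growing coefficients: multiplication by 1 - z leaves two
  boundary terms and a plain geometric sum.\<close>

lemma arith_geometric_sum:
  fixes z :: complex
  shows "(1 - z) * (\<Sum>j<m. of_real (a + real j * h) * z ^ j)
    = of_real a - of_real (a + real m * h) * z ^ m + of_real h * (\<Sum>j<m. z ^ Suc j)"
proof (induction m)
  case (Suc m)
  show ?case
    unfolding sum.lessThan_Suc distrib_left[of "1 - z"] Suc.IH by (simp add: algebra_simps)
qed simp

lemma norm_arith_trig_sum_le:
  assumes "0 \<le> a" "0 < h" "0 < y" "h * y \<le> 1 / 2" "a + real m * h \<le> 1"
  shows "norm (\<Sum>j<m. of_real (a + real j * h) * ee ((a + real j * h) * y)) \<le> 1 / (h * y)"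
proof -
  let ?z = "ee (h * y)"
  let ?S = "\<Sum>j<m. of_real (a + real j * h) * ?z ^ j"
  have "(\<Sum>j<m. of_real (a + real j * h) * ee ((a + real j * h) * y)) = ee (a * y) * ?S"
    unfolding sum_distrib_left
  proof (rule sum.cong[OF refl])
    fix j
    have "ee ((a + real j * h) * y) = ee (a * y) * ee (h * y) ^ j"
      unfolding ee_power ee_add[symmetric] by (simp add: algebra_simps)
    then show "of_real (a + real j * h) * ee ((a + real j * h) * y)
        = ee (a * y) * (of_real (a + real j * h) * ee (h * y) ^ j)"
      by simp
  qed
  then have eq: "norm (\<Sum>j<m. of_real (a + real j * h) * ee ((a + real j * h) * y)) = norm ?S"
    by (simp add: norm_mult)
  have z: "norm ?z = 1" by simp
  have "norm (1 - ?z) * norm ?S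
      = norm (of_real a - of_real (a + real m * h) * ?z ^ m + of_real h * (\<Sum>j<m. ?z ^ Suc j))"
    by (subst norm_mult[symmetric]) (simp only: arith_geometric_sum)
  \<comment> \<open>Boundary terms and geometric sum together cost 2 (a + m h) \<le> 2; division by
    |1 - z| \<ge> 2 h y then gives the claim.\<close>
  also have "\<dots> \<le> (a + (a + real m * h)) + h * real m"
  proof (intro norm_triangle_le add_mono norm_triangle_le_diff)
    show "norm (complex_of_real a) \<le> a" using assms by simp
    have "norm (of_real (a + real m * h) * ?z ^ m) = \<bar>a + real m * h\<bar>"
      by (simp only: norm_mult norm_power z norm_of_real) simp
    then show "norm (of_real (a + real m * h) * ?z ^ m) \<le> a + real m * h"
      using assms by simp
    have "norm (\<Sum>j<m. ?z ^ Suc j) \<le> (\<Sum>j<m. 1)"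
      by (intro order.trans[OF norm_sum] sum_mono) (simp only: norm_power z, simp)
    then show "norm (of_real h * (\<Sum>j<m. ?z ^ Suc j)) \<le> h * real m"
      using assms by (simp add: norm_mult del: power_Suc)
  qed
  also have "\<dots> \<le> 2"
    using assms by (simp add: mult.commute)
  finally have "norm (1 - ?z) * norm ?S \<le> 2" .
  moreover have "2 * (h * y) * norm ?S \<le> norm (1 - ?z) * norm ?S"
    using assms by (intro mult_right_mono norm_one_minus_ee_ge) auto
  ultimately have "(h * y) * norm ?S \<le> 1" by linarith
  then show ?thesis
    using assms unfolding eq by (simp add: field_simps)
qed

text \<open>The two bounds are used on either side of s = sqrt c. Right of s the function c / t is
  replaced by its maximum c / s = s, which is crude but sufficient.\<close>

lemma integral_le_of_inverse_bound:
  fixes f :: "real \<Rightarrow> real"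
  assumes f: "continuous_on {0..1} f" "\<And>t. t \<in> {0..1} \<Longrightarrow> f t \<le> 1"
    and c: "0 < c" "\<And>t. 0 < t \<Longrightarrow> t \<le> 1 \<Longrightarrow> f t \<le> c / t"
  shows "integral {0..1} f \<le> 2 * sqrt c"
proof (cases "sqrt c \<le> 1")
  case True
  define s where "s = sqrt c"
  have s: "0 < s" "s \<le> 1" "c = s * s" using True c by (auto simp: s_def)
  have "integral {0..1} f = integral {0..s} f + integral {s..1} f"
    using s f Henstock_Kurzweil_Integration.integral_combine[of 0 s 1 f]
    by (simp add: integrable_continuous_interval)
  also have "integral {0..s} f \<le> integral {0..s} (\<lambda>_. 1)"
    using s f by (intro integral_le) (auto intro!: integrable_continuous_interval intro: continuous_on_subset)
  also have "integral {s..1} f \<le> integral {s..1} (\<lambda>_. s)"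
  proof (intro integral_le)
    fix t assume t: "t \<in> {s..1}"
    then have "f t \<le> c / t" using s c by auto
    also have "\<dots> \<le> c / s" using t s c by (intro divide_left_mono) auto
    finally show "f t \<le> s" using s by simp
  qed (use s f in \<open>auto intro!: integrable_continuous_interval intro: continuous_on_subset\<close>)
  finally have "integral {0..1} f \<le> s + (1 - s) * s"
    using s by simp
  also have "\<dots> \<le> s + 1 * s"
    using s by (intro add_left_mono mult_right_mono) auto
  finally show ?thesis by (simp add: s_def)
next
  case False
  have "integral {0..1} f \<le> integral {0..1} (\<lambda>_::real. 1)"
    by (rule integral_le) (use f in \<open>auto intro!: integrable_continuous_interval\<close>)
  then have "integral {0..1} f \<le> 1" by simp
  then show ?thesis using False by linarith
qed

section \<open>Averages over equidistributed splitting ratios\<close>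

definition lev :: "nat \<Rightarrow> nat \<Rightarrow> real" where
  "lev m j = (2 * real j + 1 - real m) / real m"

definition cutpt :: "real \<Rightarrow> real \<Rightarrow> real" where
  "cutpt \<kappa> s = (1 + \<kappa> * s) / 2"

lemma abs_lev_le: "j < m \<Longrightarrow> \<bar>lev m j\<bar> \<le> 1"
  by (auto simp: lev_def abs_le_iff field_simps)

lemma lev_reflect: "j < m \<Longrightarrow> lev m (m - Suc j) = - lev m j"
  by (simp add: lev_def of_nat_diff field_simps)

lemma sum_lev: "(\<Sum>j<m. lev m j) = 0"
proof -
  have "(\<Sum>j<m. lev m j) = (\<Sum>j<m. lev m (m - Suc j))"
    by (rule sum.nat_diff_reindex[symmetric])
  also have "\<dots> = - (\<Sum>j<m. lev m j)"
    by (simp add: lev_reflect sum_negf[symmetric])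
  finally show ?thesis by simp
qed

lemma cut_bounds:
  assumes "0 \<le> \<kappa>" "\<kappa> \<le> 1 / 10" "\<bar>s\<bar> \<le> 1"
  shows "9 / 20 \<le> cutpt \<kappa> s" "cutpt \<kappa> s \<le> 11 / 20"
proof -
  have "\<bar>\<kappa> * s\<bar> \<le> 1 / 10 * 1"
    unfolding abs_mult using assms by (intro mult_mono) auto
  then show "9 / 20 \<le> cutpt \<kappa> s" "cutpt \<kappa> s \<le> 11 / 20"
    unfolding cutpt_def by (simp_all add: abs_le_iff)
qed

lemma cut_minus: "1 - cutpt \<kappa> s = cutpt \<kappa> (- s)"
  by (simp add: cutpt_def field_simps)

text \<open>The average of p e(p y) over the ratios p, where p is the weight of the left piece in
  \<open>glue\<close>. The points \<open>lev m j\<close> are the midpoints of m equal parts of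
  [-1, 1].\<close>

definition cutker :: "nat \<Rightarrow> real \<Rightarrow> real \<Rightarrow> complex" where
  "cutker m \<kappa> y = (\<Sum>j<m. (of_real (cutpt \<kappa> (lev m j)) / of_nat m) * ee (cutpt \<kappa> (lev m j) * y))"

lemma continuous_on_cutker [continuous_intros]:
  "continuous_on S f \<Longrightarrow> continuous_on S (\<lambda>t. cutker m \<kappa> (f t))"
  unfolding cutker_def by (intro continuous_intros)

lemma norm_cutker_le1:
  assumes "0 \<le> \<kappa>" "\<kappa> \<le> 1 / 10" "m > 0"
  shows "norm (cutker m \<kappa> y) \<le> 1"
proof -
  have "norm (cutker m \<kappa> y) \<le> (\<Sum>j<m. 1 / real m)"
    unfolding cutker_def
  proof (intro order.trans[OF norm_sum] sum_mono)
    fix j assume "j \<in> {..<m}"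
    then have "\<bar>cutpt \<kappa> (lev m j)\<bar> \<le> 1"
      using cut_bounds[of \<kappa> "lev m j"] abs_lev_le[of j m] assms by simp
    then show "norm (of_real (cutpt \<kappa> (lev m j)) / of_nat m * ee (cutpt \<kappa> (lev m j) * y)) \<le> 1 / real m"
      by (simp add: norm_mult norm_divide divide_right_mono)
  qed
  also have "\<dots> = 1" using assms by simp
  finally show ?thesis .
qed

text \<open>The ratios form an arithmetic progression with step \<kappa> / m. The restriction
  \<kappa> y \<le> m / 2 keeps the phase step at most 1/2, so the discrete average still decays like
  the average over a whole interval of ratios.\<close>

lemma norm_cutker_le:
  assumes "0 < \<kappa>" "\<kappa> \<le> 1 / 10" "m > 0" "0 < y" "\<kappa> * y \<le> m / 2"
  shows "norm (cutker m \<kappa> y) \<le> 1 / (\<kappa> * y)"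
proof -
  define h where "h = \<kappa> / real m"
  define a where "a = (1 + \<kappa> * (1 - real m) / real m) / 2"
  have c: "cutpt \<kappa> (lev m j) = a + real j * h" for j
    using assms by (simp add: cutpt_def lev_def a_def h_def field_simps)
  have "\<kappa> * ((1 - real m) / real m) \<ge> \<kappa> * (- 1)"
    using assms by (intro mult_left_mono) (auto simp: field_simps)
  then have a0: "0 \<le> a" using assms by (simp add: a_def)
  have "a + real m * h = (1 + \<kappa> * (1 + real m) / real m) / 2"
    using assms by (simp add: a_def h_def field_simps)
  also have "\<kappa> * (1 + real m) / real m \<le> 1 / 10 * 2"
  proof -
    have "(1 + real m) / real m \<le> 2" using assms(3) by (simp add: divide_simps)
    then have "\<kappa> * ((1 + real m) / real m) \<le> 1 / 10 * 2"
      using assms by (intro mult_mono) auto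
    then show ?thesis by simp
  qed
  finally have a1: "a + real m * h \<le> 1" by simp
  have "cutker m \<kappa> y = (\<Sum>j<m. of_real (a + real j * h) * ee ((a + real j * h) * y)) / of_nat m"
    by (simp only: cutker_def c sum_divide_distrib) (simp add: field_simps)
  then have "norm (cutker m \<kappa> y)
      = norm (\<Sum>j<m. of_real (a + real j * h) * ee ((a + real j * h) * y)) / real m"
    by (simp add: norm_divide)
  also have "\<dots> \<le> (1 / (h * y)) / real m"
    using assms a0 a1 by (intro divide_right_mono norm_arith_trig_sum_le) (auto simp: h_def field_simps)
  also have "\<dots> = 1 / (\<kappa> * y)"
    using assms by (simp add: h_def)
  finally show ?thesis .
qed

lemma integral_norm_cutker_le:
  assumes "0 < \<kappa>" "\<kappa> \<le> 1 / 10" "m > 0" "0 < \<omega>" "\<kappa> * \<omega> \<le> m / 2"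
  shows "integral {0..1} (\<lambda>t. norm (cutker m \<kappa> (\<omega> * t))) \<le> 2 / sqrt (\<kappa> * \<omega>)"
proof -
  have "integral {0..1} (\<lambda>t. norm (cutker m \<kappa> (\<omega> * t))) \<le> 2 * sqrt (1 / (\<kappa> * \<omega>))"
  proof (rule integral_le_of_inverse_bound)
    fix t :: real assume t: "0 < t" "t \<le> 1"
    have "(\<kappa> * \<omega>) * t \<le> (\<kappa> * \<omega>) * 1"
      using t assms by (intro mult_left_mono) auto
    then have "\<kappa> * (\<omega> * t) \<le> m / 2"
      using assms(5) unfolding mult.assoc[symmetric] by linarith
    then have "norm (cutker m \<kappa> (\<omega> * t)) \<le> 1 / (\<kappa> * (\<omega> * t))"
      using assms t by (intro norm_cutker_le) simp_all
    then show "norm (cutker m \<kappa> (\<omega> * t)) \<le> 1 / (\<kappa> * \<omega>) / t" by (simp add: mult_ac)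
  qed (use assms in \<open>auto intro!: continuous_intros norm_cutker_le1\<close>)
  then show ?thesis by (simp add: real_sqrt_divide)
qed

text \<open>\<open>fbound\<close> replaces \<open>A\<close> by pure exponentials, for which the
  average is the kernel \<open>cutker\<close>. No information on the tree below the node
  enters.\<close>

lemma norm_avg_left_le:
  assumes "fbound A" "0 < \<kappa>" "\<kappa> \<le> 1 / 10" "m > 0" "0 < \<omega>" "\<kappa> * \<omega> \<le> m / 2"
  shows "norm (\<Sum>j<m. (of_real (cutpt \<kappa> (lev m j)) / of_nat m) * A (cutpt \<kappa> (lev m j) * \<omega>)) \<le> 2 / sqrt (\<kappa> * \<omega>)"
proof -
  have "norm (\<Sum>j<m. (of_real (cutpt \<kappa> (lev m j)) / of_nat m) * A (cutpt \<kappa> (lev m j) * \<omega>))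
     \<le> integral {0..1} (\<lambda>t. norm (\<Sum>j<m. (of_real (cutpt \<kappa> (lev m j)) / of_nat m) * ee ((cutpt \<kappa> (lev m j) * \<omega>) * t)))"
    using assms(1)[unfolded fbound_def, rule_format, where \<beta> = "\<lambda>j. of_real (cutpt \<kappa> (lev m j)) / of_nat m"
       and \<omega> = "\<lambda>j. cutpt \<kappa> (lev m j) * \<omega>"] .
  also have "\<dots> = integral {0..1} (\<lambda>t. norm (cutker m \<kappa> (\<omega> * t)))"
    by (simp add: cutker_def mult.assoc)
  also have "\<dots> \<le> 2 / sqrt (\<kappa> * \<omega>)"
    by (rule integral_norm_cutker_le) fact+
  finally show ?thesis .
qed

text \<open>Reflecting t to 1 - t and reversing the order of the levels turns the right piece into
  the complex conjugate of the left one, up to the factor \<open>ee \<omega>\<close>; so the same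
  kernel bounds it.\<close>

lemma norm_avg_right_le:
  assumes "fbound B" "0 < \<kappa>" "\<kappa> \<le> 1 / 10" "m > 0" "0 < \<omega>" "\<kappa> * \<omega> \<le> m / 2"
  shows "norm (\<Sum>j<m. (ee (cutpt \<kappa> (lev m j) * \<omega>) * of_real (1 - cutpt \<kappa> (lev m j)) / of_nat m)
       * B ((1 - cutpt \<kappa> (lev m j)) * \<omega>)) \<le> 2 / sqrt (\<kappa> * \<omega>)"
proof -
  let ?b = "\<lambda>j. ee (cutpt \<kappa> (lev m j) * \<omega>) * of_real (1 - cutpt \<kappa> (lev m j)) / of_nat m"
  let ?w = "\<lambda>j. (1 - cutpt \<kappa> (lev m j)) * \<omega>"
  have ker: "norm (\<Sum>j<m. ?b j * ee (?w j * t)) = norm (cutker m \<kappa> (\<omega> * (1 - t)))" for t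
  proof -
    have "(\<Sum>j<m. ?b j * ee (?w j * t)) = (\<Sum>j<m. ?b (m - Suc j) * ee (?w (m - Suc j) * t))"
      by (rule sum.nat_diff_reindex[symmetric])
    also have "\<dots> = (\<Sum>j<m. ee \<omega> * cnj ((of_real (cutpt \<kappa> (lev m j)) / of_nat m) * ee (cutpt \<kappa> (lev m j) * (\<omega> * (1 - t)))))"
    proof (rule sum.cong[OF refl])
      fix j assume j: "j \<in> {..<m}"
      have "ee ((1 - cutpt \<kappa> (lev m j)) * \<omega>) * ee (cutpt \<kappa> (lev m j) * \<omega> * t)
          = ee \<omega> * ee (- (cutpt \<kappa> (lev m j) * (\<omega> * (1 - t))))"
        unfolding ee_add[symmetric] by (simp add: algebra_simps)
      moreover have "cutpt \<kappa> (- lev m j) = 1 - cutpt \<kappa> (lev m j)"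
        by (simp add: cut_minus)
      ultimately show "?b (m - Suc j) * ee (?w (m - Suc j) * t)
          = ee \<omega> * cnj ((of_real (cutpt \<kappa> (lev m j)) / of_nat m) * ee (cutpt \<kappa> (lev m j) * (\<omega> * (1 - t))))"
        using j by (simp add: lev_reflect ee_minus)
    qed
    also have "\<dots> = ee \<omega> * cnj (cutker m \<kappa> (\<omega> * (1 - t)))"
      by (simp add: cutker_def sum_distrib_left cnj_sum)
    finally show ?thesis by (simp add: norm_mult)
  qed
  have "norm (\<Sum>j<m. ?b j * B (?w j)) \<le> integral {0..1} (\<lambda>t. norm (\<Sum>j<m. ?b j * ee (?w j * t)))"
    using assms(1)[unfolded fbound_def, rule_format, where \<beta> = ?b and \<omega> = ?w] .
  also have "\<dots> = integral {0..1} (\<lambda>t. norm (cutker m \<kappa> (\<omega> * (1 - t))))"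
    by (simp only: ker)
  also have "\<dots> = integral {0..1} (\<lambda>t. norm (cutker m \<kappa> (\<omega> * t)))"
    by (rule integral_reflect_unit)
  also have "\<dots> \<le> 2 / sqrt (\<kappa> * \<omega>)"
    by (rule integral_norm_cutker_le) fact+
  finally show ?thesis .
qed

lemma norm_avg_glue_le:
  assumes "fbound A" "fbound B" "0 < \<kappa>" "\<kappa> \<le> 1 / 10" "m > 0" "0 < \<omega>" "\<kappa> * \<omega> \<le> m / 2"
  shows "norm ((\<Sum>j<m. glue (cutpt \<kappa> (lev m j)) A B \<omega>) / of_nat m) \<le> 4 / sqrt (\<kappa> * \<omega>)"
proof -
  have "(\<Sum>j<m. glue (cutpt \<kappa> (lev m j)) A B \<omega>) / of_nat m
    = (\<Sum>j<m. (of_real (cutpt \<kappa> (lev m j)) / of_nat m) * A (cutpt \<kappa> (lev m j) * \<omega>))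
    + (\<Sum>j<m. (ee (cutpt \<kappa> (lev m j) * \<omega>) * of_real (1 - cutpt \<kappa> (lev m j)) / of_nat m)
       * B ((1 - cutpt \<kappa> (lev m j)) * \<omega>))"
    by (simp add: glue_def sum.distrib[symmetric] sum_divide_distrib add_divide_distrib mult_ac)
  then have "norm ((\<Sum>j<m. glue (cutpt \<kappa> (lev m j)) A B \<omega>) / of_nat m)
     \<le> 2 / sqrt (\<kappa> * \<omega>) + 2 / sqrt (\<kappa> * \<omega>)"
    using norm_avg_left_le[OF assms(1) assms(3-)] norm_avg_right_le[OF assms(2) assms(3-)]
    by (simp only:) (rule norm_triangle_mono)
  then show ?thesis by simp
qed

section \<open>The averaged cascade\<close>

primrec tavg :: "(nat \<Rightarrow> real) \<Rightarrow> nat \<Rightarrow> nat \<Rightarrow> real" where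
  "tavg v 0 k = v k"
| "tavg v (Suc h) k = (tavg v h (2 * k) + tavg v h (2 * k + 1)) / 2"

definition haar :: "(nat \<Rightarrow> real) \<Rightarrow> nat \<Rightarrow> nat \<Rightarrow> real" where
  "haar v h k = (tavg v h (2 * k) - tavg v h (2 * k + 1)) / 2"

text \<open>Variance of the leaf values below the node, written as Haar energy: the part between the
  two children plus the mean of the parts within them.\<close>

primrec tvar :: "(nat \<Rightarrow> real) \<Rightarrow> nat \<Rightarrow> nat \<Rightarrow> real" where
  "tvar v 0 k = 0"
| "tvar v (Suc h) k = (haar v h k)\<^sup>2 + (tvar v h (2 * k) + tvar v h (2 * k + 1)) / 2"

text \<open>The weight \<open>3 / 8\<close> is less than \<open>1 / 2\<close>, so that \<open>energy\<close> stays bounded by a multiple of \<open>tvar\<close>; yet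
  \<open>amp2\<close> at a node still dominates a fixed proportion of \<open>amp2\<close> at its children.\<close>

primrec amp2 :: "(nat \<Rightarrow> real) \<Rightarrow> nat \<Rightarrow> nat \<Rightarrow> real" where
  "amp2 v 0 k = 0"
| "amp2 v (Suc h) k = (haar v h k)\<^sup>2 + 3 / 8 * (amp2 v h (2 * k) + amp2 v h (2 * k + 1))"

text \<open>The mean, over a random path from the node down to a leaf, of the sum of
  \<open>amp2\<close> along the path.\<close>

primrec energy :: "(nat \<Rightarrow> real) \<Rightarrow> nat \<Rightarrow> nat \<Rightarrow> real" where
  "energy v 0 k = 0"
| "energy v (Suc h) k = amp2 v (Suc h) k + (energy v h (2 * k) + energy v h (2 * k + 1)) / 2"

definition amp :: "(nat \<Rightarrow> real) \<Rightarrow> nat \<Rightarrow> nat \<Rightarrow> real" where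
  "amp v h k = sqrt (amp2 v h k)"

lemma amp2_nonneg: "0 \<le> amp2 v h k"
  by (induction h arbitrary: k) auto

lemma energy_ge_amp2: "amp2 v h k \<le> energy v h k"
proof (induction h arbitrary: k)
  case (Suc h)
  have "0 \<le> energy v h j" for j
    using Suc[of j] amp2_nonneg[of v h j] by linarith
  from this[of "2*k"] this[of "2*k+1"] show ?case by simp
qed simp

lemma energy_nonneg: "0 \<le> energy v h k"
  using energy_ge_amp2[of v h k] amp2_nonneg[of v h k] by linarith

text \<open>The summand -3 \<open>amp2\<close> makes the induction close: the children contribute
  3/8 - 3/2 times their \<open>amp2\<close>, which is exactly -3 * 3/8.\<close>

lemma energy_le: "energy v h k \<le> 4 * tvar v h k - 3 * amp2 v h k"
proof (induction h arbitrary: k)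
  case (Suc h)
  have "c + 3/8 * (a + b) + (e + f) / 2 \<le> 4 * (c + (t + u) / 2) - 3 * (c + 3/8 * (a + b))"
    if "e \<le> 4 * t - 3 * a" "f \<le> 4 * u - 3 * b" for a b c e f t u :: real
    using that by (simp add: field_simps)
  from this[OF Suc[of "2*k"] Suc[of "2*k+1"]] show ?case
    unfolding energy.simps amp2.simps tvar.simps .
qed simp

text \<open>The left side is the mean of the squared leaf values, as the parallelogram identity
  shows in the induction step.\<close>

lemma tvar_le: "\<forall>k. \<bar>v k\<bar> \<le> 1 \<Longrightarrow> tvar v h k + (tavg v h k)\<^sup>2 \<le> 1"
proof (induction h arbitrary: k)
  case 0
  then show ?case by (simp add: abs_square_le_1)
next
  case (Suc h)
  have "tvar v (Suc h) k + (tavg v (Suc h) k)\<^sup>2 =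
     ((tvar v h (2*k) + (tavg v h (2*k))\<^sup>2) + (tvar v h (2*k+1) + (tavg v h (2*k+1))\<^sup>2)) / 2"
    by (simp add: haar_def power2_eq_square field_simps)
  also have "\<dots> \<le> (1 + 1) / 2"
    by (intro divide_right_mono add_mono Suc) auto
  finally show ?case by simp
qed

lemma energy_le_4:
  assumes "\<forall>k. \<bar>v k\<bar> \<le> 1" shows "energy v h k \<le> 4"
  using energy_le[of v h k] tvar_le[OF assms, where h=h and k=k] amp2_nonneg[of v h k]
    zero_le_power2[of "tavg v h k"] by linarith

lemma amp2_le_1:
  assumes "\<forall>k. \<bar>v k\<bar> \<le> 1" shows "amp2 v h k \<le> 1"
  using energy_le[of v h k] tvar_le[OF assms, where h=h and k=k] energy_ge_amp2[of v h k]
    zero_le_power2[of "tavg v h k"] by linarith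

lemma amp_bounds:
  assumes "\<forall>k. \<bar>v k\<bar> \<le> 1" shows "0 \<le> amp v h k" "amp v h k \<le> 1"
  using amp2_le_1[OF assms, where h=h and k=k] amp2_nonneg[of v h k]
  by (auto simp: amp_def)

lemma amp_power2: "(amp v h k)\<^sup>2 = amp2 v h k"
  by (simp add: amp_def amp2_nonneg)

text \<open>The transform of the step function with values \<open>v\<close> on the image of a node, rescaled to
  the unit interval and averaged over all choices of the splitting ratios below that node.\<close>

primrec tree_ft :: "real \<Rightarrow> nat \<Rightarrow> (nat \<Rightarrow> real) \<Rightarrow> nat \<Rightarrow> nat \<Rightarrow> real \<Rightarrow> complex" where
  "tree_ft \<eta> m v 0 k = (\<lambda>\<omega>. of_real (v k) * unit_ft \<omega>)"
| "tree_ft \<eta> m v (Suc h) k = (\<lambda>\<omega>. (\<Sum>j<m. glue (cutpt (\<eta> * amp v (Suc h) k) (lev m j))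
      (tree_ft \<eta> m v h (2 * k)) (tree_ft \<eta> m v h (2 * k + 1)) \<omega>) / of_nat m)"

section \<open>Decay of the averaged transforms\<close>

locale cascade =
  fixes v :: "nat \<Rightarrow> real" and \<eta> :: real and m :: nat
  assumes v: "\<forall>k. \<bar>v k\<bar> \<le> 1" and eta: "0 < \<eta>" "\<eta> \<le> 1 / 10" and m: "m > 0"
begin

abbreviation "kap h k \<equiv> \<eta> * amp v h k"
abbreviation "F \<equiv> tree_ft \<eta> m v"

lemma kap_bounds: "0 \<le> kap h k" "kap h k \<le> 1 / 10" "kap h k \<le> \<eta>"
proof -
  note a = amp_bounds[OF v, where h = h and k = k]
  have "\<eta> * amp v h k \<le> \<eta> * 1" using a eta by (intro mult_left_mono) auto
  then show "kap h k \<le> 1 / 10" "kap h k \<le> \<eta>" using eta by linarith+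
  show "0 \<le> kap h k" using a eta by simp
qed

lemma cut_kap: "\<bar>s\<bar> \<le> 1 \<Longrightarrow> 9 / 20 \<le> cutpt (kap h k) s" "\<bar>s\<bar> \<le> 1 \<Longrightarrow> cutpt (kap h k) s \<le> 11 / 20"
  using cut_bounds[of "kap h k" s] kap_bounds[of h k] by auto

lemma fbound_tree: "fbound (F h k)"
proof (induction h arbitrary: k)
  case 0
  then show ?case using v by (simp add: fbound_unit_ft)
next
  case (Suc h)
  have "fbound (\<lambda>\<omega>. (\<Sum>j<m. glue (cutpt (kap (Suc h) k) (lev m j)) (F h (2 * k)) (F h (2 * k + 1)) \<omega>) / of_nat m)"
  proof (rule fbound_avg[OF _ m], rule fbound_glue[OF Suc Suc])
    fix j assume "j < m"
    then show "0 \<le> cutpt (kap (Suc h) k) (lev m j)" "cutpt (kap (Suc h) k) (lev m j) \<le> 1"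
      using cut_kap[OF abs_lev_le, of j m "Suc h" k] by simp_all
  qed
  then show ?case by (simp only: tree_ft.simps)
qed

lemma norm_tree_le_kap:
  assumes "0 < amp v (Suc h) k" "0 < \<omega>" "\<omega> \<le> m / 2"
  shows "norm (F (Suc h) k \<omega>) \<le> 4 / sqrt (kap (Suc h) k * \<omega>)"
  unfolding tree_ft.simps
proof (rule norm_avg_glue_le)
  have "kap (Suc h) k * \<omega> \<le> 1 * \<omega>"
    using kap_bounds[of "Suc h" k] assms by (intro mult_right_mono) auto
  then show "kap (Suc h) k * \<omega> \<le> real m / 2" using assms by linarith
  show "kap (Suc h) k \<le> 1 / 10" by (rule kap_bounds)
qed (use assms eta m fbound_tree in auto)

text \<open>A constant function does not see the position of the cut. This allows a multiple of
  \<open>unit_ft\<close> to be subtracted inside \<open>glue\<close>, whatever the ratio.\<close>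

lemma unit_ft_glue:
  assumes "0 \<le> p" "p \<le> 1" shows "glue p unit_ft unit_ft \<omega> = unit_ft \<omega>"
proof -
  have "unit_ft \<omega> = p *\<^sub>R integral {0..1} (\<lambda>t. ee (\<omega> * (p * t)))
      + (1 - p) *\<^sub>R integral {0..1} (\<lambda>t. ee (\<omega> * (p + (1 - p) * t)))"
    unfolding unit_ft_def using assms by (intro integral_split_affine continuous_intros) auto
  also have "(\<lambda>t. ee (\<omega> * (p + (1 - p) * t))) = (\<lambda>t. ee (p * \<omega>) * ee ((1 - p) * \<omega> * t))"
    by (auto simp: ee_add[symmetric] algebra_simps)
  finally show ?thesis
    by (simp add: glue_def unit_ft_def scaleR_conv_of_real mult_ac)
qed

lemma norm_unit_ft_minus_1: "norm (unit_ft \<omega> - 1) \<le> 2 * pi * \<bar>\<omega>\<bar>"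
proof -
  have "fbound (\<lambda>\<omega>. of_real 1 * unit_ft \<omega>)"
    by (rule fbound_unit_ft) simp
  from fbound_lipschitz[OF this, of \<omega> 0] show ?thesis
    by (simp add: unit_ft_def)
qed

text \<open>The glued function is 1 left of the cut and -1 right of it, with integral 2 p - 1 =
  \<open>\<kappa> * lev m j\<close>. These integrals average to 0 over the levels, so the mean is
  O(\<omega>) at low frequencies; beyond \<omega> = 1/16 the right side exceeds the trivial bound
  1.\<close>

lemma avg_haar_ft_le:
  fixes \<kappa> :: real
  assumes \<kappa>: "0 \<le> \<kappa>" "\<kappa> \<le> 1 / 10" and w: "0 \<le> \<omega>"
  shows "norm ((\<Sum>j<m. glue (cutpt \<kappa> (lev m j)) unit_ft (\<lambda>x. - unit_ft x) \<omega>) / of_nat m) \<le> 4 * sqrt \<omega>"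
proof (cases "\<omega> \<le> 1 / 16")
  case True
  have b: "norm (glue (cutpt \<kappa> (lev m j)) unit_ft (\<lambda>x. - unit_ft x) \<omega> - of_real (\<kappa> * lev m j)) \<le> 4 * pi * \<omega>"
    if "j < m" for j
  proof -
    let ?p = "cutpt \<kappa> (lev m j)"
    have p: "0 \<le> ?p" "?p \<le> 1"
      using cut_bounds[OF \<kappa> abs_lev_le[OF that]] by auto
    have eq: "glue ?p unit_ft (\<lambda>x. - unit_ft x) \<omega> - of_real (\<kappa> * lev m j)
       = 2 * of_real ?p * (unit_ft (?p * \<omega>) - 1) - (unit_ft \<omega> - 1)"
    proof -
      have gen: "P * A + e * ((1 - P) * (- B)) - (2 * P - 1) = 2 * P * (A - 1) - ((P * A + e * ((1 - P) * B)) - 1)"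
        for P A B e :: complex by (simp add: algebra_simps)
      define P where "P = complex_of_real ?p"
      have 1: "complex_of_real (\<kappa> * lev m j) = 2 * P - 1"
        by (simp add: P_def cutpt_def field_simps)
      have 2: "unit_ft \<omega> = P * unit_ft (?p * \<omega>) + ee (?p * \<omega>) * ((1 - P) * unit_ft ((1 - ?p) * \<omega>))"
        using unit_ft_glue[OF p, of \<omega>] by (simp add: glue_def P_def)
      have 3: "glue ?p unit_ft (\<lambda>x. - unit_ft x) \<omega>
          = P * unit_ft (?p * \<omega>) + ee (?p * \<omega>) * ((1 - P) * (- unit_ft ((1 - ?p) * \<omega>)))"
        by (simp add: glue_def P_def)
      show ?thesis
        unfolding 1 3 P_def[symmetric] by (subst 2) (rule gen)
    qed
    have "norm (2 * of_real ?p * (unit_ft (?p * \<omega>) - 1)) = 2 * ?p * norm (unit_ft (?p * \<omega>) - 1)"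
      using p by (simp add: norm_mult)
    also have "\<dots> \<le> 2 * ?p * (2 * pi * \<bar>?p * \<omega>\<bar>)"
      using p by (intro mult_left_mono norm_unit_ft_minus_1) auto
    also have "\<dots> = 2 * ?p * (2 * pi * (?p * \<omega>))"
      using p w by simp
    also have "\<dots> = 4 * pi * \<omega> * (?p * ?p)"
      by simp
    also have "\<dots> \<le> 4 * pi * \<omega> * (11 / 20 * (11 / 20))"
      using cut_bounds[OF \<kappa> abs_lev_le[OF that]] w by (intro mult_left_mono mult_mono) auto
    also have "\<dots> \<le> 2 * pi * \<omega>"
      using w by (simp add: field_simps)
    finally show ?thesis
      unfolding eq using norm_unit_ft_minus_1[of \<omega>] w
      by (intro order.trans[OF norm_triangle_ineq4]) simp
  qed
  have "(\<Sum>j<m. of_real (\<kappa> * lev m j)) = (0::complex)"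
    by (simp only: of_real_sum[symmetric] sum_distrib_left[symmetric] sum_lev) simp
  then have "norm (\<Sum>j<m. glue (cutpt \<kappa> (lev m j)) unit_ft (\<lambda>x. - unit_ft x) \<omega>)
      = norm (\<Sum>j<m. glue (cutpt \<kappa> (lev m j)) unit_ft (\<lambda>x. - unit_ft x) \<omega> - of_real (\<kappa> * lev m j))"
    by (simp add: sum_subtractf)
  also have "\<dots> \<le> (\<Sum>j<m. 4 * pi * \<omega>)"
    by (intro order.trans[OF norm_sum] sum_mono b) auto
  finally have "norm ((\<Sum>j<m. glue (cutpt \<kappa> (lev m j)) unit_ft (\<lambda>x. - unit_ft x) \<omega>) / of_nat m) \<le> 4 * pi * \<omega>"
    using m by (simp add: norm_divide field_simps)
  also have "\<dots> \<le> 4 * 4 * (sqrt \<omega> * sqrt \<omega>)"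
    using w pi_less_4 by (simp add: mult_right_mono)
  also have "\<dots> \<le> 4 * 4 * (sqrt \<omega> * (1 / 4))"
    using True w real_sqrt_le_mono[OF True] by (intro mult_left_mono) (auto simp: real_sqrt_divide)
  finally show ?thesis by simp
next
  case False
  have "norm (\<Sum>j<m. glue (cutpt \<kappa> (lev m j)) unit_ft (\<lambda>x. - unit_ft x) \<omega>) \<le> (\<Sum>j<m. 1)"
  proof (intro order.trans[OF norm_sum] sum_mono)
    fix j assume "j \<in> {..<m}"
    then have p: "0 \<le> cutpt \<kappa> (lev m j)" "cutpt \<kappa> (lev m j) \<le> 1"
      using cut_bounds[OF \<kappa> abs_lev_le, of j m] by auto
    have "fbound (glue (cutpt \<kappa> (lev m j)) unit_ft (\<lambda>x. - unit_ft x))"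
      using fbound_unit_ft[of 1] fbound_unit_ft[of "-1"] p by (intro fbound_glue) auto
    then show "norm (glue (cutpt \<kappa> (lev m j)) unit_ft (\<lambda>x. - unit_ft x) \<omega>) \<le> 1"
      by (rule fbound_bounded)
  qed
  then have "norm ((\<Sum>j<m. glue (cutpt \<kappa> (lev m j)) unit_ft (\<lambda>x. - unit_ft x) \<omega>) / of_nat m) \<le> 1"
    using m by (simp add: norm_divide field_simps)
  also have "1 \<le> 4 * sqrt \<omega>"
    using False real_sqrt_le_mono[of "1/16" \<omega>] by (simp add: real_sqrt_divide)
  finally show ?thesis .
qed

text \<open>Cauchy-Schwarz for (4, K) and (c, r) in the form of Lagrange's identity, with K = 76/5.
  It rests on 16 + K^2 < 16^2, and the margin comes from the factor 19/20 gained by the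
  children.\<close>

lemma cauchy_schwarz_rotation:
  fixes c b r :: real
  assumes "0 \<le> r" "0 \<le> c" "b\<^sup>2 = c\<^sup>2 + r\<^sup>2" "0 \<le> b"
  shows "4 * c + 16 * (19 / 20) * r \<le> 16 * b"
proof -
  have gen: "(4 * c + K * r)\<^sup>2 + (4 * r - K * c)\<^sup>2 = (16 + K\<^sup>2) * (c\<^sup>2 + r\<^sup>2)" for K :: real
    by (simp add: power2_eq_square algebra_simps)
  have "(4 * c + 16 * (19 / 20) * r)\<^sup>2 + (4 * r - 16 * (19 / 20) * c)\<^sup>2 = (16 + (16 * (19 / 20))\<^sup>2) * (c\<^sup>2 + r\<^sup>2)"
    by (rule gen)
  also have "\<dots> \<le> 16\<^sup>2 * b\<^sup>2"
    unfolding assms(3)[symmetric] by (intro mult_right_mono) (auto simp: power2_eq_square)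
  also have "\<dots> = (16 * b)\<^sup>2"
    by (simp only: power_mult_distrib)
  finally have "(4 * c + 16 * (19 / 20) * r)\<^sup>2 \<le> (16 * b)\<^sup>2"
    by (smt (verit) zero_le_power2)
  then show ?thesis
    by (rule power2_le_imp_le) (use assms in simp)
qed

text \<open>The means of the children are that of the node plus or minus the Haar coefficient, so
  the deviation splits into a Haar part and the glued deviations of the children. A child of
  relative length q gains q sqrt q \<le> (11/20)^(3/2), and 2 (11/20)^3 \<le> (19/20)^2 * 3/8 shows
  that the weight 3/8 in \<open>amp2\<close> is large enough.\<close>

lemma norm_tree_minus_avg_le:
  "0 \<le> \<omega> \<Longrightarrow> norm (F h k \<omega> - of_real (tavg v h k) * unit_ft \<omega>) \<le> 16 * amp v h k * sqrt \<omega>"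
proof (induction h arbitrary: k \<omega>)
  case 0
  then show ?case by (simp add: amp_def)
next
  case (Suc h)
  define c where "c = haar v h k"
  define \<kappa> where "\<kappa> = kap (Suc h) k"
  let ?L = "\<lambda>x. F h (2*k) x - of_real (tavg v h (2*k)) * unit_ft x"
  let ?R = "\<lambda>x. F h (2*k+1) x - of_real (tavg v h (2*k+1)) * unit_ft x"
  define r where "r = sqrt (3 / 8 * (amp2 v h (2*k) + amp2 v h (2*k+1)))"
  have r: "0 \<le> r" "r\<^sup>2 = 3 / 8 * (amp2 v h (2*k) + amp2 v h (2*k+1))"
    using amp2_nonneg[of v h] by (simp_all add: r_def)
  have pb: "9/20 \<le> cutpt \<kappa> (lev m j)" "cutpt \<kappa> (lev m j) \<le> 11/20" if "j < m" for j
    using cut_kap[OF abs_lev_le[OF that], of "Suc h" k] by (auto simp: \<kappa>_def)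
  have split: "glue (cutpt \<kappa> (lev m j)) (F h (2*k)) (F h (2*k+1)) \<omega> - of_real (tavg v (Suc h) k) * unit_ft \<omega>
      = of_real c * glue (cutpt \<kappa> (lev m j)) unit_ft (\<lambda>x. - unit_ft x) \<omega> + glue (cutpt \<kappa> (lev m j)) ?L ?R \<omega>"
    if "j < m" for j
  proof -
    let ?p = "cutpt \<kappa> (lev m j)"
    have gen: "p * FL + e * (q * FR) = c * (p * U + e * (q * (- W)))
        + (p * (FL - (T + c) * U) + e * (q * (FR - (T - c) * W))) + T * (p * U + e * (q * W))"
      for p q c e FL FR U W T :: complex by (simp add: algebra_simps)
    have L: "tavg v h (2*k) = tavg v (Suc h) k + c" and R: "tavg v h (2*k+1) = tavg v (Suc h) k - c"
      by (simp_all add: c_def haar_def field_simps)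
    have "glue ?p (F h (2*k)) (F h (2*k+1)) \<omega>
        = of_real c * glue ?p unit_ft (\<lambda>x. - unit_ft x) \<omega> + glue ?p ?L ?R \<omega>
          + of_real (tavg v (Suc h) k) * glue ?p unit_ft unit_ft \<omega>"
      unfolding glue_def L R of_real_add of_real_diff[of "tavg v (Suc h) k" c] by (rule gen)
    then show ?thesis
      using unit_ft_glue[of ?p \<omega>] pb[OF that] by simp
  qed
  have sub: "norm (glue (cutpt \<kappa> (lev m j)) ?L ?R \<omega>) \<le> 16 * (19 / 20) * r * sqrt \<omega>" if "j < m" for j
  proof -
    let ?p = "cutpt \<kappa> (lev m j)"
    have one: "q * (16 * a * sqrt (q * \<omega>)) \<le> 16 * a * sqrt \<omega> * (11/20 * sqrt (11/20))"
      if "9/20 \<le> q" "q \<le> 11/20" "0 \<le> a" for q a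
    proof -
      have "q * (16 * a * sqrt (q * \<omega>)) = 16 * a * sqrt \<omega> * (q * sqrt q)"
        by (simp add: real_sqrt_mult)
      also have "\<dots> \<le> 16 * a * sqrt \<omega> * (11/20 * sqrt (11/20))"
        using that Suc.prems by (intro mult_left_mono mult_mono) auto
      finally show ?thesis .
    qed
    have "norm (glue ?p ?L ?R \<omega>) \<le> ?p * norm (?L (?p * \<omega>)) + (1 - ?p) * norm (?R ((1 - ?p) * \<omega>))"
      using pb[OF that] unfolding glue_def
      by (intro norm_triangle_le) (simp add: norm_mult del: of_real_diff)
    also have "\<dots> \<le> ?p * (16 * amp v h (2*k) * sqrt (?p * \<omega>)) + (1 - ?p) * (16 * amp v h (2*k+1) * sqrt ((1 - ?p) * \<omega>))"
      using pb[OF that] Suc.prems by (intro add_mono mult_left_mono Suc.IH mult_nonneg_nonneg) linarith+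
    also have "\<dots> \<le> 16 * amp v h (2*k) * sqrt \<omega> * (11/20 * sqrt (11/20)) + 16 * amp v h (2*k+1) * sqrt \<omega> * (11/20 * sqrt (11/20))"
      using pb[OF that] amp_bounds[OF v] by (intro add_mono one) auto
    also have "\<dots> = 16 * sqrt \<omega> * ((11/20 * sqrt (11/20)) * (amp v h (2*k) + amp v h (2*k+1)))"
      by (simp add: algebra_simps)
    also have "\<dots> \<le> 16 * sqrt \<omega> * (19 / 20 * r)"
    proof (rule mult_left_mono[OF power2_le_imp_le])
      have sum_le: "(a + b)\<^sup>2 \<le> 2 * (a\<^sup>2 + b\<^sup>2)" for a b :: real
        using zero_le_power2[of "a - b"] by (simp add: power2_eq_square algebra_simps)
      have sq: "(q * sqrt q * s)\<^sup>2 = q ^ 3 * s\<^sup>2" if "0 \<le> q" for q s :: real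
        using that by (simp add: power_mult_distrib) (simp add: power2_eq_square power3_eq_cube)
      have "((11/20 * sqrt (11/20)) * (amp v h (2*k) + amp v h (2*k+1)))\<^sup>2
         = (11/20)^3 * (amp v h (2*k) + amp v h (2*k+1))\<^sup>2"
        using sq[of "11/20"] by simp
      also have "\<dots> \<le> (11/20)^3 * (2 * (amp2 v h (2*k) + amp2 v h (2*k+1)))"
      proof (rule mult_left_mono)
        show "(amp v h (2*k) + amp v h (2*k+1))\<^sup>2 \<le> 2 * (amp2 v h (2*k) + amp2 v h (2*k+1))"
          unfolding amp_power2[symmetric] by (rule sum_le)
      qed simp
      also have "\<dots> \<le> (19/20)\<^sup>2 * (3 / 8 * (amp2 v h (2*k) + amp2 v h (2*k+1)))"
        using amp2_nonneg[of v h] by (simp add: power2_eq_square power3_eq_cube)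
      finally show "((11/20 * sqrt (11/20)) * (amp v h (2*k) + amp v h (2*k+1)))\<^sup>2 \<le> (19 / 20 * r)\<^sup>2"
        unfolding power_mult_distrib[of "19 / 20" r] r(2) .
    qed (use r Suc.prems in simp_all)
    finally show ?thesis by (simp add: mult_ac)
  qed
  have "F (Suc h) k \<omega> - of_real (tavg v (Suc h) k) * unit_ft \<omega>
     = (\<Sum>j<m. glue (cutpt \<kappa> (lev m j)) (F h (2*k)) (F h (2*k+1)) \<omega> - of_real (tavg v (Suc h) k) * unit_ft \<omega>) / of_nat m"
    using m by (simp only: tree_ft.simps \<kappa>_def[symmetric]) (simp add: sum_subtractf diff_divide_distrib)
  also have "\<dots> = of_real c * ((\<Sum>j<m. glue (cutpt \<kappa> (lev m j)) unit_ft (\<lambda>x. - unit_ft x) \<omega>) / of_nat m)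
      + (\<Sum>j<m. glue (cutpt \<kappa> (lev m j)) ?L ?R \<omega>) / of_nat m"
    using split by (simp add: sum.distrib sum_distrib_left add_divide_distrib)
  also have "norm \<dots> \<le> \<bar>c\<bar> * (4 * sqrt \<omega>) + 16 * (19 / 20) * r * sqrt \<omega>"
  proof (intro norm_triangle_le add_mono)
    show "norm (of_real c * ((\<Sum>j<m. glue (cutpt \<kappa> (lev m j)) unit_ft (\<lambda>x. - unit_ft x) \<omega>) / of_nat m)) \<le> \<bar>c\<bar> * (4 * sqrt \<omega>)"
      unfolding norm_mult norm_of_real \<kappa>_def
      by (intro mult_left_mono avg_haar_ft_le kap_bounds Suc.prems) auto
    have "norm (\<Sum>j<m. glue (cutpt \<kappa> (lev m j)) ?L ?R \<omega>) \<le> (\<Sum>j<m. 16 * (19 / 20) * r * sqrt \<omega>)"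
      by (intro order.trans[OF norm_sum] sum_mono sub) auto
    then show "norm ((\<Sum>j<m. glue (cutpt \<kappa> (lev m j)) ?L ?R \<omega>) / of_nat m) \<le> 16 * (19 / 20) * r * sqrt \<omega>"
      using m by (simp add: norm_divide field_simps)
  qed
  also have "\<dots> = (4 * \<bar>c\<bar> + 16 * (19 / 20) * r) * sqrt \<omega>"
    by (simp add: algebra_simps)
  also have "\<dots> \<le> 16 * amp v (Suc h) k * sqrt \<omega>"
  proof (rule mult_right_mono[OF cauchy_schwarz_rotation])
    show "(amp v (Suc h) k)\<^sup>2 = \<bar>c\<bar>\<^sup>2 + r\<^sup>2"
      unfolding amp_power2 r by (simp add: c_def)
  qed (use r Suc.prems amp_bounds[OF v] in auto)
  finally show ?case .
qed

end

context cascade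
begin

text \<open>The threshold \<omega>^(-2/3) for \<open>amp\<close> balances two bounds. Below it the
  node is close to a constant, with an error of order \<open>amp\<close> * sqrt \<omega>; above it
  the ratios are wide enough for the averaging bound of order 1 / sqrt (\<eta> \<open>amp\<close>
  \<omega>). Both are O(\<omega>^(-1/6)).\<close>

lemma norm_tree_decay:
  assumes w: "1 \<le> \<omega>" "\<omega> \<le> m / 2"
  shows "norm (F h k \<omega>) \<le> 20 / sqrt \<eta> * \<omega> powr (- 1 / 6)"
proof (cases "amp v h k < \<omega> powr (- 2 / 3)")
  case True
  have "norm (F h k \<omega>) \<le> norm (F h k \<omega> - of_real (tavg v h k) * unit_ft \<omega>) + norm (of_real (tavg v h k) * unit_ft \<omega>)"
    using norm_triangle_ineq[of "F h k \<omega> - of_real (tavg v h k) * unit_ft \<omega>" "of_real (tavg v h k) * unit_ft \<omega>"]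
    by simp
  also have "\<dots> \<le> 16 * amp v h k * sqrt \<omega> + 1 * (1 / \<omega>)"
  proof (rule add_mono)
    show "norm (F h k \<omega> - of_real (tavg v h k) * unit_ft \<omega>) \<le> 16 * amp v h k * sqrt \<omega>"
      using w by (intro norm_tree_minus_avg_le) simp
    have "0 \<le> tvar v h k"
      using energy_le[of v h k] energy_ge_amp2[of v h k] amp2_nonneg[of v h k] by linarith
    then have "(tavg v h k)\<^sup>2 \<le> 1"
      using tvar_le[OF v, of h k] by linarith
    then have "\<bar>tavg v h k\<bar> \<le> 1"
      by (simp add: abs_square_le_1)
    then show "norm (of_real (tavg v h k) * unit_ft \<omega>) \<le> 1 * (1 / \<omega>)"
      unfolding norm_mult norm_of_real using w by (intro mult_mono norm_unit_ft_le) auto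
  qed
  also have "\<dots> \<le> 16 * \<omega> powr (- 1 / 6) + \<omega> powr (- 1 / 6)"
  proof (rule add_mono)
    have "16 * amp v h k * sqrt \<omega> \<le> 16 * \<omega> powr (- 2 / 3) * \<omega> powr (1 / 2)"
      using True w amp_bounds[OF v, of h k] by (intro mult_mono) (auto simp: powr_half_sqrt)
    also have "\<dots> = 16 * \<omega> powr (- 1 / 6)"
      by (simp add: powr_add[symmetric])
    finally show "16 * amp v h k * sqrt \<omega> \<le> 16 * \<omega> powr (- 1 / 6)" .
    have "1 * (1 / \<omega>) = \<omega> powr (- 1)"
      using w by (simp add: powr_minus_divide)
    also have "\<dots> \<le> \<omega> powr (- 1 / 6)"
      using w by (intro powr_mono) auto
    finally show "1 * (1 / \<omega>) \<le> \<omega> powr (- 1 / 6)" .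
  qed
  also have "\<dots> \<le> 20 * \<omega> powr (- 1 / 6)" by simp
  also have "\<dots> \<le> 20 / sqrt \<eta> * \<omega> powr (- 1 / 6)"
    using eta by (intro mult_right_mono) (auto simp: field_simps)
  finally show ?thesis .
next
  case False
  then have a: "\<omega> powr (- 2 / 3) \<le> amp v h k" by simp
  moreover have pos: "0 < \<omega> powr (- 2 / 3)" using w by simp
  ultimately have a0: "0 < amp v h k" by linarith
  then obtain h' where h: "h = Suc h'"
    by (cases h) (auto simp: amp_def)
  have "norm (F h k \<omega>) \<le> 4 / sqrt (kap h k * \<omega>)"
    unfolding h using a0 w by (intro norm_tree_le_kap) (auto simp: h)
  also have "\<dots> \<le> 4 / sqrt (\<eta> * \<omega> powr (1 / 3))"
  proof -
    have "\<omega> powr (1 / 3) = \<omega> powr (- 2 / 3) * \<omega>"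
      using w powr_add[of \<omega> "- 2 / 3" 1] by simp
    also have "\<dots> \<le> amp v h k * \<omega>"
      using a w by (intro mult_right_mono) auto
    finally have "\<eta> * \<omega> powr (1 / 3) \<le> \<eta> * (amp v h k * \<omega>)"
      using eta by (intro mult_left_mono) auto
    then have "sqrt (\<eta> * \<omega> powr (1 / 3)) \<le> sqrt (kap h k * \<omega>)"
      by (simp add: mult.assoc)
    moreover have "0 < sqrt (\<eta> * \<omega> powr (1 / 3))"
      using eta w by simp
    ultimately show ?thesis
      by (intro divide_left_mono mult_pos_pos) auto
  qed
  also have "\<dots> = 4 / sqrt \<eta> * \<omega> powr (- 1 / 6)"
  proof -
    have "sqrt (\<omega> powr (1 / 3)) = \<omega> powr (1 / 6)"
      using w by (simp add: powr_half_sqrt[symmetric] powr_powr)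
    then show ?thesis
      using w by (simp add: real_sqrt_mult powr_minus_divide)
  qed
  also have "\<dots> \<le> 20 / sqrt \<eta> * \<omega> powr (- 1 / 6)"
    using eta by (intro mult_right_mono divide_right_mono) auto
  finally show ?thesis .
qed

end

text \<open>Exponential-moment form of choosing one value for each block: the potential
  \<open>\<Sum>\<^sub>e exp (\<theta> S\<^sub>e)\<close> can be kept below its mean, as \<open>exp x \<le> x + exp (x\<^sup>2)\<close>.\<close>

lemma exp_le_add_exp_square: "exp x \<le> x + exp (x\<^sup>2)" for x :: real
proof -
  consider "x \<ge> 1" | "0 \<le> x" "x \<le> 1" | "x < 0" by linarith
  then show ?thesis
  proof cases
    case 1
    then have "x * 1 \<le> x * x" by (intro mult_left_mono) auto
    then have "exp x \<le> exp (x\<^sup>2)" by (simp add: power2_eq_square)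
    then show ?thesis using 1 by linarith
  next
    case 2
    then have "exp x \<le> 1 + x + x\<^sup>2" by (intro exp_bound) auto
    moreover have "1 + x\<^sup>2 \<le> exp (x\<^sup>2)" by (rule exp_ge_add_one_self)
    ultimately show ?thesis by linarith
  next
    case 3
    have "exp x \<le> 1 + x + x\<^sup>2"
    proof -
      have "(1 + x + x\<^sup>2) * (1 - x) = 1 - x ^ 3"
        by (simp add: power2_eq_square power3_eq_cube algebra_simps)
      moreover have "x ^ 3 \<le> 0" using 3 by (simp add: power3_eq_cube mult_nonpos_nonneg mult_nonneg_nonpos)
      ultimately have "1 \<le> (1 + x + x\<^sup>2) * (1 - x)" by linarith
      also have "\<dots> \<le> (1 + x + x\<^sup>2) * exp (- x)"
      proof (rule mult_left_mono)
        show "1 - x \<le> exp (- x)" using exp_ge_add_one_self[of "- x"] by simp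
        have "1 + x + x\<^sup>2 = (x + 1 / 2)\<^sup>2 + 3 / 4" by (simp add: power2_eq_square algebra_simps)
        then show "0 \<le> 1 + x + x\<^sup>2" by simp
      qed
      finally have "1 * exp x \<le> (1 + x + x\<^sup>2) * exp (- x) * exp x"
        by (intro mult_right_mono) auto
      then show ?thesis by (simp add: mult.assoc exp_add[symmetric])
    qed
    moreover have "1 + x\<^sup>2 \<le> exp (x\<^sup>2)" by (rule exp_ge_add_one_self)
    ultimately show ?thesis by linarith
  qed
qed

text \<open>Method of conditional expectations: the indices J are treated one by one. The linear
  term of the exponential averages out over t, so the mean of the new potential exceeds the old one
  by at most the factor exp (B J ^ 2), and some t does no worse than the mean.\<close>

lemma exists_values_potential:
  fixes f :: "'e \<Rightarrow> nat \<Rightarrow> nat \<Rightarrow> real"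
  assumes E: "finite E" and n: "n > 0"
    and mean: "\<And>e J. e \<in> E \<Longrightarrow> (\<Sum>t<n. f e J t) = 0"
    and bound: "\<And>e J t. e \<in> E \<Longrightarrow> t < n \<Longrightarrow> \<bar>f e J t\<bar> \<le> B J"
  shows "\<exists>\<tau>. (\<forall>J. \<tau> J < n) \<and>
    (\<Sum>e\<in>E. exp (\<Sum>J<q. f e J (\<tau> J))) \<le> card E * exp (\<Sum>J<q. (B J)\<^sup>2)"
proof (induction q)
  case 0
  then show ?case using n by auto
next
  case (Suc q)
  then obtain \<tau> where t: "\<And>J. \<tau> J < n"
    and IH: "(\<Sum>e\<in>E. exp (\<Sum>J<q. f e J (\<tau> J))) \<le> card E * exp (\<Sum>J<q. (B J)\<^sup>2)" by blast
  define P where "P = (\<lambda>e. exp (\<Sum>J<q. f e J (\<tau> J)))"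
  define A where "A = (\<Sum>e\<in>E. P e) * exp ((B q)\<^sup>2)"
  have "(\<Sum>t<n. \<Sum>e\<in>E. P e * exp (f e q t)) = (\<Sum>e\<in>E. P e * (\<Sum>t<n. exp (f e q t)))"
    by (subst sum.swap) (simp add: sum_distrib_left)
  also have "\<dots> \<le> (\<Sum>e\<in>E. P e * (n * exp ((B q)\<^sup>2)))"
  proof (intro sum_mono mult_left_mono)
    fix e assume e: "e \<in> E"
    have "(\<Sum>t<n. exp (f e q t)) \<le> (\<Sum>t<n. f e q t + exp ((B q)\<^sup>2))"
    proof (rule sum_mono)
      fix t assume "t \<in> {..<n}"
      then have "\<bar>f e q t\<bar> \<le> \<bar>B q\<bar>" using bound[OF e, of t q] by auto
      then have "(f e q t)\<^sup>2 \<le> (B q)\<^sup>2" by (rule abs_le_square_iff[THEN iffD1])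
      then have "exp ((f e q t)\<^sup>2) \<le> exp ((B q)\<^sup>2)" by simp
      then show "exp (f e q t) \<le> f e q t + exp ((B q)\<^sup>2)"
        using exp_le_add_exp_square[of "f e q t"] by linarith
    qed
    then show "(\<Sum>t<n. exp (f e q t)) \<le> n * exp ((B q)\<^sup>2)"
      using mean[OF e] by (simp add: sum.distrib)
  qed (simp add: P_def)
  also have "\<dots> = (\<Sum>t<n. A)"
    by (simp add: A_def sum_distrib_left sum_distrib_right mult_ac)
  finally have le: "(\<Sum>t<n. \<Sum>e\<in>E. P e * exp (f e q t)) \<le> (\<Sum>t<n. A)" .
  have "\<exists>t<n. (\<Sum>e\<in>E. P e * exp (f e q t)) \<le> A"
  proof (rule ccontr)
    assume "\<not> ?thesis"
    then have "(\<Sum>t<n. A) < (\<Sum>t<n. \<Sum>e\<in>E. P e * exp (f e q t))"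
      using n by (intro sum_strict_mono) (auto simp: not_le)
    with le show False by linarith
  qed
  then obtain t0 where t0: "t0 < n" "(\<Sum>e\<in>E. P e * exp (f e q t0)) \<le> A" by blast
  have eq: "(\<Sum>J<q. f e J ((\<tau>(q := t0)) J)) = (\<Sum>J<q. f e J (\<tau> J))" for e
    by (rule sum.cong) auto
  have "(\<Sum>e\<in>E. exp (\<Sum>J<Suc q. f e J ((\<tau>(q := t0)) J))) = (\<Sum>e\<in>E. P e * exp (f e q t0))"
    by (simp add: eq exp_add P_def)
  also have "\<dots> \<le> card E * exp (\<Sum>J<q. (B J)\<^sup>2) * exp ((B q)\<^sup>2)"
    using t0(2) mult_right_mono[OF IH exp_ge_zero[of "(B q)\<^sup>2"]] unfolding A_def P_def by linarith
  also have "\<dots> = card E * exp (\<Sum>J<Suc q. (B J)\<^sup>2)"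
    by (simp add: exp_add)
  finally show ?case using t t0 by (intro exI[of _ "\<tau>(q := t0)"]) auto
qed

text \<open>Each single exponential lies below the potential. Taking logarithms leaves the cost c /
  \<theta> of a union over \<open>E\<close> and a variance term, with \<theta> free for
  balancing.\<close>

lemma exists_values:
  fixes f :: "'e \<Rightarrow> nat \<Rightarrow> nat \<Rightarrow> real"
  assumes E: "finite E" and n: "n > 0" and \<theta>: "\<theta> > 0" and c: "real (card E) \<le> exp c"
    and mean: "\<And>e J. e \<in> E \<Longrightarrow> (\<Sum>t<n. f e J t) = 0"
    and bound: "\<And>e J t. e \<in> E \<Longrightarrow> t < n \<Longrightarrow> \<bar>f e J t\<bar> \<le> B J"
  shows "\<exists>\<tau>. (\<forall>J. \<tau> J < n) \<and> (\<forall>e\<in>E. (\<Sum>J<q. f e J (\<tau> J)) \<le> c / \<theta> + \<theta> * (\<Sum>J<q. (B J)\<^sup>2))"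
proof -
  obtain \<tau> where t: "\<forall>J. \<tau> J < n"
    and le: "(\<Sum>e\<in>E. exp (\<Sum>J<q. \<theta> * f e J (\<tau> J))) \<le> card E * exp (\<Sum>J<q. (\<theta> * B J)\<^sup>2)"
    using exists_values_potential[of E n "\<lambda>e J t. \<theta> * f e J t" "\<lambda>J. \<theta> * B J" q] assms
    by (auto simp: sum_distrib_left[symmetric] abs_mult mult_left_mono)
  have "(\<Sum>J<q. f e J (\<tau> J)) \<le> c / \<theta> + \<theta> * (\<Sum>J<q. (B J)\<^sup>2)" if e: "e \<in> E" for e
  proof -
    have "exp (\<Sum>J<q. \<theta> * f e J (\<tau> J)) \<le> (\<Sum>e\<in>E. exp (\<Sum>J<q. \<theta> * f e J (\<tau> J)))"
      using E e by (intro member_le_sum) auto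
    also have "\<dots> \<le> exp c * exp (\<Sum>J<q. (\<theta> * B J)\<^sup>2)"
      using mult_right_mono[OF c exp_ge_zero[of "\<Sum>J<q. (\<theta> * B J)\<^sup>2"]] le by linarith
    finally have "(\<Sum>J<q. \<theta> * f e J (\<tau> J)) \<le> c + (\<Sum>J<q. (\<theta> * B J)\<^sup>2)"
      by (simp add: exp_add[symmetric])
    then have "\<theta> * (\<Sum>J<q. f e J (\<tau> J)) \<le> \<theta> * (c / \<theta> + \<theta> * (\<Sum>J<q. (B J)\<^sup>2))"
      using \<theta> by (simp add: sum_distrib_left power_mult_distrib power2_eq_square mult_ac distrib_left)
    then show ?thesis using \<theta> by simp
  qed
  with t show ?thesis by blast
qed

text \<open>The real functions Re, -Re, Im and -Im of every sum are controlled at once, whence the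
  factor 4 at \<open>card E\<close>.\<close>

lemma exists_values_complex:
  fixes f :: "'e \<Rightarrow> nat \<Rightarrow> nat \<Rightarrow> complex"
  assumes E: "finite E" and n: "n > 0" and \<theta>: "\<theta> > 0" and c: "4 * real (card E) \<le> exp c"
    and mean: "\<And>e J. e \<in> E \<Longrightarrow> (\<Sum>t<n. f e J t) = 0"
    and bound: "\<And>e J t. e \<in> E \<Longrightarrow> t < n \<Longrightarrow> norm (f e J t) \<le> B J"
  shows "\<exists>\<tau>. (\<forall>J. \<tau> J < n) \<and> (\<forall>e\<in>E. norm (\<Sum>J<q. f e J (\<tau> J)) \<le> 2 * (c / \<theta> + \<theta> * (\<Sum>J<q. (B J)\<^sup>2)))"
proof -
  define g where "g = (\<lambda>(e, k::nat) J t. if k = 0 then Re (f e J t) else if k = 1 then - Re (f e J t)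
     else if k = 2 then Im (f e J t) else - Im (f e J t))"
  have "\<exists>\<tau>. (\<forall>J. \<tau> J < n) \<and> (\<forall>e\<in>E \<times> {..<4}. (\<Sum>J<q. g e J (\<tau> J)) \<le> c / \<theta> + \<theta> * (\<Sum>J<q. (B J)\<^sup>2))"
  proof (rule exists_values)
    show "real (card (E \<times> {..<4::nat})) \<le> exp c" using c E by (simp add: card_cartesian_product)
    fix x J assume x: "x \<in> E \<times> {..<4::nat}"
    then obtain e k where ek: "x = (e, k)" "e \<in> E" by auto
    have "Re (\<Sum>t<n. f e J t) = 0" "Im (\<Sum>t<n. f e J t) = 0" using mean[OF ek(2)] by auto
    then show "(\<Sum>t<n. g x J t) = 0"
      by (cases "k = 0"; cases "k = 1"; cases "k = 2") (simp_all add: g_def ek sum_negf)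
    fix t assume t: "t < n"
    show "\<bar>g x J t\<bar> \<le> B J"
      using bound[OF ek(2) t, of J] abs_Re_le_cmod[of "f e J t"] abs_Im_le_cmod[of "f e J t"]
      by (auto simp: g_def ek)
  qed (use E n \<theta> in auto)
  then obtain \<tau> where t: "\<forall>J. \<tau> J < n"
    and le: "\<And>x. x \<in> E \<times> {..<4} \<Longrightarrow> (\<Sum>J<q. g x J (\<tau> J)) \<le> c / \<theta> + \<theta> * (\<Sum>J<q. (B J)\<^sup>2)" by blast
  define K where "K = c / \<theta> + \<theta> * (\<Sum>J<q. (B J)\<^sup>2)"
  note le = le[folded K_def]
  have "norm (\<Sum>J<q. f e J (\<tau> J)) \<le> 2 * K" if e: "e \<in> E" for e
  proof -
    have "\<bar>Re (\<Sum>J<q. f e J (\<tau> J))\<bar> \<le> K"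
      using le[of "(e, 0)"] le[of "(e, 1)"] e by (simp add: g_def sum_negf)
    moreover have "\<bar>Im (\<Sum>J<q. f e J (\<tau> J))\<bar> \<le> K"
      using le[of "(e, 2)"] le[of "(e, 3)"] e by (simp add: g_def sum_negf)
    ultimately show ?thesis
      using cmod_le[of "\<Sum>J<q. f e J (\<tau> J)"] by linarith
  qed
  with t show ?thesis unfolding K_def by blast
qed

section \<open>Selecting a ratio for each cell\<close>

definition blen :: "(nat \<Rightarrow> real) \<Rightarrow> nat \<Rightarrow> nat \<Rightarrow> real" where
  "blen x e k = x ((k + 1) * 2 ^ e) - x (k * 2 ^ e)"

lemma blen_0: "blen x 0 k = x (Suc k) - x k"
  by (simp add: blen_def)

lemma blen_sum: "(\<Sum>j<2 ^ e'. blen x e (k * 2 ^ e' + j)) = blen x (e + e') k"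
proof -
  have tele: "(\<Sum>j<n. blen x e (a + j)) = x ((a + n) * 2 ^ e) - x (a * 2 ^ e)" for n a
    by (induction n) (simp_all add: blen_def algebra_simps)
  show ?thesis
    unfolding tele by (simp add: blen_def power_add algebra_simps)
qed

lemma sum_blocks:
  fixes g :: "nat \<Rightarrow> 'a::comm_monoid_add"
  shows "(\<Sum>i<2 ^ (e + e'). g (k * 2 ^ (e + e') + i))
     = (\<Sum>J<2 ^ e'. \<Sum>i<2 ^ e. g ((k * 2 ^ e' + J) * 2 ^ e + i))"
proof -
  have "(\<Sum>i<q * n. h i) = (\<Sum>J<q. \<Sum>i<n. h (J * n + i))" for q n :: nat and h :: "nat \<Rightarrow> 'a"
  proof -
    have "sum h {J * n..<J * n + n} = (\<Sum>i<n. h (J * n + i))" for J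
      by (simp add: sum.atLeastLessThan_shift_0[of h "J * n"] lessThan_atLeast0 o_def)
    then show ?thesis by (simp add: sum.nat_group[symmetric])
  qed
  from this[where q = "2 ^ e'" and n = "2 ^ e" and h = "\<lambda>i. g (k * 2 ^ (e + e') + i)"] show ?thesis
    by (simp add: power_add algebra_simps)
qed

text \<open>\<open>X i \<mu> s\<close> is the deviation from the mean that the cell \<open>[x i, x (i + 1)]\<close> contributes at frequency \<open>\<mu>\<close>
  when the choice \<open>s\<close> modulo \<open>2 m\<close> is made there.\<close>

locale selection =
  fixes x :: "nat \<Rightarrow> real" and X :: "nat \<Rightarrow> real \<Rightarrow> int \<Rightarrow> complex" and H m :: nat and A :: real
  assumes m: "m > 0" and A: "A \<ge> 0"
    and x_mono: "x i < x (Suc i)"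
    and child: "e < H \<Longrightarrow> blen x e k \<le> 11 / 20 * blen x (Suc e) (k div 2)"
    and X_bound: "0 \<le> \<mu> \<Longrightarrow> norm (X i \<mu> s) \<le> 2 * blen x 0 i"
    and X_per: "X i \<mu> (s mod (2 * int m)) = X i \<mu> s"
    and X_mean: "(\<Sum>t<2 * m. X i \<mu> (s + int t)) = 0"
    and X_lip_s: "0 \<le> \<mu> \<Longrightarrow>
      norm (X i \<mu> s - X i \<mu> s') \<le> A * blen x 0 i * (1 + \<mu> * blen x 0 i) * (of_int \<bar>s - s'\<bar> / m)"
    and X_lip_l: "0 \<le> \<mu> \<Longrightarrow> 0 \<le> \<mu>' \<Longrightarrow> j < 2 ^ e \<Longrightarrow>
      norm (ee (- \<mu> * x (k * 2 ^ e)) * X (k * 2 ^ e + j) \<mu> s - ee (- \<mu>' * x (k * 2 ^ e)) * X (k * 2 ^ e + j) \<mu>' s)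
        \<le> A * blen x 0 (k * 2 ^ e + j) * \<bar>\<mu> - \<mu>'\<bar> * blen x e k"
begin

lemma x_less: "i < j \<Longrightarrow> x i < x j"
  using lift_Suc_mono_less[of x i j] x_mono by simp

lemma blen_pos: "0 < blen x e k"
  by (simp add: blen_def x_less)

lemma blen_sub_le: "j < 2 ^ e' \<Longrightarrow> blen x e (k * 2 ^ e' + j) \<le> blen x (e + e') k"
  unfolding blen_sum[symmetric] by (rule member_le_sum) (auto simp: blen_pos less_imp_le)

lemma blen_geom: "e + e' \<le> H \<Longrightarrow> blen x e k \<le> (11 / 20) ^ e' * blen x (e + e') (k div 2 ^ e')"
proof (induction e' arbitrary: e k)
  case (Suc e')
  have "blen x e k \<le> 11 / 20 * blen x (Suc e) (k div 2)"
    using Suc.prems by (intro child) auto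
  also have "\<dots> \<le> 11 / 20 * ((11 / 20) ^ e' * blen x (Suc e + e') (k div 2 div 2 ^ e'))"
    using Suc by (intro mult_left_mono Suc.IH) auto
  finally show ?case by (simp add: div_mult2_eq)
qed simp

definition bsum :: "nat \<Rightarrow> nat \<Rightarrow> real \<Rightarrow> (nat \<Rightarrow> int) \<Rightarrow> int \<Rightarrow> complex" where
  "bsum e k \<mu> s \<sigma> = (\<Sum>i<2 ^ e. X (k * 2 ^ e + i) \<mu> (s (k * 2 ^ e + i) + \<sigma>))"

lemma norm_bsum_le:
  assumes "0 \<le> \<mu>" shows "norm (bsum e k \<mu> s \<sigma>) \<le> 2 * blen x e k"
proof -
  have "norm (bsum e k \<mu> s \<sigma>) \<le> (\<Sum>i<2 ^ e. 2 * blen x 0 (k * 2 ^ e + i))"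
    unfolding bsum_def by (intro order.trans[OF norm_sum] sum_mono X_bound assms)
  also have "\<dots> = 2 * blen x e k"
    using blen_sum[of x 0 k e] by (simp add: sum_distrib_left[symmetric])
  finally show ?thesis .
qed

lemma bsum_split:
  "bsum (e + e') k \<mu> s \<sigma> = (\<Sum>J<2 ^ e'. bsum e (k * 2 ^ e' + J) \<mu> s \<sigma>)"
  unfolding bsum_def by (rule sum_blocks)

text \<open>Demanded for all common shifts \<sigma>, so that a later shift of the whole block
  preserves it (\<open>good_shift\<close>). The range 16^e is wider than the final 4^e because
  blocks of height E also serve all heights up to 2 E, where 4^(2 E) = 16^E.\<close>

definition good :: "real \<Rightarrow> nat \<Rightarrow> nat \<Rightarrow> (nat \<Rightarrow> int) \<Rightarrow> bool" where
  "good C e k s \<longleftrightarrow> (\<forall>\<mu> \<sigma>. 0 \<le> \<mu> \<longrightarrow> \<mu> * blen x e k \<le> 16 ^ e \<longrightarrow>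
     norm (bsum e k \<mu> s \<sigma>) \<le> C * 2 powr (- real e / 8) * blen x e k)"

lemma good_shift:
  assumes "good C e k s" "\<And>i. i < 2 ^ e \<Longrightarrow> s' (k * 2 ^ e + i) = s (k * 2 ^ e + i) + c"
  shows "good C e k s'"
proof -
  have "bsum e k \<mu> s' \<sigma> = bsum e k \<mu> s (\<sigma> + c)" for \<mu> \<sigma>
    unfolding bsum_def using assms(2) by (intro sum.cong) (auto simp: algebra_simps)
  then show ?thesis using assms(1) by (simp add: good_def)
qed

lemma bsum_lip_s:
  assumes "0 \<le> \<mu>" "\<mu> * blen x e k \<le> K" "0 \<le> K"
  shows "norm (bsum e k \<mu> s \<sigma> - bsum e k \<mu> s \<sigma>') \<le> A * (1 + K) * (of_int \<bar>\<sigma> - \<sigma>'\<bar> / m) * blen x e k"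
proof -
  have "norm (bsum e k \<mu> s \<sigma> - bsum e k \<mu> s \<sigma>')
      \<le> (\<Sum>i<2 ^ e. A * (1 + K) * (of_int \<bar>\<sigma> - \<sigma>'\<bar> / m) * blen x 0 (k * 2 ^ e + i))"
    unfolding bsum_def sum_subtractf[symmetric]
  proof (intro order.trans[OF norm_sum] sum_mono)
    fix i assume i: "i \<in> {..<(2::nat) ^ e}"
    let ?i = "k * 2 ^ e + i"
    have "blen x 0 ?i \<le> blen x e k"
      using blen_sub_le[of i e 0 k] i by simp
    then have K: "1 + \<mu> * blen x 0 ?i \<le> 1 + K"
      using assms mult_left_mono[of "blen x 0 ?i" "blen x e k" \<mu>] by linarith
    have "norm (X ?i \<mu> (s ?i + \<sigma>) - X ?i \<mu> (s ?i + \<sigma>'))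
       \<le> A * blen x 0 ?i * (1 + \<mu> * blen x 0 ?i) * (of_int \<bar>(s ?i + \<sigma>) - (s ?i + \<sigma>')\<bar> / m)"
      by (rule X_lip_s) fact
    also have "\<dots> \<le> A * blen x 0 ?i * (1 + K) * (of_int \<bar>\<sigma> - \<sigma>'\<bar> / m)"
      using A blen_pos[of 0 ?i] K assms
      by (intro mult_mono mult_left_mono) (auto intro!: mult_nonneg_nonneg add_nonneg_nonneg less_imp_le[OF blen_pos])
    finally show "norm (X ?i \<mu> (s ?i + \<sigma>) - X ?i \<mu> (s ?i + \<sigma>'))
       \<le> A * (1 + K) * (of_int \<bar>\<sigma> - \<sigma>'\<bar> / m) * blen x 0 ?i" by (simp add: mult_ac)
  qed
  also have "\<dots> = A * (1 + K) * (of_int \<bar>\<sigma> - \<sigma>'\<bar> / m) * blen x e k"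
    using blen_sum[of x 0 k e] by (simp only: sum_distrib_left[symmetric] add_0)
  finally show ?thesis .
qed

text \<open>The phase at the left end of the block is removed first; otherwise the constant would
  grow with the position of the block and not only with its length.\<close>

lemma bsum_lip_l:
  assumes "0 \<le> \<mu>" "0 \<le> \<mu>'"
  shows "norm (ee (- \<mu> * x (k * 2 ^ e)) * bsum e k \<mu> s \<sigma> - ee (- \<mu>' * x (k * 2 ^ e)) * bsum e k \<mu>' s \<sigma>)
      \<le> A * (\<bar>\<mu> - \<mu>'\<bar> * blen x e k) * blen x e k"
proof -
  have "norm (ee (- \<mu> * x (k * 2 ^ e)) * bsum e k \<mu> s \<sigma> - ee (- \<mu>' * x (k * 2 ^ e)) * bsum e k \<mu>' s \<sigma>)
      \<le> (\<Sum>i<2 ^ e. A * (\<bar>\<mu> - \<mu>'\<bar> * blen x e k) * blen x 0 (k * 2 ^ e + i))"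
    unfolding bsum_def sum_distrib_left sum_subtractf[symmetric]
  proof (intro order.trans[OF norm_sum] sum_mono)
    fix i assume i: "i \<in> {..<(2::nat) ^ e}"
    let ?i = "k * 2 ^ e + i"
    have "norm (ee (- \<mu> * x (k * 2 ^ e)) * X ?i \<mu> (s ?i + \<sigma>) - ee (- \<mu>' * x (k * 2 ^ e)) * X ?i \<mu>' (s ?i + \<sigma>))
      \<le> A * blen x 0 ?i * \<bar>\<mu> - \<mu>'\<bar> * blen x e k"
      using i assms by (intro X_lip_l) auto
    then show "norm (ee (- \<mu> * x (k * 2 ^ e)) * X ?i \<mu> (s ?i + \<sigma>) - ee (- \<mu>' * x (k * 2 ^ e)) * X ?i \<mu>' (s ?i + \<sigma>))
      \<le> A * (\<bar>\<mu> - \<mu>'\<bar> * blen x e k) * blen x 0 ?i" by (simp add: mult_ac)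
  qed
  also have "\<dots> = A * (\<bar>\<mu> - \<mu>'\<bar> * blen x e k) * blen x e k"
    using blen_sum[of x 0 k e] by (simp add: sum_distrib_left[symmetric])
  finally show ?thesis .
qed

lemma bsum_per: "bsum e k \<mu> s (\<sigma> mod (2 * int m)) = bsum e k \<mu> s \<sigma>"
  unfolding bsum_def
proof (rule sum.cong[OF refl])
  fix i
  let ?i = "k * 2 ^ e + i"
  have "X ?i \<mu> (s ?i + \<sigma> mod (2 * int m)) = X ?i \<mu> ((s ?i + \<sigma> mod (2 * int m)) mod (2 * int m))"
    by (rule X_per[symmetric])
  also have "\<dots> = X ?i \<mu> ((s ?i + \<sigma>) mod (2 * int m))"
    by (simp add: mod_simps)
  finally show "X ?i \<mu> (s ?i + \<sigma> mod (2 * int m)) = X ?i \<mu> (s ?i + \<sigma>)"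
    by (simp only: X_per)
qed

text \<open>A full period of shifts annihilates every cell separately, whatever the choices
  \<open>s\<close> inside the block. With respect to a common shift, a block is thus a single random
  variable of mean 0.\<close>

lemma bsum_mean: "(\<Sum>t<2 * m. bsum e k \<mu> s (\<sigma> + int t)) = 0"
proof -
  have "(\<Sum>t<2 * m. bsum e k \<mu> s (\<sigma> + int t))
      = (\<Sum>i<2 ^ e. \<Sum>t<2 * m. X (k * 2 ^ e + i) \<mu> ((s (k * 2 ^ e + i) + \<sigma>) + int t))"
    unfolding bsum_def by (subst sum.swap) (simp add: algebra_simps)
  also have "\<dots> = 0" by (simp only: X_mean sum.neutral_const)
  finally show ?thesis .
qed

end

section \<open>Selection on blocks of doubling height\<close>

lemma quarter_root_half: "((2::real) powr (- 1 / 4)) ^ 4 = 1 / 2"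
proof -
  have "((2::real) powr (- 1 / 4)) ^ 4 = 2 powr (- 1)"
    using powr_realpow[of "2 powr (- 1 / 4 :: real)" 4, symmetric] by (simp only: powr_powr) simp
  then show ?thesis by (simp add: powr_minus_divide)
qed

text \<open>The factor E stems from the logarithm of the number of constraints; half of the decay
  2^(-E/2) pays for it. The ratio is at most 6/7, and 6/7 * 6 + 6/7 = 6 closes the
  induction.\<close>

lemma pow_exp_bound: "real E * (2 powr (- 1 / 4)) ^ E \<le> 6"
proof -
  define r where "r = 2 powr (- 1 / 4 :: real)"
  have r0: "0 < r" by (simp add: r_def)
  have "r ^ 4 = 1 / 2"
    unfolding r_def by (rule quarter_root_half)
  have r6: "r \<le> 6 / 7"
  proof (rule ccontr)
    assume "\<not> r \<le> 6 / 7"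
    then have "(6 / 7) ^ 4 \<le> r ^ 4" by (intro power_mono) auto
    then show False using \<open>r ^ 4 = 1 / 2\<close> by (simp add: power4_eq_xxxx)
  qed
  have "real E * r ^ E \<le> 6"
  proof (induction E)
    case (Suc E)
    have "real (Suc E) * r ^ Suc E = r * (real E * r ^ E) + r * r ^ E"
      by (simp add: algebra_simps)
    also have "\<dots> \<le> 6 / 7 * 6 + 6 / 7 * 1"
      using Suc r0 r6 by (intro add_mono mult_mono power_le_one) auto
    finally show ?case by simp
  qed simp
  then show ?thesis by (simp add: r_def)
qed

context selection
begin

definition Csel :: real where "Csel = 400 + 3 * A"

text \<open>A block of height 2 E consists of 2^E parts of height E, and exponential moments choose
  one shift for each part. It matters only that the parts have mean 0 over the shifts and size at
  most 2 (11/20)^E L. Frequencies and outer shifts are rounded to a finite set whose logarithm is of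
  order E.\<close>

lemma select_block:
  assumes E: "1 \<le> E" "2 * E \<le> H"
  shows "\<exists>\<tau>. good Csel (2 * E) k (\<lambda>i. s i + int (\<tau> (i div 2 ^ E - k * 2 ^ E)))"
proof -
  define L where "L = blen x (2 * E) k"
  define x0 where "x0 = x (k * 2 ^ (2 * E))"
  define r :: real where "r = 2 powr (- 1 / 4)"
  \<comment> \<open>With this spacing, rounding the frequency changes the block sum by at most A
    4^(-E) L.\<close>
  define \<delta> where "\<delta> = 1 / (4 ^ E * L)"
  \<comment> \<open>Spacing of the outer shifts. The Lipschitz constant in the shift is about 2^(8
    E), as \<mu> L \<le> 16^(2 E), and a gain of 2^(-E) is wanted, hence 9 E. If m < 2^(9 E), the
    spacing is 1 and nothing is rounded.\<close>
  define w where "w = max 1 (m div 2 ^ (9 * E))"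
  \<comment> \<open>The range \<mu> L \<le> 2^(8 E) with spacing 4^(-E) needs indices up to 2^(10
    E).\<close>
  define Es where "Es = {..(2::nat) ^ (10 * E)} \<times> {..(4::nat) * 2 ^ (9 * E)}"
  define f where "f = (\<lambda>(a::nat, b::nat) J t. ee (- (real a * \<delta>) * x0) *
      bsum E (k * 2 ^ E + J) (real a * \<delta>) s (int (b * w) + int t))"
  have L: "L > 0" by (simp add: L_def blen_pos)
  have d: "\<delta> > 0" using L by (simp add: \<delta>_def)
  have w: "w \<ge> 1" by (simp add: w_def)
  have r0: "0 < r" by (simp add: r_def)
  have "2 powr (- 1 / 2) = r ^ 2"
    by (simp add: r_def powr_power)
  then have r2: "r\<^sup>2 = 1 / sqrt 2"
    by (simp add: powr_minus_divide powr_half_sqrt)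
  have BJ: "blen x E (k * 2 ^ E + J) \<le> (11 / 20) ^ E * L" if "J < 2 ^ E" for J
    using blen_geom[of E E "k * 2 ^ E + J"] E that by (simp add: L_def mult_2)
  have Bsum: "(\<Sum>J<2 ^ E. blen x E (k * 2 ^ E + J)) = L"
    using blen_sum[of x E k E] by (simp add: L_def mult_2)
  define B where "B = (\<lambda>J. 2 * blen x E (k * 2 ^ E + J))"
  have B2: "(\<Sum>J<2 ^ E. (B J)\<^sup>2) \<le> 4 * (11 / 20) ^ E * L\<^sup>2"
  proof -
    have "(\<Sum>J<2 ^ E. (B J)\<^sup>2) \<le> (\<Sum>J<2 ^ E. 4 * ((11 / 20) ^ E * L) * blen x E (k * 2 ^ E + J))"
    proof (rule sum_mono)
      fix J assume "J \<in> {..<(2::nat) ^ E}"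
      then have "blen x E (k * 2 ^ E + J) * blen x E (k * 2 ^ E + J) \<le> ((11 / 20) ^ E * L) * blen x E (k * 2 ^ E + J)"
        using BJ[of J] blen_pos[of E "k * 2 ^ E + J"] by (intro mult_right_mono) auto
      then show "(B J)\<^sup>2 \<le> 4 * ((11 / 20) ^ E * L) * blen x E (k * 2 ^ E + J)"
        by (simp add: B_def power2_eq_square)
    qed
    also have "\<dots> = 4 * ((11 / 20) ^ E * L) * L"
      by (simp only: sum_distrib_left[symmetric] Bsum)
    finally show ?thesis by (simp add: power2_eq_square mult_ac)
  qed
  \<comment> \<open>The parameter \<theta> = 2^(E/2) / L makes the union term 25 E L 2^(-E/2), while
    the variance term is of order (sqrt 2 * 11/20)^E L; both are O(2^(-E/4) L).\<close>
  have "\<exists>\<tau>. (\<forall>J. \<tau> J < 2 * m) \<and> (\<forall>e\<in>Es. norm (\<Sum>J<2 ^ E. f e J (\<tau> J))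
      \<le> 2 * ((25 * E) / (sqrt 2 ^ E / L) + (sqrt 2 ^ E / L) * (\<Sum>J<2 ^ E. (B J)\<^sup>2)))"
  proof (rule exists_values_complex)
    show "finite Es" by (simp add: Es_def)
    show "2 * m > 0" using m by simp
    show "sqrt 2 ^ E / L > 0" using L by simp
    have "card Es = (2 ^ (10 * E) + 1) * (4 * 2 ^ (9 * E) + 1)"
      by (simp add: Es_def card_cartesian_product)
    also have "\<dots> \<le> (2 * 2 ^ (10 * E)) * (8 * 2 ^ (9 * E))"
      by (intro mult_mono) auto
    also have "\<dots> = 2 ^ (19 * E + 4)"
    proof -
      have "(2::nat) ^ (10 * E) * 2 ^ (9 * E) = 2 ^ (19 * E)"
        by (simp add: power_add[symmetric])
      then show ?thesis by (simp add: power_add)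
    qed
    finally have "4 * card Es \<le> 2 ^ (19 * E + 6)" by (simp add: power_add)
    also have "\<dots> \<le> 2 ^ (25 * E)" using E by (intro power_increasing) auto
    finally have "real (4 * card Es) \<le> real (2 ^ (25 * E))"
      by (simp only: of_nat_le_iff)
    then have "4 * real (card Es) \<le> 2 ^ (25 * E)" by simp
    also have "\<dots> \<le> exp 1 ^ (25 * E)"
      using exp_ge_add_one_self[of 1] by (intro power_mono) auto
    also have "\<dots> = exp (25 * E)"
      by (simp add: exp_of_nat_mult[symmetric] mult.commute)
    finally show "4 * real (card Es) \<le> exp (real (25 * E))" by simp
    fix e J assume "e \<in> Es"
    then obtain a b where e: "e = (a, b)" by (cases e)
    show "(\<Sum>t<2 * m. f e J t) = 0"
      using bsum_mean[of E "k * 2 ^ E + J" "real a * \<delta>" s "int (b * w)"]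
      by (simp add: f_def e sum_distrib_left[symmetric])
    fix t
    show "norm (f e J t) \<le> B J"
      using norm_bsum_le[of "real a * \<delta>"] d by (simp add: f_def e norm_mult B_def)
  qed
  then obtain \<tau> where tau: "\<And>e. e \<in> Es \<Longrightarrow> norm (\<Sum>J<2 ^ E. f e J (\<tau> J))
      \<le> 2 * ((25 * E) / (sqrt 2 ^ E / L) + (sqrt 2 ^ E / L) * (\<Sum>J<2 ^ E. (B J)\<^sup>2))" by blast
  define s' where "s' = (\<lambda>i. s i + int (\<tau> (i div 2 ^ E - k * 2 ^ E)))"
  have f_eq: "(\<Sum>J<2 ^ E. f (a, b) J (\<tau> J)) = ee (- (real a * \<delta>) * x0) * bsum (2 * E) k (real a * \<delta>) s' (int (b * w))" for a b
  proof -
    have "bsum (2 * E) k (real a * \<delta>) s' (int (b * w)) = (\<Sum>J<2 ^ E. bsum E (k * 2 ^ E + J) (real a * \<delta>) s' (int (b * w)))"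
      unfolding mult_2 by (rule bsum_split)
    also have "\<dots> = (\<Sum>J<2 ^ E. bsum E (k * 2 ^ E + J) (real a * \<delta>) s (int (b * w) + int (\<tau> J)))"
      unfolding bsum_def by (intro sum.cong refl arg_cong[where f = "X _ _"]) (simp add: s'_def)
    finally show ?thesis by (simp add: f_def sum_distrib_left)
  qed
  have grid: "norm (bsum (2 * E) k (real a * \<delta>) s' (int (b * w))) \<le> 400 * r ^ E * L"
    if "a \<le> 2 ^ (10 * E)" "b \<le> 4 * 2 ^ (9 * E)" for a b
  proof -
    have "(a, b) \<in> Es" using that by (simp add: Es_def)
    from tau[OF this] have "norm (bsum (2 * E) k (real a * \<delta>) s' (int (b * w)))
       \<le> 2 * ((25 * E) / (sqrt 2 ^ E / L) + (sqrt 2 ^ E / L) * (\<Sum>J<2 ^ E. (B J)\<^sup>2))"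
      by (simp add: f_eq norm_mult)
    also have "\<dots> \<le> 2 * ((25 * E) / (sqrt 2 ^ E / L) + (sqrt 2 ^ E / L) * (4 * (11 / 20) ^ E * L\<^sup>2))"
      using B2 L by (intro mult_left_mono add_left_mono) auto
    also have "\<dots> = L * (50 * (real E * (1 / sqrt 2) ^ E) + 8 * (sqrt 2 * (11 / 20)) ^ E)"
      using L by (simp add: power2_eq_square power_divide power_mult_distrib field_simps)
    also have "\<dots> \<le> L * (300 * r ^ E + 8 * r ^ E)"
    proof (intro mult_left_mono add_mono)
      have "real E * (1 / sqrt 2) ^ E = (real E * r ^ E) * r ^ E"
        unfolding r2[symmetric] by (simp add: power2_eq_square power_mult_distrib)
      also have "\<dots> \<le> 6 * r ^ E"
        using pow_exp_bound[of E] r0 by (intro mult_right_mono) (auto simp: r_def)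
      finally show "50 * (real E * (1 / sqrt 2) ^ E) \<le> 300 * r ^ E" by simp
      have "sqrt 2 * (11 / 20) \<le> r"
      proof (rule power_le_imp_le_base[where n = 3])
        have r3: "r ^ Suc 3 = 1 / 2"
          using quarter_root_half by (simp add: r_def eval_nat_numeral)
        have q3: "(sqrt 2 * (11 / 20)) ^ Suc 3 = 4 * (11 / 20) ^ 4"
        proof -
          have "(q * t) ^ Suc 3 = (q\<^sup>2)\<^sup>2 * t ^ 4" for q t :: real
            by (simp add: power2_eq_square eval_nat_numeral mult_ac)
          from this[of "sqrt 2" "11 / 20"] show ?thesis by simp
        qed
        show "(sqrt 2 * (11 / 20)) ^ Suc 3 \<le> r ^ Suc 3"
          unfolding q3 r3 by (simp add: power4_eq_xxxx)
      qed (use r0 in simp)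
      then show "(sqrt 2 * (11 / 20)) ^ E \<le> r ^ E"
        by (intro power_mono) auto
    qed (use L in auto)
    also have "\<dots> \<le> 400 * r ^ E * L"
      using L r0 by simp
    finally show ?thesis .
  qed
  have half: "(1 / 2) ^ E \<le> r ^ E"
  proof (rule power_mono)
    have "2 powr (- 1) \<le> (2::real) powr (- 1 / 4)" by (intro powr_mono) auto
    then show "1 / 2 \<le> r" by (simp add: r_def powr_minus_divide)
  qed simp
  have "good Csel (2 * E) k s'"
    unfolding good_def
  proof (intro allI impI)
    fix \<mu> :: real and \<sigma> :: int
    assume l: "0 \<le> \<mu>" and lL: "\<mu> * blen x (2 * E) k \<le> 16 ^ (2 * E)"
    define a where "a = nat \<lfloor>\<mu> / \<delta>\<rfloor>"
    have fl: "real a \<le> \<mu> / \<delta>" "\<mu> / \<delta> < real a + 1"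
      using l d by (simp_all add: a_def)
    have al: "real a * \<delta> \<le> \<mu>" "\<mu> - real a * \<delta> \<le> \<delta>"
      using fl d by (simp_all add: field_simps)
    have "\<mu> / \<delta> = 4 ^ E * (\<mu> * L)"
      by (simp add: \<delta>_def)
    also have "\<dots> \<le> 4 ^ E * 16 ^ (2 * E)"
      using lL by (intro mult_left_mono) (auto simp: L_def)
    also have "\<dots> = 2 ^ (10 * E)"
      by (simp add: power_mult power_mult_distrib[symmetric])
    finally have "real a \<le> 2 ^ (10 * E)" using fl by linarith
    then have a: "a \<le> 2 ^ (10 * E)" by simp
    define \<sigma>0 where "\<sigma>0 = nat (\<sigma> mod (2 * int m))"
    have s0: "int \<sigma>0 = \<sigma> mod (2 * int m)" "\<sigma>0 < 2 * m"
      using m by (auto simp: \<sigma>0_def nat_less_iff)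
    define b where "b = \<sigma>0 div w"
    define c where "c = \<sigma>0 mod w"
    have bc: "\<sigma>0 = b * w + c" "c < w" using w by (auto simp: b_def c_def)
    have m_lt: "m < 2 * w * 2 ^ (9 * E)"
    proof -
      have "m < (m div 2 ^ (9 * E) + 1) * 2 ^ (9 * E)"
        using dividend_less_div_times[of "2 ^ (9 * E)" m] by (simp add: algebra_simps)
      also have "\<dots> \<le> 2 * w * 2 ^ (9 * E)"
        by (intro mult_right_mono) (auto simp: w_def)
      finally show ?thesis .
    qed
    have "b * w \<le> \<sigma>0" using bc by simp
    also have "\<sigma>0 < 2 * m" by (rule s0)
    also have "2 * m < 2 * (2 * w * 2 ^ (9 * E))" using m_lt by (rule mult_strict_left_mono) simp
    also have "\<dots> = 4 * 2 ^ (9 * E) * w" by simp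
    finally have b: "b \<le> 4 * 2 ^ (9 * E)" by simp
    have "c * 2 ^ (9 * E) \<le> m"
    proof (cases "m div 2 ^ (9 * E) = 0")
      case True
      then show ?thesis using bc by (simp add: w_def)
    next
      case False
      then have "w = m div 2 ^ (9 * E)" by (simp add: w_def)
      then have "c * 2 ^ (9 * E) \<le> m div 2 ^ (9 * E) * 2 ^ (9 * E)"
        using bc by (intro mult_right_mono) auto
      also have "\<dots> \<le> m" by (rule div_times_less_eq_dividend)
      finally show ?thesis .
    qed
    then have "real (c * 2 ^ (9 * E)) \<le> real m"
      by (simp only: of_nat_le_iff)
    then have "real c * 2 ^ (9 * E) \<le> real m" by simp
    then have cm: "real c / real m \<le> 1 / 2 ^ (9 * E)"
      using m by (simp add: field_simps)
    let ?la = "real a * \<delta>"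
    have la0: "0 \<le> ?la" using d by simp
    have laL: "?la * blen x (2 * E) k \<le> 2 ^ (8 * E)"
    proof -
      have "?la * blen x (2 * E) k \<le> \<mu> * blen x (2 * E) k"
        using al blen_pos[of "2 * E" k] by (intro mult_right_mono) auto
      also have "\<dots> \<le> 2 ^ (8 * E)" using lL by (simp add: power_mult)
      finally show ?thesis .
    qed
    have "norm (bsum (2 * E) k \<mu> s' \<sigma>) = norm (ee (- \<mu> * x0) * bsum (2 * E) k \<mu> s' (int \<sigma>0))"
      by (simp add: norm_mult s0 bsum_per)
    also have "\<dots> \<le> norm (ee (- ?la * x0) * bsum (2 * E) k ?la s' (int \<sigma>0)) + A * (\<bar>\<mu> - ?la\<bar> * L) * L"
      using bsum_lip_l[OF l la0, of k "2 * E" s' "int \<sigma>0"]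
        norm_triangle_sub[of "ee (- \<mu> * x0) * bsum (2 * E) k \<mu> s' (int \<sigma>0)" "ee (- ?la * x0) * bsum (2 * E) k ?la s' (int \<sigma>0)"]
      unfolding x0_def L_def by linarith
    also have "A * (\<bar>\<mu> - ?la\<bar> * L) * L \<le> A * r ^ E * L"
    proof (intro mult_right_mono mult_left_mono)
      have "\<bar>\<mu> - ?la\<bar> * L \<le> \<delta> * L" using al L by (intro mult_right_mono) auto
      also have "\<dots> = (1 / 4) ^ E" using L by (simp add: \<delta>_def power_divide)
      also have "\<dots> \<le> (1 / 2) ^ E" by (intro power_mono) auto
      finally show "\<bar>\<mu> - ?la\<bar> * L \<le> r ^ E" using half by linarith
    qed (use A L in auto)
    also have "norm (ee (- ?la * x0) * bsum (2 * E) k ?la s' (int \<sigma>0)) = norm (bsum (2 * E) k ?la s' (int \<sigma>0))"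
      by (simp add: norm_mult)
    also have "\<dots> \<le> norm (bsum (2 * E) k ?la s' (int (b * w))) + A * (1 + 2 ^ (8 * E)) * (of_int \<bar>int \<sigma>0 - int (b * w)\<bar> / m) * L"
      using bsum_lip_s[OF la0 laL, of s' "int \<sigma>0" "int (b * w)"]
        norm_triangle_sub[of "bsum (2 * E) k ?la s' (int \<sigma>0)" "bsum (2 * E) k ?la s' (int (b * w))"]
      unfolding L_def by simp
    also have "A * (1 + 2 ^ (8 * E)) * (of_int \<bar>int \<sigma>0 - int (b * w)\<bar> / m) * L \<le> A * (2 * r ^ E) * L"
    proof (rule mult_right_mono)
      have "(of_int \<bar>int \<sigma>0 - int (b * w)\<bar> / m) = real c / m"
        by (simp add: bc(1))
      then have "(1 + 2 ^ (8 * E)) * (of_int \<bar>int \<sigma>0 - int (b * w)\<bar> / m) \<le> (2 * 2 ^ (8 * E)) * (1 / 2 ^ (9 * E))"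
        using cm by (intro mult_mono) auto
      also have "\<dots> = 2 * (1 / 2) ^ E"
        by (simp add: power_divide power_add[symmetric] field_simps)
      also have "\<dots> \<le> 2 * r ^ E" using half by simp
      finally show "A * (1 + 2 ^ (8 * E)) * (of_int \<bar>int \<sigma>0 - int (b * w)\<bar> / m) \<le> A * (2 * r ^ E)"
        using A by (simp only: mult.assoc) (rule mult_left_mono)
    qed (use L in simp)
    also have "norm (bsum (2 * E) k ?la s' (int (b * w))) \<le> 400 * r ^ E * L"
      by (rule grid[OF a b])
    finally have "norm (bsum (2 * E) k \<mu> s' \<sigma>) \<le> 400 * r ^ E * L + A * (2 * r ^ E) * L + A * r ^ E * L"
      by simp
    also have "\<dots> = Csel * r ^ E * L" by (simp add: Csel_def algebra_simps)
    also have "r ^ E = 2 powr (- real (2 * E) / 8)"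
      by (simp add: r_def powr_power)
    finally show "norm (bsum (2 * E) k \<mu> s' \<sigma>) \<le> Csel * 2 powr (- real (2 * E) / 8) * blen x (2 * E) k"
      by (simp add: L_def)
  qed
  then show ?thesis unfolding s'_def by blast
qed

lemma Csel_ge: "Csel \<ge> 400"
  using A by (simp add: Csel_def)

text \<open>The height doubles in every step, and the shifts added for height 2 E are constant on
  blocks of height E, so all estimates at smaller heights survive. At height 1 the trivial bound
  suffices because \<open>Csel\<close> is large.\<close>

lemma select_dyadic_heights:
  "\<exists>s. \<forall>i\<le>j. 2 ^ i \<le> H \<longrightarrow> (\<forall>k. good Csel (2 ^ i) k s)"
proof (induction j)
  case 0
  have "good Csel 1 k (\<lambda>_. 0)" for k
    unfolding good_def
  proof (intro allI impI)
    fix \<mu> :: real and \<sigma> assume l: "0 \<le> \<mu>"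
    have "2 powr (- 1) \<le> (2::real) powr (- 1 / 8)" by (intro powr_mono) auto
    then have "400 * (1 / 2) \<le> Csel * 2 powr (- 1 / 8)"
      using Csel_ge by (intro mult_mono) (auto simp: powr_minus_divide)
    then have "2 * blen x 1 k \<le> Csel * 2 powr (- 1 / 8) * blen x 1 k"
      using blen_pos[of 1 k] by (intro mult_right_mono) auto
    then show "norm (bsum 1 k \<mu> (\<lambda>_. 0) \<sigma>) \<le> Csel * 2 powr (- real 1 / 8) * blen x 1 k"
      using norm_bsum_le[OF l, of 1 k "\<lambda>_. 0" \<sigma>] by simp
  qed
  then show ?case by (intro exI[of _ "\<lambda>_. 0"]) auto
next
  case (Suc j)
  then obtain s where s: "\<And>i k. i \<le> j \<Longrightarrow> 2 ^ i \<le> H \<Longrightarrow> good Csel (2 ^ i) k s" by blast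
  show ?case
  proof (cases "2 ^ Suc j \<le> H")
    case False
    then show ?thesis using s by (intro exI[of _ s]) (auto simp: le_Suc_eq)
  next
    case True
    define E where "E = (2::nat) ^ j"
    have E: "1 \<le> E" "2 * E \<le> H" using True by (auto simp: E_def)
    have "\<forall>k. \<exists>\<tau>. good Csel (2 * E) k (\<lambda>i. s i + int (\<tau> (i div 2 ^ E - k * 2 ^ E)))"
      using select_block[OF E] by blast
    then obtain \<tau> where tau: "\<And>k. good Csel (2 * E) k (\<lambda>i. s i + int (\<tau> k (i div 2 ^ E - k * 2 ^ E)))"
      by metis
    \<comment> \<open>\<open>i div 2 ^ (2 * E)\<close> recovers the block of a cell, so the choices
      of all blocks merge into one sequence.\<close>
    define s' where "s' = (\<lambda>i. s i + int (\<tau> (i div 2 ^ (2 * E)) (i div 2 ^ E - (i div 2 ^ (2 * E)) * 2 ^ E)))"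
    have "good Csel (2 ^ i) k s'" if i: "i \<le> Suc j" "2 ^ i \<le> H" for i k
    proof (cases "i = Suc j")
      case True
      have "good Csel (2 * E) k s'"
        by (rule good_shift[OF tau[of k], of _ 0]) (simp add: s'_def)
      then show ?thesis using True by (simp add: E_def)
    next
      case False
      with i have ij: "i \<le> j" by simp
      then have le: "(2::nat) ^ i \<le> E" by (simp add: E_def)
      have d: "(k * 2 ^ 2 ^ i + l) div 2 ^ e = k div 2 ^ (e - 2 ^ i)" if "l < 2 ^ 2 ^ i" "2 ^ i \<le> e" for l e :: nat
      proof -
        have "(2::nat) ^ e = 2 ^ 2 ^ i * 2 ^ (e - 2 ^ i)"
          using that by (simp add: power_add[symmetric])
        then show ?thesis using that by (simp add: div_mult2_eq)
      qed
      show ?thesis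
        by (rule good_shift[OF s[OF ij i(2), of k]]) (use le in \<open>simp add: s'_def d\<close>)
    qed
    then show ?thesis by blast
  qed
qed

text \<open>A height e between consecutive powers of two E and 2 E is treated by cutting the block
  into blocks of height E. As only E / 8 \<ge> e / 16 remains, half of the exponent is lost.\<close>

lemma selection:
  "\<exists>s. \<forall>e\<le>H. \<forall>k \<mu>. 0 \<le> \<mu> \<longrightarrow> \<mu> * blen x e k \<le> 4 ^ e \<longrightarrow>
     norm (bsum e k \<mu> s 0) \<le> Csel * 2 powr (- real e / 16) * blen x e k"
proof -
  obtain s where s: "\<And>i k. i \<le> H \<Longrightarrow> 2 ^ i \<le> H \<Longrightarrow> good Csel (2 ^ i) k s"
    using select_dyadic_heights[of H] by blast
  have "norm (bsum e k \<mu> s 0) \<le> Csel * 2 powr (- real e / 16) * blen x e k"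
    if e: "e \<le> H" and l: "0 \<le> \<mu>" "\<mu> * blen x e k \<le> 4 ^ e" for e k \<mu>
  proof (cases "e = 0")
    case True
    have "2 * blen x e k \<le> Csel * blen x e k"
      using Csel_ge blen_pos[of e k] by (intro mult_right_mono) auto
    then show ?thesis
      using norm_bsum_le[OF l(1), of e k s 0] True by simp
  next
    case False
    then obtain j where j: "2 ^ j \<le> e" "e < 2 ^ Suc j"
      using ex_power_ivl1[of 2 e] by auto
    define E where "E = (2::nat) ^ j"
    define n where "n = e - E"
    have en: "e = E + n" "e \<le> 2 * E" using j by (auto simp: n_def E_def)
    have jH: "j \<le> H" "2 ^ j \<le> H"
      using j e less_exp[of j] by linarith+
    have "norm (bsum e k \<mu> s 0) \<le> (\<Sum>J<2 ^ n. Csel * 2 powr (- real e / 16) * blen x E (k * 2 ^ n + J))"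
      unfolding en(1) bsum_split
    proof (intro order.trans[OF norm_sum] sum_mono)
      fix J assume J: "J \<in> {..<(2::nat) ^ n}"
      have "\<mu> * blen x E (k * 2 ^ n + J) \<le> \<mu> * blen x e k"
        using blen_sub_le[of J n E k] J l en by (intro mult_left_mono) auto
      also have "\<dots> \<le> 4 ^ (2 * E)"
        using l en by (intro order.trans[OF l(2)] power_increasing) auto
      finally have "\<mu> * blen x E (k * 2 ^ n + J) \<le> 16 ^ E" by (simp add: power_mult)
      then have "norm (bsum E (k * 2 ^ n + J) \<mu> s 0) \<le> Csel * 2 powr (- real E / 8) * blen x E (k * 2 ^ n + J)"
        using s[OF jH] l by (simp add: good_def E_def)
      also have "\<dots> \<le> Csel * 2 powr (- real (E + n) / 16) * blen x E (k * 2 ^ n + J)"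
        using Csel_ge blen_pos[of E "k * 2 ^ n + J"] en by (intro mult_right_mono mult_left_mono powr_mono) auto
      finally show "norm (bsum E (k * 2 ^ n + J) \<mu> s 0) \<le> Csel * 2 powr (- real (E + n) / 16) * blen x E (k * 2 ^ n + J)" .
    qed
    also have "\<dots> = Csel * 2 powr (- real e / 16) * blen x e k"
      using blen_sum[of x E k n] en by (simp add: sum_distrib_left[symmetric])
    finally show ?thesis .
  qed
  then show ?thesis by blast
qed

end

text \<open>One period runs through the levels \<open>lev m\<close> upwards and then downwards, so that neighbouring shifts,
  also across the ends, give ratios that differ by \<open>O(1 / m)\<close>.\<close>

definition tent :: "nat \<Rightarrow> int \<Rightarrow> real" where
  "tent m j = (let i = j mod (2 * int m) in
     if i < int m then (2 * of_int i + 1 - real m) / real m else (3 * real m - 1 - 2 * of_int i) / real m)"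

lemma tent_mod: "tent m (j mod (2 * int m)) = tent m j"
  by (simp add: tent_def)

lemma abs_tent_le: "m > 0 \<Longrightarrow> \<bar>tent m j\<bar> \<le> 1"
proof -
  assume m: "m > 0"
  define i where "i = j mod (2 * int m)"
  have i: "0 \<le> i" "i < 2 * int m" using m by (simp_all add: i_def)
  then have "0 \<le> real_of_int i" "real_of_int i + 1 \<le> 2 * real m" by linarith+
  moreover have "real_of_int i + 1 \<le> real m" if "i < int m" using that by linarith
  moreover have "real_of_int i \<ge> real m" if "\<not> i < int m" using that by linarith
  ultimately show ?thesis
    using m by (auto simp: tent_def Let_def i_def[symmetric] abs_le_iff divide_simps)
qed

lemma tent_step: "m > 0 \<Longrightarrow> \<bar>tent m (j + 1) - tent m j\<bar> \<le> 2 / m"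
proof -
  assume m: "m > 0"
  define i where "i = j mod (2 * int m)"
  have i: "0 \<le> i" "i < 2 * int m" using m by (simp_all add: i_def)
  have n: "(j + 1) mod (2 * int m) = (if i + 1 = 2 * int m then 0 else i + 1)"
  proof -
    have "(j + 1) mod (2 * int m) = (i + 1) mod (2 * int m)"
      by (simp add: i_def mod_simps)
    then show ?thesis using i by (simp add: mod_pos_pos_trivial)
  qed
  consider "i + 1 < int m" | "i + 1 = int m" | "int m \<le> i" "i + 1 < 2 * int m" | "i + 1 = 2 * int m"
    using i by linarith
  then show ?thesis
  proof cases
    case 1
    then show ?thesis using m i by (simp add: tent_def Let_def i_def[symmetric] n diff_divide_distrib[symmetric])
  next
    case 2
    then have ii: "i = int m - 1" by linarith
    show ?thesis using m by (simp add: tent_def Let_def i_def[symmetric] n ii diff_divide_distrib[symmetric])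
  next
    case 3
    then show ?thesis using m i by (simp add: tent_def Let_def i_def[symmetric] n diff_divide_distrib[symmetric])
  next
    case 4
    then have ii: "i = 2 * int m - 1" by linarith
    show ?thesis using m by (simp add: tent_def Let_def i_def[symmetric] n ii diff_divide_distrib[symmetric])
  qed
qed

lemma tent_lipschitz:
  assumes "m > 0" shows "\<bar>tent m i - tent m j\<bar> \<le> 2 * (of_int \<bar>i - j\<bar> / m)"
proof -
  have nat: "\<bar>tent m (j + int n) - tent m j\<bar> \<le> 2 * (real n / m)" for j n
  proof (induction n)
    case (Suc n)
    have "\<bar>tent m (j + int n + 1) - tent m (j + int n)\<bar> \<le> 2 / m"
      by (rule tent_step[OF assms])
    with Suc show ?case by (simp add: add_divide_distrib algebra_simps)
  qed simp
  show ?thesis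
  proof (cases "j \<le> i")
    case True
    then show ?thesis using nat[of j "nat (i - j)"] by simp
  next
    case False
    then show ?thesis using nat[of i "nat (j - i)"] by (simp add: abs_minus_commute)
  qed
qed

lemma sum_periodic:
  fixes G :: "int \<Rightarrow> 'a::ab_group_add"
  assumes "\<And>j. G (j + int n) = G j"
  shows "(\<Sum>t<n. G (s + int t)) = (\<Sum>t<n. G (int t))"
proof -
  have step: "(\<Sum>t<n. G (s + 1 + int t)) = (\<Sum>t<n. G (s + int t))" for s
  proof -
    have "(\<Sum>t<n. G (s + 1 + int t)) + G s = (\<Sum>t<Suc n. G (s + int t))"
      by (subst sum.lessThan_Suc_shift) (simp add: algebra_simps)
    also have "\<dots> = (\<Sum>t<n. G (s + int t)) + G s" by (simp add: assms)
    finally show ?thesis by simp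
  qed
  show ?thesis
  proof (induction s rule: int_induct[where k = 0])
    case (step1 i)
    then show ?case using step[of i] by simp
  next
    case (step2 i)
    then show ?case using step[of "i - 1"] by simp
  qed simp
qed

text \<open>One period meets every level exactly twice, once going up and once going down.\<close>

lemma sum_tent:
  fixes g :: "real \<Rightarrow> complex"
  assumes m: "m > 0"
  shows "(\<Sum>t<2 * m. g (tent m (s + int t))) = 2 * (\<Sum>j<m. g (lev m j))"
proof -
  have per: "tent m (j + int (2 * m)) = tent m j" for j
    by (simp add: tent_def)
  have "(\<Sum>t<2 * m. g (tent m (s + int t))) = (\<Sum>t<2 * m. g (tent m (int t)))"
    by (rule sum_periodic) (simp only: per)
  also have "\<dots> = (\<Sum>t<m. g (tent m (int t))) + (\<Sum>t<m. g (tent m (int (m + t))))"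
    using sum.atLeastLessThan_concat[of 0 m "2 * m" "\<lambda>t. g (tent m (int t))", symmetric]
      sum.atLeastLessThan_shift_0[of "\<lambda>t. g (tent m (int t))" m "2 * m"]
    by (simp add: lessThan_atLeast0 o_def)
  also have "(\<Sum>t<m. g (tent m (int t))) = (\<Sum>j<m. g (lev m j))"
    by (intro sum.cong refl) (simp add: tent_def lev_def)
  also have "(\<Sum>t<m. g (tent m (int (m + t)))) = (\<Sum>t<m. g (lev m (m - Suc t)))"
  proof (intro sum.cong refl arg_cong[where f = g])
    fix t assume t: "t \<in> {..<m}"
    then have "tent m (int (m + t)) = (3 * real m - 1 - 2 * (real m + real t)) / real m"
      by (simp add: tent_def Let_def)
    also have "\<dots> = - lev m t" using m by (simp add: lev_def field_simps)
    finally show "tent m (int (m + t)) = lev m (m - Suc t)" using t by (simp add: lev_reflect)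
  qed
  also have "\<dots> = (\<Sum>j<m. g (lev m j))"
    by (rule sum.nat_diff_reindex)
  finally show ?thesis by simp
qed

text \<open>The ratio enters through the weights, the phase and the rescaled frequencies, each of
  which varies by at most a multiple of |p - p'| (1 + \<omega>). The constant 24 replaces 6
  pi.\<close>

lemma glue_lipschitz:
  assumes A: "fbound A" and B: "fbound B" and p: "0 \<le> p" "p \<le> 1" "0 \<le> p'" "p' \<le> 1" and w: "0 \<le> \<omega>"
  shows "norm (glue p A B \<omega> - glue p' A B \<omega>) \<le> 24 * \<bar>p - p'\<bar> * (1 + \<omega>)"
proof -
  let ?d = "\<bar>p - p'\<bar>"
  have w': "\<bar>p * \<omega> - p' * \<omega>\<bar> = ?d * \<omega>" "\<bar>(1 - p) * \<omega> - (1 - p') * \<omega>\<bar> = ?d * \<omega>"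
    using w by (simp_all add: abs_mult left_diff_distrib[symmetric] abs_minus_commute)
  have prod3: "norm (a * b * c - a' * b' * c') \<le> norm (a - a') + norm (b - b') + norm (c - c')"
    if "norm a \<le> 1" "norm b \<le> 1" "norm c \<le> 1" "norm a' \<le> 1" "norm b' \<le> 1" "norm c' \<le> 1"
    for a b c a' b' c' :: complex
  proof -
    have "a * b * c - a' * b' * c' = (a - a') * (b * c) + a' * ((b - b') * c) + a' * b' * (c - c')"
      by (simp add: algebra_simps)
    moreover have "norm ((a - a') * (b * c)) \<le> norm (a - a')" "norm (a' * ((b - b') * c)) \<le> norm (b - b')"
      "norm (a' * b' * (c - c')) \<le> norm (c - c')"
      using that by (auto simp: norm_mult intro!: mult_left_le_one_le mult_right_le_one_le mult_le_one mult_nonneg_nonneg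
         order.trans[OF mult_left_le_one_le])
    moreover have tri: "norm (P + Q + R) \<le> norm P + norm Q + norm R" for P Q R :: complex
      using norm_triangle_ineq[of "P + Q" R] norm_triangle_ineq[of P Q] by linarith
    ultimately show ?thesis
      by (simp only:) (intro order.trans[OF tri] add_mono)
  qed
  have 1: "norm (1 * of_real p * A (p * \<omega>) - 1 * of_real p' * A (p' * \<omega>)) \<le> norm (1 - 1 :: complex) + norm (of_real p - of_real p' :: complex) + norm (A (p * \<omega>) - A (p' * \<omega>))"
    using p fbound_bounded[OF A] by (intro prod3) auto
  have 2: "norm (ee (p * \<omega>) * of_real (1 - p) * B ((1 - p) * \<omega>) - ee (p' * \<omega>) * of_real (1 - p') * B ((1 - p') * \<omega>))
     \<le> norm (ee (p * \<omega>) - ee (p' * \<omega>)) + norm (of_real (1 - p) - of_real (1 - p') :: complex) + norm (B ((1 - p) * \<omega>) - B ((1 - p') * \<omega>))"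
  proof (rule prod3)
    show "norm (complex_of_real (1 - p)) \<le> 1" "norm (complex_of_real (1 - p')) \<le> 1"
      using p by (simp_all only: norm_of_real abs_le_iff) linarith+
  qed (use fbound_bounded[OF B] in simp_all)
  have n1: "norm (of_real p - of_real p' :: complex) = ?d" "norm (of_real (1 - p) - of_real (1 - p') :: complex) = ?d"
    by (simp_all only: of_real_diff[symmetric] norm_of_real)
  have "norm (glue p A B \<omega> - glue p' A B \<omega>)
     \<le> norm (1 * of_real p * A (p * \<omega>) - 1 * of_real p' * A (p' * \<omega>)) +
       norm (ee (p * \<omega>) * of_real (1 - p) * B ((1 - p) * \<omega>) - ee (p' * \<omega>) * of_real (1 - p') * B ((1 - p') * \<omega>))"
    unfolding glue_def mult_1 mult.assoc[symmetric] add_diff_add by (rule norm_triangle_ineq)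
  also have "\<dots> \<le> ?d + 2 * pi * (?d * \<omega>) + (2 * pi * (?d * \<omega>) + ?d + 2 * pi * (?d * \<omega>))"
    using n1 fbound_lipschitz[OF A, of "p * \<omega>" "p' * \<omega>"] fbound_lipschitz[OF B, of "(1 - p) * \<omega>" "(1 - p') * \<omega>"]
      ee_lipschitz[of "p * \<omega>" "p' * \<omega>"] unfolding w'
    by (intro add_mono[OF order.trans[OF 1] order.trans[OF 2]] add_mono) simp_all
  also have "\<dots> = 2 * ?d + 6 * pi * (?d * \<omega>)" by simp
  also have "\<dots> \<le> 24 * ?d + 24 * (?d * \<omega>)"
    using pi_less_4 w by (intro add_mono mult_right_mono) auto
  finally show ?thesis by (simp add: algebra_simps)
qed

section \<open>Refinement of dyadic grids\<close>

definition refine :: "(nat \<Rightarrow> real) \<Rightarrow> (nat \<Rightarrow> real) \<Rightarrow> nat \<Rightarrow> real" where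
  "refine p x i = (if even i then x (i div 2) else x (i div 2) + p (i div 2) * (x (i div 2 + 1) - x (i div 2)))"

lemma refine_even [simp]: "refine p x (2 * i) = x i"
  by (simp add: refine_def)

lemma refine_odd: "refine p x (2 * i + 1) = x i + p i * (x (Suc i) - x i)"
  by (simp add: refine_def)

lemma blen_refine_Suc: "blen (refine p x) (Suc e) k = blen x e k"
proof -
  have "(k + 1) * 2 ^ Suc e = 2 * ((k + 1) * 2 ^ e)" "k * 2 ^ Suc e = 2 * (k * 2 ^ e)" by simp_all
  then show ?thesis unfolding blen_def by (simp only: refine_even)
qed

lemma blen_refine_0:
  "blen (refine p x) 0 (2 * i) = p i * blen x 0 i"
  "blen (refine p x) 0 (2 * i + 1) = (1 - p i) * blen x 0 i"
proof -
  show "blen (refine p x) 0 (2 * i) = p i * blen x 0 i"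
    using refine_odd[of p x i] by (simp add: blen_0)
  have "Suc (2 * i + 1) = 2 * Suc i" by simp
  then show "blen (refine p x) 0 (2 * i + 1) = (1 - p i) * blen x 0 i"
    unfolding blen_0 by (simp only: refine_even refine_odd) (simp add: algebra_simps)
qed

text \<open>Indexed by all natural numbers, with 2^d cells in each unit interval, so that blocks
  need no case distinction at the end of the circle. The bound 11/20 for both halves of a block
  implies the lower bound 9/20, since they add up to the block.\<close>

definition dyadic_grid :: "nat \<Rightarrow> (nat \<Rightarrow> real) \<Rightarrow> bool" where
  "dyadic_grid d x \<longleftrightarrow> (\<forall>i. x i < x (Suc i)) \<and> (\<forall>k. x (k * 2 ^ d) = real k) \<and>
     (\<forall>e<d. \<forall>k. blen x e k \<le> 11 / 20 * blen x (Suc e) (k div 2))"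

lemma dyadic_grid_0: "dyadic_grid 0 real"
  by (simp add: dyadic_grid_def)

lemma dyadic_grid_refine:
  assumes x: "dyadic_grid d x" and p: "\<And>i. 9 / 20 \<le> p i" "\<And>i. p i \<le> 11 / 20"
  shows "dyadic_grid (Suc d) (refine p x)"
proof -
  have pos: "0 < blen x 0 i" for i using x by (simp add: dyadic_grid_def blen_0)
  have b0: "0 < blen (refine p x) 0 i \<and> blen (refine p x) 0 i \<le> 11 / 20 * blen x 0 (i div 2)" for i
  proof (cases "even i")
    case True
    then obtain j where i: "i = 2 * j" by blast
    have "p j * blen x 0 j \<le> 11 / 20 * blen x 0 j" "0 < p j * blen x 0 j"
      using p[of j] pos[of j] by (auto intro!: mult_right_mono mult_pos_pos)
    then show ?thesis unfolding i blen_refine_0 by simp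
  next
    case False
    then obtain j where i: "i = 2 * j + 1" by (elim oddE)
    have "(1 - p j) * blen x 0 j \<le> 11 / 20 * blen x 0 j" "0 < (1 - p j) * blen x 0 j"
      using p[of j] pos[of j] by (auto intro!: mult_right_mono mult_pos_pos)
    then show ?thesis unfolding i blen_refine_0 by simp
  qed
  show ?thesis
    unfolding dyadic_grid_def
  proof (intro conjI allI impI)
    fix i
    show "refine p x i < refine p x (Suc i)" using b0[of i] by (simp add: blen_0)
    have "refine p x (2 * (i * 2 ^ d)) = real i"
      using x by (simp only: refine_even) (simp add: dyadic_grid_def)
    then show "refine p x (i * 2 ^ Suc d) = real i" by (simp add: mult_ac)
  next
    fix e k assume e: "e < Suc d"
    show "blen (refine p x) e k \<le> 11 / 20 * blen (refine p x) (Suc e) (k div 2)"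
    proof (cases e)
      case 0
      then show ?thesis using b0[of k] by (simp add: blen_refine_Suc)
    next
      case (Suc e')
      then show ?thesis using x e by (simp add: blen_refine_Suc dyadic_grid_def)
    qed
  qed
qed

section \<open>Deviations of single cells\<close>

context cascade
begin

definition cell_var :: "(nat \<Rightarrow> real) \<Rightarrow> nat \<Rightarrow> nat \<Rightarrow> real \<Rightarrow> int \<Rightarrow> complex" where
  "cell_var x h i \<mu> s = of_real (blen x 0 i) * (ee (\<mu> * x i) *
     (glue (cutpt (kap (Suc h) i) (tent m s)) (F h (2 * i)) (F h (2 * i + 1)) (\<mu> * blen x 0 i)
       - F (Suc h) i (\<mu> * blen x 0 i)))"

lemma fbound_glue_tent: "fbound (glue (cutpt (kap (Suc h) i) (tent m s)) (F h (2 * i)) (F h (2 * i + 1)))"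
  using cut_kap[OF abs_tent_le[OF m], of "Suc h" i s] by (intro fbound_glue fbound_tree) linarith+

text \<open>The mean vanishes because \<open>F (Suc h)\<close> is by construction the average of the
  glued transforms over the levels. Size and Lipschitz bounds hold for all \<open>fbound\<close>
  transforms, so they are uniform in the tree.\<close>

lemma selection_cell_var:
  assumes x: "dyadic_grid d x"
  shows "selection x (cell_var x h) d m 24"
proof
  have pos: "0 < blen x 0 i" for i using x by (simp add: dyadic_grid_def blen_0)
  show "x i < x (Suc i)" for i using x by (simp add: dyadic_grid_def)
  show "blen x e k \<le> 11 / 20 * blen x (Suc e) (k div 2)" if "e < d" for e k
    using x that by (simp add: dyadic_grid_def)
  show "cell_var x h i \<mu> (s mod (2 * int m)) = cell_var x h i \<mu> s" for i \<mu> s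
    by (simp add: cell_var_def tent_mod)
  show "(\<Sum>t<2 * m. cell_var x h i \<mu> (s + int t)) = 0" for i \<mu> s
  proof -
    define g where "g = (\<lambda>s. glue (cutpt (kap (Suc h) i) s) (F h (2 * i)) (F h (2 * i + 1)) (\<mu> * blen x 0 i))"
    have "(\<Sum>t<2 * m. g (tent m (s + int t)) - F (Suc h) i (\<mu> * blen x 0 i))
       = 2 * (\<Sum>j<m. g (lev m j)) - of_nat (2 * m) * F (Suc h) i (\<mu> * blen x 0 i)"
      by (simp add: sum_subtractf sum_tent[OF m])
    also have "\<dots> = 0"
      using m by (simp only: tree_ft.simps g_def) simp
    finally show ?thesis
      unfolding cell_var_def g_def sum_distrib_left[symmetric] by simp
  qed
  fix \<mu> :: real assume mu: "0 \<le> \<mu>"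
  show "norm (cell_var x h i \<mu> s) \<le> 2 * blen x 0 i" for i s
  proof -
    have "norm (glue (cutpt (kap (Suc h) i) (tent m s)) (F h (2 * i)) (F h (2 * i + 1)) (\<mu> * blen x 0 i)
       - F (Suc h) i (\<mu> * blen x 0 i)) \<le> 1 + 1"
      by (intro order.trans[OF norm_triangle_ineq4] add_mono fbound_bounded fbound_glue_tent fbound_tree)
    then show ?thesis
      using pos[of i] by (simp add: cell_var_def norm_mult)
  qed
  show "norm (cell_var x h i \<mu> s - cell_var x h i \<mu> s')
      \<le> 24 * blen x 0 i * (1 + \<mu> * blen x 0 i) * (of_int \<bar>s - s'\<bar> / m)" for i s s'
  proof -
    let ?p = "\<lambda>s. cutpt (kap (Suc h) i) (tent m s)"
    have p: "0 \<le> ?p s" "?p s \<le> 1" for s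
      using cut_kap[OF abs_tent_le[OF m], of "Suc h" i s] by linarith+
    have "\<bar>?p s - ?p s'\<bar> = kap (Suc h) i * \<bar>tent m s - tent m s'\<bar> / 2"
    proof -
      have "\<bar>cutpt K a - cutpt K b\<bar> = K * \<bar>a - b\<bar> / 2" if "0 \<le> K" for K a b
      proof -
        have "cutpt K a - cutpt K b = K * (a - b) / 2"
          by (simp add: cutpt_def field_simps)
        then have "\<bar>cutpt K a - cutpt K b\<bar> = \<bar>K * (a - b) / 2\<bar>" by (rule arg_cong)
        then show ?thesis using that by (simp add: abs_mult)
      qed
      then show ?thesis using kap_bounds(1) by blast
    qed
    also have "\<dots> \<le> 1 * (2 * (of_int \<bar>s - s'\<bar> / m)) / 2"
      using kap_bounds[of "Suc h" i] tent_lipschitz[OF m, of s s']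
      by (intro divide_right_mono mult_mono) auto
    finally have pd: "\<bar>?p s - ?p s'\<bar> \<le> of_int \<bar>s - s'\<bar> / m" by simp
    have "norm (cell_var x h i \<mu> s - cell_var x h i \<mu> s') = blen x 0 i *
       norm (glue (?p s) (F h (2 * i)) (F h (2 * i + 1)) (\<mu> * blen x 0 i)
         - glue (?p s') (F h (2 * i)) (F h (2 * i + 1)) (\<mu> * blen x 0 i))"
      using pos[of i] unfolding cell_var_def right_diff_distrib[symmetric] by (simp add: norm_mult)
    also have "\<dots> \<le> blen x 0 i * (24 * \<bar>?p s - ?p s'\<bar> * (1 + \<mu> * blen x 0 i))"
      using pos[of i] mu p by (intro mult_left_mono glue_lipschitz fbound_tree) auto
    also have "\<dots> \<le> blen x 0 i * (24 * (of_int \<bar>s - s'\<bar> / m) * (1 + \<mu> * blen x 0 i))"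
      using pos[of i] mu pd by (intro mult_left_mono mult_right_mono) auto
    finally show ?thesis by (simp add: mult_ac)
  qed
  fix \<mu>' :: real assume mu': "0 \<le> \<mu>'"
  show "norm (ee (- \<mu> * x (k * 2 ^ e)) * cell_var x h (k * 2 ^ e + j) \<mu> s - ee (- \<mu>' * x (k * 2 ^ e)) * cell_var x h (k * 2 ^ e + j) \<mu>' s)
        \<le> 24 * blen x 0 (k * 2 ^ e + j) * \<bar>\<mu> - \<mu>'\<bar> * blen x e k" if j: "j < 2 ^ e" for e k j s
  proof -
    define i where "i = k * 2 ^ e + j"
    define y where "y = x i - x (k * 2 ^ e)"
    define D where "D = (\<lambda>\<omega>. glue (cutpt (kap (Suc h) i) (tent m s)) (F h (2 * i)) (F h (2 * i + 1)) \<omega> - F (Suc h) i \<omega>)"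
    have mono: "x a \<le> x b" if "a \<le> b" for a b
      using lift_Suc_mono_le[of x a b] x that by (auto simp: dyadic_grid_def less_imp_le)
    have y0: "0 \<le> y" unfolding y_def using mono[of "k * 2 ^ e" i] by (simp add: i_def)
    have yb: "y + blen x 0 i \<le> blen x e k"
      using mono[of "Suc i" "(k + 1) * 2 ^ e"] j by (simp add: y_def blen_0 blen_def[of x e] i_def)
    have Dn: "norm (D \<omega>) \<le> 2" for \<omega>
      unfolding D_def using fbound_bounded[OF fbound_glue_tent[of h i s], of \<omega>] fbound_bounded[OF fbound_tree[of "Suc h" i], of \<omega>]
      by (intro order.trans[OF norm_triangle_ineq4]) simp
    have Dl: "norm (D \<omega> - D \<omega>') \<le> 4 * pi * \<bar>\<omega> - \<omega>'\<bar>" for \<omega> \<omega>'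
    proof -
      define G where "G = glue (cutpt (kap (Suc h) i) (tent m s)) (F h (2 * i)) (F h (2 * i + 1))"
      have G: "fbound G" unfolding G_def by (rule fbound_glue_tent)
      have "D \<omega> - D \<omega>' = (G \<omega> - G \<omega>') - (F (Suc h) i \<omega> - F (Suc h) i \<omega>')"
        by (simp add: D_def G_def)
      then have "norm (D \<omega> - D \<omega>') \<le> norm (G \<omega> - G \<omega>') + norm (F (Suc h) i \<omega> - F (Suc h) i \<omega>')"
        by (simp only: norm_triangle_ineq4)
      also have "\<dots> \<le> 2 * pi * \<bar>\<omega> - \<omega>'\<bar> + 2 * pi * \<bar>\<omega> - \<omega>'\<bar>"
        by (intro add_mono fbound_lipschitz G fbound_tree)
      finally show ?thesis by simp
    qed
    have eq: "ee (- \<nu> * x (k * 2 ^ e)) * cell_var x h i \<nu> s = of_real (blen x 0 i) * (ee (\<nu> * y) * D (\<nu> * blen x 0 i))" for \<nu>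
    proof -
      have "ee (\<nu> * y) = ee (- \<nu> * x (k * 2 ^ e)) * ee (\<nu> * x i)"
        unfolding ee_add[symmetric] by (simp add: y_def algebra_simps)
      then show ?thesis by (simp add: cell_var_def D_def)
    qed
    have "norm (ee (\<mu> * y) * D (\<mu> * blen x 0 i) - ee (\<mu>' * y) * D (\<mu>' * blen x 0 i))
       \<le> norm (ee (\<mu> * y) - ee (\<mu>' * y)) * norm (D (\<mu> * blen x 0 i)) + norm (D (\<mu> * blen x 0 i) - D (\<mu>' * blen x 0 i))"
    proof -
      have "ee (\<mu> * y) * D (\<mu> * blen x 0 i) - ee (\<mu>' * y) * D (\<mu>' * blen x 0 i)
        = (ee (\<mu> * y) - ee (\<mu>' * y)) * D (\<mu> * blen x 0 i) + ee (\<mu>' * y) * (D (\<mu> * blen x 0 i) - D (\<mu>' * blen x 0 i))"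
        by (simp add: algebra_simps)
      then show ?thesis
        by (simp only:) (intro order.trans[OF norm_triangle_ineq], simp add: norm_mult)
    qed
    also have "\<dots> \<le> (2 * pi * \<bar>\<mu> * y - \<mu>' * y\<bar>) * 2 + 4 * pi * \<bar>\<mu> * blen x 0 i - \<mu>' * blen x 0 i\<bar>"
      using Dn Dl by (intro add_mono mult_mono ee_lipschitz) auto
    also have "\<dots> = 4 * pi * (\<bar>\<mu> - \<mu>'\<bar> * (y + blen x 0 i))"
    proof -
      have "\<bar>\<mu> * z - \<mu>' * z\<bar> = \<bar>\<mu> - \<mu>'\<bar> * z" if "0 \<le> z" for z
        unfolding left_diff_distrib[symmetric] abs_mult using that by simp
      from this[OF y0] this[OF less_imp_le[OF pos[of i]]] show ?thesis
        by (simp only:) (simp add: distrib_left)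
    qed
    also have "\<dots> \<le> 24 * (\<bar>\<mu> - \<mu>'\<bar> * blen x e k)"
      using pi_less_4 y0 yb pos[of i] by (intro mult_mono mult_left_mono) auto
    finally have "blen x 0 i * norm (ee (\<mu> * y) * D (\<mu> * blen x 0 i) - ee (\<mu>' * y) * D (\<mu>' * blen x 0 i))
       \<le> blen x 0 i * (24 * (\<bar>\<mu> - \<mu>'\<bar> * blen x e k))"
      using pos[of i] by (intro mult_left_mono) auto
    moreover have "norm (ee (- \<mu> * x (k * 2 ^ e)) * cell_var x h i \<mu> s - ee (- \<mu>' * x (k * 2 ^ e)) * cell_var x h i \<mu>' s)
      = blen x 0 i * norm (ee (\<mu> * y) * D (\<mu> * blen x 0 i) - ee (\<mu>' * y) * D (\<mu>' * blen x 0 i))"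
      unfolding eq right_diff_distrib[symmetric] using pos[of i] by (simp add: norm_mult)
    ultimately show ?thesis by (simp add: i_def mult_ac)
  qed
qed (use m in auto)

end

section \<open>Fixing the ratios level by level\<close>

context cascade
begin

text \<open>Transform, on one block, of a hybrid: the ratios down to the cells of \<open>x\<close>
  are already fixed, those in the \<open>h\<close> levels below a cell are still averaged. One
  selection moves the border down by one level.\<close>

definition fsum :: "nat \<Rightarrow> (nat \<Rightarrow> real) \<Rightarrow> nat \<Rightarrow> nat \<Rightarrow> real \<Rightarrow> complex" where
  "fsum h x e k \<mu> = (\<Sum>i<2 ^ e. of_real (blen x 0 (k * 2 ^ e + i)) *
     (ee (\<mu> * x (k * 2 ^ e + i)) * F h (k * 2 ^ e + i) (\<mu> * blen x 0 (k * 2 ^ e + i))))"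

lemma fsum_refine:
  assumes p: "\<And>i. p i = cutpt (kap (Suc h) i) (tent m (s i))"
  shows "fsum h (refine p x) (Suc e) k \<mu> - fsum (Suc h) x e k \<mu>
     = (\<Sum>i<2 ^ e. cell_var x h (k * 2 ^ e + i) \<mu> (s (k * 2 ^ e + i)))"
proof -
  define x' where "x' = refine p x"
  define g where "g = (\<lambda>i. of_real (blen x' 0 i) * (ee (\<mu> * x' i) * F h i (\<mu> * blen x' 0 i)))"
  have "fsum h x' (Suc e) k \<mu> = (\<Sum>i<2 ^ (1 + e). g (k * 2 ^ (1 + e) + i))"
    by (simp add: fsum_def g_def)
  also have "\<dots> = (\<Sum>J<2 ^ e. \<Sum>i<2 ^ 1. g ((k * 2 ^ e + J) * 2 ^ 1 + i))"
    by (rule sum_blocks)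
  also have "\<dots> = (\<Sum>J<2 ^ e. g (2 * (k * 2 ^ e + J)) + g (2 * (k * 2 ^ e + J) + 1))"
    by (simp add: numeral_2_eq_2 mult.commute)
  finally have sum: "fsum h x' (Suc e) k \<mu> = (\<Sum>J<2 ^ e. g (2 * (k * 2 ^ e + J)) + g (2 * (k * 2 ^ e + J) + 1))" .
  have cell: "g (2 * i) + g (2 * i + 1) = of_real (blen x 0 i) * (ee (\<mu> * x i) *
     glue (p i) (F h (2 * i)) (F h (2 * i + 1)) (\<mu> * blen x 0 i))" for i
  proof -
    have e: "ee (\<mu> * x' (2 * i + 1)) = ee (\<mu> * x i) * ee (p i * (\<mu> * blen x 0 i))"
      unfolding x'_def refine_odd ee_add[symmetric] by (simp add: blen_0 algebra_simps)
    have w: "\<mu> * (p i * blen x 0 i) = p i * (\<mu> * blen x 0 i)" "\<mu> * ((1 - p i) * blen x 0 i) = (1 - p i) * (\<mu> * blen x 0 i)"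
      by (simp_all only: mult_ac)
    have x': "x' (2 * i) = x i" by (simp add: x'_def)
    show ?thesis
      unfolding g_def e x' unfolding x'_def blen_refine_0 w glue_def of_real_mult by (simp only: distrib_left mult_ac)
  qed
  show ?thesis
    unfolding x'_def[symmetric] sum fsum_def[of "Suc h"] sum_subtractf[symmetric] cell cell_var_def p[symmetric]
    by (simp add: right_diff_distrib)
qed

text \<open>By \<open>fsum_refine\<close> the change is a block sum of a selection problem with A =
  24, and then \<open>Csel\<close> = 400 + 3 * 24 = 472.\<close>

lemma exists_refinement:
  assumes x: "dyadic_grid d x"
  shows "\<exists>p. (\<forall>i. \<exists>\<sigma>. \<bar>\<sigma>\<bar> \<le> 1 \<and> p i = cutpt (kap (Suc h) i) \<sigma>) \<and>
    (\<forall>e\<le>d. \<forall>k \<mu>. 0 \<le> \<mu> \<longrightarrow> \<mu> * blen x e k \<le> 4 ^ e \<longrightarrow>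
       norm (fsum h (refine p x) (Suc e) k \<mu> - fsum (Suc h) x e k \<mu>) \<le> 472 * 2 powr (- real e / 16) * blen x e k)"
proof -
  interpret selection x "cell_var x h" d m 24
    by (rule selection_cell_var[OF x])
  obtain s where s: "\<And>e k \<mu>. e \<le> d \<Longrightarrow> 0 \<le> \<mu> \<Longrightarrow> \<mu> * blen x e k \<le> 4 ^ e \<Longrightarrow>
     norm (bsum e k \<mu> s 0) \<le> Csel * 2 powr (- real e / 16) * blen x e k"
    using selection by blast
  define p where "p = (\<lambda>i. cutpt (kap (Suc h) i) (tent m (s i)))"
  have "fsum h (refine p x) (Suc e) k \<mu> - fsum (Suc h) x e k \<mu> = bsum e k \<mu> s 0" for e k \<mu>
    unfolding bsum_def by (subst fsum_refine[where s = s]) (simp_all add: p_def)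
  then have "\<forall>e\<le>d. \<forall>k \<mu>. 0 \<le> \<mu> \<longrightarrow> \<mu> * blen x e k \<le> 4 ^ e \<longrightarrow>
       norm (fsum h (refine p x) (Suc e) k \<mu> - fsum (Suc h) x e k \<mu>) \<le> 472 * 2 powr (- real e / 16) * blen x e k"
    using s by (simp add: Csel_def)
  moreover have "\<exists>\<sigma>. \<bar>\<sigma>\<bar> \<le> 1 \<and> p i = cutpt (kap (Suc h) i) \<sigma>" for i
    using abs_tent_le[OF m, of "s i"] by (auto simp: p_def)
  ultimately show ?thesis by blast
qed

lemma cutpt_0: "cutpt \<kappa> 0 = 1 / 2"
  by (simp add: cutpt_def)

lemma exists_grids:
  "\<exists>xs. xs 0 = real \<and> (\<forall>d. dyadic_grid d (xs d)) \<and> (\<forall>d. \<exists>p. xs (Suc d) = refine p (xs d) \<and>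
     (\<forall>i. \<exists>\<sigma>. \<bar>\<sigma>\<bar> \<le> 1 \<and> p i = cutpt (kap (N - d) i) \<sigma>) \<and>
     (d < N \<longrightarrow> (\<forall>e\<le>d. \<forall>k \<mu>. 0 \<le> \<mu> \<longrightarrow> \<mu> * blen (xs d) e k \<le> 4 ^ e \<longrightarrow>
       norm (fsum (N - Suc d) (xs (Suc d)) (Suc e) k \<mu> - fsum (N - d) (xs d) e k \<mu>)
         \<le> 472 * 2 powr (- real e / 16) * blen (xs d) e k)))"
proof -
  define P where "P = (\<lambda>d x. dyadic_grid d x \<and> (d = 0 \<longrightarrow> x = real))"
  define Q where "Q = (\<lambda>d x y. \<exists>p. y = refine p x \<and>
     (\<forall>i. \<exists>\<sigma>. \<bar>\<sigma>\<bar> \<le> 1 \<and> p i = cutpt (kap (N - d) i) \<sigma>) \<and>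
     (d < N \<longrightarrow> (\<forall>e\<le>d. \<forall>k \<mu>. 0 \<le> \<mu> \<longrightarrow> \<mu> * blen x e k \<le> 4 ^ e \<longrightarrow>
       norm (fsum (N - Suc d) y (Suc e) k \<mu> - fsum (N - d) x e k \<mu>)
         \<le> 472 * 2 powr (- real e / 16) * blen x e k)))"
  have "\<exists>xs. \<forall>d. P d (xs d) \<and> Q d (xs d) (xs (Suc d))"
  proof (rule dependent_nat_choice)
    show "\<exists>x. P 0 x" using dyadic_grid_0 by (auto simp: P_def)
  next
    fix x d assume "P d x"
    then have x: "dyadic_grid d x" by (simp add: P_def)
    have "\<exists>p. (\<forall>i. \<exists>\<sigma>. \<bar>\<sigma>\<bar> \<le> 1 \<and> p i = cutpt (kap (N - d) i) \<sigma>) \<and>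
      (d < N \<longrightarrow> (\<forall>e\<le>d. \<forall>k \<mu>. 0 \<le> \<mu> \<longrightarrow> \<mu> * blen x e k \<le> 4 ^ e \<longrightarrow>
       norm (fsum (N - Suc d) (refine p x) (Suc e) k \<mu> - fsum (N - d) x e k \<mu>) \<le> 472 * 2 powr (- real e / 16) * blen x e k))"
    proof (cases "d < N")
      case True
      then have "N - d = Suc (N - Suc d)" by simp
      then show ?thesis using exists_refinement[OF x, of "N - Suc d"] True by simp
    next
      \<comment> \<open>Below the leaves \<open>amp\<close> is 0 and only the ratio 1/2 is allowed;
        these levels merely make the grids defined at all depths.\<close>
      case False
      have "\<exists>\<sigma>. \<bar>\<sigma>\<bar> \<le> 1 \<and> 1 / 2 = cutpt (kap (N - d) i) \<sigma>" for i
        by (rule exI[of _ 0]) (simp add: cutpt_0)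
      then show ?thesis using False by (intro exI[of _ "\<lambda>_. 1 / 2"]) simp
    qed
    then obtain p where p: "\<And>i. \<exists>\<sigma>. \<bar>\<sigma>\<bar> \<le> 1 \<and> p i = cutpt (kap (N - d) i) \<sigma>"
      "d < N \<longrightarrow> (\<forall>e\<le>d. \<forall>k \<mu>. 0 \<le> \<mu> \<longrightarrow> \<mu> * blen x e k \<le> 4 ^ e \<longrightarrow>
       norm (fsum (N - Suc d) (refine p x) (Suc e) k \<mu> - fsum (N - d) x e k \<mu>) \<le> 472 * 2 powr (- real e / 16) * blen x e k)"
      by blast
    have "9 / 20 \<le> p i" "p i \<le> 11 / 20" for i
      using p(1)[of i] cut_kap by auto
    then have "dyadic_grid (Suc d) (refine p x)"
      by (intro dyadic_grid_refine x) auto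
    then show "\<exists>y. P (Suc d) y \<and> Q d x y"
      using p by (intro exI[of _ "refine p x"]) (auto simp: P_def Q_def)
  qed
  then obtain xs where "\<And>d. P d (xs d)" "\<And>d. Q d (xs d) (xs (Suc d))" by blast
  then show ?thesis unfolding P_def Q_def by (intro exI[of _ xs]) blast
qed

text \<open>Adds the frequencies up to 1, where the right side is at least 1, and the leaves, where
  \<open>unit_ft\<close> decays without an upper limit on the frequency.\<close>

lemma norm_tree_decay':
  assumes w: "0 < \<omega>" "\<omega> \<le> m / 2 \<or> h = 0"
  shows "norm (F h k \<omega>) \<le> 20 / sqrt \<eta> * \<omega> powr (- 1 / 6)"
proof (cases "\<omega> \<le> 1")
  case True
  have "\<omega> powr (1 / 6) \<le> 1" using True w by (simp add: powr_le1)
  then have "1 \<le> \<omega> powr (- 1 / 6)" using w by (simp add: powr_minus_divide)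
  moreover have "1 \<le> 20 / sqrt \<eta>" using eta by (simp add: field_simps real_le_lsqrt)
  ultimately have "1 * 1 \<le> 20 / sqrt \<eta> * \<omega> powr (- 1 / 6)" using eta by (intro mult_mono) auto
  then show ?thesis using fbound_bounded[OF fbound_tree, of h k \<omega>] by linarith
next
  case False
  show ?thesis
  proof (cases "h = 0")
    case False
    then show ?thesis using w \<open>\<not> \<omega> \<le> 1\<close> by (intro norm_tree_decay) auto
  next
    case True
    have "norm (F h k \<omega>) \<le> 1 * (1 / \<omega>)"
      unfolding True tree_ft.simps norm_mult norm_of_real using v w by (intro mult_mono norm_unit_ft_le) auto
    also have "\<dots> = \<omega> powr (- 1)" using w by (simp add: powr_minus_divide)
    also have "\<dots> \<le> \<omega> powr (- 1 / 6)" using \<open>\<not> \<omega> \<le> 1\<close> by (intro powr_mono) auto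
    also have "\<dots> = 1 * \<omega> powr (- 1 / 6)" by (simp only: mult_1)
    also have "\<dots> \<le> 20 / sqrt \<eta> * \<omega> powr (- 1 / 6)"
      using eta by (intro mult_right_mono) (auto simp: field_simps real_le_lsqrt)
    finally show ?thesis .
  qed
qed

end

text \<open>As (31/32)^16 > 1/2, the ratio 2^(-1/16) is at most 31/32 and the series at most 32
  times its first term.\<close>

lemma geom_sixteenth:
  "(\<Sum>e\<in>{d..<n}. 2 powr (- real e / 16)) \<le> 32 * 2 powr (- real d / 16)"
proof -
  define r where "r = 2 powr (- 1 / 16 :: real)"
  have pw: "2 powr (- real e / 16) = r ^ e" for e
    by (simp add: r_def powr_power)
  have r0: "0 < r" by (simp add: r_def)
  have r1: "r \<le> 31 / 32"
  proof (rule power_le_imp_le_base[where n = 15])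
    have "r ^ Suc 15 = 2 powr (- 1)"
      using pw[of 16] by simp
    also have "\<dots> = 1 / 2" by (simp add: powr_minus_divide)
    also have "1 / 2 \<le> (31 / 32 :: real) ^ Suc 15"
      by (simp add: eval_nat_numeral)
    finally show "r ^ Suc 15 \<le> (31 / 32) ^ Suc 15" .
  qed simp
  have "(\<Sum>e\<in>{d..<n}. r ^ e) \<le> 32 * r ^ d - 32 * r ^ n" if "d \<le> n" for n
    using that
  proof (induction n rule: dec_induct)
    case (step n)
    have "32 * (r ^ n * r) \<le> 32 * (r ^ n * (31 / 32))"
      using r0 r1 by (intro mult_left_mono) auto
    then show ?case using step by (simp add: mult.commute)
  qed simp
  moreover have "0 \<le> r ^ n" using r0 by simp
  moreover have "0 \<le> r ^ d" using r0 by simp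
  ultimately show ?thesis
    unfolding pw by (cases "d \<le> n") fastforce+
qed

context cascade
begin

text \<open>After e \<le> d subdivisions every cell has at least (9/20)^e times the length of the
  block, so its normalized frequency is at least (4 * 9/20)^d / 4 = (9/5)^d / 4. The decay exponent
  1/6 then gives 2^(-d/16), because 9/5 \<ge> 2^(3/8).\<close>

lemma fsum_decay:
  assumes x: "dyadic_grid (d0 + e) x" and k: "0 \<le> \<mu>"
    and w: "4 ^ d \<le> 4 * (\<mu> * blen x e k)" "e \<le> d" "\<mu> * blen x e k \<le> m / 2 \<or> h = 0"
  shows "norm (fsum h x e k \<mu>) \<le> 40 / sqrt \<eta> * 2 powr (- real d / 16) * blen x e k"
proof -
  have pos: "0 < blen x 0 i" for i using x by (simp add: dyadic_grid_def blen_0)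
  have lower: "(9 / 20) ^ e' * blen x e' k \<le> blen x 0 (k * 2 ^ e' + i)" if "e' \<le> d0 + e" "i < 2 ^ e'" for e' k i
    using that
  proof (induction e' arbitrary: k i)
    case 0
    then show ?case by simp
  next
    case (Suc e')
    define b where "b = i div 2 ^ e'"
    have b: "b < 2" using Suc.prems by (simp add: b_def div_less_iff_less_mult mult.commute)
    have i: "k * 2 ^ Suc e' + i = (2 * k + b) * 2 ^ e' + i mod 2 ^ e'"
      using div_mult_mod_eq[of i "2 ^ e'"] by (simp add: b_def algebra_simps)
    have sum: "blen x e' (2 * k) + blen x e' (2 * k + 1) = blen x (Suc e') k"
      using blen_sum[of x e' k 1] by (simp add: numeral_2_eq_2 mult.commute)
    have g: "blen x e' j \<le> 11 / 20 * blen x (Suc e') (j div 2)" for j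
      using x Suc.prems(1) by (simp add: dyadic_grid_def)
    have le: "blen x e' (2 * k) \<le> 11 / 20 * blen x (Suc e') k" "blen x e' (2 * k + 1) \<le> 11 / 20 * blen x (Suc e') k"
      using g[of "2 * k"] g[of "2 * k + 1"] by simp_all
    have half: "9 / 20 * blen x (Suc e') k \<le> blen x e' (2 * k + b)"
    proof (cases "b = 0")
      case True
      then show ?thesis using le sum by simp
    next
      case False
      then have "b = 1" using b by simp
      then show ?thesis using le sum by simp
    qed
    have "(9 / 20) ^ Suc e' * blen x (Suc e') k = (9 / 20) ^ e' * (9 / 20 * blen x (Suc e') k)" by simp
    also have "\<dots> \<le> (9 / 20) ^ e' * blen x e' (2 * k + b)"
      using half by (intro mult_left_mono) auto
    also have "\<dots> \<le> blen x 0 ((2 * k + b) * 2 ^ e' + i mod 2 ^ e')"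
      using Suc.prems by (intro Suc.IH) auto
    finally show ?case unfolding i .
  qed
  have wpos: "0 \<le> \<mu> * blen x e k"
    using w(1) zero_le_power[of "4::real" d] by linarith
  define y where "y = (1 / 4) * (9 / 5 :: real) ^ d"
  have y: "0 < y" by (simp add: y_def)
  have yw: "y \<le> \<mu> * blen x 0 (k * 2 ^ e + i)" if "i < 2 ^ e" for i
  proof -
    have "y = 4 ^ d / 4 * (9 / 20) ^ d"
      by (simp add: y_def power_mult_distrib[symmetric])
    also have "\<dots> \<le> (\<mu> * blen x e k) * (9 / 20) ^ e"
      using w wpos by (intro mult_mono power_decreasing) auto
    also have "\<dots> \<le> \<mu> * blen x 0 (k * 2 ^ e + i)"
      using lower[of e i k] that k by (simp add: mult_left_mono mult_ac)
    finally show ?thesis .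
  qed
  have up: "blen x 0 (k * 2 ^ e + i) \<le> blen x e k" if "i < 2 ^ e" for i
    using blen_sum[of x 0 k e] that pos member_le_sum[of i "{..<2 ^ e}" "\<lambda>j. blen x 0 (k * 2 ^ e + j)"]
    by (simp add: less_imp_le)
  have "y powr (- 1 / 6) \<le> 2 * 2 powr (- real d / 16)"
  proof -
    have "y powr (- 1 / 6) = (1 / 4) powr (- 1 / 6) * ((9 / 5) powr real d) powr (- 1 / 6)"
    proof -
      have "y = (1 / 4) * (9 / 5) powr real d" by (simp add: y_def powr_realpow)
      then show ?thesis by (simp only:) (rule powr_mult)
    qed
    also have "\<dots> \<le> 2 * ((2 powr (3 / 8)) powr real d) powr (- 1 / 6)"
    proof (rule mult_mono)
      have "(1 / 4) powr (- 1 / 6) = (4::real) powr (1 / 6)"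
        by (simp add: powr_minus_divide powr_divide)
      also have "\<dots> \<le> 4 powr (1 / 2)" by (intro powr_mono) auto
      finally show "(1 / 4) powr (- 1 / 6) \<le> (2::real)" by (simp add: powr_half_sqrt)
      have "2 powr (3 / 8) \<le> (9 / 5 :: real)"
      proof -
        have "2 powr (3 / 8) \<le> (2::real) powr (1 / 2)" by (intro powr_mono) auto
        also have "\<dots> = sqrt 2" by (simp add: powr_half_sqrt)
        also have "\<dots> \<le> 9 / 5" by (rule real_le_lsqrt) (auto simp: power2_eq_square)
        finally show ?thesis .
      qed
      then have le: "(2 powr (3 / 8)) powr real d \<le> (9 / 5 :: real) powr real d"
        by (intro powr_mono2) auto
      show "((9 / 5) powr real d) powr (- 1 / 6) \<le> ((2 powr (3 / 8)) powr real d) powr (- 1 / 6 :: real)"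
        by (rule powr_mono2'[OF _ _ le]) auto
    qed auto
    also have "\<dots> = 2 * 2 powr (- real d / 16)" by (simp add: powr_powr)
    finally show ?thesis .
  qed
  then have yp: "20 / sqrt \<eta> * y powr (- 1 / 6) \<le> 40 / sqrt \<eta> * 2 powr (- real d / 16)"
    using eta mult_left_mono[of "y powr (- 1 / 6)" "2 * 2 powr (- real d / 16)" "20 / sqrt \<eta>"] by simp
  have "norm (fsum h x e k \<mu>) \<le> (\<Sum>i<2 ^ e. 40 / sqrt \<eta> * 2 powr (- real d / 16) * blen x 0 (k * 2 ^ e + i))"
    unfolding fsum_def
  proof (intro order.trans[OF norm_sum] sum_mono)
    fix i assume "i \<in> {..<(2::nat) ^ e}"
    then have i: "i < 2 ^ e" by simp
    let ?i = "k * 2 ^ e + i"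
    let ?w = "\<mu> * blen x 0 ?i"
    have "?w \<le> \<mu> * blen x e k" using up[OF i] k by (intro mult_left_mono) auto
    then have "norm (F h ?i ?w) \<le> 20 / sqrt \<eta> * ?w powr (- 1 / 6)"
      using yw[OF i] y w by (intro norm_tree_decay') auto
    also have "\<dots> \<le> 20 / sqrt \<eta> * y powr (- 1 / 6)"
      using yw[OF i] y eta by (intro mult_left_mono powr_mono2') auto
    also note yp
    finally have "blen x 0 ?i * norm (F h ?i ?w) \<le> blen x 0 ?i * (40 / sqrt \<eta> * 2 powr (- real d / 16))"
      using pos[of ?i] by (intro mult_left_mono) auto
    then show "norm (of_real (blen x 0 ?i) * (ee (\<mu> * x ?i) * F h ?i ?w)) \<le> 40 / sqrt \<eta> * 2 powr (- real d / 16) * blen x 0 ?i"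
      using pos[of ?i] by (simp add: norm_mult mult_ac)
  qed
  also have "\<dots> = 40 / sqrt \<eta> * 2 powr (- real d / 16) * blen x e k"
    using blen_sum[of x 0 k e] by (simp only: sum_distrib_left[symmetric] add_0)
  finally show ?thesis .
qed

end

section \<open>Decay and density for the finite cascade\<close>

definition step_ft :: "(nat \<Rightarrow> real) \<Rightarrow> (nat \<Rightarrow> real) \<Rightarrow> nat \<Rightarrow> nat \<Rightarrow> real \<Rightarrow> complex" where
  "step_ft v x n k \<mu> = (\<Sum>i<2 ^ n. of_real (v (k * 2 ^ n + i)) *
     integral {x (k * 2 ^ n + i)..x (Suc (k * 2 ^ n + i))} (\<lambda>y. ee (\<mu> * y)))"

lemma integral_ee_eq_unit_ft:
  assumes "a \<le> b"
  shows "integral {a..b} (\<lambda>y. ee (\<mu> * y)) = of_real (b - a) * (ee (\<mu> * a) * unit_ft (\<mu> * (b - a)))"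
proof -
  have "integral {a..b} (\<lambda>y. ee (\<mu> * y)) = (b - a) *\<^sub>R integral {0..1} (\<lambda>t. ee (\<mu> * (a + (b - a) * t)))"
    using assms by (intro has_integral_affine continuous_intros) auto
  also have "(\<lambda>t. ee (\<mu> * (a + (b - a) * t))) = (\<lambda>t. ee (\<mu> * a) * ee (\<mu> * (b - a) * t))"
    by (auto simp: ee_add[symmetric] algebra_simps)
  finally show ?thesis
    by (simp add: unit_ft_def scaleR_conv_of_real)
qed

context cascade
begin

lemma fsum_0: "dyadic_grid d x \<Longrightarrow> fsum 0 x n k \<mu> = step_ft v x n k \<mu>"
  unfolding fsum_def step_ft_def
proof (rule sum.cong[OF refl])
  fix i
  assume x: "dyadic_grid d x"
  let ?i = "k * 2 ^ n + i"
  have "x ?i \<le> x (Suc ?i)" using x by (simp add: dyadic_grid_def less_imp_le)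
  then show "of_real (blen x 0 ?i) * (ee (\<mu> * x ?i) * F 0 ?i (\<mu> * blen x 0 ?i))
      = of_real (v ?i) * integral {x ?i..x (Suc ?i)} (\<lambda>y. ee (\<mu> * y))"
    by (simp add: integral_ee_eq_unit_ft[of _ _ \<mu>] blen_0 del: of_real_diff)
qed

text \<open>The levels below one cell of level d0 are followed one at a time. After d of them the
  averaged transform is small by \<open>fsum_decay\<close>; from then on \<mu> L \<le> 4^j holds at
  the j-th level, so each further selection costs at most 472 * 2^(-j/16) L. If fewer than d levels
  remain, \<open>fsum_decay\<close> applies to the step function itself.\<close>

lemma grids_local_decay:
  assumes g: "\<And>d. dyadic_grid d (xs d)"
    and ref: "\<And>d. \<exists>p. xs (Suc d) = refine p (xs d)"
    and inc: "\<And>d e k \<mu>. d < N \<Longrightarrow> e \<le> d \<Longrightarrow> 0 \<le> \<mu> \<Longrightarrow> \<mu> * blen (xs d) e k \<le> 4 ^ e \<Longrightarrow>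
       norm (fsum (N - Suc d) (xs (Suc d)) (Suc e) k \<mu> - fsum (N - d) (xs d) e k \<mu>)
         \<le> 472 * 2 powr (- real e / 16) * blen (xs d) e k"
    and m2: "2 * 4 ^ N \<le> m" and d0: "d0 \<le> N" and mu: "0 \<le> \<mu>"
    and w: "4 ^ d \<le> 4 * (\<mu> * blen (xs d0) 0 k)" "\<mu> * blen (xs d0) 0 k \<le> 4 ^ d"
  shows "norm (step_ft v (xs N) (N - d0) k \<mu>) \<le> (40 / sqrt \<eta> + 16000) * 2 powr (- real d / 16) * blen (xs d0) 0 k"
proof -
  define L where "L = blen (xs d0) 0 k"
  have L: "L > 0" using g[of d0] by (simp add: L_def dyadic_grid_def blen_0)
  have bl: "blen (xs (d0 + j)) j k = L" for j
  proof (induction j)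
    case (Suc j)
    then show ?case using ref[of "d0 + j"] by (auto simp: blen_refine_Suc)
  qed (simp add: L_def)
  define n where "n = N - d0"
  have N: "N = d0 + n" using d0 by (simp add: n_def)
  define Z where "Z = (\<lambda>j. fsum (n - j) (xs (d0 + j)) j k \<mu>)"
  have Zn: "step_ft v (xs N) (N - d0) k \<mu> = Z n"
    using fsum_0[OF g[of N]] by (simp add: Z_def N)
  have pos: "0 \<le> 2 powr (- real d / 16) * L" using L by simp
  show ?thesis
  proof (cases "d \<le> n")
    case True
    have Zd: "norm (Z d) \<le> 40 / sqrt \<eta> * 2 powr (- real d / 16) * blen (xs (d0 + d)) d k"
      unfolding Z_def
    proof (rule fsum_decay)
      \<comment> \<open>Here the number m \<ge> 2 * 4^N of ratios is used: the frequency stays below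
        m / 2.\<close>
      have "\<mu> * L \<le> 4 ^ N"
        using w True N by (intro order.trans[OF w(2)[folded L_def]] power_increasing) auto
      then show "\<mu> * blen (xs (d0 + d)) d k \<le> real m / 2 \<or> n - d = 0"
        using m2 of_nat_mono[OF m2, where 'a = real] by (simp add: bl)
    qed (use g mu w in \<open>auto simp: bl L_def\<close>)
    have tele: "norm (Z j) \<le> norm (Z d) + (\<Sum>e\<in>{d..<j}. 472 * 2 powr (- real e / 16) * L)" if "d \<le> j" "j \<le> n" for j
      using that
    proof (induction j rule: dec_induct)
      case (step j)
      have "norm (Z (Suc j) - Z j) \<le> 472 * 2 powr (- real j / 16) * blen (xs (d0 + j)) j k"
      proof -
        have "\<mu> * L \<le> 4 ^ j"
          using step by (intro order.trans[OF w(2)[folded L_def]] power_increasing) auto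
        then show ?thesis
          using inc[of "d0 + j" j \<mu> k] step mu by (simp add: Z_def N bl)
      qed
      moreover have "norm (Z (Suc j)) \<le> norm (Z j) + norm (Z (Suc j) - Z j)"
        using norm_triangle_ineq[of "Z j" "Z (Suc j) - Z j"] by simp
      ultimately show ?case using step by (simp add: bl)
    qed simp
    from tele[OF True order.refl] have "norm (Z n) \<le> norm (Z d) + 472 * L * (\<Sum>e\<in>{d..<n}. 2 powr (- real e / 16))"
      by (simp add: sum_distrib_left mult_ac)
    also have "\<dots> \<le> norm (Z d) + 472 * L * (32 * 2 powr (- real d / 16))"
      using L by (intro add_left_mono mult_left_mono geom_sixteenth) auto
    also have "\<dots> \<le> norm (Z d) + 16000 * (2 powr (- real d / 16) * L)"
    proof -
      have e: "472 * L * (32 * P) = 15104 * (P * L)" for P by simp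
      show ?thesis unfolding e by (intro add_left_mono mult_right_mono pos) simp
    qed
    finally show ?thesis
      using Zd[unfolded bl] unfolding Zn L_def[symmetric] distrib_right mult.assoc by linarith
  next
    case False
    have "norm (Z n) \<le> 40 / sqrt \<eta> * 2 powr (- real d / 16) * blen (xs (d0 + n)) n k"
      unfolding Z_def by (rule fsum_decay) (use g mu w False in \<open>auto simp: bl L_def\<close>)
    then show ?thesis
      using pos unfolding Zn by (simp add: bl L_def[symmetric] distrib_right mult.assoc)
  qed
qed

end

section \<open>Moments of the densities\<close>

lemma inverse_power_two_sided:
  "\<exists>C\<ge>0. \<forall>x::real. \<bar>x\<bar> \<le> 1 / 2 \<longrightarrow> (1 / (1 + x)) ^ b + (1 / (1 - x)) ^ b \<le> 2 * (1 + C * x\<^sup>2)"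
proof -
  \<comment> \<open>The one-sided expansion with its linear term is what can be proved by induction
    on b; adding it at x and at -x cancels the linear terms.\<close>
  have "\<exists>C\<ge>0. \<forall>x::real. \<bar>x\<bar> \<le> 1 / 2 \<longrightarrow> (1 / (1 + x)) ^ b \<le> 1 - real b * x + C * x\<^sup>2"
  proof (induction b)
    case 0
    then show ?case by auto
  next
    case (Suc b)
    then obtain C where C: "C \<ge> 0" "\<And>x::real. \<bar>x\<bar> \<le> 1 / 2 \<Longrightarrow> (1 / (1 + x)) ^ b \<le> 1 - real b * x + C * x\<^sup>2" by blast
    have "(1 / (1 + x)) ^ Suc b \<le> 1 - real (Suc b) * x + (2 * C + 2 * real (Suc b)) * x\<^sup>2" if x: "\<bar>x\<bar> \<le> 1 / 2" for x :: real
    proof -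
      \<comment> \<open>On |x| \<le> 1/2 the factor 1 + x is at least 1/2, so twice the required C +
        b + 1 suffices.\<close>
      define D where "D = 2 * C + 2 * real (Suc b)"
      have x1: "1 + x \<ge> 1 / 2" using x by (simp add: abs_le_iff)
      have "(1 / (1 + x)) ^ Suc b = (1 / (1 + x)) ^ b / (1 + x)" by simp
      also have "\<dots> \<le> (1 - real b * x + C * x\<^sup>2) / (1 + x)"
        using C(2)[OF x] x1 by (intro divide_right_mono) auto
      also have "\<dots> \<le> 1 - real (Suc b) * x + D * x\<^sup>2"
      proof -
        have "(1 - real (Suc b) * x + D * x\<^sup>2) * (1 + x) - (1 - real b * x + C * x\<^sup>2)
            = x\<^sup>2 * (D * (1 + x) - real (Suc b) - C)"
          by (simp add: power2_eq_square algebra_simps)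
        also have "D * (1 / 2) \<le> D * (1 + x)"
          using x1 C(1) by (intro mult_left_mono) (auto simp: D_def)
        then have "0 \<le> x\<^sup>2 * (D * (1 + x) - real (Suc b) - C)"
          by (intro mult_nonneg_nonneg) (auto simp: D_def)
        finally show ?thesis using x1 by (simp add: pos_divide_le_eq)
      qed
      finally show ?thesis by (simp add: D_def)
    qed
    then show ?case using C(1) by (intro exI[of _ "2 * C + 2 * real (Suc b)"]) auto
  qed
  then obtain C where C: "C \<ge> 0" "\<And>x::real. \<bar>x\<bar> \<le> 1 / 2 \<Longrightarrow> (1 / (1 + x)) ^ b \<le> 1 - real b * x + C * x\<^sup>2" by blast
  have "(1 / (1 + x)) ^ b + (1 / (1 - x)) ^ b \<le> 2 * (1 + C * x\<^sup>2)" if "\<bar>x\<bar> \<le> 1 / 2" for x :: real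
    using C(2)[of x] C(2)[of "- x"] that by simp
  with C(1) show ?thesis by blast
qed

text \<open>Product of 1 + l \<open>amp2\<close> over the strict ancestors of node k at depth d: the
  factor by which squared density powers are allowed to grow on the way down to the node.\<close>

primrec weight :: "(nat \<Rightarrow> real) \<Rightarrow> real \<Rightarrow> nat \<Rightarrow> nat \<Rightarrow> nat \<Rightarrow> real" where
  "weight v l N 0 k = 1"
| "weight v l N (Suc d) k = weight v l N d (k div 2) * (1 + l * amp2 v (N - d) (k div 2))"

lemma weight_ge_1: "0 \<le> l \<Longrightarrow> 1 \<le> weight v l N d k"
proof (induction d arbitrary: k)
  case (Suc d)
  have "1 * 1 \<le> weight v l N d (k div 2) * (1 + l * amp2 v (N - d) (k div 2))"
    using Suc.prems amp2_nonneg[of v "N - d" "k div 2"] Suc.IH[OF Suc.prems, of "k div 2"]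
    by (intro mult_mono) auto
  then show ?case by simp
qed simp

lemma sum_double: "(\<Sum>k<2 ^ Suc d. g k) = (\<Sum>k<2 ^ d. g (2 * k) + g (2 * k + 1))"
  for g :: "nat \<Rightarrow> real"
  using sum_blocks[of g 0 1 d] by (simp add: numeral_2_eq_2 mult.commute)

text \<open>The factor 1 + 2 l \<open>energy\<close> pays in advance for the weights still to come,
  so that the mean over a level does not increase with the depth. The step needs 2 l
  \<open>energy\<close> \<le> 1, which 8 l \<le> 1 and \<open>energy\<close> \<le> 4
  provide.\<close>

lemma sum_weight_le:
  assumes v: "\<forall>k. \<bar>v k\<bar> \<le> 1" and l: "0 \<le> l" "8 * l \<le> 1"
  shows "(\<Sum>k<2 ^ d. weight v l N d k * (1 + 2 * l * energy v (N - d) k)) \<le> 2 * 2 ^ d"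
proof (induction d)
  case 0
  have "l * energy v N 0 \<le> l * 4"
    using l energy_le_4[OF v, of N 0] by (intro mult_left_mono) auto
  then show ?case using l by simp
next
  case (Suc d)
  have "(\<Sum>k<2 ^ Suc d. weight v l N (Suc d) k * (1 + 2 * l * energy v (N - Suc d) k))
     = (\<Sum>k<2 ^ d. weight v l N d k * (1 + l * amp2 v (N - d) k) *
         ((1 + 2 * l * energy v (N - Suc d) (2 * k)) + (1 + 2 * l * energy v (N - Suc d) (2 * k + 1))))"
    unfolding sum_double by (simp add: algebra_simps)
  also have "\<dots> \<le> (\<Sum>k<2 ^ d. 2 * (weight v l N d k * (1 + 2 * l * energy v (N - d) k)))"
  proof (rule sum_mono)
    fix k
    define a B e where "a = amp2 v (N - d) k" and "B = energy v (N - d) k"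
      and "e = energy v (N - Suc d) (2 * k) + energy v (N - Suc d) (2 * k + 1)"
    have aB: "0 \<le> a" "a \<le> B" "B \<le> 4"
      using amp2_nonneg energy_ge_amp2 energy_le_4[OF v] by (auto simp: a_def B_def)
    have e: "e \<le> 2 * (B - a)"
    proof (cases "N - d")
      case 0
      then show ?thesis using aB by (simp add: e_def)
    next
      case (Suc h)
      then have "N - Suc d = h" by simp
      then show ?thesis using Suc by (simp add: e_def B_def a_def)
    qed
    have "(1 + l * a) * (1 + l * e) \<le> (1 + l * a) * (1 + l * (2 * (B - a)))"
      using e l aB by (intro mult_left_mono add_left_mono) auto
    also have "\<dots> = 1 + 2 * l * B - l * a * (1 - 2 * (l * (B - a)))"
      by (simp add: algebra_simps)
    also have "\<dots> \<le> 1 + 2 * l * B"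
    proof -
      have "l * (B - a) \<le> l * 4" using aB l by (intro mult_left_mono) auto
      then have "0 \<le> l * a * (1 - 2 * (l * (B - a)))"
        using l aB by (intro mult_nonneg_nonneg) auto
      then show ?thesis by simp
    qed
    finally have "weight v l N d k * ((1 + l * a) * (1 + l * e)) \<le> weight v l N d k * (1 + 2 * l * B)"
      using weight_ge_1[OF l(1), of v N d k] by (intro mult_left_mono) auto
    then show "weight v l N d k * (1 + l * amp2 v (N - d) k) *
         ((1 + 2 * l * energy v (N - Suc d) (2 * k)) + (1 + 2 * l * energy v (N - Suc d) (2 * k + 1)))
       \<le> 2 * (weight v l N d k * (1 + 2 * l * energy v (N - d) k))"
      by (simp add: a_def B_def e_def algebra_simps)
  qed
  also have "\<dots> \<le> 2 * 2 ^ Suc d"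
    using Suc by (simp add: sum_distrib_left[symmetric])
  finally show ?case .
qed

text \<open>The numbers 1 / (2^d |cell|) are the difference quotients of the inverse map. Averaged
  over two children, their powers of order 2 a grow at most by 1 + l \<open>amp2\<close>, just like
  \<open>weight\<close>; so the weighted mean of squares stays bounded, and 2 G \<le> G^2 / w + w
  removes the weight.\<close>

lemma sum_density_power_le:
  assumes v: "\<forall>k. \<bar>v k\<bar> \<le> 1" and l: "0 \<le> l" "8 * l \<le> 1"
    and eta: "0 < \<eta>" "\<eta> \<le> 1 / 10" "C * \<eta>\<^sup>2 \<le> l" "0 \<le> C"
    and C: "\<And>x::real. \<bar>x\<bar> \<le> 1 / 2 \<Longrightarrow> (1 / (1 + x)) ^ (2 * a) + (1 / (1 - x)) ^ (2 * a) \<le> 2 * (1 + C * x\<^sup>2)"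
    and x0: "xs 0 = real" and g: "\<And>d. dyadic_grid d (xs d)"
    and ref: "\<And>d. \<exists>p. xs (Suc d) = refine p (xs d) \<and> (\<forall>i. \<exists>\<sigma>. \<bar>\<sigma>\<bar> \<le> 1 \<and> p i = cutpt (\<eta> * amp v (N - d) i) \<sigma>)"
  shows "(\<Sum>k<2 ^ d. (1 / (2 ^ d * blen (xs d) 0 k)) ^ a) \<le> 2 * 2 ^ d"
proof -
  define G where "G = (\<lambda>d k. (1 / (2 ^ d * blen (xs d) 0 k)) ^ a)"
  have pos: "0 < blen (xs d) 0 k" for d k using g[of d] by (simp add: dyadic_grid_def blen_0)
  have main: "(\<Sum>k<2 ^ d. (G d k)\<^sup>2 / weight v l N d k) \<le> 2 ^ d" for d
  proof (induction d)
    case 0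
    then show ?case by (simp add: G_def x0 blen_0)
  next
    case (Suc d)
    obtain p where p: "xs (Suc d) = refine p (xs d)"
      "\<And>i. \<exists>\<sigma>. \<bar>\<sigma>\<bar> \<le> 1 \<and> p i = cutpt (\<eta> * amp v (N - d) i) \<sigma>"
      using ref[of d] by blast
    have "(\<Sum>k<2 ^ Suc d. (G (Suc d) k)\<^sup>2 / weight v l N (Suc d) k)
       = (\<Sum>k<2 ^ d. ((G (Suc d) (2 * k))\<^sup>2 + (G (Suc d) (2 * k + 1))\<^sup>2) / (weight v l N d k * (1 + l * amp2 v (N - d) k)))"
      unfolding sum_double by (simp add: add_divide_distrib)
    also have "\<dots> \<le> (\<Sum>k<2 ^ d. 2 * ((G d k)\<^sup>2 / weight v l N d k))"
    proof (rule sum_mono)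
      fix k
      obtain \<sigma> where \<sigma>: "\<bar>\<sigma>\<bar> \<le> 1" "p k = cutpt (\<eta> * amp v (N - d) k) \<sigma>" using p(2) by blast
      define y where "y = \<eta> * amp v (N - d) k * \<sigma>"
      have am: "0 \<le> amp v (N - d) k" "amp v (N - d) k \<le> 1" using amp_bounds[OF v] by auto
      have "\<bar>y\<bar> = \<eta> * (amp v (N - d) k * \<bar>\<sigma>\<bar>)" using eta am by (simp add: y_def abs_mult)
      also have "\<dots> \<le> 1 / 10 * (1 * 1)" using eta am \<sigma> by (intro mult_mono) auto
      finally have y: "\<bar>y\<bar> \<le> 1 / 2" by simp
      have "y\<^sup>2 = \<eta>\<^sup>2 * amp2 v (N - d) k * \<sigma>\<^sup>2"
        by (simp add: y_def power_mult_distrib amp_power2)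
      also have "\<dots> \<le> \<eta>\<^sup>2 * amp2 v (N - d) k * 1"
        using \<sigma>(1) amp2_nonneg[of v "N - d" k] by (intro mult_left_mono) (auto simp: abs_square_le_1)
      finally have "C * y\<^sup>2 \<le> C * \<eta>\<^sup>2 * amp2 v (N - d) k"
        using eta by (simp add: mult_left_mono mult.assoc)
      also have "\<dots> \<le> l * amp2 v (N - d) k"
        using eta amp2_nonneg[of v "N - d" k] by (intro mult_right_mono) auto
      finally have Cy: "C * y\<^sup>2 \<le> l * amp2 v (N - d) k" .
      have pk: "2 * p k = 1 + y" "2 * (1 - p k) = 1 - y"
        by (simp_all add: \<sigma> cutpt_def y_def field_simps)
      let ?l = "blen (xs d) 0 k"
      have bl: "2 ^ Suc d * blen (xs (Suc d)) 0 (2 * k) = (1 + y) * (2 ^ d * ?l)"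
        "2 ^ Suc d * blen (xs (Suc d)) 0 (2 * k + 1) = (1 - y) * (2 ^ d * ?l)"
        unfolding p(1) blen_refine_0 pk[symmetric] by simp_all
      have G2: "(G (Suc d) (2 * k))\<^sup>2 = (G d k)\<^sup>2 * (1 / (1 + y)) ^ (2 * a)"
        "(G (Suc d) (2 * k + 1))\<^sup>2 = (G d k)\<^sup>2 * (1 / (1 - y)) ^ (2 * a)"
        unfolding G_def bl by (simp_all add: power_mult_distrib power_divide power_mult[symmetric] mult_ac)
      have W: "0 < weight v l N d k" "0 < 1 + l * amp2 v (N - d) k"
        using weight_ge_1[OF l(1), of v N d k] l amp2_nonneg[of v "N - d" k]
        by (auto intro: less_le_trans[OF zero_less_one] add_pos_nonneg)
      have "((G (Suc d) (2 * k))\<^sup>2 + (G (Suc d) (2 * k + 1))\<^sup>2) / (weight v l N d k * (1 + l * amp2 v (N - d) k))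
         = (G d k)\<^sup>2 / weight v l N d k * (((1 / (1 + y)) ^ (2 * a) + (1 / (1 - y)) ^ (2 * a)) / (1 + l * amp2 v (N - d) k))"
        unfolding G2 distrib_left[symmetric] by simp
      also have "\<dots> \<le> (G d k)\<^sup>2 / weight v l N d k * 2"
      proof (rule mult_left_mono)
        have "(1 / (1 + y)) ^ (2 * a) + (1 / (1 - y)) ^ (2 * a) \<le> 2 * (1 + l * amp2 v (N - d) k)"
          by (rule order.trans[OF C[OF y]]) (use Cy in simp)
        then show "((1 / (1 + y)) ^ (2 * a) + (1 / (1 - y)) ^ (2 * a)) / (1 + l * amp2 v (N - d) k) \<le> 2"
          using W by (simp add: pos_divide_le_eq)
      qed (use W in simp)
      finally show "((G (Suc d) (2 * k))\<^sup>2 + (G (Suc d) (2 * k + 1))\<^sup>2) / (weight v l N d k * (1 + l * amp2 v (N - d) k))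
         \<le> 2 * ((G d k)\<^sup>2 / weight v l N d k)"
        by (simp only: mult.commute[of "(G d k)\<^sup>2 / weight v l N d k" 2])
    qed
    also have "\<dots> \<le> 2 ^ Suc d"
      unfolding sum_distrib_left[symmetric] using Suc by simp
    finally show ?case .
  qed
  have "(\<Sum>k<2 ^ d. G d k) \<le> (\<Sum>k<2 ^ d. ((G d k)\<^sup>2 / weight v l N d k + weight v l N d k * (1 + 2 * l * energy v (N - d) k)) / 2)"
  proof (rule sum_mono)
    fix k
    let ?w = "weight v l N d k"
    have w: "1 \<le> ?w" by (rule weight_ge_1[OF l(1)])
    have half: "g \<le> (a + c) / 2" if "2 * g \<le> a + b" "b \<le> c" for g a b c :: real
      using that by simp
    have "2 * G d k * ?w \<le> (G d k)\<^sup>2 + ?w\<^sup>2"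
      by (rule sum_squares_bound)
    then have le: "2 * G d k \<le> (G d k)\<^sup>2 / ?w + ?w"
      using w by (simp add: field_simps power2_eq_square)
    have "?w \<le> ?w * (1 + 2 * l * energy v (N - d) k)"
      using w l energy_nonneg[of v "N - d" k] by (simp add: algebra_simps)
    with le show "G d k \<le> ((G d k)\<^sup>2 / ?w + ?w * (1 + 2 * l * energy v (N - d) k)) / 2"
      by (rule half)
  qed
  also have "\<dots> = ((\<Sum>k<2 ^ d. (G d k)\<^sup>2 / weight v l N d k) + (\<Sum>k<2 ^ d. weight v l N d k * (1 + 2 * l * energy v (N - d) k))) / 2"
    by (simp add: sum.distrib sum_divide_distrib[symmetric])
  also have "\<dots> \<le> (2 ^ d + 2 * 2 ^ d) / 2"
    by (intro divide_right_mono add_mono main sum_weight_le[OF v l]) simp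
  also have "\<dots> \<le> 2 * 2 ^ d" by simp
  finally show ?thesis by (simp add: G_def)
qed

lemma norm_step_ft_le:
  assumes v: "\<forall>k. \<bar>v k\<bar> \<le> 1" and x: "\<And>i. x i \<le> x (Suc i)"
  shows "norm (step_ft v x n k \<mu>) \<le> blen x n k"
proof -
  have "norm (step_ft v x n k \<mu>) \<le> (\<Sum>i<2 ^ n. blen x 0 (k * 2 ^ n + i))"
    unfolding step_ft_def
  proof (intro order.trans[OF norm_sum] sum_mono)
    fix i
    let ?i = "k * 2 ^ n + i"
    have "norm (integral {x ?i..x (Suc ?i)} (\<lambda>y. ee (\<mu> * y))) \<le> integral {x ?i..x (Suc ?i)} (\<lambda>y. 1)"
      by (rule integral_norm_bound_integral) (auto intro!: integrable_continuous_interval continuous_intros)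
    then have "norm (integral {x ?i..x (Suc ?i)} (\<lambda>y. ee (\<mu> * y))) \<le> blen x 0 ?i"
      using x[of ?i] by (simp add: blen_0)
    then have "\<bar>v ?i\<bar> * norm (integral {x ?i..x (Suc ?i)} (\<lambda>y. ee (\<mu> * y))) \<le> 1 * blen x 0 ?i"
      using v by (intro mult_mono) auto
    then show "norm (of_real (v ?i) * integral {x ?i..x (Suc ?i)} (\<lambda>y. ee (\<mu> * y))) \<le> blen x 0 ?i"
      by (simp add: norm_mult)
  qed
  then show ?thesis using blen_sum[of x 0 k n] by simp
qed

text \<open>The width \<eta> depends only on the exponent a, through the constant of
  \<open>inverse_power_two_sided\<close>. Hence K is uniform in the depth N and in the values v,
  which is what makes the passage to the limit possible.\<close>

lemma finite_stage:
  "\<exists>K>0. \<forall>N v. (\<forall>k. \<bar>v k\<bar> \<le> 1) \<longrightarrow> (\<exists>xs. xs 0 = real \<and> (\<forall>d. dyadic_grid d (xs d)) \<and>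
     (\<forall>d. \<exists>p. xs (Suc d) = refine p (xs d)) \<and>
     (\<forall>d. (\<Sum>k<2 ^ d. (1 / (2 ^ d * blen (xs d) 0 k)) ^ a) \<le> 2 * 2 ^ d) \<and>
     (\<forall>n\<le>N. \<forall>k \<mu>. 0 < \<mu> \<longrightarrow> norm (step_ft v (xs N) (N - n) k \<mu>)
        \<le> K * (\<mu> * blen (xs n) 0 k) powr (- 1 / 32) * blen (xs n) 0 k))"
proof -
  obtain C where C: "C \<ge> 0" "\<And>x::real. \<bar>x\<bar> \<le> 1 / 2 \<Longrightarrow> (1 / (1 + x)) ^ (2 * a) + (1 / (1 - x)) ^ (2 * a) \<le> 2 * (1 + C * x\<^sup>2)"
    using inverse_power_two_sided[of "2 * a"] by blast
  define \<eta> where "\<eta> = min (1 / 10) (1 / (8 * (C + 1)))"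
  have eta: "0 < \<eta>" "\<eta> \<le> 1 / 10" using C(1) by (auto simp: \<eta>_def)
  have Ceta: "C * \<eta>\<^sup>2 \<le> 1 / 8"
  proof -
    have "\<eta> * \<eta> \<le> 1 / (8 * (C + 1)) * 1" using eta by (intro mult_mono) (auto simp: \<eta>_def)
    then have "C * (\<eta> * \<eta>) \<le> C * (1 / (8 * (C + 1)))" using C(1) by (intro mult_left_mono) auto
    also have "\<dots> \<le> 1 / 8" using C(1) by (simp add: field_simps)
    finally show ?thesis by (simp add: power2_eq_square)
  qed
  define K where "K = 40 / sqrt \<eta> + 16000"
  have K: "K \<ge> 1" using eta by (simp add: K_def add_nonneg_nonneg order.trans[of 1 16000])
  have "\<exists>xs. xs 0 = real \<and> (\<forall>d. dyadic_grid d (xs d)) \<and>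
     (\<forall>d. \<exists>p. xs (Suc d) = refine p (xs d)) \<and>
     (\<forall>d. (\<Sum>k<2 ^ d. (1 / (2 ^ d * blen (xs d) 0 k)) ^ a) \<le> 2 * 2 ^ d) \<and>
     (\<forall>n\<le>N. \<forall>k \<mu>. 0 < \<mu> \<longrightarrow> norm (step_ft v (xs N) (N - n) k \<mu>)
        \<le> K * (\<mu> * blen (xs n) 0 k) powr (- 1 / 32) * blen (xs n) 0 k)"
    if v: "\<forall>k. \<bar>v k\<bar> \<le> 1" for N and v :: "nat \<Rightarrow> real"
  proof -
    \<comment> \<open>With 2 * 4^N ratios at each node the averaging is effective up to the
      frequency 4^N.\<close>
    interpret cascade v \<eta> "2 * 4 ^ N"
      by standard (use v eta in auto)
    obtain xs where xs: "xs 0 = real" "\<And>d. dyadic_grid d (xs d)"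
      and ref: "\<And>d. \<exists>p. xs (Suc d) = refine p (xs d) \<and>
        (\<forall>i. \<exists>\<sigma>. \<bar>\<sigma>\<bar> \<le> 1 \<and> p i = cutpt (kap (N - d) i) \<sigma>) \<and>
        (d < N \<longrightarrow> (\<forall>e\<le>d. \<forall>k \<mu>. 0 \<le> \<mu> \<longrightarrow> \<mu> * blen (xs d) e k \<le> 4 ^ e \<longrightarrow>
        norm (fsum (N - Suc d) (xs (Suc d)) (Suc e) k \<mu> - fsum (N - d) (xs d) e k \<mu>)
         \<le> 472 * 2 powr (- real e / 16) * blen (xs d) e k))"
      using exists_grids[of N] by blast
    have dens: "(\<Sum>k<2 ^ d. (1 / (2 ^ d * blen (xs d) 0 k)) ^ a) \<le> 2 * 2 ^ d" for d
    proof (rule sum_density_power_le[OF v _ _ eta Ceta C xs])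
      show "\<exists>p. xs (Suc d) = refine p (xs d) \<and> (\<forall>i. \<exists>\<sigma>. \<bar>\<sigma>\<bar> \<le> 1 \<and> p i = cutpt (\<eta> * amp v (N - d) i) \<sigma>)" for d
        using ref[of d] by blast
    qed auto
    have "norm (step_ft v (xs N) (N - n) k \<mu>) \<le> K * (\<mu> * blen (xs n) 0 k) powr (- 1 / 32) * blen (xs n) 0 k"
      if n: "n \<le> N" and mu: "0 < \<mu>" for n k \<mu>
    proof -
      define L where "L = blen (xs n) 0 k"
      have L: "0 < L" using xs(2)[of n] by (simp add: L_def dyadic_grid_def blen_0)
      have pos: "0 < \<mu> * L" using L mu by simp
      show ?thesis
      proof (cases "\<mu> * L \<le> 1")
        case True
        have mono: "xs N i \<le> xs N (Suc i)" for i using xs(2)[of N] by (simp add: dyadic_grid_def less_imp_le)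
        have bl: "blen (xs (n + j)) j k = L" for j
        proof (induction j)
          case (Suc j)
          then show ?case using ref[of "n + j"] by (auto simp: blen_refine_Suc)
        qed (simp add: L_def)
        have "norm (step_ft v (xs N) (N - n) k \<mu>) \<le> 1 * 1 * L"
          using norm_step_ft_le[OF v, of "xs N" "N - n" k \<mu>] mono bl[of "N - n"] n by simp
        also have "\<dots> \<le> K * (\<mu> * L) powr (- 1 / 32) * L"
        proof (intro mult_right_mono mult_mono)
          show "1 \<le> (\<mu> * L) powr (- 1 / 32)"
            using powr_mono2'[of "- 1 / 32" "\<mu> * L" 1] True pos by simp
        qed (use K L in auto)
        finally show ?thesis by (simp add: L_def)
      next
        case False
        \<comment> \<open>The least d with \<mu> L \<le> 4^d; the exponent 1/32 arises from
          2^(-d/16) = (4^d)^(-1/32).\<close>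
        define d where "d = nat \<lceil>log 4 (\<mu> * L)\<rceil>"
        have lg: "0 < log 4 (\<mu> * L)" using False by simp
        then have d: "log 4 (\<mu> * L) \<le> real d" "real d - 1 < log 4 (\<mu> * L)"
          unfolding d_def by linarith+
        have 1: "\<mu> * L \<le> 4 ^ d"
          using d(1) pos by (simp add: log_le_iff powr_realpow)
        have "4 powr (real d - 1) < \<mu> * L"
          using d(2) pos by (simp add: less_log_iff)
        then have 2: "4 ^ d \<le> 4 * (\<mu> * L)"
          by (simp add: powr_diff powr_realpow)
        have "norm (step_ft v (xs N) (N - n) k \<mu>) \<le> K * 2 powr (- real d / 16) * blen (xs n) 0 k"
          unfolding K_def
        proof (rule grids_local_decay[OF xs(2)])
          show "\<exists>p. xs (Suc d) = refine p (xs d)" for d using ref[of d] by blast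
          show "cmod (fsum (N - Suc d) (xs (Suc d)) (Suc e) k \<mu> - fsum (N - d) (xs d) e k \<mu>)
             \<le> 472 * 2 powr (- real e / 16) * blen (xs d) e k"
            if "d < N" "e \<le> d" "0 \<le> \<mu>" "\<mu> * blen (xs d) e k \<le> 4 ^ e" for d e k \<mu>
            using ref[of d] that by blast
        qed (use n mu 1 2 in \<open>auto simp: L_def\<close>)
        also have "\<dots> \<le> K * (\<mu> * L) powr (- 1 / 32) * L"
          unfolding L_def[symmetric]
        proof (intro mult_right_mono mult_left_mono)
          have "(4 ^ d) powr (- 1 / 32) \<le> (\<mu> * L) powr (- 1 / 32)"
            by (rule powr_mono2'[OF _ pos 1]) simp
          moreover have "((4::real) ^ d) powr (- 1 / 32) = 2 powr (- real d / 16)"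
          proof -
            have "(4::real) ^ d = 2 powr (2 * real d)"
              by (simp add: powr_realpow[symmetric] powr_powr[of 2 2, symmetric])
            then show ?thesis by (simp add: powr_powr)
          qed
          ultimately show "2 powr (- real d / 16) \<le> (\<mu> * L) powr (- 1 / 32)" by simp
        qed (use K L in auto)
        finally show ?thesis by (simp add: L_def)
      qed
    qed
    then show ?thesis using xs dens ref by (intro exI[of _ xs]) blast
  qed
  then show ?thesis using K by (intro exI[of _ K]) auto
qed

section \<open>The limit grid\<close>

locale limit_grid =
  fixes X :: "nat \<Rightarrow> nat \<Rightarrow> real"
  assumes X_0: "X 0 k = real k"
    and X_even: "X (Suc n) (2 * k) = X n k"
    and X_less: "X n k < X n (Suc k)"
    and X_odd: "9 / 20 * (X n (Suc k) - X n k) \<le> X (Suc n) (2 * k + 1) - X n k"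
       "X (Suc n) (2 * k + 1) - X n k \<le> 11 / 20 * (X n (Suc k) - X n k)"
begin

definition len :: "nat \<Rightarrow> nat \<Rightarrow> real" where
  "len n k = X n (Suc k) - X n k"

lemma len_pos: "0 < len n k"
  using X_less by (simp add: len_def)

end

section \<open>Compactness of the finite grids\<close>

lemma grid_bounds:
  assumes g: "\<And>d. dyadic_grid d (xs d)" and ref: "\<And>d. \<exists>p. xs (Suc d) = refine p (xs d)"
  shows "xs (Suc n) (2 * k) = xs n k"
    and "9 / 20 * blen (xs n) 0 k \<le> xs (Suc n) (2 * k + 1) - xs n k"
    and "xs (Suc n) (2 * k + 1) - xs n k \<le> 11 / 20 * blen (xs n) 0 k"
    and "0 \<le> xs n k" "xs n k \<le> real k" "xs n k < xs n (Suc k)"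
    and "(9 / 20) ^ n \<le> blen (xs n) 0 k"
proof -
  obtain p where p: "xs (Suc n) = refine p (xs n)" using ref by blast
  show e: "xs (Suc n) (2 * k) = xs n k" by (simp add: p)
  have c: "blen (xs (Suc n)) 0 j \<le> 11 / 20 * blen (xs (Suc n)) 1 (j div 2)" for j
    using g[of "Suc n"] by (simp add: dyadic_grid_def)
  have b: "blen (xs (Suc n)) 1 j = blen (xs n) 0 j" for j
    using blen_refine_Suc[of p "xs n" 0 j] by (simp add: p)
  have o: "blen (xs (Suc n)) 0 (2 * k) = xs (Suc n) (2 * k + 1) - xs n k"
    by (simp add: blen_0 e)
  have "blen (xs (Suc n)) 0 (2 * k) + blen (xs (Suc n)) 0 (2 * k + 1) = blen (xs n) 0 k"
    unfolding p blen_refine_0 by (simp add: algebra_simps)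
  then show "9 / 20 * blen (xs n) 0 k \<le> xs (Suc n) (2 * k + 1) - xs n k"
    and "xs (Suc n) (2 * k + 1) - xs n k \<le> 11 / 20 * blen (xs n) 0 k"
    using c[of "2 * k"] c[of "2 * k + 1"] b[of k] o by simp_all
  show l: "xs n k < xs n (Suc k)" for n k using g[of n] by (simp add: dyadic_grid_def)
  have m: "i \<le> j \<Longrightarrow> xs n i \<le> xs n j" for i j n
    using lift_Suc_mono_le[of "xs n" i j] l by (simp add: less_imp_le)
  show "0 \<le> xs n k"
    using m[of 0 k n] g[of n] by (simp add: dyadic_grid_def) (metis mult_0 of_nat_0)
  have "xs n k \<le> xs n (k * 2 ^ n)" by (rule m) simp
  then show "xs n k \<le> real k" using g[of n] by (simp add: dyadic_grid_def)
next
  have l: "xs n k < xs n (Suc k)" for n k using g[of n] by (simp add: dyadic_grid_def)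
  show "(9 / 20) ^ n \<le> blen (xs n) 0 k"
  proof (induction n arbitrary: k)
    case 0
    have "xs 0 j = real j" for j using g[of 0] unfolding dyadic_grid_def by (metis mult.right_neutral power_0)
    then show ?case by (simp add: blen_0)
  next
    case (Suc n)
    obtain p where p: "xs (Suc n) = refine p (xs n)" using ref by blast
    define j where "j = k div 2"
    have c: "blen (xs (Suc n)) 0 i \<le> 11 / 20 * blen (xs n) 0 (i div 2)" for i
    proof -
      have "blen (xs (Suc n)) 0 i \<le> 11 / 20 * blen (xs (Suc n)) (Suc 0) (i div 2)"
        using g[of "Suc n"] unfolding dyadic_grid_def by blast
      then show ?thesis unfolding p blen_refine_Suc .
    qed
    have s: "blen (xs (Suc n)) 0 (2 * j) + blen (xs (Suc n)) 0 (2 * j + 1) = blen (xs n) 0 j"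
      unfolding p blen_refine_0 by (simp add: algebra_simps)
    have "k = 2 * j \<or> k = 2 * j + 1" unfolding j_def by linarith
    then have "9 / 20 * blen (xs n) 0 j \<le> blen (xs (Suc n)) 0 k"
      using c[of "2 * j"] c[of "2 * j + 1"] s by auto
    then show ?case using Suc[of j] by simp
  qed
qed

lemma continuous_on_unit_ft: "continuous_on UNIV unit_ft"
proof -
  have "norm (unit_ft x - unit_ft y) \<le> 2 * pi * \<bar>x - y\<bar>" for x y
    using fbound_lipschitz[OF fbound_unit_ft[of 1], of x y] by simp
  then have "(2 * pi)-lipschitz_on UNIV unit_ft"
    by (intro lipschitz_onI) (auto simp: dist_norm)
  then show ?thesis by (rule lipschitz_on_continuous_on)
qed

text \<open>The closed form through \<open>unit_ft\<close> makes the integral visibly continuous in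
  both end points.\<close>

lemma tendsto_integral_ee:
  assumes "(\<lambda>j. a j) \<longlonglongrightarrow> a'" "(\<lambda>j. b j) \<longlonglongrightarrow> b'" "\<And>j. a j \<le> b j" "a' \<le> b'"
  shows "(\<lambda>j. integral {a j..b j} (\<lambda>y. ee (\<mu> * y))) \<longlonglongrightarrow> integral {a'..b'} (\<lambda>y. ee (\<mu> * y))"
proof -
  have u: "isCont unit_ft x" for x
    using continuous_on_unit_ft by (simp add: continuous_on_eq_continuous_at)
  have e: "isCont ee x" for x
    using continuous_on_ee[of UNIV "\<lambda>x. x"] by (simp add: continuous_on_eq_continuous_at)
  show ?thesis
    using assms unfolding integral_ee_eq_unit_ft[OF assms(3)] integral_ee_eq_unit_ft[OF assms(4)]
    by (intro tendsto_intros isCont_tendsto_compose[OF u] isCont_tendsto_compose[OF e])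
qed

lemma integral_grid_sum:
  fixes f :: "real \<Rightarrow> complex"
  assumes x: "\<And>i. x i \<le> x (Suc i)" and f: "f integrable_on {x a..x (a + M)}"
  shows "integral {x a..x (a + M)} f = (\<Sum>J<M. integral {x (a + J)..x (Suc (a + J))} f)"
  using f
proof (induction M)
  case (Suc M)
  have m: "i \<le> j \<Longrightarrow> x i \<le> x j" for i j using lift_Suc_mono_le[of x i j] x by simp
  have "f integrable_on {x a..x (a + M)}"
    by (rule integrable_subinterval_real[OF Suc.prems]) (use m in auto)
  then have "integral {x a..x (a + M)} f = (\<Sum>J<M. integral {x (a + J)..x (Suc (a + J))} f)"
    by (rule Suc.IH)
  moreover have "integral {x a..x (a + M)} f + integral {x (a + M)..x (a + Suc M)} f = integral {x a..x (a + Suc M)} f"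
    by (rule Henstock_Kurzweil_Integration.integral_combine[OF _ _ Suc.prems]) (use m in auto)
  ultimately show ?case by simp
qed simp

lemma norm_integral_ee_le:
  assumes "a \<le> b" shows "norm (integral {a..b} (\<lambda>y. ee (\<mu> * y))) \<le> b - a"
proof -
  have "norm (integral {a..b} (\<lambda>y. ee (\<mu> * y))) \<le> integral {a..b} (\<lambda>y. 1)"
    by (rule integral_norm_bound_integral) (auto intro!: integrable_continuous_interval continuous_intros)
  then show ?thesis using assms by simp
qed

text \<open>One value \<open>c\<close> replaces the values on 2^M consecutive cells. Only the 2^D
  coarse terms are followed in the limit, and their number does not change with the depth of the
  grid.\<close>

lemma step_ft_coarse:
  assumes x: "\<And>i. x i \<le> x (Suc i)"
    and c: "\<And>q i. i < 2 ^ M \<Longrightarrow> \<bar>v (q * 2 ^ M + i) - c q\<bar> \<le> \<epsilon>"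
  shows "norm (step_ft v x (M + D) k \<mu> -
      (\<Sum>J<2 ^ D. of_real (c (k * 2 ^ D + J)) * integral {x ((k * 2 ^ D + J) * 2 ^ M)..x (Suc (k * 2 ^ D + J) * 2 ^ M)} (\<lambda>y. ee (\<mu> * y))))
    \<le> \<epsilon> * blen x (M + D) k"
proof -
  let ?I = "\<lambda>i. integral {x i..x (Suc i)} (\<lambda>y. ee (\<mu> * y))"
  have I: "integral {x (q * 2 ^ M)..x (Suc q * 2 ^ M)} (\<lambda>y. ee (\<mu> * y)) = (\<Sum>i<2 ^ M. ?I (q * 2 ^ M + i))" for q
    using integral_grid_sum[of x "\<lambda>y. ee (\<mu> * y)" "q * 2 ^ M" "2 ^ M"] x
    by (simp add: add.commute integrable_continuous_interval continuous_intros)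
  have S: "step_ft v x (M + D) k \<mu> = (\<Sum>J<2 ^ D. \<Sum>i<2 ^ M. of_real (v ((k * 2 ^ D + J) * 2 ^ M + i)) * ?I ((k * 2 ^ D + J) * 2 ^ M + i))"
    unfolding step_ft_def by (rule sum_blocks)
  have B: "(\<Sum>J<2 ^ D. \<Sum>i<2 ^ M. blen x 0 ((k * 2 ^ D + J) * 2 ^ M + i)) = blen x (M + D) k"
    using blen_sum[of x 0] blen_sum[of x M k D] by simp
  have "norm (\<Sum>J<2 ^ D. \<Sum>i<2 ^ M. of_real (v ((k * 2 ^ D + J) * 2 ^ M + i) - c (k * 2 ^ D + J)) * ?I ((k * 2 ^ D + J) * 2 ^ M + i))
     \<le> (\<Sum>J<2 ^ D. \<Sum>i<2 ^ M. \<epsilon> * blen x 0 ((k * 2 ^ D + J) * 2 ^ M + i))"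
  proof (intro order.trans[OF norm_sum] sum_mono)
    fix J i assume "i \<in> {..<(2::nat) ^ M}"
    then have "\<bar>v ((k * 2 ^ D + J) * 2 ^ M + i) - c (k * 2 ^ D + J)\<bar> * norm (?I ((k * 2 ^ D + J) * 2 ^ M + i))
        \<le> \<epsilon> * blen x 0 ((k * 2 ^ D + J) * 2 ^ M + i)"
      using c[of i "k * 2 ^ D + J"] norm_integral_ee_le[OF x] unfolding blen_0 by (intro mult_mono) auto
    then show "norm (of_real (v ((k * 2 ^ D + J) * 2 ^ M + i) - c (k * 2 ^ D + J)) * ?I ((k * 2 ^ D + J) * 2 ^ M + i))
        \<le> \<epsilon> * blen x 0 ((k * 2 ^ D + J) * 2 ^ M + i)"
      by (simp add: norm_mult del: of_real_diff)
  qed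
  also have "\<dots> = \<epsilon> * blen x (M + D) k"
    unfolding B[symmetric] by (simp only: sum_distrib_left)
  finally show ?thesis
    unfolding S I by (simp add: sum_distrib_left sum_subtractf[symmetric] left_diff_distrib)
qed

lemma norm_le_of_diff: "norm (a - b) \<le> e \<Longrightarrow> norm a \<le> c \<Longrightarrow> norm b \<le> c + e"
  for a b :: complex
  using norm_triangle_ineq2[of b a] by (simp add: norm_minus_commute)

text \<open>All points of the grid may move with N, so a diagonal subsequence is taken along which
  each of them converges. The oscillatory estimate is stated for every \<open>G\<close> whose values
  on a cell are values of \<open>g0\<close> on the matching dyadic interval; thus it can precede the
  construction of the inverse map.\<close>

lemma exists_limit_grid:
  assumes K: "K > 0" and g0: "continuous_on UNIV g0" "\<And>x. \<bar>g0 x\<bar> \<le> 1"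
    and fin: "\<And>N v. \<forall>k. \<bar>v k\<bar> \<le> 1 \<Longrightarrow> \<exists>xs. xs 0 = real \<and> (\<forall>d. dyadic_grid d (xs d)) \<and>
     (\<forall>d. \<exists>p. xs (Suc d) = refine p (xs d)) \<and>
     (\<forall>d. (\<Sum>k<2 ^ d. (1 / (2 ^ d * blen (xs d) 0 k)) ^ a) \<le> 2 * 2 ^ d) \<and>
     (\<forall>n\<le>N. \<forall>k \<mu>. 0 < \<mu> \<longrightarrow> norm (step_ft v (xs N) (N - n) k \<mu>)
        \<le> K * (\<mu> * blen (xs n) 0 k) powr (- 1 / 32) * blen (xs n) 0 k)"
  shows "\<exists>X. limit_grid X \<and> (\<forall>n. (\<Sum>k<2 ^ n. (1 / (2 ^ n * (X n (Suc k) - X n k))) ^ a) \<le> 2 * 2 ^ n) \<and>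
    (\<forall>G. continuous_on {0..1} G \<longrightarrow>
       (\<forall>n k y. k < 2 ^ n \<longrightarrow> y \<in> {X n k..X n (Suc k)} \<longrightarrow> (\<exists>z\<in>{real k / 2 ^ n..real (Suc k) / 2 ^ n}. G y = g0 z)) \<longrightarrow>
       (\<forall>n k \<mu>. k < 2 ^ n \<longrightarrow> 0 < \<mu> \<longrightarrow> norm (integral {X n k..X n (Suc k)} (\<lambda>y. of_real (G y) * ee (\<mu> * y)))
          \<le> K * (\<mu> * (X n (Suc k) - X n k)) powr (- 1 / 32) * (X n (Suc k) - X n k)))"
proof -
  define v where "v = (\<lambda>N i. g0 (real i / 2 ^ N))"
  have v1: "\<forall>k. \<bar>v N k\<bar> \<le> 1" for N by (simp add: v_def g0)
  have "\<forall>N. \<exists>xs. xs 0 = real \<and> (\<forall>d. dyadic_grid d (xs d)) \<and>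
     (\<forall>d. \<exists>p. xs (Suc d) = refine p (xs d)) \<and>
     (\<forall>d. (\<Sum>k<2 ^ d. (1 / (2 ^ d * blen (xs d) 0 k)) ^ a) \<le> 2 * 2 ^ d) \<and>
     (\<forall>n\<le>N. \<forall>k \<mu>. 0 < \<mu> \<longrightarrow> norm (step_ft (v N) (xs N) (N - n) k \<mu>)
        \<le> K * (\<mu> * blen (xs n) 0 k) powr (- 1 / 32) * blen (xs n) 0 k)"
    using fin[OF v1] by blast
  then obtain xs where xs0: "\<And>N. xs N 0 = real" and xg: "\<And>N d. dyadic_grid d (xs N d)"
    and xr: "\<And>N d. \<exists>p. xs N (Suc d) = refine p (xs N d)"
    and xd: "\<And>N d. (\<Sum>k<2 ^ d. (1 / (2 ^ d * blen (xs N d) 0 k)) ^ a) \<le> 2 * 2 ^ d"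
    and xm: "\<And>N n k \<mu>. n \<le> N \<Longrightarrow> 0 < \<mu> \<Longrightarrow> norm (step_ft (v N) (xs N N) (N - n) k \<mu>)
        \<le> K * (\<mu> * blen (xs N n) 0 k) powr (- 1 / 32) * blen (xs N n) 0 k"
    by metis
  note gb = grid_bounds[where xs = "xs N" for N, OF xg xr]
  \<comment> \<open>The division by k + 1 provides the common bound over all indices that the
    subsequence argument requires.\<close>
  have "norm (xs N n k / (real k + 1)) \<le> 1" for N n k
    using gb(4,5)[of N n k] by (simp add: field_simps)
  then have bd: "norm ((\<lambda>N (n, k). xs N n k / (real k + 1)) N q) \<le> 1" for N q
    by (cases q) auto
  obtain r where r: "strict_mono r"
    and conv: "\<And>q. \<exists>l. (\<lambda>j. (\<lambda>N (n, k). xs N n k / (real k + 1)) (r j) q) \<longlonglongrightarrow> l"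
  proof (rule function_convergent_subsequence[of "UNIV :: (nat \<times> nat) set" "\<lambda>N (n, k). xs N n k / (real k + 1)" 1])
    fix r assume "strict_mono (r :: nat \<Rightarrow> nat)"
      and "\<And>q. q \<in> UNIV \<Longrightarrow> \<exists>l. (\<lambda>j. (\<lambda>N (n, k). xs N n k / (real k + 1)) (r j) q) \<longlonglongrightarrow> l"
    then show thesis by (intro that) blast+
  qed (use bd in auto)
  have "\<exists>l. (\<lambda>j. xs (r j) n k) \<longlonglongrightarrow> l" for n k
  proof -
    obtain l where "(\<lambda>j. xs (r j) n k / (real k + 1)) \<longlonglongrightarrow> l" using conv[of "(n, k)"] by auto
    then have "(\<lambda>j. xs (r j) n k / (real k + 1) * (real k + 1)) \<longlonglongrightarrow> l * (real k + 1)"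
      by (intro tendsto_intros)
    moreover have "xs (r j) n k / (real k + 1) * (real k + 1) = xs (r j) n k" for j
      by (simp add: add_nonneg_eq_0_iff)
    ultimately show ?thesis by auto
  qed
  then obtain X where X: "\<And>n k. (\<lambda>j. xs (r j) n k) \<longlonglongrightarrow> X n k" by metis
  have bl: "(\<lambda>j. blen (xs (r j) n) 0 k) \<longlonglongrightarrow> X n (Suc k) - X n k" for n k
    unfolding blen_0 by (intro tendsto_intros X)
  have Xpos: "(9 / 20) ^ n \<le> X n (Suc k) - X n k" for n k
    by (rule LIMSEQ_le_const[OF bl]) (use gb(7) in auto)
  have Xless: "X n k < X n (Suc k)" for n k
    using Xpos[of n k] zero_less_power[of "9 / 20 :: real" n] by linarith
  have Xeven: "X (Suc n) (2 * k) = X n k" for n k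
    using X[of "Suc n" "2 * k"] X[of n k] gb(1) LIMSEQ_unique by (simp only:) blast
  have grid: "limit_grid X"
  proof
    show "X 0 k = real k" for k
      using X[of 0 k] LIMSEQ_unique[OF X[of 0 k], of "real k"] xs0 by simp
    show "9 / 20 * (X n (Suc k) - X n k) \<le> X (Suc n) (2 * k + 1) - X n k" for n k
      by (rule LIMSEQ_le[OF tendsto_mult[OF tendsto_const bl] tendsto_diff[OF X X]]) (use gb(2) in auto)
    show "X (Suc n) (2 * k + 1) - X n k \<le> 11 / 20 * (X n (Suc k) - X n k)" for n k
      by (rule LIMSEQ_le[OF tendsto_diff[OF X X] tendsto_mult[OF tendsto_const bl]]) (use gb(3) in auto)
  qed (rule Xeven Xless)+
  have dens: "(\<Sum>k<2 ^ n. (1 / (2 ^ n * (X n (Suc k) - X n k))) ^ a) \<le> 2 * 2 ^ n" for n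
  proof (rule LIMSEQ_le_const2)
    show "(\<lambda>j. \<Sum>k<2 ^ n. (1 / (2 ^ n * blen (xs (r j) n) 0 k)) ^ a) \<longlonglongrightarrow> (\<Sum>k<2 ^ n. (1 / (2 ^ n * (X n (Suc k) - X n k))) ^ a)"
      using Xless[of n] by (intro tendsto_intros bl) (auto simp: less_imp_neq[symmetric])
  qed (use xd in auto)
  have ME: "norm (integral {X n k..X n (Suc k)} (\<lambda>y. of_real (G y) * ee (\<mu> * y)))
          \<le> K * (\<mu> * (X n (Suc k) - X n k)) powr (- 1 / 32) * (X n (Suc k) - X n k)"
    if Gc: "continuous_on {0..1} G"
      and G: "\<And>n k y. k < 2 ^ n \<Longrightarrow> y \<in> {X n k..X n (Suc k)} \<Longrightarrow> \<exists>z\<in>{real k / 2 ^ n..real (Suc k) / 2 ^ n}. G y = g0 z"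
      and k: "k < 2 ^ n" and mu: "0 < \<mu>" for G :: "real \<Rightarrow> real" and n k \<mu>
  proof -
    define L where "L = X n (Suc k) - X n k"
    have L: "0 < L" using Xless by (simp add: L_def)
    define B where "B = K * (\<mu> * L) powr (- 1 / 32) * L"
    have "norm (integral {X n k..X n (Suc k)} (\<lambda>y. of_real (G y) * ee (\<mu> * y))) \<le> B + e" if e: "0 < e" for e
    proof -
      define \<epsilon> where "\<epsilon> = e / (2 * L)"
      have eps: "0 < \<epsilon>" using e L by (simp add: \<epsilon>_def)
      have "uniformly_continuous_on {0..1} g0"
        using continuous_on_subset[OF g0(1)] by (intro compact_uniformly_continuous) auto
      then obtain \<delta> where d: "0 < \<delta>" "\<And>z z'. z \<in> {0..1} \<Longrightarrow> z' \<in> {0..1} \<Longrightarrow> \<bar>z - z'\<bar> < \<delta> \<Longrightarrow> \<bar>g0 z - g0 z'\<bar> < \<epsilon>"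
        unfolding uniformly_continuous_on_def dist_real_def using eps by metis
      \<comment> \<open>D = n0 further levels make \<open>g0\<close> vary by at most \<epsilon> on a
        dyadic interval; D stays fixed while the depth tends to infinity.\<close>
      obtain n0 where n0: "(1 / 2) ^ n0 < \<delta>" using real_arch_pow_inv[OF d(1), of "1 / 2"] by auto
      define D where "D = n0"
      define n' where "n' = n + D"
      have n'd: "1 / 2 ^ n' < \<delta>"
      proof -
        have "(1 / 2 :: real) ^ n' \<le> (1 / 2) ^ n0" by (intro power_decreasing) (auto simp: n'_def D_def)
        then show ?thesis using n0 by (simp add: power_divide)
      qed
      have Xs: "X (n + i) (j * 2 ^ i) = X n j" for i j
      proof (induction i)
        case (Suc i)
        have "X (Suc (n + i)) (2 * (j * 2 ^ i)) = X n j" by (simp only: Xeven Suc)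
        then show ?case by (simp add: mult_ac)
      qed simp
      have q: "Suc (k * 2 ^ D + J) \<le> 2 ^ n'" if "J < 2 ^ D" for J
      proof -
        have "Suc (k * 2 ^ D + J) \<le> Suc k * 2 ^ D" using that by simp
        also have "\<dots> \<le> 2 ^ n * 2 ^ D" using k by (intro mult_right_mono) auto
        finally show ?thesis by (simp add: n'_def power_add)
      qed
      define c where "c = (\<lambda>q. g0 (real q / 2 ^ n'))"
      let ?S = "\<Sum>J<2 ^ D. of_real (c (k * 2 ^ D + J)) * integral {X n' (k * 2 ^ D + J)..X n' (Suc (k * 2 ^ D + J))} (\<lambda>y. ee (\<mu> * y))"
      have close: "\<bar>g0 z - c q\<bar> \<le> \<epsilon>" if "Suc q \<le> 2 ^ n'" "z \<in> {real q / 2 ^ n'..real (Suc q) / 2 ^ n'}" for z q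
      proof -
        have "real (Suc q) \<le> real (2 ^ n')" using that(1) by (simp only: of_nat_le_iff)
        then have 1: "real (Suc q) / 2 ^ n' \<le> 1" by simp
        have 2: "real (Suc q) / 2 ^ n' = real q / 2 ^ n' + 1 / 2 ^ n'" by (simp add: add_divide_distrib)
        have 3: "0 \<le> real q / 2 ^ n'" by simp
        have "\<bar>g0 z - g0 (real q / 2 ^ n')\<bar> < \<epsilon>"
          using that(2) 1 2 3 n'd unfolding atLeastAtMost_iff
          by (intro d(2)) (auto simp only: atLeastAtMost_iff abs_less_iff)
        then show ?thesis by (simp add: c_def)
      qed
      have Xm: "X j i \<le> X j (Suc i)" for i j using Xless[of j i] by simp
      have X01: "{X j i..X j (Suc i)} \<subseteq> {0..1}" if "Suc i \<le> 2 ^ j" for i j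
      proof -
        have m: "a \<le> b \<Longrightarrow> X j a \<le> X j b" for a b using lift_Suc_mono_le[of "X j" a b] Xm by simp
        have "X (0 + j) (0 * 2 ^ j) = 0" "X (0 + j) (1 * 2 ^ j) = 1"
        proof -
          interpret limit_grid X by (rule grid)
          have "X (0 + i) (l * 2 ^ i) = X 0 l" for i l
          proof (induction i)
            case (Suc i)
            have "X (Suc (0 + i)) (2 * (l * 2 ^ i)) = X 0 l" by (simp only: Xeven Suc)
            then show ?case by (simp add: mult_ac)
          qed simp
          then show "X (0 + j) (0 * 2 ^ j) = 0" "X (0 + j) (1 * 2 ^ j) = 1" by (simp_all only: X_0 of_nat_0 of_nat_1)
        qed
        then show ?thesis using m[of 0 i] m[of "Suc i" "2 ^ j"] that by auto
      qed
      have Gi: "(\<lambda>y. of_real (G y) * ee (\<mu> * y)) integrable_on {X j i..X j (Suc i)}" if "Suc i \<le> 2 ^ j" for i j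
        using X01[OF that] by (intro integrable_continuous_interval continuous_intros continuous_on_subset[OF Gc]) auto
      have "integral {X n k..X n (Suc k)} (\<lambda>y. of_real (G y) * ee (\<mu> * y))
          = integral {X n' (k * 2 ^ D)..X n' (k * 2 ^ D + 2 ^ D)} (\<lambda>y. of_real (G y) * ee (\<mu> * y))"
        using Xs[of D k] Xs[of D "Suc k"] by (simp add: n'_def add.commute)
      also have "\<dots> = (\<Sum>J<2 ^ D. integral {X n' (k * 2 ^ D + J)..X n' (Suc (k * 2 ^ D + J))} (\<lambda>y. of_real (G y) * ee (\<mu> * y)))"
      proof (rule integral_grid_sum[where x = "X n'", OF Xm])
        show "(\<lambda>y. of_real (G y) * ee (\<mu> * y)) integrable_on {X n' (k * 2 ^ D)..X n' (k * 2 ^ D + 2 ^ D)}"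
          using Gi[of k n] k Xs[of D k] Xs[of D "Suc k"] by (simp add: n'_def add.commute)
      qed
      finally have split: "integral {X n k..X n (Suc k)} (\<lambda>y. of_real (G y) * ee (\<mu> * y))
          = (\<Sum>J<2 ^ D. integral {X n' (k * 2 ^ D + J)..X n' (Suc (k * 2 ^ D + J))} (\<lambda>y. of_real (G y) * ee (\<mu> * y)))" .
      have 1: "norm (integral {X n k..X n (Suc k)} (\<lambda>y. of_real (G y) * ee (\<mu> * y)) - ?S) \<le> \<epsilon> * L"
      proof -
        have "norm (integral {X n k..X n (Suc k)} (\<lambda>y. of_real (G y) * ee (\<mu> * y)) - ?S)
          \<le> (\<Sum>J<2 ^ D. \<epsilon> * blen (X n') 0 (k * 2 ^ D + J))"
          unfolding split sum_subtractf[symmetric]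
        proof (intro order.trans[OF norm_sum] sum_mono)
          fix J assume "J \<in> {..<(2::nat) ^ D}"
          then have qJ: "Suc (k * 2 ^ D + J) \<le> 2 ^ n'" using q by simp
          define q where "q = k * 2 ^ D + J"
          have "integral {X n' q..X n' (Suc q)} (\<lambda>y. of_real (G y) * ee (\<mu> * y)) - of_real (c q) * integral {X n' q..X n' (Suc q)} (\<lambda>y. ee (\<mu> * y))
            = integral {X n' q..X n' (Suc q)} (\<lambda>y. of_real (G y) * ee (\<mu> * y) - of_real (c q) * ee (\<mu> * y))"
            using Gi[OF qJ] unfolding q_def[symmetric]
            by (subst Henstock_Kurzweil_Integration.integral_diff) (auto intro!: integrable_continuous_interval continuous_intros)
          also have "norm \<dots> \<le> integral {X n' q..X n' (Suc q)} (\<lambda>y. \<epsilon>)"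
          proof (rule integral_norm_bound_integral)
            show "(\<lambda>y. of_real (G y) * ee (\<mu> * y) - of_real (c q) * ee (\<mu> * y)) integrable_on {X n' q..X n' (Suc q)}"
              using Gi[OF qJ] unfolding q_def[symmetric]
              by (intro Henstock_Kurzweil_Integration.integrable_diff) (auto intro!: integrable_continuous_interval continuous_intros)
            fix y assume y: "y \<in> {X n' q..X n' (Suc q)}"
            obtain z where z: "z \<in> {real q / 2 ^ n'..real (Suc q) / 2 ^ n'}" "G y = g0 z"
              using G[OF _ y] qJ by (auto simp: q_def)
            have "\<bar>G y - c q\<bar> \<le> \<epsilon>"
              using close[OF _ z(1)] qJ z(2) by (simp add: q_def)
            then show "norm (of_real (G y) * ee (\<mu> * y) - of_real (c q) * ee (\<mu> * y)) \<le> \<epsilon>"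
              by (simp add: left_diff_distrib[symmetric] norm_mult flip: of_real_diff)
          qed auto
          also have "\<dots> = \<epsilon> * blen (X n') 0 q"
            using Xm[of n' q] by (simp add: blen_0)
          finally show "norm (integral {X n' (k * 2 ^ D + J)..X n' (Suc (k * 2 ^ D + J))} (\<lambda>y. of_real (G y) * ee (\<mu> * y))
              - of_real (c (k * 2 ^ D + J)) * integral {X n' (k * 2 ^ D + J)..X n' (Suc (k * 2 ^ D + J))} (\<lambda>y. ee (\<mu> * y)))
              \<le> \<epsilon> * blen (X n') 0 (k * 2 ^ D + J)" by (simp only: q_def)
        qed
        also have "\<dots> = \<epsilon> * blen (X n') D k"
          using blen_sum[of "X n'" 0 k D] by (simp only: sum_distrib_left[symmetric] add_0)
        also have "blen (X n') D k = L"
          using Xs[of D k] Xs[of D "Suc k"] by (simp add: blen_def L_def n'_def)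
        finally show ?thesis .
      qed
      \<comment> \<open>The coarse sum has a fixed number of terms with converging end points, so
        the estimate of the finite grids passes to it.\<close>
      have 2: "norm ?S \<le> B + \<epsilon> * L"
      proof (rule LIMSEQ_le)
        let ?Sj = "\<lambda>j. \<Sum>J<2 ^ D. of_real (c (k * 2 ^ D + J)) * integral {xs (r j) n' (k * 2 ^ D + J)..xs (r j) n' (Suc (k * 2 ^ D + J))} (\<lambda>y. ee (\<mu> * y))"
        show "(\<lambda>j. norm (?Sj j)) \<longlonglongrightarrow> norm ?S"
          by (intro tendsto_norm tendsto_sum tendsto_mult tendsto_const tendsto_integral_ee X Xm)
             (use gb(6) in \<open>auto intro: less_imp_le\<close>)
        show "(\<lambda>j. K * (\<mu> * blen (xs (r j) n) 0 k) powr (- 1 / 32) * blen (xs (r j) n) 0 k + \<epsilon> * blen (xs (r j) n) 0 k)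
            \<longlonglongrightarrow> B + \<epsilon> * L"
          unfolding B_def L_def using mu L by (intro tendsto_intros bl) (auto simp: L_def)
        show "\<exists>M. \<forall>j\<ge>M. norm (?Sj j) \<le> K * (\<mu> * blen (xs (r j) n) 0 k) powr (- 1 / 32) * blen (xs (r j) n) 0 k + \<epsilon> * blen (xs (r j) n) 0 k"
        proof (intro exI allI impI)
          fix j assume "n' \<le> j"
          then have N: "n' \<le> r j" using seq_suble[OF r, of j] by simp
          define N where "N = r j"
          define M where "M = N - n'"
          have NM: "N = n' + M" "N - n = M + D" using N by (auto simp: N_def M_def n'_def)
          have xsh: "xs N (l + i) (q * 2 ^ i) = xs N l q" for l i q
          proof (induction i)
            case (Suc i)
            have "xs N (Suc (l + i)) (2 * (q * 2 ^ i)) = xs N l q" by (simp only: gb(1) Suc)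
            then show ?case by (simp add: mult_ac)
          qed simp
          have xshN: "xs N N (q * 2 ^ M) = xs N n' q" for q
            using xsh[of n' M q] unfolding NM(1)[symmetric] .
          have xle: "xs N l i \<le> xs N l (Suc i)" for l i using gb(6)[of N l i] by simp
          have bl': "blen (xs N N) (M + D) k = blen (xs N n) 0 k"
            using xsh[of n "D + M" k] xsh[of n "D + M" "Suc k"]
            by (simp add: blen_def NM(1) n'_def add.assoc add.commute[of M])
          \<comment> \<open>Beyond the unit interval the values are set to \<open>c\<close>:
            \<open>close\<close> gives no comparison there, while \<open>step_ft_coarse\<close> asks
            for one on all blocks. The block in question lies inside, so its transform is
            unchanged.\<close>
          have "norm (step_ft (\<lambda>i. if i < 2 ^ N then v N i else c (i div 2 ^ M)) (xs N N) (M + D) k \<mu> -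
             (\<Sum>J<2 ^ D. of_real (c (k * 2 ^ D + J)) * integral {xs N N ((k * 2 ^ D + J) * 2 ^ M)..xs N N (Suc (k * 2 ^ D + J) * 2 ^ M)} (\<lambda>y. ee (\<mu> * y))))
             \<le> \<epsilon> * blen (xs N N) (M + D) k"
          proof (rule step_ft_coarse[where c = c and x = "xs N N"])
            show "xs N N i \<le> xs N N (Suc i)" for i by (rule xle)
            fix q i assume i: "i < (2::nat) ^ M"
            show "\<bar>(if q * 2 ^ M + i < 2 ^ N then v N (q * 2 ^ M + i) else c ((q * 2 ^ M + i) div 2 ^ M)) - c q\<bar> \<le> \<epsilon>"
            proof (cases "q * 2 ^ M + i < 2 ^ N")
              case True
              have "q * 2 ^ M < 2 ^ n' * 2 ^ M" using True unfolding NM(1) power_add by linarith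
              then have qn: "Suc q \<le> 2 ^ n'" by simp
              have z: "real (q * 2 ^ M + i) / 2 ^ N = (real q + real i / 2 ^ M) / 2 ^ n'"
                by (simp add: NM(1) power_add field_simps)
              have "real i < real (2 ^ M)" using i by (simp only: of_nat_less_iff)
              then have "real i / 2 ^ M \<le> 1" by simp
              then have "real (q * 2 ^ M + i) / 2 ^ N \<in> {real q / 2 ^ n'..real (Suc q) / 2 ^ n'}"
                unfolding z atLeastAtMost_iff by (auto intro!: divide_right_mono)
              then show ?thesis using close[OF qn] True by (simp add: v_def)
            next
              case False
              then show ?thesis using i eps by simp
            qed
          qed
          also have "step_ft (\<lambda>i. if i < 2 ^ N then v N i else c (i div 2 ^ M)) (xs N N) (M + D) k \<mu> = step_ft (v N) (xs N N) (M + D) k \<mu>"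
            unfolding step_ft_def
          proof (intro sum.cong refl)
            fix i assume "i \<in> {..<(2::nat) ^ (M + D)}"
            then have "k * 2 ^ (M + D) + i < Suc k * 2 ^ (M + D)" by simp
            also have "\<dots> \<le> 2 ^ n * 2 ^ (M + D)" using k by (intro mult_right_mono) auto
            also have "\<dots> = 2 ^ N" by (simp add: NM(1) n'_def power_add)
            finally show "of_real (if k * 2 ^ (M + D) + i < 2 ^ N then v N (k * 2 ^ (M + D) + i) else c ((k * 2 ^ (M + D) + i) div 2 ^ M)) *
                integral {xs N N (k * 2 ^ (M + D) + i)..xs N N (Suc (k * 2 ^ (M + D) + i))} (\<lambda>y. ee (\<mu> * y))
              = of_real (v N (k * 2 ^ (M + D) + i)) * integral {xs N N (k * 2 ^ (M + D) + i)..xs N N (Suc (k * 2 ^ (M + D) + i))} (\<lambda>y. ee (\<mu> * y))"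
              by simp
          qed
          also have "(\<Sum>J<2 ^ D. of_real (c (k * 2 ^ D + J)) * integral {xs N N ((k * 2 ^ D + J) * 2 ^ M)..xs N N (Suc (k * 2 ^ D + J) * 2 ^ M)} (\<lambda>y. ee (\<mu> * y))) = ?Sj j"
            unfolding N_def[symmetric] by (simp only: xshN)
          finally have "norm (step_ft (v N) (xs N N) (M + D) k \<mu> - ?Sj j) \<le> \<epsilon> * blen (xs N n) 0 k"
            unfolding bl' .
          moreover have "norm (step_ft (v N) (xs N N) (M + D) k \<mu>) \<le> K * (\<mu> * blen (xs N n) 0 k) powr (- 1 / 32) * blen (xs N n) 0 k"
            using xm[of n N \<mu> k] mu NM(1) unfolding NM(2) by (simp add: n'_def)
          ultimately show "norm (?Sj j) \<le> K * (\<mu> * blen (xs (r j) n) 0 k) powr (- 1 / 32) * blen (xs (r j) n) 0 k + \<epsilon> * blen (xs (r j) n) 0 k"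
            unfolding N_def[symmetric] by (rule norm_le_of_diff)
        qed
      qed
      have "norm (integral {X n k..X n (Suc k)} (\<lambda>y. of_real (G y) * ee (\<mu> * y))) \<le> B + \<epsilon> * L + \<epsilon> * L"
        by (rule norm_le_of_diff[OF _ 2]) (use 1 in \<open>simp add: norm_minus_commute\<close>)
      also have "\<dots> = B + e" using L by (simp add: \<epsilon>_def)
      finally show ?thesis .
    qed
    then show ?thesis unfolding B_def L_def by (rule field_le_epsilon)
  qed
  show ?thesis
    using grid dens ME by (intro exI[of _ X]) blast
qed

section \<open>The limit homeomorphism of the unit interval\<close>

context limit_grid
begin

lemma X_shift: "X (n + i) (k * 2 ^ i) = X n k"
proof (induction i)
  case (Suc i)
  have "X (Suc (n + i)) (2 * (k * 2 ^ i)) = X n k" by (simp only: X_even Suc)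
  then show ?case by (simp add: mult_ac)
qed simp

lemma X_strict: "j < k \<Longrightarrow> X n j < X n k"
  using lift_Suc_mono_less[of "X n" j k] X_less by simp

lemma X_le: "j \<le> k \<Longrightarrow> X n j \<le> X n k"
  using X_strict[of j k n] by (cases "j = k") auto

lemma X_first: "X n 0 = 0" and X_last: "X n (2 ^ n) = 1"
  using X_shift[of 0 n 0] X_shift[of 0 n 1] by (simp_all add: X_0)

lemma X_le_cross: "X n k \<le> X n' k' \<Longrightarrow> k * 2 ^ n' \<le> k' * 2 ^ n"
proof -
  assume "X n k \<le> X n' k'"
  moreover have "X n k = X (n + n') (k * 2 ^ n')" by (rule X_shift[symmetric])
  moreover have "X n' k' = X (n + n') (k' * 2 ^ n)"
    using X_shift[of n' n k'] by (simp add: add.commute)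
  ultimately show ?thesis using X_strict[of "k' * 2 ^ n" "k * 2 ^ n'" "n + n'"] by (metis not_le)
qed

lemma len_children:
  "9 / 20 * len n k \<le> len (Suc n) (2 * k)" "len (Suc n) (2 * k) \<le> 11 / 20 * len n k"
  "9 / 20 * len n k \<le> len (Suc n) (2 * k + 1)" "len (Suc n) (2 * k + 1) \<le> 11 / 20 * len n k"
proof -
  have "Suc (2 * k + 1) = 2 * Suc k" by simp
  then have "X (Suc n) (Suc (2 * k + 1)) = X n (Suc k)" by (simp only: X_even)
  then show "9 / 20 * len n k \<le> len (Suc n) (2 * k)" "len (Suc n) (2 * k) \<le> 11 / 20 * len n k"
    "9 / 20 * len n k \<le> len (Suc n) (2 * k + 1)" "len (Suc n) (2 * k + 1) \<le> 11 / 20 * len n k"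
    using X_odd[of n k] by (simp_all add: len_def X_even)
qed

lemma len_bounds: "(9 / 20) ^ n \<le> len n k" "len n k \<le> (11 / 20) ^ n"
proof -
  have "(9 / 20) ^ n \<le> len n k \<and> len n k \<le> (11 / 20) ^ n"
  proof (induction n arbitrary: k)
    case 0
    then show ?case by (simp add: len_def X_0)
  next
    case (Suc n)
    have "k = 2 * (k div 2) \<or> k = 2 * (k div 2) + 1" by linarith
    then have "9 / 20 * len n (k div 2) \<le> len (Suc n) k" "len (Suc n) k \<le> 11 / 20 * len n (k div 2)"
      using len_children[of n "k div 2"] by metis+
    then show ?case using Suc[of "k div 2"] by simp
  qed
  then show "(9 / 20) ^ n \<le> len n k" "len n k \<le> (11 / 20) ^ n" by auto
qed

text \<open>Inverse of the limit map, sending the grid point \<open>X n k\<close> to k / 2^n. The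
  supremum defines it at all points at once, and its properties are read off from
  \<open>h_between\<close>.\<close>

definition h :: "real \<Rightarrow> real" where
  "h y = Sup {real k / 2 ^ n |n k. k \<le> 2 ^ n \<and> X n k \<le> y}"

lemma h_between:
  assumes "X n k \<le> y" "y \<le> X n (Suc k)" "Suc k \<le> 2 ^ n"
  shows "real k / 2 ^ n \<le> h y" "h y \<le> real (Suc k) / 2 ^ n"
proof -
  let ?S = "{real k / 2 ^ n |n k. k \<le> 2 ^ n \<and> X n k \<le> y}"
  have ub: "s \<le> real (Suc k) / 2 ^ n" if "s \<in> ?S" for s
  proof -
    from that obtain n' k' where s: "s = real k' / 2 ^ n'" "X n' k' \<le> y" by blast
    then have "k' * 2 ^ n \<le> Suc k * 2 ^ n'" using assms by (intro X_le_cross) linarith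
    then have "real (k' * 2 ^ n) \<le> real (Suc k * 2 ^ n')" by (simp only: of_nat_le_iff)
    then show ?thesis by (simp add: s field_simps)
  qed
  have mem: "real k / 2 ^ n \<in> ?S" using assms by fastforce
  then show "real k / 2 ^ n \<le> h y" unfolding h_def by (rule cSup_upper) (rule bdd_aboveI, rule ub)
  show "h y \<le> real (Suc k) / 2 ^ n" unfolding h_def using mem ub by (intro cSup_least) auto
qed

lemma cell_exists:
  assumes "0 \<le> y" "y < 1"
  obtains k where "k < 2 ^ n" "X n k \<le> y" "y < X n (Suc k)"
proof -
  have "\<exists>k. k < j \<and> X n k \<le> y \<and> y < X n (Suc k)" if "y < X n j" for j
    using that
  proof (induction j)
    case 0
    then show ?case using assms X_first by simp
  next
    case (Suc j)
    then show ?case by (cases "y < X n j") (auto intro: less_SucI)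
  qed
  from this[of "2 ^ n"] show ?thesis using that assms X_last by auto
qed

lemma cell_exists':
  assumes "0 \<le> y" "y \<le> 1"
  obtains k where "Suc k \<le> 2 ^ n" "X n k \<le> y" "y \<le> X n (Suc k)"
proof (cases "y = 1")
  case True
  have "Suc (2 ^ n - 1) = (2::nat) ^ n" by simp
  then show ?thesis using that[of "2 ^ n - 1"] True X_last[of n] X_less[of n "2 ^ n - 1"] by simp
next
  case False
  then show ?thesis using cell_exists[of y n] assms that by (metis Suc_leI less_eq_real_def)
qed

lemma h_0: "h 0 = 0" and h_1: "h 1 = 1"
proof -
  have a: "real (2 ^ n - 1) / 2 ^ n \<le> h 1 \<and> h 1 \<le> 1" for n
    using h_between[of n "2 ^ n - 1" 1] X_last[of n] X_less[of n "2 ^ n - 1"] by simp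
  have b: "real (2 ^ n - 1) / 2 ^ n = 1 - (1 / 2) ^ n" for n
    by (simp add: of_nat_diff diff_divide_distrib power_divide)
  have 1: "1 - h 1 \<le> (1 / 2) ^ n" "h 1 \<le> 1" for n
    using a[of n] unfolding b by simp_all
  have 0: "h 0 \<le> (1 / 2) ^ n" "0 \<le> h 0" for n
    using h_between[of n 0 0] X_first[of n] X_less[of n 0] by (auto simp: power_divide)
  have "\<not> 0 < e" if "\<And>n. e \<le> (1 / 2) ^ n" for e :: real
  proof
    assume "0 < e"
    then obtain n where "(1 / 2) ^ n < e" using real_arch_pow_inv[of e "1 / 2"] by auto
    then show False using that[of n] by simp
  qed
  from this[of "h 0"] this[of "1 - h 1"] show "h 0 = 0" "h 1 = 1" using 0 1 by force+
qed

text \<open>Cells of level n have length at most (11/20)^n, so at some level a whole cell fits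
  between the two points, and \<open>h\<close> increases by 1 / 2^n on it.\<close>

lemma h_strict_mono:
  assumes "0 \<le> y" "y < y'" "y' \<le> 1" shows "h y < h y'"
proof -
  obtain n where n: "(11 / 20) ^ n < (y' - y) / 2"
    using real_arch_pow_inv[of "(y' - y) / 2" "11 / 20"] assms by auto
  obtain k where k: "k < 2 ^ n" "X n k \<le> y" "y < X n (Suc k)"
    using cell_exists[of y n] assms by auto
  have "X n (Suc (Suc k)) = X n k + len n k + len n (Suc k)" by (simp add: len_def)
  moreover have "a + b + c < y'" if "a \<le> y" "b \<le> r" "c \<le> r" "r < (y' - y) / 2" for a b c r
    using that by simp
  ultimately have less: "X n (Suc (Suc k)) < y'"
    using len_bounds(2)[of n k] len_bounds(2)[of n "Suc k"] n k(2) by simp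
  obtain j where j: "Suc j \<le> 2 ^ n" "X n j \<le> y'" "y' \<le> X n (Suc j)"
    using cell_exists'[of y' n] assms by auto
  have "Suc (Suc k) \<le> j"
  proof (rule ccontr)
    assume "\<not> Suc (Suc k) \<le> j"
    then have "X n (Suc j) \<le> X n (Suc (Suc k))" by (intro X_le) simp
    then show False using j less by simp
  qed
  then have "real (Suc k) / 2 ^ n < real j / 2 ^ n"
    by (intro divide_strict_right_mono) auto
  then show ?thesis
    using h_between[OF j(2,3,1)] h_between[of n k y] k by (simp add: Suc_le_eq)
qed

lemma h_mono: "0 \<le> y \<Longrightarrow> y \<le> y' \<Longrightarrow> y' \<le> 1 \<Longrightarrow> h y \<le> h y'"
  using h_strict_mono[of y y'] by (cases "y = y'") auto

lemma h_range: "0 \<le> y \<Longrightarrow> y \<le> 1 \<Longrightarrow> 0 \<le> h y \<and> h y \<le> 1"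
  using h_mono[of 0 y] h_mono[of y 1] h_0 h_1 by auto

lemma h_X: "k \<le> 2 ^ n \<Longrightarrow> h (X n k) = real k / 2 ^ n"
proof -
  assume k: "k \<le> 2 ^ n"
  show ?thesis
  proof (cases "k = 0")
    case True
    then show ?thesis by (simp add: X_first h_0)
  next
    case False
    then obtain j where j: "k = Suc j" by (cases k) auto
    have up: "h (X n k) \<le> real k / 2 ^ n"
      using h_between[of n j "X n k"] X_less[of n j] k j by simp
    have "real k / 2 ^ n \<le> h (X n k)"
    proof (cases "k = 2 ^ n")
      case True
      then show ?thesis using X_last h_1 by simp
    next
      case False
      then show ?thesis using h_between[of n k "X n k"] X_less[of n k] k by simp
    qed
    with up show ?thesis by simp
  qed
qed

text \<open>No cell of level n is shorter than (9/20)^n, so the two points lie in the same or in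
  adjacent cells.\<close>

lemma h_diff_le:
  assumes "0 \<le> y" "y \<le> y'" "y' \<le> 1" "y' - y < (9 / 20) ^ n" shows "h y' - h y \<le> 2 / 2 ^ n"
proof (cases "y < 1")
  case True
  obtain k where k: "k < 2 ^ n" "X n k \<le> y" "y < X n (Suc k)"
    using cell_exists[of y n] assms True by auto
  have lo: "real k / 2 ^ n \<le> h y" using h_between[of n k y] k by simp
  have "h y' \<le> real (Suc (Suc k)) / 2 ^ n"
  proof (cases "y' \<le> X n (Suc k)")
    case True
    then have "h y' \<le> real (Suc k) / 2 ^ n" using h_between[of n k y'] k assms by simp
    also have "\<dots> \<le> real (Suc (Suc k)) / 2 ^ n" by (intro divide_right_mono) auto
    finally show ?thesis .
  next
    case False
    then have "Suc k \<noteq> 2 ^ n" using X_last[of n] assms by auto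
    moreover have "y' \<le> X n (Suc (Suc k))"
      using len_bounds(1)[of n "Suc k"] k assms by (simp add: len_def)
    ultimately show ?thesis using h_between[of n "Suc k" y'] False k by simp
  qed
  moreover have "real (Suc (Suc k)) / 2 ^ n = real k / 2 ^ n + 2 / 2 ^ n" by (simp add: add_divide_distrib)
  ultimately show ?thesis using lo by linarith
next
  case False
  then have "y' = y" using assms by linarith
  then show ?thesis by simp
qed

lemma continuous_on_h: "continuous_on {0..1} h"
  unfolding continuous_on_iff
proof (intro ballI allI impI)
  fix y e :: real assume y: "y \<in> {0..1}" and e: "0 < e"
  obtain n where n: "(1 / 2) ^ n < e / 2" using real_arch_pow_inv[of "e / 2" "1 / 2"] e by auto
  show "\<exists>d>0. \<forall>x'\<in>{0..1}. dist x' y < d \<longrightarrow> dist (h x') (h y) < e"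
  proof (intro exI[of _ "(9 / 20) ^ n"] conjI ballI impI)
    fix x' assume x: "x' \<in> {0..1}" "dist x' y < (9 / 20) ^ n"
    have "\<bar>h x' - h y\<bar> \<le> 2 / 2 ^ n"
    proof (cases "x' \<le> y")
      case True
      then show ?thesis using h_diff_le[of x' y n] h_mono[of x' y] x y by (auto simp: dist_real_def)
    next
      case False
      then show ?thesis using h_diff_le[of y x' n] h_mono[of y x'] x y by (auto simp: dist_real_def)
    qed
    then show "dist (h x') (h y) < e" using n by (simp add: dist_real_def power_divide)
  qed simp
qed

text \<open>By the density bound, the cells of level n with difference quotient above T have images
  of total length at most 2 / T. An increment of \<open>h\<close> is therefore at most T times the
  length, plus the images of the steep cells inside the interval, plus those of two boundary
  cells.\<close>

lemma h_absolutely_continuous: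
  assumes dens: "\<And>n. (\<Sum>k<2 ^ n. (1 / (2 ^ n * len n k)) ^ a) \<le> 2 * 2 ^ n" and a: "1 \<le> a"
  shows "absolutely_continuous_on {0..1} h"
  unfolding absolutely_continuous_on_def
proof (intro allI impI)
  fix \<epsilon> :: real assume eps: "0 < \<epsilon>"
  \<comment> \<open>Makes 2 / T \<le> \<epsilon> / 4, one of three shares of this size.\<close>
  define T where "T = 1 + 8 / \<epsilon>"
  have T: "1 \<le> T" "8 / \<epsilon> \<le> T" using eps by (simp_all add: T_def)
  have T0: "2 / T \<le> \<epsilon> / 4"
  proof -
    have "8 / T \<le> \<epsilon>" using T eps by (simp add: field_simps)
    then show ?thesis by simp
  qed
  define w where "w = (\<lambda>n k. if T * len n k < 1 / 2 ^ n then 1 / 2 ^ n else (0::real))"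
  have w0: "0 \<le> w n k" for n k by (simp add: w_def)
  have wsum: "(\<Sum>k<2 ^ n. w n k) \<le> 2 / T" for n
  proof -
    have "(\<Sum>k<2 ^ n. w n k) \<le> (\<Sum>k<2 ^ n. (1 / (2 ^ n * len n k)) ^ a / (2 ^ n * T))"
    proof (rule sum_mono)
      fix k
      have l: "0 < len n k" by (rule len_pos)
      show "w n k \<le> (1 / (2 ^ n * len n k)) ^ a / (2 ^ n * T)"
      proof (cases "T * len n k < 1 / 2 ^ n")
        case True
        then have t: "T \<le> 1 / (2 ^ n * len n k)" using l by (simp add: field_simps)
        then have "T ^ 1 \<le> (1 / (2 ^ n * len n k)) ^ a"
          using T a by (intro order.trans[OF power_increasing[OF a]] power_mono) auto
        then have "1 / 2 ^ n * (T / T) \<le> 1 / 2 ^ n * ((1 / (2 ^ n * len n k)) ^ a / T)"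
          using T by (intro mult_left_mono divide_right_mono) auto
        then show ?thesis using T True by (simp add: w_def)
      next
        case False
        then show ?thesis using l T by (simp add: w_def)
      qed
    qed
    also have "\<dots> \<le> (2 * 2 ^ n) / (2 ^ n * T)"
      unfolding sum_divide_distrib[symmetric] using dens T by (intro divide_right_mono) auto
    finally show ?thesis by simp
  qed
  show "\<exists>\<delta>>0. \<forall>D. finite D \<longrightarrow> (\<forall>(a, b)\<in>D. a \<le> b \<and> {a..b} \<subseteq> {0..1}) \<longrightarrow>
      pairwise (\<lambda>(a, b) (c, d). {a<..<b} \<inter> {c<..<d} = {}) D \<longrightarrow>
      (\<Sum>(a, b)\<in>D. b - a) < \<delta> \<longrightarrow> (\<Sum>(a, b)\<in>D. \<bar>h b - h a\<bar>) < \<epsilon>"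
  proof (intro exI[of _ "\<epsilon> / (4 * T)"] conjI allI impI)
    show "0 < \<epsilon> / (4 * T)" using eps T by simp
    fix D :: "(real \<times> real) set"
    assume fin: "finite D" and D: "\<forall>(a, b)\<in>D. a \<le> b \<and> {a..b} \<subseteq> {0..1}"
      and pw: "pairwise (\<lambda>(a, b) (c, d). {a<..<b} \<inter> {c<..<d} = {}) D"
      and small: "(\<Sum>(a, b)\<in>D. b - a) < \<epsilon> / (4 * T)"
    have Dab: "a \<le> b" "0 \<le> a" "b \<le> 1" if "(a, b) \<in> D" for a b
      using D that by fastforce+
    \<comment> \<open>The level is chosen after the family \<open>D\<close>, so that the boundary
      cells of all its intervals cost at most \<epsilon> / 4; \<delta> does not depend on
      it.\<close>
    obtain n where n: "(1 / 2) ^ n < \<epsilon> / (8 * (real (card D) + 1))"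
      using real_arch_pow_inv[of "\<epsilon> / (8 * (real (card D) + 1))" "1 / 2"] eps by auto
    define In where "In = (\<lambda>(a, b) k. a \<le> X n k \<and> X n (Suc k) \<le> b)"
    have one: "h b - h a \<le> T * (b - a) + (\<Sum>k<2 ^ n. if In (a, b) k then w n k else 0) + 2 / 2 ^ n"
      if ab: "0 \<le> a" "a \<le> b" "b \<le> 1" for a b
    proof -
      obtain i where i: "Suc i \<le> 2 ^ n" "X n i \<le> a" "a \<le> X n (Suc i)" using cell_exists'[of a n] ab by auto
      obtain j where j: "Suc j \<le> 2 ^ n" "X n j \<le> b" "b \<le> X n (Suc j)" using cell_exists'[of b n] ab by auto
      have ha: "real i / 2 ^ n \<le> h a" using h_between[OF i(2,3,1)] by simp
      have hb: "h b \<le> real (Suc j) / 2 ^ n" using h_between[OF j(2,3,1)] by simp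
      have pos: "0 \<le> T * (b - a)" "0 \<le> (\<Sum>k<2 ^ n. if In (a, b) k then w n k else 0)"
        using that T w0 by (auto intro!: sum_nonneg)
      show ?thesis
      proof (cases "Suc i \<le> j")
        case False
        then have "real (Suc j) / 2 ^ n \<le> (real i + 1) / 2 ^ n" by (intro divide_right_mono) auto
        then have "h b - h a \<le> 1 / 2 ^ n" using ha hb by (simp add: add_divide_distrib)
        also have "\<dots> \<le> 2 / 2 ^ n" by (intro divide_right_mono) auto
        finally show ?thesis using pos by linarith
      next
        case True
        have "real (j - Suc i) / 2 ^ n = (\<Sum>k\<in>{Suc i..<j}. 1 / 2 ^ n)" by simp
        also have "\<dots> \<le> (\<Sum>k\<in>{Suc i..<j}. T * (X n (Suc k) - X n k) + (if In (a, b) k then w n k else 0))"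
        proof (rule sum_mono)
          fix k assume k: "k \<in> {Suc i..<j}"
          then have "In (a, b) k"
            using X_le[of "Suc i" k n] X_le[of "Suc k" j n] i j by (auto simp: In_def)
          moreover have "0 \<le> T * len n k" using T len_pos[of n k] by simp
          ultimately show "1 / 2 ^ n \<le> T * (X n (Suc k) - X n k) + (if In (a, b) k then w n k else 0)"
            by (auto simp: w_def len_def[symmetric])
        qed
        also have "\<dots> = T * (\<Sum>k\<in>{Suc i..<j}. X n (Suc k) - X n k) + (\<Sum>k\<in>{Suc i..<j}. if In (a, b) k then w n k else 0)"
          by (simp add: sum.distrib sum_distrib_left)
        also have "(\<Sum>k\<in>{Suc i..<j}. X n (Suc k) - X n k) = X n j - X n (Suc i)"
          using True by (rule sum_Suc_diff')
        also have "T * (X n j - X n (Suc i)) + (\<Sum>k\<in>{Suc i..<j}. if In (a, b) k then w n k else 0)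
           \<le> T * (b - a) + (\<Sum>k<2 ^ n. if In (a, b) k then w n k else 0)"
          using T i j w0 by (intro add_mono mult_left_mono sum_mono2) auto
        finally have le: "real (j - Suc i) / 2 ^ n \<le> T * (b - a) + (\<Sum>k<2 ^ n. if In (a, b) k then w n k else 0)" .
        have "real (Suc j) = real (j - Suc i) + real i + 2" using True by simp
        then have "real (Suc j) / 2 ^ n = real (j - Suc i) / 2 ^ n + real i / 2 ^ n + 2 / 2 ^ n"
          by (simp only: add_divide_distrib)
        then show ?thesis using ha hb le by linarith
      qed
    qed
    have "(\<Sum>(a, b)\<in>D. \<bar>h b - h a\<bar>) \<le> (\<Sum>d\<in>D. T * (snd d - fst d) + (\<Sum>k<2 ^ n. if In d k then w n k else 0) + 2 / 2 ^ n)"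
    proof (rule sum_mono)
      fix d assume d: "d \<in> D"
      obtain a b where ab: "d = (a, b)" by (cases d)
      then show "(case d of (a, b) \<Rightarrow> \<bar>h b - h a\<bar>) \<le> T * (snd d - fst d) + (\<Sum>k<2 ^ n. if In d k then w n k else 0) + 2 / 2 ^ n"
        using one[of a b] Dab[of a b] h_mono[of a b] d by simp
    qed
    also have "\<dots> = T * (\<Sum>(a, b)\<in>D. b - a) + (\<Sum>d\<in>D. \<Sum>k<2 ^ n. if In d k then w n k else 0) + card D * (2 / 2 ^ n)"
      by (simp add: sum.distrib sum_distrib_left split_def)
    \<comment> \<open>Non-overlapping intervals cannot contain the same cell, so every steep cell is
      counted at most once.\<close>
    also have "(\<Sum>d\<in>D. \<Sum>k<2 ^ n. if In d k then w n k else 0) \<le> (\<Sum>k<2 ^ n. w n k)"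
    proof (subst sum.swap, rule sum_mono)
      fix k
      have "(\<Sum>d\<in>D. if In d k then w n k else 0) = (\<Sum>d\<in>{d \<in> D. In d k}. w n k)"
        by (rule sum.inter_filter[OF fin, symmetric])
      also have "\<dots> = real (card {d \<in> D. In d k}) * w n k" by simp
      also have "\<dots> \<le> 1 * w n k"
      proof (rule mult_right_mono)
        have "d = d'" if d: "d \<in> D" "In d k" "d' \<in> D" "In d' k" for d d'
        proof (rule ccontr)
          assume "d \<noteq> d'"
          then have "(\<lambda>(a, b) (c, d). {a<..<b} \<inter> {c<..<d} = {}) d d'"
            using pw d unfolding pairwise_def by blast
          moreover obtain y where "X n k < y" "y < X n (Suc k)" using dense[OF X_less] by blast
          ultimately show False using d by (auto simp: In_def split_def disjoint_iff)
        qed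
        then have "card {d \<in> D. In d k} \<le> 1" using fin by (intro card_le_Suc0_iff_eq[THEN iffD2, simplified One_nat_def[symmetric]]) auto
        then show "real (card {d \<in> D. In d k}) \<le> 1" by simp
      qed (rule w0)
      finally show "(\<Sum>d\<in>D. if In d k then w n k else 0) \<le> w n k" by simp
    qed
    also have "\<dots> \<le> \<epsilon> / 4" using wsum[of n] T0 by linarith
    also have "T * (\<Sum>(a, b)\<in>D. b - a) \<le> \<epsilon> / 4"
    proof -
      have "T * (\<Sum>(a, b)\<in>D. b - a) \<le> T * (\<epsilon> / (4 * T))" using small T by (intro mult_left_mono) auto
      then show ?thesis using T by simp
    qed
    also have "card D * (2 / 2 ^ n) \<le> \<epsilon> / 4"
    proof -
      have "real (card D) * (1 / 2) ^ n \<le> (real (card D) + 1) * (\<epsilon> / (8 * (real (card D) + 1)))"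
        using n by (intro mult_mono) auto
      also have "\<dots> = \<epsilon> / 8"
      proof -
        have "y * (\<epsilon> / (8 * y)) = \<epsilon> / 8" if "0 < y" for y using that by simp
        then show ?thesis by (simp only: of_nat_0_le_iff add_nonneg_pos zero_less_one)
      qed
      finally show ?thesis by (simp add: power_divide mult.commute)
    qed
    finally show "(\<Sum>(a, b)\<in>D. \<bar>h b - h a\<bar>) < \<epsilon>" using eps by simp
  qed
qed

end

section \<open>Differentiation of monotone functions\<close>

text \<open>Vitali covering inside an open set. The balls must contain the points of
  \<open>E\<close> but need not be centred at them; radii below half the size of a neighbourhood in
  \<open>U\<close> keep them inside \<open>U\<close>.\<close>

lemma vitali_measure_le:
  fixes E U :: "real set" and \<nu> :: "real measure" and q :: real
  assumes E: "E \<in> sets borel" and U: "open U" "E \<subseteq> U" and nu: "sets \<nu> = sets borel" and q: "0 \<le> q"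
    and small: "\<And>x d. x \<in> E \<Longrightarrow> 0 < d \<Longrightarrow> \<exists>a r. x \<in> ball a r \<and> r < d \<and> P a r"
  obtains C where "countable C" "disjoint_family_on (\<lambda>(a, r). ball a r) C"
    "\<And>a r. (a, r) \<in> C \<Longrightarrow> P a r" "\<Union>((\<lambda>(a, r). ball a r) ` C) \<subseteq> U"
    "emeasure lborel (E - \<Union>((\<lambda>(a, r). ball a r) ` C)) = 0"
proof -
  define K where "K = {(a, r). ball a r \<subseteq> U \<and> P a r}"
  have cov: "\<exists>i. i \<in> K \<and> x \<in> ball (fst i) (snd i) \<and> snd i < d" if x: "x \<in> E" and d: "0 < d" for x d
  proof -
    obtain e where e: "0 < e" "ball x e \<subseteq> U" using U x by (meson openE subsetD)
    obtain a r where ar: "x \<in> ball a r" "r < min d (e / 2)" "P a r"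
      using small[OF x, of "min d (e / 2)"] d e by auto
    have "ball a r \<subseteq> ball x e"
    proof
      fix y assume "y \<in> ball a r"
      then show "y \<in> ball x e"
        using ar dist_triangle_half_r[of a x e y] dist_triangle[of x y a] by (auto simp: dist_commute)
    qed
    then show ?thesis using ar e by (intro exI[of _ "(a, r)"]) (auto simp: K_def)
  qed
  obtain C where C: "countable C" "C \<subseteq> K"
    and disj: "pairwise (\<lambda>i j. disjnt (ball (fst i) (snd i)) (ball (fst j) (snd j))) C"
    and neg: "negligible (E - (\<Union>i\<in>C. ball (fst i) (snd i)))"
    using Vitali_covering_theorem_balls[of E K fst snd] cov by blast
  have eq: "(\<Union>i\<in>C. ball (fst i) (snd i)) = \<Union>((\<lambda>(a, r). ball a r) ` C)"
    by (auto simp: split_def)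
  have open_W: "open (\<Union>((\<lambda>(a, r). ball a r) ` C))" by (auto simp: split_def)
  show ?thesis
  proof (rule that[OF C(1)])
    show "disjoint_family_on (\<lambda>(a, r). ball a r) C"
      using disj by (auto simp: disjoint_family_on_def pairwise_def disjnt_def split_def)
    show "P a r" if "(a, r) \<in> C" for a r using C(2) that by (auto simp: K_def)
    show "\<Union>((\<lambda>(a, r). ball a r) ` C) \<subseteq> U" using C(2) by (auto simp: K_def)
    have "E - \<Union>((\<lambda>(a, r). ball a r) ` C) \<in> sets borel"
      by (rule sets.Diff[OF E borel_open[OF open_W]])
    then show "emeasure lborel (E - \<Union>((\<lambda>(a, r). ball a r) ` C)) = 0"
      using neg unfolding eq by (auto simp: negligible_iff_null_sets null_sets_completion_iff)
  qed
qed


lemma emeasure_UN_mono_scaled: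
  assumes C: "countable C" "disjoint_family_on X C" and M: "\<And>i. i \<in> C \<Longrightarrow> X i \<in> sets M" "\<And>i. i \<in> C \<Longrightarrow> X i \<in> sets M'"
    and le: "\<And>i. i \<in> C \<Longrightarrow> c * emeasure M (X i) \<le> d * emeasure M' (X i)"
  shows "c * emeasure M (\<Union>(X ` C)) \<le> d * emeasure M' (\<Union>(X ` C))"
proof -
  have "c * emeasure M (\<Union>(X ` C)) = (\<integral>\<^sup>+i. c * emeasure M (X i) \<partial>count_space C)"
    using C M by (subst emeasure_UN_countable) (auto simp: nn_integral_cmult)
  also have "\<dots> \<le> (\<integral>\<^sup>+i. d * emeasure M' (X i) \<partial>count_space C)"
    using le by (intro nn_integral_mono) auto
  also have "\<dots> = d * emeasure M' (\<Union>(X ` C))"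
    using C M by (subst emeasure_UN_countable) (auto simp: nn_integral_cmult)
  finally show ?thesis .
qed

text \<open>\<open>Hi\<close> and \<open>Lo\<close> stand for the upper and lower derivates over
  intervals containing the point. In this form they are countable intersections of open sets, hence
  Borel without any discussion of measurability of derivates.\<close>

definition Hi :: "(real \<Rightarrow> real) \<Rightarrow> real \<Rightarrow> real set" where
  "Hi F q = (\<Inter>n::nat. \<Union>{ball a r |a r. r < 1 / (real n + 1) \<and> q * (2 * r) < F (a + r) - F (a - r)})"

definition Lo :: "(real \<Rightarrow> real) \<Rightarrow> real \<Rightarrow> real set" where
  "Lo F p = (\<Inter>n::nat. \<Union>{ball a r |a r. r < 1 / (real n + 1) \<and> F (a + r) - F (a - r) < p * (2 * r)})"

context
  fixes F :: "real \<Rightarrow> real"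
  assumes F_mono: "\<And>x y. x \<le> y \<Longrightarrow> F x \<le> F y" and F_cont: "continuous_on UNIV F"
begin

lemma emeasure_F_ball:
  assumes "0 \<le> r"
  shows "emeasure (interval_measure F) (ball a r) = ennreal (F (a + r) - F (a - r))"
proof (cases "r = 0")
  case False
  then have r: "0 < r" using assms by simp
  have null: "{y} \<in> null_sets (interval_measure F)" for y
    using emeasure_interval_measure_Icc[OF order.refl F_mono F_cont, of y] by (intro null_setsI) auto
  have "{a - r..a + r} = ball a r \<union> ({a - r} \<union> {a + r})"
    using r by (auto simp: ball_eq_greaterThanLessThan)
  then have "emeasure (interval_measure F) {a - r..a + r} = emeasure (interval_measure F) (ball a r \<union> ({a - r} \<union> {a + r}))"
    by simp
  also have "\<dots> = emeasure (interval_measure F) (ball a r)"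
    by (intro emeasure_Un_null_set null_sets.Un null) auto
  finally show ?thesis
    using emeasure_interval_measure_Icc[OF _ F_mono F_cont, of "a - r" "a + r"] r by simp
qed simp

lemma emeasure_lborel_ball: "0 \<le> r \<Longrightarrow> emeasure lborel (ball a r) = ennreal (2 * r)" for a r :: real
  by (simp add: ball_eq_greaterThanLessThan)

text \<open>On each ball of a disjoint Vitali cover the measure of \<open>F\<close> is at least q
  times the length; the balls fill \<open>E\<close> up to a null set and stay in
  \<open>U\<close>.\<close>

lemma upper_derivative_measure_le:
  assumes E: "E \<in> sets borel" and U: "open U" "E \<subseteq> U" and q: "0 \<le> q"
    and big: "\<And>x d. x \<in> E \<Longrightarrow> 0 < d \<Longrightarrow> \<exists>a r. x \<in> ball a r \<and> r < d \<and> q * (2 * r) \<le> F (a + r) - F (a - r)"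
  shows "ennreal q * emeasure lborel E \<le> emeasure (interval_measure F) U"
proof -
  have big': "\<exists>a r. x \<in> ball a r \<and> r < d \<and> (0 \<le> r \<and> q * (2 * r) \<le> F (a + r) - F (a - r))" if "x \<in> E" "0 < d" for x d
  proof -
    obtain a r where ar: "x \<in> ball a r" "r < d" "q * (2 * r) \<le> F (a + r) - F (a - r)" using big[OF \<open>x \<in> E\<close> \<open>0 < d\<close>] by blast
    then have "0 \<le> r" using zero_le_dist[of a x] unfolding mem_ball by linarith
    then show ?thesis using ar by blast
  qed
  obtain C where C: "countable C" "disjoint_family_on (\<lambda>(a, r). ball a r) C"
    and P: "\<And>a r. (a, r) \<in> C \<Longrightarrow> 0 \<le> r \<and> q * (2 * r) \<le> F (a + r) - F (a - r)"
    and W: "\<Union>((\<lambda>(a, r). ball a r) ` C) \<subseteq> U" and null: "emeasure lborel (E - \<Union>((\<lambda>(a, r). ball a r) ` C)) = 0"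
    using vitali_measure_le[OF E U sets_interval_measure q big'] by metis
  let ?W = "\<Union>((\<lambda>(a, r). ball a r) ` C)"
  have Wo: "open ?W" by (auto simp: split_def)
  have "emeasure lborel E \<le> emeasure lborel (?W \<union> (E - ?W))"
    using E Wo by (intro emeasure_mono) (auto intro!: sets.Un sets.Diff)
  also have "\<dots> \<le> emeasure lborel ?W + emeasure lborel (E - ?W)"
    using E Wo by (intro emeasure_subadditive) (auto intro!: sets.Diff)
  also have "\<dots> = emeasure lborel ?W" by (simp add: null)
  finally have "ennreal q * emeasure lborel E \<le> ennreal q * emeasure lborel ?W"
    by (rule mult_left_mono) simp
  also have "\<dots> \<le> 1 * emeasure (interval_measure F) ?W"
  proof (rule emeasure_UN_mono_scaled[OF C])
    fix i assume i: "i \<in> C"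
    obtain a r where ar: "i = (a, r)" by (cases i)
    have "ennreal q * emeasure lborel (ball a r) = ennreal (q * (2 * r))"
      using P[of a r] i ar q by (simp add: emeasure_lborel_ball ennreal_mult)
    also have "\<dots> \<le> 1 * emeasure (interval_measure F) (ball a r)"
      using P[of a r] i ar by (simp add: emeasure_F_ball ennreal_leI)
    finally show "ennreal q * emeasure lborel (case i of (a, r) \<Rightarrow> ball a r) \<le> 1 * emeasure (interval_measure F) (case i of (a, r) \<Rightarrow> ball a r)"
      by (simp add: ar)
  qed (auto simp: split_def)
  also have "\<dots> \<le> emeasure (interval_measure F) U"
    using U W by (simp add: emeasure_mono)
  finally show ?thesis .
qed

text \<open>Two Vitali covers in succession: small quotients yield an open W inside U that covers
  almost all of E and has F-measure at most p |U|; large quotients inside W then give q |E| \<le> p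
  |U|. As U may be chosen with |U| close to |E|, p < q forces |E| = 0.\<close>

lemma derivative_gap_null:
  assumes E: "E \<in> sets borel" "E \<subseteq> ball 0 R" and pq: "0 \<le> p" "p < q"
    and lo: "\<And>x d. x \<in> E \<Longrightarrow> 0 < d \<Longrightarrow> \<exists>a r. x \<in> ball a r \<and> r < d \<and> F (a + r) - F (a - r) \<le> p * (2 * r)"
    and hi: "\<And>x d. x \<in> E \<Longrightarrow> 0 < d \<Longrightarrow> \<exists>a r. x \<in> ball a r \<and> r < d \<and> q * (2 * r) \<le> F (a + r) - F (a - r)"
  shows "emeasure lborel E = 0"
proof -
  have "emeasure lborel E \<le> emeasure lborel (ball 0 R :: real set)" using E by (intro emeasure_mono) auto
  also have "\<dots> < \<infinity>" by (rule emeasure_bounded_finite) (rule bounded_ball)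
  finally have fin: "emeasure lborel E < \<infinity>" .
  define e where "e = measure lborel E"
  have e: "emeasure lborel E = ennreal e" "0 \<le> e"
    using fin by (simp_all add: e_def emeasure_eq_ennreal_measure less_top)
  have main: "q * e \<le> p * e + p * d" if d: "0 < d" for d
  proof -
    have El: "E \<in> sets lebesgue" using E by auto
    obtain U where U: "open U" "E \<subseteq> U" "U - E \<in> lmeasurable" "emeasure lebesgue (U - E) < ennreal d"
      using sets_lebesgue_outer_open[OF El d] by blast
    have UE: "U - E \<in> sets borel" using U E by auto
    have "emeasure lborel U \<le> emeasure lborel (E \<union> (U - E))" using U E by (intro emeasure_mono) auto
    also have "\<dots> \<le> emeasure lborel E + emeasure lborel (U - E)"
      using E UE by (intro emeasure_subadditive) auto
    also have "\<dots> \<le> ennreal e + ennreal d"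
      using U(4) UE e by (intro add_mono) auto
    finally have lU: "emeasure lborel U \<le> ennreal (e + d)" using e d by (simp add: ennreal_plus)
    have lo': "\<exists>a r. x \<in> ball a r \<and> r < d \<and> (0 \<le> r \<and> F (a + r) - F (a - r) \<le> p * (2 * r))" if "x \<in> E" "0 < d" for x d
    proof -
      obtain a r where ar: "x \<in> ball a r" "r < d" "F (a + r) - F (a - r) \<le> p * (2 * r)" using lo[OF \<open>x \<in> E\<close> \<open>0 < d\<close>] by blast
      then have "0 \<le> r" using zero_le_dist[of a x] unfolding mem_ball by linarith
      then show ?thesis using ar by blast
    qed
    obtain C where C: "countable C" "disjoint_family_on (\<lambda>(a, r). ball a r) C"
      and P: "\<And>a r. (a, r) \<in> C \<Longrightarrow> 0 \<le> r \<and> F (a + r) - F (a - r) \<le> p * (2 * r)"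
      and W: "\<Union>((\<lambda>(a, r). ball a r) ` C) \<subseteq> U" and null: "emeasure lborel (E - \<Union>((\<lambda>(a, r). ball a r) ` C)) = 0"
      using vitali_measure_le[OF E(1) U(1,2) sets_interval_measure pq(1) lo'] by metis
    let ?W = "\<Union>((\<lambda>(a, r). ball a r) ` C)"
    have Wo: "open ?W" by (auto simp: split_def)
    have "emeasure lborel E \<le> emeasure lborel ((E \<inter> ?W) \<union> (E - ?W))"
      using E Wo by (intro emeasure_mono) (auto intro!: sets.Un sets.Diff sets.Int)
    also have "\<dots> \<le> emeasure lborel (E \<inter> ?W) + emeasure lborel (E - ?W)"
      using E Wo by (intro emeasure_subadditive) (auto intro!: sets.Diff sets.Int)
    also have "\<dots> = emeasure lborel (E \<inter> ?W)" by (simp add: null)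
    finally have "ennreal q * emeasure lborel E \<le> ennreal q * emeasure lborel (E \<inter> ?W)"
      by (rule mult_left_mono) simp
    also have "\<dots> \<le> emeasure (interval_measure F) ?W"
      by (rule upper_derivative_measure_le[OF _ Wo]) (use E Wo pq hi in \<open>auto intro!: sets.Int\<close>)
    also have "\<dots> = 1 * emeasure (interval_measure F) ?W" by simp
    also have "\<dots> \<le> ennreal p * emeasure lborel ?W"
    proof (rule emeasure_UN_mono_scaled[OF C])
      fix i assume i: "i \<in> C"
      obtain a r where ar: "i = (a, r)" by (cases i)
      have "1 * emeasure (interval_measure F) (ball a r) \<le> ennreal (p * (2 * r))"
        using P[of a r] i ar by (simp add: emeasure_F_ball ennreal_leI)
      also have "\<dots> = ennreal p * emeasure lborel (ball a r)"
        using P[of a r] i ar pq by (simp add: emeasure_lborel_ball ennreal_mult)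
      finally show "1 * emeasure (interval_measure F) (case i of (a, r) \<Rightarrow> ball a r) \<le> ennreal p * emeasure lborel (case i of (a, r) \<Rightarrow> ball a r)"
        by (simp add: ar)
    qed (auto simp: split_def)
    also have "\<dots> \<le> ennreal p * ennreal (e + d)"
      using U W by (intro mult_left_mono order.trans[OF _ lU] emeasure_mono) auto
    finally have "ennreal (q * e) \<le> ennreal (p * (e + d))"
      using e pq d by (simp add: ennreal_mult)
    then have "q * e \<le> p * (e + d)" using e pq d by (subst (asm) ennreal_le_iff) auto
    then show ?thesis by (simp add: distrib_left)
  qed
  have "q * e \<le> p * e + d" if d: "0 < d" for d
  proof -
    have "p * (d / (p + 1)) \<le> d" using pq d by (simp add: field_simps)
    then show ?thesis using main[of "d / (p + 1)"] pq d by simp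
  qed
  then have "q * e \<le> p * e" by (rule field_le_epsilon)
  then have "e = 0" using pq e by (simp add: mult_le_cancel_right)
  then show ?thesis using e by simp
qed

lemma Hi_Lo_borel [measurable]: "Hi F q \<in> sets borel" "Lo F p \<in> sets borel"
  unfolding Hi_def Lo_def by (intro sets.countable_INT'' borel_open open_Union; auto)+

lemma Hi_D: "x \<in> Hi F q \<Longrightarrow> 0 < d \<Longrightarrow> \<exists>a r. x \<in> ball a r \<and> r < d \<and> q * (2 * r) \<le> F (a + r) - F (a - r)"
proof -
  assume x: "x \<in> Hi F q" and d: "0 < d"
  obtain n where n: "1 / (real n + 1) < d" using reals_Archimedean[OF d] by (auto simp: inverse_eq_divide add.commute)
  from x obtain a r where "x \<in> ball a r" "r < 1 / (real n + 1)" "q * (2 * r) < F (a + r) - F (a - r)"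
    unfolding Hi_def by blast
  then show ?thesis using n by (intro exI[of _ a] exI[of _ r]) auto
qed

lemma Lo_D: "x \<in> Lo F p \<Longrightarrow> 0 < d \<Longrightarrow> \<exists>a r. x \<in> ball a r \<and> r < d \<and> F (a + r) - F (a - r) \<le> p * (2 * r)"
proof -
  assume x: "x \<in> Lo F p" and d: "0 < d"
  obtain n where n: "1 / (real n + 1) < d" using reals_Archimedean[OF d] by (auto simp: inverse_eq_divide add.commute)
  from x obtain a r where "x \<in> ball a r" "r < 1 / (real n + 1)" "F (a + r) - F (a - r) < p * (2 * r)"
    unfolding Lo_def by blast
  then show ?thesis using n by (intro exI[of _ a] exI[of _ r]) auto
qed

lemma Hi_antimono: "q \<le> q' \<Longrightarrow> Hi F q' \<subseteq> Hi F q"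
proof
  fix x assume q: "q \<le> q'" and x: "x \<in> Hi F q'"
  show "x \<in> Hi F q"
    unfolding Hi_def
  proof (rule INT_I)
    fix n :: nat
    from x obtain a r where ar: "x \<in> ball a r" "r < 1 / (real n + 1)" "q' * (2 * r) < F (a + r) - F (a - r)"
      unfolding Hi_def by blast
    then have "0 \<le> r" using zero_le_dist[of a x] unfolding mem_ball by linarith
    then have "q * (2 * r) \<le> q' * (2 * r)" using q by (intro mult_right_mono) auto
    then have "q * (2 * r) < F (a + r) - F (a - r)" using ar(3) by (rule le_less_trans)
    then show "x \<in> \<Union>{ball a r |a r. r < 1 / (real n + 1) \<and> q * (2 * r) < F (a + r) - F (a - r)}"
      using ar(2) by (intro UnionI[OF _ ar(1)]) blast
  qed
qed

lemma AE_not_gap: "0 \<le> p \<Longrightarrow> p < q \<Longrightarrow> AE x in lborel. \<not> (x \<in> Lo F p \<and> x \<in> Hi F q)"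
proof -
  assume pq: "0 \<le> p" "p < q"
  have "emeasure lborel (Lo F p \<inter> Hi F q \<inter> ball 0 (real R)) = 0" for R
    by (rule derivative_gap_null[OF _ _ pq]) (use Lo_D Hi_D in auto)
  then have "AE x in lborel. x \<notin> Lo F p \<inter> Hi F q \<inter> ball 0 (real R)" for R :: nat
    by (intro AE_not_in null_setsI) auto
  then have "AE x in lborel. \<forall>R. x \<notin> Lo F p \<inter> Hi F q \<inter> ball 0 (real R)"
    unfolding AE_all_countable by blast
  then show ?thesis
  proof (eventually_elim)
    case (elim x)
    obtain R :: nat where "\<bar>x\<bar> < real R" using reals_Archimedean2 by blast
    then show ?case using elim by (auto simp: dist_real_def)
  qed
qed

text \<open>On a bounded part E of the exceptional set, n |E| is at most the increase of
  \<open>F\<close> over a fixed interval, for every n.\<close>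

lemma AE_not_infinite: "AE x in lborel. \<exists>n::nat. x \<notin> Hi F (real n)"
proof -
  have "emeasure lborel ((\<Inter>n::nat. Hi F (real n)) \<inter> ball 0 (real R)) = 0" for R :: nat
  proof -
    let ?E = "(\<Inter>n::nat. Hi F (real n)) \<inter> ball 0 (real R)"
    have E: "?E \<in> sets borel" by measurable
    have "emeasure lborel ?E \<le> emeasure lborel (ball 0 (real R) :: real set)" by (intro emeasure_mono) auto
    also have "\<dots> < \<infinity>" by (simp add: emeasure_lborel_ball)
    finally have fin: "emeasure lborel ?E = ennreal (measure lborel ?E)"
      by (simp add: emeasure_eq_ennreal_measure less_top)
    have "real n * measure lborel ?E \<le> F (real R) - F (- real R)" for n :: nat
    proof -
      have "ennreal (real n) * emeasure lborel ?E \<le> emeasure (interval_measure F) (ball 0 (real R))"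
        by (rule upper_derivative_measure_le[OF E]) (use Hi_D in auto)
      then have "ennreal (real n * measure lborel ?E) \<le> ennreal (F (real R) - F (- real R))"
        using fin emeasure_F_ball[of "real R" 0] by (simp add: ennreal_mult)
      then show ?thesis using F_mono[of "- real R" "real R"] by (subst (asm) ennreal_le_iff) auto
    qed
    then have "\<not> 0 < measure lborel ?E"
      using reals_Archimedean3[of "measure lborel ?E"] by (metis not_less)
    then have "measure lborel ?E = 0" using measure_nonneg[of lborel ?E] by linarith
    then show ?thesis using fin by simp
  qed
  then have "AE x in lborel. x \<notin> (\<Inter>n::nat. Hi F (real n)) \<inter> ball 0 (real R)" for R :: nat
    by (intro AE_not_in null_setsI) auto
  then have "AE x in lborel. \<forall>R::nat. x \<notin> (\<Inter>n::nat. Hi F (real n)) \<inter> ball 0 (real R)"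
    unfolding AE_all_countable by blast
  then show ?thesis
  proof (eventually_elim)
    case (elim x)
    obtain R :: nat where "\<bar>x\<bar> < real R" using reals_Archimedean2 by blast
    then show ?case using elim by (auto simp: dist_real_def)
  qed
qed

end

text \<open>The intervals are only required to contain \<open>x\<close>, as do the cells of the grids around \<open>x\<close>;
  \<open>x\<close> need not be an end point.\<close>

definition interval_deriv :: "(real \<Rightarrow> real) \<Rightarrow> real \<Rightarrow> real \<Rightarrow> bool" where
  "interval_deriv F x L \<longleftrightarrow> (\<forall>\<epsilon>>0. \<exists>\<delta>>0. \<forall>a b. a < x \<longrightarrow> x < b \<longrightarrow> b - a < \<delta> \<longrightarrow>
     \<bar>(F b - F a) - L * (b - a)\<bar> \<le> \<epsilon> * (b - a))"

text \<open>The candidate is the supremum L of all q with x in \<open>Hi F q\<close>, which bounds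
  the quotients from above. From below, a rational p < L leaves room for a rational q between p and
  L, and then x cannot lie in \<open>Lo F p\<close>. Rational pairs suffice, so only countably many
  null sets are removed.\<close>

lemma AE_interval_deriv:
  assumes F: "\<And>x y. x \<le> y \<Longrightarrow> F x \<le> F y" "continuous_on UNIV F"
  shows "AE x in lborel. \<exists>L. interval_deriv F x L"
proof -
  have "AE x in lborel. \<forall>p\<in>\<rat>. \<forall>q\<in>\<rat>. 0 \<le> p \<and> p < q \<longrightarrow> \<not> (x \<in> Lo F p \<and> x \<in> Hi F q)"
    by (intro AE_ball_countable[THEN iffD2] ballI countable_rat AE_impI) (use AE_not_gap[OF F] in auto)
  moreover have "AE x in lborel. \<exists>n::nat. x \<notin> Hi F (real n)" by (rule AE_not_infinite[OF F])
  ultimately show ?thesis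
  proof eventually_elim
    case (elim x)
    define S where "S = {q. x \<in> Hi F q}"
    have down: "q \<in> S" if "q' \<in> S" "q \<le> q'" for q q' using Hi_antimono[OF F, of q q'] that by (auto simp: S_def)
    obtain n0 :: nat where n0: "real n0 \<notin> S" using elim by (auto simp: S_def)
    have bdd: "bdd_above S" using n0 down by (intro bdd_aboveI[of _ "real n0"]) (metis le_cases)
    have neg: "q \<in> S" if "q < 0" for q
      unfolding S_def Hi_def mem_Collect_eq
    proof (rule INT_I)
      fix n :: nat
      define r where "r = 1 / (2 * (real n + 1))"
      have r: "0 < r" "r < 1 / (real n + 1)" by (simp_all add: r_def field_simps)
      have "q * (2 * r) < F (x + r) - F (x - r)"
        using mult_neg_pos[OF that, of "2 * r"] r F(1)[of "x - r" "x + r"] by linarith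
      then show "x \<in> \<Union>{ball a r |a r. r < 1 / (real n + 1) \<and> q * (2 * r) < F (a + r) - F (a - r)}"
        using r by (intro UnionI[of "ball x r"]) auto
    qed
    have ne: "S \<noteq> {}" using neg[of "-1"] by auto
    define L where "L = Sup S"
    have L0: "0 \<le> L"
    proof (rule field_le_epsilon)
      fix e :: real assume "0 < e"
      then have "- e \<in> S" by (intro neg) simp
      then show "0 \<le> L + e" using cSup_upper[OF _ bdd, of "- e"] by (simp add: L_def)
    qed
    have ball: "\<exists>c r. a = c - r \<and> b = c + r \<and> x \<in> ball c r \<and> 2 * r = b - a \<and> r < \<delta>"
      if "a < x" "x < b" "b - a < \<delta>" for a b \<delta>
      using that by (intro exI[of _ "(a + b) / 2"] exI[of _ "(b - a) / 2"]) (auto simp: dist_real_def field_simps abs_less_iff)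
    have "interval_deriv F x L"
      unfolding interval_deriv_def
    proof (intro allI impI)
      fix \<epsilon> :: real assume e: "0 < \<epsilon>"
      have "L + \<epsilon> \<notin> S" using cSup_upper[OF _ bdd, of "L + \<epsilon>"] e by (auto simp: L_def)
      then obtain n1 where n1: "x \<notin> \<Union>{ball a r |a r. r < 1 / (real n1 + 1) \<and> (L + \<epsilon>) * (2 * r) < F (a + r) - F (a - r)}"
        unfolding S_def Hi_def by auto
      have up: "F b - F a \<le> (L + \<epsilon>) * (b - a)" if ab: "a < x" "x < b" "b - a < 1 / (real n1 + 1)" for a b
      proof (rule ccontr)
        assume c: "\<not> ?thesis"
        obtain y r where yr: "a = y - r" "b = y + r" "x \<in> ball y r" "2 * r = b - a" "r < 1 / (real n1 + 1)" using ball[OF ab] by blast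
        have "x \<in> \<Union>{ball a r |a r. r < 1 / (real n1 + 1) \<and> (L + \<epsilon>) * (2 * r) < F (a + r) - F (a - r)}"
        proof (rule UnionI[OF _ yr(3)])
          have "(L + \<epsilon>) * (2 * r) < F (y + r) - F (y - r)"
            using c unfolding yr(1,2)[symmetric] yr(4) by simp
          then show "ball y r \<in> {ball a r |a r. r < 1 / (real n1 + 1) \<and> (L + \<epsilon>) * (2 * r) < F (a + r) - F (a - r)}"
            using yr(5) by blast
        qed
        then show False using n1 by blast
      qed
      have "\<exists>\<delta>>0. \<forall>a b. a < x \<longrightarrow> x < b \<longrightarrow> b - a < \<delta> \<longrightarrow> (L - \<epsilon>) * (b - a) \<le> F b - F a"
      proof (cases "L - \<epsilon> < 0")
        \<comment> \<open>A negative lower bound is free for a monotone function;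
          \<open>AE_not_gap\<close> covers p \<ge> 0.\<close>
        case True
        show ?thesis
        proof (intro exI[of _ 1] conjI allI impI)
          fix a b assume ab: "a < x" "x < b"
          have "(L - \<epsilon>) * (b - a) \<le> 0" using True ab by (intro mult_nonpos_nonneg) auto
          then show "(L - \<epsilon>) * (b - a) \<le> F b - F a" using F(1)[of a b] ab by simp
        qed simp
      next
        case False
        obtain p where p: "p \<in> \<rat>" "L - \<epsilon> < p" "p < L" using Rats_dense_in_real[of "L - \<epsilon>" L] e by auto
        obtain q where q: "q \<in> \<rat>" "p < q" "q < L" using Rats_dense_in_real[OF p(3)] by auto
        obtain s where "s \<in> S" "q < s" using q(3) less_cSup_iff[OF ne bdd] by (auto simp: L_def)
        then have "x \<in> Hi F q" using down[of s q] by (simp add: S_def)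
        then have "x \<notin> Lo F p" using elim p q False by auto
        then obtain n2 where n2: "x \<notin> \<Union>{ball a r |a r. r < 1 / (real n2 + 1) \<and> F (a + r) - F (a - r) < p * (2 * r)}"
          unfolding Lo_def by auto
        show ?thesis
        proof (intro exI[of _ "1 / (real n2 + 1)"] conjI allI impI)
          fix a b assume ab: "a < x" "x < b" "b - a < 1 / (real n2 + 1)"
          have "p * (b - a) \<le> F b - F a"
          proof (rule ccontr)
            assume c: "\<not> ?thesis"
            obtain y r where yr: "a = y - r" "b = y + r" "x \<in> ball y r" "2 * r = b - a" "r < 1 / (real n2 + 1)" using ball[OF ab] by blast
            have "x \<in> \<Union>{ball a r |a r. r < 1 / (real n2 + 1) \<and> F (a + r) - F (a - r) < p * (2 * r)}"
            proof (rule UnionI[OF _ yr(3)])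
              have "F (y + r) - F (y - r) < p * (2 * r)"
                using c unfolding yr(1,2)[symmetric] yr(4) by simp
              then show "ball y r \<in> {ball a r |a r. r < 1 / (real n2 + 1) \<and> F (a + r) - F (a - r) < p * (2 * r)}"
                using yr(5) by blast
            qed
            then show False using n2 by blast
          qed
          moreover have "(L - \<epsilon>) * (b - a) \<le> p * (b - a)" using p ab by (intro mult_right_mono) auto
          ultimately show "(L - \<epsilon>) * (b - a) \<le> F b - F a" by linarith
        qed simp
      qed
      then obtain \<delta>2 where d2: "0 < \<delta>2" "\<And>a b. a < x \<Longrightarrow> x < b \<Longrightarrow> b - a < \<delta>2 \<Longrightarrow> (L - \<epsilon>) * (b - a) \<le> F b - F a" by blast
      show "\<exists>\<delta>>0. \<forall>a b. a < x \<longrightarrow> x < b \<longrightarrow> b - a < \<delta> \<longrightarrow> \<bar>(F b - F a) - L * (b - a)\<bar> \<le> \<epsilon> * (b - a)"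
      proof (intro exI[of _ "min \<delta>2 (1 / (real n1 + 1))"] conjI allI impI)
        fix a b assume ab: "a < x" "x < b" "b - a < min \<delta>2 (1 / (real n1 + 1))"
        have u: "F b - F a \<le> (L + \<epsilon>) * (b - a)" using up[of a b] ab by simp
        have l: "(L - \<epsilon>) * (b - a) \<le> F b - F a" using d2(2)[of a b] ab by simp
        have "\<bar>w - L * t\<bar> \<le> \<epsilon> * t" if "w \<le> (L + \<epsilon>) * t" "(L - \<epsilon>) * t \<le> w" for w t
          using that by (simp add: abs_le_iff algebra_simps)
        from this[OF u l] show "\<bar>(F b - F a) - L * (b - a)\<bar> \<le> \<epsilon> * (b - a)" .
      qed (use d2 in simp)
    qed
    then show ?case by blast
  qed
qed

lemma interval_deriv_imp_derivative:
  assumes F: "continuous_on UNIV F" and d: "interval_deriv F x L"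
  shows "(F has_real_derivative L) (at x)"
proof -
  have cont: "(F \<longlongrightarrow> F y) (at y within S)" for y S
    using F by (metis UNIV_I continuous_on_def tendsto_within_subset subset_UNIV)
  have "((\<lambda>y. (F y - F x) / (y - x)) \<longlongrightarrow> L) (at x)"
    unfolding Lim_at
  proof (intro allI impI)
    fix e :: real assume e: "0 < e"
    then obtain \<delta> where \<delta>: "0 < \<delta>" "\<And>a b. a < x \<Longrightarrow> x < b \<Longrightarrow> b - a < \<delta> \<Longrightarrow> \<bar>(F b - F a) - L * (b - a)\<bar> \<le> e / 2 * (b - a)"
      using d unfolding interval_deriv_def by (meson half_gt_zero)
    have main: "\<bar>(F b - F a) - L * (b - a)\<bar> \<le> e / 2 * (b - a)" if "a \<le> x" "x \<le> b" "a < b" "b - a < \<delta>" for a b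
    proof -
      \<comment> \<open>The hypothesis speaks of intervals with x in the interior. Widening [a, b]
        by 1 / (n + 1) on both sides and using continuity extends it to intervals with end point
        x.\<close>
      define A where "A = (\<lambda>n::nat. a - 1 / (real n + 1))"
      define B where "B = (\<lambda>n::nat. b + 1 / (real n + 1))"
      have z: "(\<lambda>n::nat. 1 / (real n + 1)) \<longlonglongrightarrow> 0"
        using LIMSEQ_inverse_real_of_nat by (simp add: inverse_eq_divide add.commute)
      have A: "A \<longlonglongrightarrow> a" and B: "B \<longlonglongrightarrow> b"
        unfolding A_def B_def using tendsto_diff[OF tendsto_const z, of a] tendsto_add[OF tendsto_const z, of b] by auto
      have c: "isCont F y" for y using F by (simp add: continuous_on_eq_continuous_at)
      have FA: "(\<lambda>n. F (A n)) \<longlonglongrightarrow> F a" and FB: "(\<lambda>n. F (B n)) \<longlonglongrightarrow> F b"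
        using isCont_tendsto_compose[OF c A] isCont_tendsto_compose[OF c B] by auto
      have l1: "(\<lambda>n. \<bar>(F (B n) - F (A n)) - L * (B n - A n)\<bar>) \<longlonglongrightarrow> \<bar>(F b - F a) - L * (b - a)\<bar>"
        by (intro tendsto_intros A B FA FB)
      have l2: "(\<lambda>n. e / 2 * (B n - A n)) \<longlonglongrightarrow> e / 2 * (b - a)"
        by (intro tendsto_intros A B)
      have "eventually (\<lambda>n. B n - A n < \<delta>) sequentially"
        using tendsto_diff[OF B A] that(4) by (rule order_tendstoD)
      then have "eventually (\<lambda>n. \<bar>(F (B n) - F (A n)) - L * (B n - A n)\<bar> \<le> e / 2 * (B n - A n)) sequentially"
      proof eventually_elim
        case (elim n)
        have "0 < 1 / (real n + 1)" by simp
        then have "A n < x" "x < B n" using that unfolding A_def B_def by linarith+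
        then show ?case using \<delta>(2) elim by blast
      qed
      then show ?thesis by (rule tendsto_le[OF sequentially_bot l2 l1])
    qed
    show "\<exists>d>0. \<forall>y. 0 < dist y x \<and> dist y x < d \<longrightarrow> dist ((F y - F x) / (y - x)) L < e"
    proof (intro exI[of _ \<delta>] conjI allI impI)
      fix y assume y: "0 < dist y x \<and> dist y x < \<delta>"
      have "\<bar>(F y - F x) - L * (y - x)\<bar> \<le> e / 2 * \<bar>y - x\<bar>"
      proof (cases "x < y")
        case True
        then show ?thesis using main[of x y] y by (simp add: dist_real_def)
      next
        case False
        then have "y < x" using y by (auto simp: dist_real_def)
        then show ?thesis using main[of y x] y by (simp add: dist_real_def abs_minus_commute algebra_simps)
      qed
      moreover have "(F y - F x) / (y - x) - L = ((F y - F x) - L * (y - x)) / (y - x)"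
        using y by (auto simp: field_simps dist_real_def)
      ultimately have "\<bar>(F y - F x) / (y - x) - L\<bar> \<le> e / 2"
        using y by (simp add: dist_real_def field_simps)
      then show "dist ((F y - F x) / (y - x)) L < e" using e by (simp add: dist_real_def)
    qed (rule \<delta>)
  qed
  then show ?thesis by (simp add: has_field_derivative_iff)
qed

section \<open>The Dirichlet kernel\<close>

definition dirichlet :: "nat \<Rightarrow> real \<Rightarrow> complex" where
  "dirichlet r t = (\<Sum>k\<in>{- int r..int r}. ee (of_int k * t))"

lemma dirichlet_Suc: "dirichlet (Suc r) t = dirichlet r t + ee ((real r + 1) * t) + ee (- ((real r + 1) * t))"
proof -
  have "{- int (Suc r)..int (Suc r)} = insert (int r + 1) (insert (- int r - 1) {- int r..int r})" by auto
  then have "dirichlet (Suc r) t = ee (of_int (int r + 1) * t) + (ee (of_int (- int r - 1) * t) + dirichlet r t)"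
    by (simp only: dirichlet_def) simp
  moreover have "of_int (int r + 1) * t = (real r + 1) * t" "of_int (- int r - 1) * t = - ((real r + 1) * t)"
    by (simp_all add: algebra_simps)
  ultimately show ?thesis by (simp only: add.assoc add.commute add.left_commute)
qed

lemma norm_dirichlet_le: "norm (dirichlet r t) \<le> 2 * (real r + 1 / 2)"
proof -
  have "norm (dirichlet r t) \<le> (\<Sum>k\<in>{- int r..int r}. 1)"
    unfolding dirichlet_def by (intro order.trans[OF norm_sum] sum_mono) simp
  then show ?thesis by simp
qed

lemma ee_diff_sin: "ee (t / 2) - ee (- (t / 2)) = 2 * \<i> * of_real (sin (pi * t))"
  by (simp add: ee_def complex_eq_iff)

text \<open>Multiplication by the sine makes the exponential sum telescope; each induction step
  extends it at both ends. The half-integer frequency r + 1/2 reappears as l in the cell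
  estimates.\<close>

lemma dirichlet_sin:
  "dirichlet r t * (2 * \<i> * of_real (sin (pi * t))) = ee ((real r + 1 / 2) * t) - ee (- ((real r + 1 / 2) * t))"
proof (induction r)
  case 0
  then show ?case using ee_diff_sin[of t] by (simp add: dirichlet_def mult.commute)
next
  case (Suc r)
  have 1: "ee ((real r + 1) * t) * (ee (t / 2) - ee (- (t / 2))) = ee ((real (Suc r) + 1 / 2) * t) - ee ((real r + 1 / 2) * t)"
  proof -
    have "(real r + 1) * t + t / 2 = (real (Suc r) + 1 / 2) * t" "(real r + 1) * t + - (t / 2) = (real r + 1 / 2) * t"
      by (simp_all add: field_simps)
    then show ?thesis unfolding right_diff_distrib ee_add[symmetric] by simp
  qed
  have 2: "ee (- ((real r + 1) * t)) * (ee (t / 2) - ee (- (t / 2))) = ee (- ((real r + 1 / 2) * t)) - ee (- ((real (Suc r) + 1 / 2) * t))"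
  proof -
    have "- ((real r + 1) * t) + t / 2 = - ((real r + 1 / 2) * t)" "- ((real r + 1) * t) + - (t / 2) = - ((real (Suc r) + 1 / 2) * t)"
      by (simp_all add: field_simps)
    then show ?thesis unfolding right_diff_distrib ee_add[symmetric] by simp
  qed
  have gen: "(d + a + b) * s = p - q'" if "d * s = u - v" "a * s = p - u" "b * s = v - q'" for a b d s p q' u v :: complex
    using that by (simp add: distrib_right)
  show ?case
    unfolding dirichlet_Suc by (rule gen[OF Suc 1[unfolded ee_diff_sin] 2[unfolded ee_diff_sin]])
qed

lemma continuous_on_dirichlet [continuous_intros]:
  "continuous_on S f \<Longrightarrow> continuous_on S (\<lambda>x. dirichlet r (f x))"
  unfolding dirichlet_def by (intro continuous_intros)

text \<open>On [-1, 1] the left side is the distance to the nearest integer; the reflection u to 1 -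
  u carries the bound near 0 to the neighbourhoods of 1 and -1.\<close>

lemma abs_sin_pi_ge:
  assumes "\<bar>t\<bar> \<le> 1" shows "min \<bar>t\<bar> (1 - \<bar>t\<bar>) \<le> \<bar>sin (pi * t)\<bar>"
proof -
  have base: "u \<le> sin (pi * u)" if "0 \<le> u" "u \<le> 1 / 2" for u
  proof -
    have "pi * u / 3 \<le> sin (pi * u)"
      using that mult_left_mono[of u "1/2" pi] by (intro sin_ge_third) auto
    moreover have "3 * u \<le> pi * u" using that pi_gt3 by (intro mult_right_mono) auto
    ultimately show ?thesis by linarith
  qed
  have abs: "\<bar>sin (pi * t)\<bar> = \<bar>sin (pi * \<bar>t\<bar>)\<bar>"
    by (cases "0 \<le> t") auto
  show ?thesis
  proof (cases "\<bar>t\<bar> \<le> 1 / 2")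
    case True
    then show ?thesis using base[of "\<bar>t\<bar>"] abs by linarith
  next
    case False
    have "sin (pi * (1 - \<bar>t\<bar>)) = sin (pi * \<bar>t\<bar>)"
      by (simp add: right_diff_distrib sin_diff)
    then show ?thesis using base[of "1 - \<bar>t\<bar>"] False assms abs by linarith
  qed
qed

lemma sin_pi_lipschitz: "\<bar>sin (pi * x) - sin (pi * y)\<bar> \<le> pi * \<bar>x - y\<bar>"
proof -
  have "\<bar>sin (pi * x) - sin (pi * y)\<bar> = 2 * \<bar>sin ((pi * x - pi * y) / 2)\<bar> * \<bar>cos ((pi * x + pi * y) / 2)\<bar>"
    by (simp add: sin_diff_sin abs_mult)
  also have "\<dots> \<le> 2 * \<bar>(pi * x - pi * y) / 2\<bar> * 1"
    by (intro mult_mono abs_sin_x_le_abs_x) auto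
  also have "\<dots> = pi * \<bar>x - y\<bar>"
    by (simp add: abs_mult flip: right_diff_distrib)
  finally show ?thesis .
qed

section \<open>An integrable majorant for the cells\<close>

lemma integral_kernel_right:
  fixes l c a p q :: real
  assumes l: "0 < l" and c: "0 < c" and ab: "a \<le> p" "p \<le> q"
  shows "integral {p..q} (\<lambda>y. l * (1 + l * \<bar>y - a\<bar>) powr (- 1 - c)) \<le> 1 / c"
proof -
  let ?A = "\<lambda>y. - (1 / c) * (1 + l * (y - a)) powr (- c)"
  have pos: "0 < 1 + l * (y - a)" if "y \<in> {p..q}" for y
    by (rule add_pos_nonneg[OF zero_less_one mult_nonneg_nonneg]) (use that ab l in auto)
  have "((\<lambda>y. l * (1 + l * (y - a)) powr (- 1 - c)) has_integral (?A q - ?A p)) {p..q}"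
  proof (rule fundamental_theorem_of_calculus[OF ab(2)])
    fix y assume y: "y \<in> {p..q}"
    show "(?A has_vector_derivative l * (1 + l * (y - a)) powr (- 1 - c)) (at y within {p..q})"
      unfolding has_real_derivative_iff_has_vector_derivative[symmetric]
      using pos[OF y] c by (auto intro!: derivative_eq_intros simp: powr_diff powr_minus_divide)
  qed
  then have "((\<lambda>y. l * (1 + l * \<bar>y - a\<bar>) powr (- 1 - c)) has_integral (?A q - ?A p)) {p..q}"
    by (rule has_integral_eq[rotated]) (use ab in auto)
  then have "integral {p..q} (\<lambda>y. l * (1 + l * \<bar>y - a\<bar>) powr (- 1 - c)) = ?A q - ?A p"
    by (rule integral_unique)
  also have "\<dots> = (1 / c) * (1 + l * (p - a)) powr (- c) - (1 / c) * (1 + l * (q - a)) powr (- c)" by simp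
  also have "\<dots> \<le> (1 / c) * 1 - 0"
  proof (intro diff_mono mult_left_mono)
    show "(1 + l * (p - a)) powr - c \<le> 1"
      using powr_mono2'[of "- c" 1 "1 + l * (p - a)"] ab l c by simp
  qed (use c in auto)
  finally show ?thesis by simp
qed

lemma integral_kernel_left:
  fixes l c a p q :: real
  assumes l: "0 < l" and c: "0 < c" and ab: "q \<le> a" "p \<le> q"
  shows "integral {p..q} (\<lambda>y. l * (1 + l * \<bar>y - a\<bar>) powr (- 1 - c)) \<le> 1 / c"
proof -
  have "integral {p..q} (\<lambda>y. l * (1 + l * \<bar>y - a\<bar>) powr (- 1 - c))
     = integral {- q..- p} (\<lambda>y. l * (1 + l * \<bar>- y - a\<bar>) powr (- 1 - c))"
    using Henstock_Kurzweil_Integration.integral_reflect_real[of q p "\<lambda>y. l * (1 + l * \<bar>y - a\<bar>) powr (- 1 - c)"] by (rule sym)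
  also have "(\<lambda>y. l * (1 + l * \<bar>- y - a\<bar>) powr (- 1 - c)) = (\<lambda>y. l * (1 + l * \<bar>y - (- a)\<bar>) powr (- 1 - c))"
    by (intro ext) (metis abs_minus_cancel minus_diff_eq uminus_add_conv_diff diff_minus_eq_add add.commute)
  also have "integral {- q..- p} \<dots> \<le> 1 / c"
    using ab by (intro integral_kernel_right l c) auto
  finally show ?thesis .
qed

lemma continuous_on_kernel [continuous_intros]:
  fixes f :: "'a::topological_space \<Rightarrow> real" and l c :: real
  assumes "continuous_on S f" "0 < l" "\<And>y. y \<in> S \<Longrightarrow> 0 \<le> f y"
  shows "continuous_on S (\<lambda>y. l * (1 + l * f y) powr c)"
proof -
  have "1 + l * f y \<noteq> 0" if "y \<in> S" for y
    using add_pos_nonneg[OF zero_less_one mult_nonneg_nonneg[OF less_imp_le[OF assms(2)] assms(3)[OF that]]] by simp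
  then show ?thesis using assms(1) by (intro continuous_intros) auto
qed

text \<open>The sine is small only near y = x, x + 1 and x - 1, so three translates of an integrable
  kernel dominate. Cutting the first at x leaves four one-sided integrals, each at most 1 /
  c.\<close>

lemma integral_sin_kernel_le:
  fixes l c x :: real
  assumes l: "0 < l" and c: "0 < c" and x: "x \<in> {0..1}"
  shows "integral {0..1} (\<lambda>y. l * (1 + l * \<bar>sin (pi * (x - y))\<bar>) powr (- 1 - c)) \<le> 4 / c"
proof -
  let ?\<Phi> = "\<lambda>a y. l * (1 + l * \<bar>y - a\<bar>) powr (- 1 - c)"
  have int: "?\<Phi> a integrable_on {p..q}" for a p q
    using l by (intro integrable_continuous_interval continuous_intros) auto
  have "integral {0..1} (\<lambda>y. l * (1 + l * \<bar>sin (pi * (x - y))\<bar>) powr (- 1 - c))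
     \<le> integral {0..1} (\<lambda>y. ?\<Phi> x y + ?\<Phi> (x + 1) y + ?\<Phi> (x - 1) y)"
  proof (rule integral_le)
    show "(\<lambda>y. l * (1 + l * \<bar>sin (pi * (x - y))\<bar>) powr (- 1 - c)) integrable_on {0..1}"
      using l by (intro integrable_continuous_interval continuous_intros) auto
    show "(\<lambda>y. ?\<Phi> x y + ?\<Phi> (x + 1) y + ?\<Phi> (x - 1) y) integrable_on {0..1}"
      by (intro Henstock_Kurzweil_Integration.integrable_add int)
    fix y :: real assume y: "y \<in> {0..1}"
    have mono: "l * (1 + l * s) powr (- 1 - c) \<le> l * (1 + l * s') powr (- 1 - c)" if "0 \<le> s'" "s' \<le> s" for s s'
      using l c that by (intro mult_left_mono powr_mono2') (auto intro!: add_pos_nonneg)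
    have nn: "0 \<le> ?\<Phi> a y" for a using l by simp
    have m: "min \<bar>x - y\<bar> (1 - \<bar>x - y\<bar>) \<le> \<bar>sin (pi * (x - y))\<bar>"
      using x y by (intro abs_sin_pi_ge) (auto simp: abs_le_iff)
    consider "\<bar>y - x\<bar> \<le> \<bar>sin (pi * (x - y))\<bar>" | "\<bar>y - (x + 1)\<bar> \<le> \<bar>sin (pi * (x - y))\<bar>" | "\<bar>y - (x - 1)\<bar> \<le> \<bar>sin (pi * (x - y))\<bar>"
      using m x y by (cases "x \<le> y"; cases "\<bar>x - y\<bar> \<le> 1 - \<bar>x - y\<bar>") auto
    then show "l * (1 + l * \<bar>sin (pi * (x - y))\<bar>) powr (- 1 - c) \<le> ?\<Phi> x y + ?\<Phi> (x + 1) y + ?\<Phi> (x - 1) y"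
    proof cases
      case 1
      then show ?thesis using mono[OF abs_ge_zero 1] nn[of "x + 1"] nn[of "x - 1"] by linarith
    next
      case 2
      then show ?thesis using mono[OF abs_ge_zero 2] nn[of x] nn[of "x - 1"] by linarith
    next
      case 3
      then show ?thesis using mono[OF abs_ge_zero 3] nn[of x] nn[of "x + 1"] by linarith
    qed
  qed
  also have "\<dots> = integral {0..1} (?\<Phi> x) + integral {0..1} (?\<Phi> (x + 1)) + integral {0..1} (?\<Phi> (x - 1))"
    by (simp add: Henstock_Kurzweil_Integration.integral_add Henstock_Kurzweil_Integration.integrable_add int)
  also have "integral {0..1} (?\<Phi> x) = integral {0..x} (?\<Phi> x) + integral {x..1} (?\<Phi> x)"
    using x int by (intro Henstock_Kurzweil_Integration.integral_combine[symmetric]) auto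
  also have "integral {0..x} (?\<Phi> x) + integral {x..1} (?\<Phi> x) + integral {0..1} (?\<Phi> (x + 1)) + integral {0..1} (?\<Phi> (x - 1))
     \<le> 1 / c + 1 / c + 1 / c + 1 / c"
    using x by (intro add_mono integral_kernel_left integral_kernel_right l c) auto
  finally show ?thesis by simp
qed

text \<open>A bookkeeping device: its mass is bounded uniformly in r and x, and each cell of the
  decomposition is charged with a small multiple of the mass on that cell, so cells need not be
  counted. The exponent 1/128 leaves room below 1/64, half of the decay exponent 1/32.\<close>

definition kernel :: "nat \<Rightarrow> real \<Rightarrow> real \<Rightarrow> real" where
  "kernel r x y = (real r + 1 / 2) * (1 + (real r + 1 / 2) * \<bar>sin (pi * (x - y))\<bar>) powr (- 1 - 1 / 128)"

lemma kernel_integrable: "kernel r x integrable_on {p..q}"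
  unfolding kernel_def
  by (intro integrable_continuous_interval continuous_on_kernel continuous_on_rabs continuous_on_sin continuous_on_mult_left
      continuous_on_diff continuous_on_const continuous_on_id) auto

lemma kernel_ge:
  assumes "(real r + 1 / 2) * \<bar>sin (pi * (x - y))\<bar> \<le> R"
  shows "(real r + 1 / 2) * (1 + R) powr (- 1 - 1 / 128) \<le> kernel r x y"
  unfolding kernel_def
proof (intro mult_left_mono powr_mono2')
  show "0 < 1 + (real r + 1 / 2) * \<bar>sin (pi * (x - y))\<bar>"
    by (rule add_pos_nonneg[OF zero_less_one mult_nonneg_nonneg]) auto
qed (use assms in auto)

lemma integral_kernel_le: "x \<in> {0..1} \<Longrightarrow> integral {0..1} (kernel r x) \<le> 512"
  using integral_sin_kernel_le[of "real r + 1 / 2" "1 / 128" x] by (simp add: kernel_def[abs_def])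

text \<open>Near the singularity no cancellation is sought: the smallness of \<open>G\<close> beats
  the size 2 (r + 1/2) of the Dirichlet kernel.\<close>

lemma near_cell_bound:
  fixes G :: "real \<Rightarrow> real"
  assumes G: "continuous_on {p..q} G"
    and small: "\<And>y. y \<in> {p..q} \<Longrightarrow> \<bar>G y\<bar> \<le> \<eta> * (1 + R) powr (- 1 - 1 / 128) / 2"
    and R: "\<And>y. y \<in> {p..q} \<Longrightarrow> (real r + 1 / 2) * \<bar>sin (pi * (x - y))\<bar> \<le> R"
    and \<eta>: "0 \<le> \<eta>"
  shows "norm (integral {p..q} (\<lambda>y. of_real (G y) * dirichlet r (x - y))) \<le> \<eta> * integral {p..q} (kernel r x)"
proof -
  have "norm (integral {p..q} (\<lambda>y. of_real (G y) * dirichlet r (x - y))) \<le> integral {p..q} (\<lambda>y. \<eta> * kernel r x y)"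
  proof (rule integral_norm_bound_integral)
    show "(\<lambda>y. complex_of_real (G y) * dirichlet r (x - y)) integrable_on {p..q}"
      by (intro integrable_continuous_interval continuous_intros G)
    show "(\<lambda>y. \<eta> * kernel r x y) integrable_on {p..q}"
      by (rule integrable_on_mult_right[OF kernel_integrable])
    fix y assume y: "y \<in> {p..q}"
    have "norm (complex_of_real (G y) * dirichlet r (x - y)) \<le> (\<eta> * (1 + R) powr (- 1 - 1 / 128) / 2) * (2 * (real r + 1 / 2))"
      unfolding norm_mult norm_of_real
      by (intro mult_mono small[OF y] norm_dirichlet_le) (use order.trans[OF abs_ge_zero small[OF y]] in auto)
    also have "\<dots> = \<eta> * ((real r + 1 / 2) * (1 + R) powr (- 1 - 1 / 128))" by simp
    also have "\<dots> \<le> \<eta> * kernel r x y" by (intro mult_left_mono kernel_ge R y \<eta>)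
    finally show "norm (complex_of_real (G y) * dirichlet r (x - y)) \<le> \<eta> * kernel r x y" .
  qed
  then show ?thesis by simp
qed

text \<open>Away from the singularity the factor \<open>1 / sin\<close> of the Dirichlet kernel is frozen at the
  left end point of the cell.\<close>

lemma far_cell_bound:
  fixes G :: "real \<Rightarrow> real" and p q x B M :: real
  assumes pq: "p < q" and G: "continuous_on {p..q} G" and M: "\<And>y. y \<in> {p..q} \<Longrightarrow> \<bar>G y\<bar> \<le> M"
    and e: "e = (real r + 1 / 2) * (q - p)" "1 \<le> e"
    and far: "\<And>y. y \<in> {p..q} \<Longrightarrow> e\<^sup>2 \<le> (real r + 1 / 2) * \<bar>sin (pi * (x - y))\<bar>"
    and osc: "norm (integral {p..q} (\<lambda>y. of_real (G y) * ee ((real r + 1 / 2) * y))) \<le> B * e powr (- 1 / 32) * (q - p)"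
  shows "norm (integral {p..q} (\<lambda>y. of_real (G y) * dirichlet r (x - y))) \<le> (B + 4 * M) * (e * (e powr (- 1 / 32) / e\<^sup>2))"
proof -
  define l where "l = real r + 1 / 2"
  define s where "s y = sin (pi * (x - y))" for y
  define u where "u y = ee (l * (x - y)) - ee (- (l * (x - y)))" for y
  define J where "J = integral {p..q} (\<lambda>y. of_real (G y) * ee (l * y))"
  have l: "0 < l" and e': "e = l * (q - p)" using e by (simp_all add: l_def)
  have s_ge: "e\<^sup>2 / l \<le> \<bar>s y\<bar>" if "y \<in> {p..q}" for y
    using far[OF that] l by (simp add: l_def[symmetric] s_def pos_divide_le_eq mult.commute)
  have el: "0 < e\<^sup>2 / l" using l e(2) by simp
  have s0: "s y \<noteq> 0" if "y \<in> {p..q}" for y using s_ge[OF that] el by auto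
  have p: "p \<in> {p..q}" using pq by auto
  have M0: "0 \<le> M" using M[OF p] by linarith
  have inv: "1 / \<bar>s y\<bar> \<le> l / e\<^sup>2" if "y \<in> {p..q}" for y
    using le_imp_inverse_le[OF s_ge[OF that] el] by (simp add: inverse_eq_divide)
  \<comment> \<open>Over the cell 1 / s varies by at most 4 (q - p) (l / e^2)^2 = 4 l / e^3.
    Relative to its size l / e^2 this gains 1 / e, more than the oscillation gain e^(-1/32).\<close>
  have diff: "\<bar>1 / s y - 1 / s p\<bar> \<le> 4 * l / e ^ 3" if y: "y \<in> {p..q}" for y
  proof -
    have "\<bar>s p - s y\<bar> \<le> 4 * (q - p)"
    proof -
      have "\<bar>s p - s y\<bar> \<le> pi * \<bar>(x - p) - (x - y)\<bar>" unfolding s_def by (rule sin_pi_lipschitz)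
      also have "\<dots> \<le> 4 * (q - p)" using y pi_less_4 by (intro mult_mono) auto
      finally show ?thesis .
    qed
    moreover have "\<bar>1 / s y - 1 / s p\<bar> = \<bar>s p - s y\<bar> * ((1 / \<bar>s y\<bar>) * (1 / \<bar>s p\<bar>))"
      using s0[OF y] s0[OF p] by (simp add: diff_frac_eq abs_mult)
    moreover have "\<bar>s p - s y\<bar> * ((1 / \<bar>s y\<bar>) * (1 / \<bar>s p\<bar>)) \<le> (4 * (q - p)) * ((l / e\<^sup>2) * (l / e\<^sup>2))"
      if "\<bar>s p - s y\<bar> \<le> 4 * (q - p)"
      by (intro mult_mono inv y p that) (use l pq in auto)
    ultimately have "\<bar>1 / s y - 1 / s p\<bar> \<le> (4 * (q - p)) * ((l / e\<^sup>2) * (l / e\<^sup>2))" by presburger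
    also have "\<dots> = 4 * (l * (q - p)) * l / e ^ 4"
    proof -
      have "(4 * w) * ((l / e\<^sup>2) * (l / e\<^sup>2)) = 4 * (l * w) * l / e ^ 4" for w
        by (simp add: power2_eq_square power4_eq_xxxx mult_ac)
      then show ?thesis .
    qed
    also have "\<dots> = 4 * l / e ^ 3"
      unfolding e'[symmetric] using e(2) by (simp add: power4_eq_xxxx power3_eq_cube)
    finally show ?thesis .
  qed
  have cu: "continuous_on {p..q} u" unfolding u_def by (intro continuous_intros)
  have cs: "continuous_on {p..q} s" unfolding s_def by (intro continuous_intros)
  have nu: "norm (u y) \<le> 2" for y
    unfolding u_def using norm_triangle_ineq4[of "ee (l * (x - y))" "ee (- (l * (x - y)))"] by simp
  have D: "dirichlet r (x - y) = u y / (2 * \<i> * of_real (s y))" if "y \<in> {p..q}" for y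
    using dirichlet_sin[of r "x - y"] s0[OF that] by (simp add: l_def u_def s_def field_simps)
  let ?A = "\<lambda>y. (1 / (2 * \<i> * of_real (s p))) * (of_real (G y) * u y)"
  let ?E = "\<lambda>y. of_real (G y) * u y * (of_real (1 / s y - 1 / s p) / (2 * \<i>))"
  have split: "of_real (G y) * dirichlet r (x - y) = ?A y + ?E y" if "y \<in> {p..q}" for y
    unfolding D[OF that] using s0[OF that] s0[OF p] by (simp add: field_simps)
  have iA: "?A integrable_on {p..q}" and iG: "(\<lambda>y. of_real (G y) * u y) integrable_on {p..q}"
    by (intro integrable_continuous_interval continuous_intros G cu)+
  have iE: "?E integrable_on {p..q}"
    by (intro integrable_continuous_interval continuous_intros G cu cs) (use s0 in auto)
  have iJ: "(\<lambda>y. of_real (G y) * ee (l * y)) integrable_on {p..q}"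
    by (intro integrable_continuous_interval continuous_intros G)
  have iJ': "(\<lambda>y. cnj (of_real (G y) * ee (l * y))) integrable_on {p..q}"
    by (intro integrable_continuous_interval continuous_intros G)
  \<comment> \<open>Both exponentials of the kernel lead to the same integral J, once through its
    conjugate, because \<open>G\<close> is real.\<close>
  have uJ: "integral {p..q} (\<lambda>y. of_real (G y) * u y) = ee (l * x) * cnj J - ee (- (l * x)) * J"
  proof -
    have "of_real (G y) * u y = ee (l * x) * cnj (of_real (G y) * ee (l * y)) - ee (- (l * x)) * (of_real (G y) * ee (l * y))" for y
    proof -
      have "l * (x - y) = l * x + - (l * y)" "- (l * (x - y)) = - (l * x) + l * y" by (simp_all add: right_diff_distrib)
      then have "u y = ee (l * x) * cnj (ee (l * y)) - ee (- (l * x)) * ee (l * y)"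
        unfolding u_def by (simp only: ee_add ee_minus)
      then show ?thesis by (simp add: right_diff_distrib)
    qed
    then have "integral {p..q} (\<lambda>y. of_real (G y) * u y)
        = ee (l * x) * integral {p..q} (\<lambda>y. cnj (of_real (G y) * ee (l * y))) - ee (- (l * x)) * J"
      unfolding J_def
      by (simp only: Henstock_Kurzweil_Integration.integral_diff integrable_on_mult_right iJ iJ' integral_mult_right)
    then show ?thesis by (simp only: integral_cnj J_def)
  qed
  have nA: "norm (integral {p..q} ?A) \<le> B * (e * (e powr (- 1 / 32) / e\<^sup>2))"
  proof -
    have "norm (integral {p..q} (\<lambda>y. of_real (G y) * u y)) \<le> 2 * norm J"
      unfolding uJ using norm_triangle_ineq4[of "ee (l * x) * cnj J" "ee (- (l * x)) * J"] by (simp add: norm_mult)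
    then have "norm (integral {p..q} ?A) \<le> (1 / \<bar>s p\<bar>) * norm J"
    proof -
      have "norm (integral {p..q} ?A) = norm (integral {p..q} (\<lambda>y. of_real (G y) * u y)) / (2 * \<bar>s p\<bar>)"
        by (simp add: norm_mult norm_divide)
      then show ?thesis
        using divide_right_mono[OF \<open>norm (integral {p..q} (\<lambda>y. of_real (G y) * u y)) \<le> 2 * norm J\<close>, of "2 * \<bar>s p\<bar>"] by simp
    qed
    also have "\<dots> \<le> (l / e\<^sup>2) * (B * e powr (- 1 / 32) * (q - p))"
      using osc l by (intro mult_mono inv p) (auto simp: J_def l_def)
    also have "\<dots> = B * ((l * (q - p)) * (e powr (- 1 / 32) / e\<^sup>2))" by simp
    finally show ?thesis unfolding e'[symmetric] .
  qed
  have nE: "norm (integral {p..q} ?E) \<le> 4 * M * (e * (e powr (- 1 / 32) / e\<^sup>2))"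
  proof -
    have "norm (integral {p..q} ?E) \<le> integral {p..q} (\<lambda>y. M * 2 * ((4 * l / e ^ 3) / 2))"
    proof (rule integral_norm_bound_integral[OF iE])
      fix y assume y: "y \<in> {p..q}"
      have "norm (?E y) = \<bar>G y\<bar> * norm (u y) * (\<bar>1 / s y - 1 / s p\<bar> / 2)"
        by (simp only: norm_mult norm_divide norm_of_real) simp
      also have "\<dots> \<le> M * 2 * ((4 * l / e ^ 3) / 2)"
        by (intro mult_mono M y nu divide_right_mono diff) (use M0 in auto)
      finally show "norm (?E y) \<le> M * 2 * ((4 * l / e ^ 3) / 2)" .
    qed auto
    also have "\<dots> = 4 * M * ((l * (q - p)) * ((1 / e) / e\<^sup>2))" using pq e(2) by (simp add: power3_eq_cube power2_eq_square)
    also have "\<dots> = 4 * M * (e * ((1 / e) / e\<^sup>2))" unfolding e'[symmetric] ..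
    also have "\<dots> \<le> 4 * M * (e * (e powr (- 1 / 32) / e\<^sup>2))"
      using powr_mono[of "- 1" "- 1 / 32" e] e(2) M0
      by (intro mult_left_mono divide_right_mono) (auto simp: powr_minus_divide)
    finally show ?thesis .
  qed
  have "integral {p..q} (\<lambda>y. of_real (G y) * dirichlet r (x - y)) = integral {p..q} (\<lambda>y. ?A y + ?E y)"
    by (rule Henstock_Kurzweil_Integration.integral_cong) (rule split)
  also have "\<dots> = integral {p..q} ?A + integral {p..q} ?E"
    by (rule Henstock_Kurzweil_Integration.integral_add[OF iA iE])
  finally have eq: "integral {p..q} (\<lambda>y. of_real (G y) * dirichlet r (x - y)) = integral {p..q} ?A + integral {p..q} ?E" .
  show ?thesis unfolding eq distrib_right by (rule norm_triangle_mono[OF nA nE])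
qed

text \<open>The cell has length e / l and the majorant sees it at distance at most 45 e^2 / l, so
  its mass there is at least of order e^(-1 - 1/64), against the cell bound e^(-1 - 1/32). The
  quotient e^(-1/64) is small because 45 e^2 \<ge> R.\<close>

lemma far_cell_kernel:
  fixes p q x B M :: real
  assumes pq: "p < q" and e: "e = (real r + 1 / 2) * (q - p)" "1 \<le> e" and \<eta>: "0 \<le> \<eta>" and C: "0 \<le> C"
    and near: "\<And>y. y \<in> {p..q} \<Longrightarrow> (real r + 1 / 2) * \<bar>sin (pi * (x - y))\<bar> \<le> 45 * e\<^sup>2"
    and R: "0 < R" "R \<le> 45 * e\<^sup>2" "C * 46 powr (1 + 1 / 128) * (R / 45) powr (- 1 / 128) \<le> \<eta>"
  shows "C * (e * (e powr (- 1 / 32) / e\<^sup>2)) \<le> \<eta> * integral {p..q} (kernel r x)"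
proof -
  define P where "P = (46 * e\<^sup>2) powr (- 1 - 1 / 128)"
  have "integral {p..q} (\<lambda>y. (real r + 1 / 2) * P) \<le> integral {p..q} (kernel r x)"
  proof (rule integral_le[OF _ kernel_integrable])
    fix y assume "y \<in> {p..q}"
    then have "(real r + 1 / 2) * (1 + 45 * e\<^sup>2) powr (- 1 - 1 / 128) \<le> kernel r x y" by (intro kernel_ge near)
    moreover have "P \<le> (1 + 45 * e\<^sup>2) powr (- 1 - 1 / 128)"
      unfolding P_def using e(2) by (intro powr_mono2') (auto intro!: add_pos_nonneg)
    ultimately show "(real r + 1 / 2) * P \<le> kernel r x y"
      by (meson mult_left_mono order_trans of_nat_0_le_iff add_nonneg_nonneg zero_le_divide_1_iff zero_le_numeral)
  qed auto
  then have I: "e * P \<le> integral {p..q} (kernel r x)" using pq by (simp add: e(1) mult_ac)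
  have sq: "e\<^sup>2 = e powr 2" using e(2) by simp
  have P: "P = 46 powr (- 1 - 1 / 128) * e powr (- 2 - 1 / 64)"
    unfolding P_def sq by (simp add: powr_mult powr_powr)
  have rt: "e powr (- 1 / 64) \<le> (R / 45) powr (- 1 / 128)"
  proof -
    have "(e\<^sup>2) powr (- 1 / 128) \<le> (R / 45) powr (- 1 / 128)" using R by (intro powr_mono2') auto
    then show ?thesis unfolding sq powr_powr by simp
  qed
  have q: "e powr (- 1 / 32) / e\<^sup>2 = e powr (- 1 / 64) * e powr (- 2 - 1 / 64)"
    unfolding sq powr_diff[symmetric] powr_add[symmetric] by simp
  have "C * (e powr (- 1 / 32) / e\<^sup>2) = (C * 46 powr (1 + 1 / 128) * e powr (- 1 / 64)) * P"
  proof -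
    have "46 powr (1 + 1 / 128) * 46 powr (- 1 - 1 / 128) = (1::real)" unfolding powr_add[symmetric] by simp
    then show ?thesis unfolding P q by algebra
  qed
  also have "\<dots> \<le> \<eta> * P"
  proof (rule mult_right_mono)
    show "C * 46 powr (1 + 1 / 128) * e powr (- 1 / 64) \<le> \<eta>"
      using mult_left_mono[OF rt, of "C * 46 powr (1 + 1 / 128)"] C R(3) by simp
  qed (simp add: P_def)
  finally have "e * (C * (e powr (- 1 / 32) / e\<^sup>2)) \<le> e * (\<eta> * P)" using e(2) by (intro mult_left_mono) auto
  then show ?thesis using mult_left_mono[OF I \<eta>] by (simp add: mult_ac)
qed

section \<open>Adaptive decomposition into cells\<close>

context limit_grid begin

text \<open>Stopping rule along the dyadic tree: a cell with e = l |cell| is final if it is near (45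
  e^2 \<le> R) or far (\<sigma> \<ge> e^2 throughout), and is split otherwise. The invariant
  \<sigma> \<le> 45 e^2 keeps cells from becoming too short for their distance. The cell bounds add
  up to \<eta> times the mass of \<open>kernel\<close>.\<close>

lemma dirichlet_integral_small:
  fixes g :: "real \<Rightarrow> real"
  assumes g: "continuous_on {0..1} g" "\<And>y. y \<in> {0..1} \<Longrightarrow> \<bar>g y\<bar> \<le> Mg" and K: "0 \<le> K"
    and osc: "\<And>n k \<mu>. k < 2 ^ n \<Longrightarrow> 0 < \<mu> \<Longrightarrow> norm (integral {X n k..X n (Suc k)} (\<lambda>y. of_real (g y) * ee (\<mu> * y)))
       \<le> K * (\<mu> * len n k) powr (- 1 / 32) * len n k"
    and x: "x \<in> {0..1}" and r: "1 \<le> r" and \<eta>: "0 < \<eta>"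
    and R: "45 \<le> R" "(K + 9 * Mg) * 46 powr (1 + 1 / 128) * (R / 45) powr (- 1 / 128) \<le> \<eta>"
    and unif: "\<And>y. y \<in> {0..1} \<Longrightarrow> (real r + 1 / 2) * \<bar>sin (pi * (x - y))\<bar> \<le> R \<Longrightarrow>
       \<bar>g y - g x\<bar> \<le> \<eta> * (1 + R) powr (- 1 - 1 / 128) / 2"
  shows "norm (integral {0..1} (\<lambda>y. of_real (g y - g x) * dirichlet r (x - y))) \<le> \<eta> * 512"
proof -
  define l where "l = real r + 1 / 2"
  have l1: "1 \<le> l" using r by (simp add: l_def)
  have Mg: "0 \<le> Mg" using g(2)[OF x] by linarith
  define \<sigma> where "\<sigma> y = l * \<bar>sin (pi * (x - y))\<bar>" for y
  let ?D = "\<lambda>p q. norm (integral {p..q} (\<lambda>y. of_real (g y - g x) * dirichlet r (x - y)))"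
  have sub: "{X n k..X n (Suc k)} \<subseteq> {0..1}" if "k < 2 ^ n" for n k
    using X_le[of 0 k n] X_le[of "Suc k" "2 ^ n" n] that X_first[of n] X_last[of n] by auto
  have int: "(\<lambda>y. complex_of_real (g y - g x) * dirichlet r (x - y)) integrable_on {p..q}" if "{p..q} \<subseteq> {0..1}" for p q
    by (intro integrable_continuous_interval continuous_intros continuous_on_subset[OF g(1) that])
  \<comment> \<open>From level n1 on all cells have e \<le> 1 and are near because R \<ge> 45; this
    ends the recursion.\<close>
  obtain n1 where n1: "(11 / 20) ^ n1 < 1 / l" using real_arch_pow_inv[of "1 / l" "11 / 20"] l1 by auto
  have near: "?D (X n k) (X n (Suc k)) \<le> \<eta> * integral {X n k..X n (Suc k)} (kernel r x)"
    if k: "k < 2 ^ n" and H: "\<And>y. y \<in> {X n k..X n (Suc k)} \<Longrightarrow> \<sigma> y \<le> R" for n k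
  proof (rule near_cell_bound)
    show "continuous_on {X n k..X n (Suc k)} (\<lambda>y. g y - g x)"
      by (intro continuous_intros continuous_on_subset[OF g(1) sub[OF k]])
    fix y assume y: "y \<in> {X n k..X n (Suc k)}"
    show R': "(real r + 1 / 2) * \<bar>sin (pi * (x - y))\<bar> \<le> R" using H[OF y] by (simp add: \<sigma>_def l_def)
    show "\<bar>g y - g x\<bar> \<le> \<eta> * (1 + R) powr (- 1 - 1 / 128) / 2" using sub[OF k] y by (intro unif R') auto
  qed (use \<eta> in auto)
  have far: "?D (X n k) (X n (Suc k)) \<le> \<eta> * integral {X n k..X n (Suc k)} (kernel r x)"
    if k: "k < 2 ^ n" and e1: "1 \<le> l * len n k" and Re: "R \<le> 45 * (l * len n k)\<^sup>2"
      and H: "\<And>y. y \<in> {X n k..X n (Suc k)} \<Longrightarrow> \<sigma> y \<le> 45 * (l * len n k)\<^sup>2"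
      and L: "\<And>y. y \<in> {X n k..X n (Suc k)} \<Longrightarrow> (l * len n k)\<^sup>2 \<le> \<sigma> y" for n k
  proof -
    let ?p = "X n k" and ?q = "X n (Suc k)"
    define e where "e = l * len n k"
    have e: "e = (real r + 1 / 2) * (?q - ?p)" by (simp add: e_def l_def len_def)
    have e1': "1 \<le> e" using e1 by (simp add: e_def)
    have c: "continuous_on {?p..?q} g" by (rule continuous_on_subset[OF g(1) sub[OF k]])
    \<comment> \<open>Subtracting the constant g x costs its own transform, which decays like 1 / e
      and adds Mg to the constant.\<close>
    have osc': "norm (integral {?p..?q} (\<lambda>y. of_real (g y - g x) * ee ((real r + 1 / 2) * y)))
        \<le> (K + Mg) * e powr (- 1 / 32) * (?q - ?p)"
    proof -
      have i: "(\<lambda>y. of_real (g y) * ee (l * y)) integrable_on {?p..?q}" "(\<lambda>y. ee (l * y)) integrable_on {?p..?q}"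
        by (intro integrable_continuous_interval continuous_intros c)+
      have eq: "integral {?p..?q} (\<lambda>y. of_real (g y - g x) * ee (l * y))
          = integral {?p..?q} (\<lambda>y. of_real (g y) * ee (l * y)) - of_real (g x) * integral {?p..?q} (\<lambda>y. ee (l * y))"
        by (simp add: left_diff_distrib Henstock_Kurzweil_Integration.integral_diff i integrable_on_mult_right)
      have 1: "norm (integral {?p..?q} (\<lambda>y. of_real (g y) * ee (l * y))) \<le> K * e powr (- 1 / 32) * len n k"
        unfolding e_def using osc[OF k, of l] l1 by simp
      have "norm (integral {?p..?q} (\<lambda>y. ee (l * y))) = len n k * norm (unit_ft e)"
        using len_pos[of n k] X_less[of n k] by (simp add: integral_ee_eq_unit_ft norm_mult e_def len_def flip: of_real_diff)
      also have "\<dots> \<le> len n k * e powr (- 1 / 32)"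
      proof (rule mult_left_mono)
        have "norm (unit_ft e) \<le> 1 / e" using e1' by (intro norm_unit_ft_le) auto
        also have "\<dots> \<le> e powr (- 1 / 32)" using powr_mono[of "- 1" "- 1 / 32" e] e1' by (simp add: powr_minus_divide)
        finally show "norm (unit_ft e) \<le> e powr (- 1 / 32)" .
      qed (use len_pos[of n k] in auto)
      finally have 2: "norm (of_real (g x) * integral {?p..?q} (\<lambda>y. ee (l * y))) \<le> Mg * (len n k * e powr (- 1 / 32))"
        unfolding norm_mult norm_of_real using Mg by (intro mult_mono g(2) x) auto
      have "norm (integral {?p..?q} (\<lambda>y. of_real (g y - g x) * ee (l * y))) \<le> K * e powr (- 1 / 32) * len n k + Mg * (len n k * e powr (- 1 / 32))"
        unfolding eq by (rule order.trans[OF norm_triangle_ineq4 add_mono[OF 1 2]])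
      also have "\<dots> = (K + Mg) * e powr (- 1 / 32) * len n k" by (simp add: algebra_simps)
      finally show ?thesis by (simp only: l_def len_def)
    qed
    have "?D ?p ?q \<le> ((K + Mg) + 4 * (2 * Mg)) * (e * (e powr (- 1 / 32) / e\<^sup>2))"
    proof (rule far_cell_bound[OF X_less _ _ e e1' _ osc'])
      show "continuous_on {?p..?q} (\<lambda>y. g y - g x)" by (intro continuous_intros c)
      fix y assume y: "y \<in> {?p..?q}"
      show "\<bar>g y - g x\<bar> \<le> 2 * Mg" using g(2)[OF x] g(2)[of y] y sub[OF k] abs_triangle_ineq4[of "g y" "g x"] by auto
      show "e\<^sup>2 \<le> (real r + 1 / 2) * \<bar>sin (pi * (x - y))\<bar>" using L[OF y] by (simp add: e_def \<sigma>_def l_def)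
    qed
    also have "((K + Mg) + 4 * (2 * Mg)) = K + 9 * Mg" by simp
    also have "(K + 9 * Mg) * (e * (e powr (- 1 / 32) / e\<^sup>2)) \<le> \<eta> * integral {?p..?q} (kernel r x)"
    proof (rule far_cell_kernel[OF X_less e e1' _ _ _ _ _ R(2)])
      fix y assume y: "y \<in> {?p..?q}"
      show "(real r + 1 / 2) * \<bar>sin (pi * (x - y))\<bar> \<le> 45 * e\<^sup>2" using H[OF y] by (simp add: e_def \<sigma>_def l_def)
    qed (use \<eta> K Mg R Re in \<open>auto simp: e_def\<close>)
    finally show ?thesis .
  qed
  \<comment> \<open>The number m bounds how many levels may still be descended.\<close>
  have claim: "?D (X n k) (X n (Suc k)) \<le> \<eta> * integral {X n k..X n (Suc k)} (kernel r x)"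
    if "n1 \<le> n + m" "k < 2 ^ n" "\<And>y. y \<in> {X n k..X n (Suc k)} \<Longrightarrow> \<sigma> y \<le> 45 * (l * len n k)\<^sup>2" for m n k
    using that
  proof (induction m arbitrary: n k)
    case 0
    have "l * len n k \<le> l * (11 / 20) ^ n1"
      using order.trans[OF len_bounds(2)[of n k] power_decreasing[of n1 n "11 / 20 :: real"]] 0(1) l1 by (intro mult_left_mono) auto
    also have "\<dots> \<le> 1" using n1 l1 by (simp add: field_simps)
    finally have "(l * len n k)\<^sup>2 \<le> 1" using l1 len_pos[of n k] by (intro power_le_one) auto
    then show ?case using 0(3) R(1) by (intro near 0(2)) fastforce
  next
    case (Suc m)
    let ?p = "X n k" and ?q = "X n (Suc k)" and ?c = "X (Suc n) (2 * k + 1)"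
    define e where "e = l * len n k"
    have e0: "0 < e" using l1 len_pos[of n k] by (simp add: e_def)
    consider "45 * e\<^sup>2 \<le> R" | "R < 45 * e\<^sup>2" "\<And>y. y \<in> {?p..?q} \<Longrightarrow> e\<^sup>2 \<le> \<sigma> y"
      | y0 where "R < 45 * e\<^sup>2" "y0 \<in> {?p..?q}" "\<sigma> y0 < e\<^sup>2"
      by (meson not_le)
    then show ?case
    proof cases
      case 1
      then show ?thesis using Suc.prems(3) by (intro near Suc.prems(2)) (force simp: e_def)
    next
      case 2
      have "1 \<le> e"
      proof (rule ccontr)
        assume "\<not> 1 \<le> e"
        then have "e\<^sup>2 \<le> 1" using e0 by (intro power_le_one) auto
        then show False using 2(1) R(1) by linarith
      qed
      then show ?thesis using 2 Suc.prems by (intro far) (auto simp: e_def)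
    next
      case 3
      have e1: "1 \<le> e"
      proof (rule ccontr)
        assume "\<not> 1 \<le> e"
        then have "e\<^sup>2 \<le> 1" using e0 by (intro power_le_one) auto
        then show False using 3(1) R(1) by linarith
      qed
      \<comment> \<open>One point with \<sigma> < e^2 forces \<sigma> \<le> e^2 + 4 e \<le> 5 e^2 on
        the whole cell. A child has at least 9/20 of the length, and 45 (9/20)^2 > 5 restores the
        invariant.\<close>
      have \<sigma>5: "\<sigma> y \<le> 5 * e\<^sup>2" if y: "y \<in> {?p..?q}" for y
      proof -
        have "\<bar>sin (pi * (x - y)) - sin (pi * (x - y0))\<bar> \<le> pi * \<bar>(x - y) - (x - y0)\<bar>" by (rule sin_pi_lipschitz)
        also have "\<dots> \<le> 4 * len n k" using y 3(2) pi_less_4 by (intro mult_mono) (auto simp: len_def abs_le_iff)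
        finally have "\<bar>sin (pi * (x - y))\<bar> \<le> \<bar>sin (pi * (x - y0))\<bar> + 4 * len n k" by linarith
        then have "\<sigma> y \<le> l * (\<bar>sin (pi * (x - y0))\<bar> + 4 * len n k)"
          unfolding \<sigma>_def using l1 by (intro mult_left_mono) auto
        also have "\<dots> = \<sigma> y0 + 4 * e" by (simp add: \<sigma>_def e_def distrib_left)
        also have "\<dots> \<le> 5 * e\<^sup>2"
        proof -
          have "e \<le> e\<^sup>2" by (rule self_le_power[OF e1]) simp
          then show ?thesis using 3(3) by linarith
        qed
        finally show ?thesis .
      qed
      have child: "5 * e\<^sup>2 \<le> 45 * (l * len (Suc n) k')\<^sup>2" if "9 / 20 * len n k \<le> len (Suc n) k'" for k'
      proof -
        have "9 / 20 * e \<le> l * len (Suc n) k'"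
          using mult_left_mono[OF that, of l] l1 by (simp add: e_def mult_ac)
        then have "(9 / 20 * e)\<^sup>2 \<le> (l * len (Suc n) k')\<^sup>2" using e0 by (intro power_mono) auto
        moreover have "(9 / 20 * e)\<^sup>2 = 81 / 400 * e\<^sup>2" by (simp add: power2_eq_square)
        moreover have "0 \<le> (l * len (Suc n) k')\<^sup>2" by (rule zero_le_power2)
        ultimately show ?thesis by linarith
      qed
      have eqs: "X (Suc n) (2 * k) = ?p" "X (Suc n) (Suc (2 * k + 1)) = ?q"
        using X_even[of n k] X_even[of n "Suc k"] by simp_all
      have ord: "?p < ?c" "?c < ?q"
        using X_less[of "Suc n" "2 * k"] X_less[of "Suc n" "2 * k + 1"] eqs by simp_all
      have IH1: "?D ?p ?c \<le> \<eta> * integral {?p..?c} (kernel r x)"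
      proof -
        have "?D (X (Suc n) (2 * k)) (X (Suc n) (Suc (2 * k))) \<le> \<eta> * integral {X (Suc n) (2 * k)..X (Suc n) (Suc (2 * k))} (kernel r x)"
        proof (rule Suc.IH)
          fix y assume "y \<in> {X (Suc n) (2 * k)..X (Suc n) (Suc (2 * k))}"
          then have "y \<in> {?p..?q}" using eqs ord by auto
          then show "\<sigma> y \<le> 45 * (l * len (Suc n) (2 * k))\<^sup>2" using \<sigma>5 child[OF len_children(1)] order_trans by blast
        qed (use Suc.prems in auto)
        then show ?thesis by (simp add: eqs)
      qed
      have IH2: "?D ?c ?q \<le> \<eta> * integral {?c..?q} (kernel r x)"
      proof -
        have "?D ?c (X (Suc n) (Suc (2 * k + 1))) \<le> \<eta> * integral {?c..X (Suc n) (Suc (2 * k + 1))} (kernel r x)"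
        proof (rule Suc.IH)
          fix y assume "y \<in> {?c..X (Suc n) (Suc (2 * k + 1))}"
          then have "y \<in> {?p..?q}" using eqs ord by auto
          then show "\<sigma> y \<le> 45 * (l * len (Suc n) (2 * k + 1))\<^sup>2" using \<sigma>5 child[OF len_children(3)] order_trans by blast
        qed (use Suc.prems in auto)
        then show ?thesis by (simp only: eqs)
      qed
      have comb: "integral {?p..?q} (\<lambda>y. of_real (g y - g x) * dirichlet r (x - y))
         = integral {?p..?c} (\<lambda>y. of_real (g y - g x) * dirichlet r (x - y)) + integral {?c..?q} (\<lambda>y. of_real (g y - g x) * dirichlet r (x - y))"
        using ord int[OF sub[OF Suc.prems(2)]] by (intro Henstock_Kurzweil_Integration.integral_combine[symmetric]) auto
      have "integral {?p..?q} (kernel r x) = integral {?p..?c} (kernel r x) + integral {?c..?q} (kernel r x)"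
        using ord kernel_integrable by (intro Henstock_Kurzweil_Integration.integral_combine[symmetric]) auto
      then show ?thesis unfolding comb using norm_triangle_mono[OF IH1 IH2] by (simp add: distrib_left)
    qed
  qed
  have "?D (X 0 0) (X 0 (Suc 0)) \<le> \<eta> * integral {X 0 0..X 0 (Suc 0)} (kernel r x)"
  proof (rule claim[of 0 n1 0])
    fix y
    have "\<sigma> y \<le> l * 1" unfolding \<sigma>_def using l1 by (intro mult_left_mono) auto
    also have "\<dots> \<le> 45 * l\<^sup>2" using l1 mult_mono[of 1 l 1 l] by (simp add: power2_eq_square)
    finally show "\<sigma> y \<le> 45 * (l * len 0 0)\<^sup>2" by (simp add: len_def X_0)
  qed auto
  moreover have "\<eta> * integral {0..1} (kernel r x) \<le> \<eta> * 512"
    using integral_kernel_le[OF x] \<eta> by (intro mult_left_mono) auto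
  ultimately show ?thesis by (simp add: X_0)
qed

text \<open>R is fixed first, independently of r, so that far cells are negligible. Only then is r
  taken so large that \<sigma> \<le> R forces y to be close to x on the circle, where g varies
  little.\<close>

lemma dirichlet_integral_converges:
  fixes g :: "real \<Rightarrow> real"
  assumes g: "continuous_on {0..1} g" and per: "g 0 = g 1" and K: "0 \<le> K"
    and osc: "\<And>n k \<mu>. k < 2 ^ n \<Longrightarrow> 0 < \<mu> \<Longrightarrow> norm (integral {X n k..X n (Suc k)} (\<lambda>y. of_real (g y) * ee (\<mu> * y)))
       \<le> K * (\<mu> * len n k) powr (- 1 / 32) * len n k"
    and \<epsilon>: "0 < \<epsilon>"
  obtains r0 where "\<And>r x. r0 \<le> r \<Longrightarrow> x \<in> {0..1} \<Longrightarrow> norm (integral {0..1} (\<lambda>y. of_real (g y - g x) * dirichlet r (x - y))) \<le> \<epsilon>"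
proof -
  obtain Mg where Mg: "\<And>y. y \<in> {0..1} \<Longrightarrow> \<bar>g y\<bar> \<le> Mg"
  proof -
    obtain a where "\<forall>y\<in>{0..1}. \<bar>g y\<bar> \<le> a"
      using compact_imp_bounded[OF compact_continuous_image[OF g compact_Icc]] by (auto simp: bounded_iff)
    then show ?thesis using that by blast
  qed
  define \<eta> where "\<eta> = \<epsilon> / 512"
  have \<eta>: "0 < \<eta>" using \<epsilon> by (simp add: \<eta>_def)
  define C where "C = (K + 9 * Mg) * 46 powr (1 + 1 / 128)"
  have "((\<lambda>R::real. C * (R / 45) powr (- 1 / 128)) \<longlongrightarrow> C * 0) at_top"
    by (intro tendsto_mult tendsto_const tendsto_neg_powr filterlim_tendsto_pos_mult_at_top[OF tendsto_const[of "1 / 45"] _ filterlim_ident, simplified]) auto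
  then have "\<forall>\<^sub>F R::real in at_top. C * (R / 45) powr (- 1 / 128) < \<eta>"
    using \<eta> by (intro order_tendstoD(2)) auto
  then obtain R where R: "45 \<le> R" "C * (R / 45) powr (- 1 / 128) \<le> \<eta>"
  proof -
    have "\<forall>\<^sub>F R::real in at_top. C * (R / 45) powr (- 1 / 128) < \<eta> \<and> 45 \<le> R"
      using \<open>\<forall>\<^sub>F R in at_top. C * (R / 45) powr (- 1 / 128) < \<eta>\<close> eventually_ge_at_top by (rule eventually_conj)
    then obtain R where "C * (R / 45) powr (- 1 / 128) < \<eta> \<and> 45 \<le> R"
      using eventually_happens'[OF trivial_limit_at_top_linorder] by blast
    then show ?thesis using that[of R] by linarith
  qed
  \<comment> \<open>Half of the permitted variation: if x and y are close across the point 0 = 1,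
    the comparison takes two steps, through g 0 = g 1.\<close>
  define \<rho> where "\<rho> = \<eta> * (1 + R) powr (- 1 - 1 / 128) / 4"
  have \<rho>: "0 < \<rho>" using \<eta> R(1) by (simp add: \<rho>_def)
  obtain d where d: "0 < d" "\<And>y y'. y \<in> {0..1} \<Longrightarrow> y' \<in> {0..1} \<Longrightarrow> \<bar>y - y'\<bar> < d \<Longrightarrow> \<bar>g y - g y'\<bar> < \<rho>"
    using compact_uniformly_continuous[OF g compact_Icc] \<rho> unfolding uniformly_continuous_on_def dist_real_def by metis
  obtain r0 where r0: "R / d < real r0" using reals_Archimedean2 by blast
  show ?thesis
  proof (rule that[of "Suc r0"])
    fix r x assume r: "Suc r0 \<le> r" and x: "x \<in> {0..1 :: real}"
    have "norm (integral {0..1} (\<lambda>y. of_real (g y - g x) * dirichlet r (x - y))) \<le> \<eta> * 512"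
    proof (rule dirichlet_integral_small[OF g Mg K osc x _ \<eta> R(1) R(2)[unfolded C_def]])
      fix y assume y: "y \<in> {0..1 :: real}" and s: "(real r + 1 / 2) * \<bar>sin (pi * (x - y))\<bar> \<le> R"
      have "R < real r0 * d" using r0 d by (simp add: field_simps)
      also have "\<dots> \<le> (real r + 1 / 2) * d" using r d by (intro mult_right_mono) auto
      finally have "(real r + 1 / 2) * \<bar>sin (pi * (x - y))\<bar> < (real r + 1 / 2) * d" using s by linarith
      then have sd: "\<bar>sin (pi * (x - y))\<bar> < d" by (simp add: mult_less_cancel_left)
      have m: "min \<bar>x - y\<bar> (1 - \<bar>x - y\<bar>) < d"
        using x y by (intro le_less_trans[OF abs_sin_pi_ge sd]) (auto simp: abs_le_iff)
      have "\<bar>g y - g x\<bar> < 2 * \<rho>"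
      proof (cases "\<bar>x - y\<bar> < d")
        case True
        then show ?thesis using d(2)[OF y x] \<rho> by (auto simp: abs_minus_commute)
      next
        case False
        then have f: "1 - \<bar>x - y\<bar> < d" using m by auto
        show ?thesis
        proof (cases "x \<le> y")
          case True
          then have "\<bar>g x - g 0\<bar> < \<rho>" "\<bar>g y - g 1\<bar> < \<rho>"
            using f x y by (auto intro!: d(2))
          then show ?thesis using per by linarith
        next
          case False
          then have "\<bar>g x - g 1\<bar> < \<rho>" "\<bar>g y - g 0\<bar> < \<rho>"
            using f x y by (auto intro!: d(2))
          then show ?thesis using per by linarith
        qed
      qed
      then show "\<bar>g y - g x\<bar> \<le> \<eta> * (1 + R) powr (- 1 - 1 / 128) / 2" by (simp add: \<rho>_def)
    qed (use r in auto)
    then show "norm (integral {0..1} (\<lambda>y. of_real (g y - g x) * dirichlet r (x - y))) \<le> \<epsilon>" by (simp add: \<eta>_def)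
  qed
qed

end

section \<open>Integrability of the derivative\<close>

context limit_grid begin

definition slope :: "nat \<Rightarrow> real \<Rightarrow> real" where
  "slope n x = (\<Sum>k<2 ^ n. 1 / (2 ^ n * len n k) * indicator {X n k..<X n (Suc k)} x)"

lemma slope_measurable [measurable]: "slope n \<in> borel_measurable borel"
  unfolding slope_def by measurable

lemma indicator_cell:
  assumes "X n k \<le> x" "x < X n (Suc k)"
  shows "indicator {X n j..<X n (Suc j)} x = (if j = k then 1 else 0)"
proof (cases j k rule: linorder_cases)
  case less
  then show ?thesis using X_le[of "Suc j" k n] assms by auto
next
  case greater
  then show ?thesis using X_le[of "Suc k" j n] assms by auto
qed (use assms in auto)

lemma cell_sum:
  assumes "X n k \<le> x" "x < X n (Suc k)" "k < 2 ^ n"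
  shows "(\<Sum>j<2 ^ n. c j * indicator {X n j..<X n (Suc j)} x) = (c k :: 'a::comm_semiring_1)"
proof -
  have "(\<Sum>j<2 ^ n. c j * indicator {X n j..<X n (Suc j)} x) = (\<Sum>j<2 ^ n. if j = k then c j else 0)"
    by (intro sum.cong refl) (simp add: indicator_cell[OF assms(1,2)])
  then show ?thesis using assms(3) by simp
qed

text \<open>On a cell, slope times length is 2^(-n). The integral thus absorbs one power, and the
  power sums of order a control the moment of order a + 1.\<close>

lemma nn_integral_slope_power:
  assumes dens: "(\<Sum>k<2 ^ n. (1 / (2 ^ n * len n k)) ^ a) \<le> 2 * 2 ^ n"
  shows "(\<integral>\<^sup>+x. ennreal (\<bar>slope n x\<bar> ^ Suc a) \<partial>lborel) \<le> 2"
proof -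
  define d where "d k = 1 / (2 ^ n * len n k)" for k
  have d0: "0 \<le> d k" for k using len_pos[of n k] by (simp add: d_def)
  have eq: "ennreal (\<bar>slope n x\<bar> ^ Suc a) \<le> (\<Sum>k<2 ^ n. ennreal (d k ^ Suc a) * indicator {X n k..<X n (Suc k)} x)" for x
  proof (cases "\<exists>k<2 ^ n. X n k \<le> x \<and> x < X n (Suc k)")
    case True
    then obtain k where k: "k < 2 ^ n" "X n k \<le> x" "x < X n (Suc k)" by blast
    show ?thesis unfolding slope_def d_def[symmetric] cell_sum[OF k(2,3,1)] using d0[of k] by simp
  next
    case False
    then have "slope n x = 0" unfolding slope_def by (intro sum.neutral) (auto simp: indicator_def)
    then show ?thesis by simp
  qed
  have "(\<integral>\<^sup>+x. ennreal (\<bar>slope n x\<bar> ^ Suc a) \<partial>lborel)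
      \<le> (\<integral>\<^sup>+x. (\<Sum>k<2 ^ n. ennreal (d k ^ Suc a) * indicator {X n k..<X n (Suc k)} x) \<partial>lborel)"
    by (intro nn_integral_mono eq)
  also have "\<dots> = (\<Sum>k<2 ^ n. ennreal (d k ^ Suc a) * ennreal (len n k))"
  proof (subst nn_integral_sum)
    show "(\<Sum>k<2 ^ n. \<integral>\<^sup>+x. ennreal (d k ^ Suc a) * indicator {X n k..<X n (Suc k)} x \<partial>lborel) = (\<Sum>k<2 ^ n. ennreal (d k ^ Suc a) * ennreal (len n k))"
      using X_less by (intro sum.cong refl) (subst nn_integral_cmult_indicator, auto simp: len_def less_imp_le)
  qed measurable
  also have "\<dots> = (\<Sum>k<2 ^ n. ennreal (d k ^ a / 2 ^ n))"
  proof (intro sum.cong refl)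
    fix k
    have "ennreal (d k ^ Suc a) * ennreal (len n k) = ennreal (d k ^ a * (d k * len n k))"
      using d0[of k] len_pos[of n k] by (simp add: ennreal_mult'[symmetric] mult_ac)
    also have "d k * len n k = 1 / 2 ^ n" using len_pos[of n k] by (simp add: d_def)
    finally show "ennreal (d k ^ Suc a) * ennreal (len n k) = ennreal (d k ^ a / 2 ^ n)" by simp
  qed
  also have "\<dots> = ennreal ((\<Sum>k<2 ^ n. d k ^ a) / 2 ^ n)"
    using d0 by (subst sum_ennreal) (auto simp: sum_divide_distrib)
  also have "\<dots> \<le> ennreal 2"
    using dens by (intro ennreal_leI) (simp add: d_def pos_divide_le_eq)
  finally show ?thesis by simp
qed

text \<open>Since x is no grid point, its cells contain it in their interior, and the slope is the
  difference quotient of \<open>F\<close> over the cell; this is the kind of quotient that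
  \<open>interval_deriv\<close> controls.\<close>

lemma slope_tendsto:
  assumes F: "\<And>y. y \<in> {0..1} \<Longrightarrow> F y = h y" and x: "0 < x" "x < 1" "x \<notin> (\<Union>n k. {X n k})"
    and d: "interval_deriv F x L"
  shows "(\<lambda>n. slope n x) \<longlonglongrightarrow> L"
  unfolding LIMSEQ_iff
proof (intro allI impI)
  fix \<epsilon> :: real assume \<epsilon>: "0 < \<epsilon>"
  obtain \<delta> where \<delta>: "0 < \<delta>" "\<And>a b. a < x \<Longrightarrow> x < b \<Longrightarrow> b - a < \<delta> \<Longrightarrow> \<bar>(F b - F a) - L * (b - a)\<bar> \<le> \<epsilon> / 2 * (b - a)"
    using d \<epsilon> unfolding interval_deriv_def by (meson half_gt_zero)
  obtain n0 where n0: "(11 / 20) ^ n0 < \<delta>" using real_arch_pow_inv[of \<delta> "11 / 20"] \<delta> by auto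
  show "\<exists>no. \<forall>n\<ge>no. norm (slope n x - L) < \<epsilon>"
  proof (intro exI allI impI)
    fix n assume n: "n0 \<le> n"
    obtain k where k: "k < 2 ^ n" "X n k \<le> x" "x < X n (Suc k)" using cell_exists[of x n] x by auto
    let ?p = "X n k" and ?q = "X n (Suc k)"
    have p: "?p < x" using k(2) x(3) by (cases "?p = x") auto
    have l: "?q - ?p = len n k" by (simp add: len_def)
    have "len n k < \<delta>" using order.trans[OF len_bounds(2)[of n k] power_decreasing[OF n, of "11 / 20 :: real"]] n0 by linarith
    then have b: "\<bar>(F ?q - F ?p) - L * len n k\<bar> \<le> \<epsilon> / 2 * len n k" using \<delta>(2)[OF p k(3)] l by simp
    have "?p \<in> {0..1}" "?q \<in> {0..1}"
      using X_le[of 0 k n] X_le[of "Suc k" "2 ^ n" n] X_first[of n] X_last[of n] k X_less[of n k] by auto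
    then have "F ?q - F ?p = 1 / 2 ^ n" using F h_X[of k n] h_X[of "Suc k" n] k(1) by (simp add: diff_divide_distrib[symmetric])
    moreover have "slope n x = 1 / (2 ^ n * len n k)" unfolding slope_def by (rule cell_sum[OF k(2,3,1)])
    ultimately have "F ?q - F ?p = slope n x * len n k" using len_pos[of n k] by simp
    then have "\<bar>slope n x - L\<bar> * len n k \<le> \<epsilon> / 2 * len n k"
      using b len_pos[of n k] by (simp add: abs_mult flip: left_diff_distrib)
    then have "\<bar>slope n x - L\<bar> \<le> \<epsilon> / 2" using len_pos[of n k] by simp
    then show "norm (slope n x - L) < \<epsilon>" using \<epsilon> by simp
  qed
qed

lemma deriv_in_Lp:
  assumes F: "\<And>x y. x \<le> y \<Longrightarrow> F x \<le> F y" "continuous_on UNIV F" "\<And>y. y \<in> {0..1} \<Longrightarrow> F y = h y"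
    and dens: "\<And>n. (\<Sum>k<2 ^ n. (1 / (2 ^ n * len n k)) ^ a) \<le> 2 * 2 ^ n" and p: "0 < p" "p \<le> real (Suc a)"
  shows "AE x in lebesgue_on {0..1}. F differentiable (at x)" "in_Lp p (lebesgue_on {0..1}) (deriv F)"
proof -
  define D where "D x = lim (\<lambda>n. slope n x)" for x
  have Dm [measurable]: "D \<in> borel_measurable borel" unfolding D_def[abs_def] by measurable
  have null: "AE x in lborel. x \<notin> {0, 1} \<union> (\<Union>n k. {X n k})"
    by (intro AE_not_in countable_imp_null_set_lborel) auto
  have der: "AE x in lborel. \<exists>L. interval_deriv F x L" by (intro AE_interval_deriv F)
  have ae: "AE x in lborel. x \<in> {0..1} \<longrightarrow> F differentiable (at x) \<and> deriv F x = D x \<and> (\<lambda>n. slope n x) \<longlonglongrightarrow> D x"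
    using der null
  proof eventually_elim
    case (elim x)
    then obtain L where L: "interval_deriv F x L" by blast
    have 1: "(F has_real_derivative L) (at x)" by (rule interval_deriv_imp_derivative[OF F(2) L])
    show ?case
    proof
      assume "x \<in> {0..1}"
      then have "(\<lambda>n. slope n x) \<longlonglongrightarrow> L" using elim by (intro slope_tendsto[OF F(3) _ _ _ L]) auto
      then show "F differentiable (at x) \<and> deriv F x = D x \<and> (\<lambda>n. slope n x) \<longlonglongrightarrow> D x"
        using 1 by (auto simp: D_def limI DERIV_imp_deriv real_differentiable_def)
    qed
  qed
  have ae': "AE x in lebesgue. x \<in> {0..1} \<longrightarrow> F differentiable (at x) \<and> deriv F x = D x \<and> (\<lambda>n. slope n x) \<longlonglongrightarrow> D x"
    by (rule AE_completion[OF ae])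
  show "AE x in lebesgue_on {0..1}. F differentiable (at x)"
    using ae' by (subst AE_restrict_space_iff) auto
  have meas: "deriv F \<in> borel_measurable (lebesgue_on {0..1})"
  proof -
    \<comment> \<open>\<open>deriv F\<close> agrees with the Borel function D only almost everywhere
      on [0, 1]; completeness of Lebesgue measure gives measurability. Outside [0, 1] D itself is
      inserted.\<close>
    let ?g = "\<lambda>x. if x \<in> {0..1} then deriv F x else D x"
    have Dl: "D \<in> borel_measurable lebesgue" by (rule measurable_completion) simp
    have "?g \<in> borel_measurable lebesgue"
      by (rule borel_measurable_AE[OF Dl]) (use ae' in eventually_elim, auto)
    then have "?g \<in> borel_measurable (lebesgue_on {0..1})" by (rule measurable_restrict_space1)
    then show ?thesis by (rule measurable_cong[THEN iffD1, rotated]) (auto simp: space_restrict_space)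
  qed
  let ?u = "\<lambda>n x. ennreal (\<bar>slope n x\<bar> ^ Suc a)"
  have um: "?u n \<in> borel_measurable lborel" for n by measurable
  have "(\<integral>\<^sup>+x. liminf (\<lambda>n. ?u n x) \<partial>lborel) \<le> liminf (\<lambda>n. \<integral>\<^sup>+x. ?u n x \<partial>lborel)"
    by (rule nn_integral_liminf[OF um])
  also have "\<dots> \<le> liminf (\<lambda>n. 2)"
    by (intro Liminf_mono always_eventually allI nn_integral_slope_power dens)
  finally have fatou: "(\<integral>\<^sup>+x. liminf (\<lambda>n. ?u n x) \<partial>lborel) \<le> 2" by (simp add: Liminf_const)
  let ?w = "\<lambda>x. indicator {0..1} x * \<bar>D x\<bar> powr p"
  have w: "integrable lborel ?w"
  proof (rule integrableI_bounded)
    show "?w \<in> borel_measurable lborel" by measurable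
    have "AE x in lborel. ennreal (norm (?w x)) \<le> indicator {0..1} x + liminf (\<lambda>n. ?u n x)"
      using ae
    proof eventually_elim
      case (elim x)
      show ?case
      proof (cases "x \<in> {0..1}")
        case True
        then have "(\<lambda>n. ?u n x) \<longlonglongrightarrow> ennreal (\<bar>D x\<bar> ^ Suc a)"
          using elim by (intro tendsto_ennrealI tendsto_power tendsto_rabs) auto
        then have lim: "liminf (\<lambda>n. ?u n x) = ennreal (\<bar>D x\<bar> ^ Suc a)"
          by (intro lim_imp_Liminf) auto
        \<comment> \<open>Covers all p up to a + 1; the additional 1 is integrable over
          [0, 1].\<close>
        have "\<bar>D x\<bar> powr p \<le> 1 + \<bar>D x\<bar> ^ Suc a"
        proof (cases "\<bar>D x\<bar> \<le> 1")
          case True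
          then have "\<bar>D x\<bar> powr p \<le> 1" using p powr_mono2[of p "\<bar>D x\<bar>" 1] by simp
          then show ?thesis using zero_le_power[OF abs_ge_zero, of "D x" "Suc a"] by linarith
        next
          case False
          then have "\<bar>D x\<bar> powr p \<le> \<bar>D x\<bar> powr real (Suc a)" using p by (intro powr_mono) auto
          also have "\<dots> = \<bar>D x\<bar> ^ Suc a" using False by (intro powr_realpow) auto
          finally show ?thesis by linarith
        qed
        then have "ennreal (\<bar>D x\<bar> powr p) \<le> ennreal (1 + \<bar>D x\<bar> ^ Suc a)" by (rule ennreal_leI)
        then show ?thesis using True unfolding lim by (simp add: ennreal_plus del: power_Suc)
      qed simp
    qed
    then have "(\<integral>\<^sup>+x. ennreal (norm (?w x)) \<partial>lborel) \<le> (\<integral>\<^sup>+x. indicator {0..1} x + liminf (\<lambda>n. ?u n x) \<partial>lborel)"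
      by (rule nn_integral_mono_AE)
    also have "\<dots> = (\<integral>\<^sup>+x. indicator {0..1 :: real} x \<partial>lborel) + (\<integral>\<^sup>+x. liminf (\<lambda>n. ?u n x) \<partial>lborel)"
      by (intro nn_integral_add) (measurable, use um in measurable)
    also have "\<dots> \<le> 1 + 2" by (intro add_mono fatou) simp
    also have "\<dots> < \<infinity>" by simp
    finally show "(\<integral>\<^sup>+x. ennreal (norm (?w x)) \<partial>lborel) < \<infinity>" .
  qed
  have "integrable lebesgue ?w" using w by (subst integrable_completion) auto
  then have "integrable (lebesgue_on {0..1}) (\<lambda>x. \<bar>D x\<bar> powr p)"
    by (subst integrable_restrict_space) auto
  moreover have "(\<lambda>x. \<bar>deriv F x\<bar> powr p) \<in> borel_measurable (lebesgue_on {0..1})"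
    by (rule measurable_compose[OF meas]) simp
  moreover have "AE x in lebesgue_on {0..1}. \<bar>D x\<bar> powr p = \<bar>deriv F x\<bar> powr p"
    using ae' by (subst AE_restrict_space_iff) auto
  ultimately have "integrable (lebesgue_on {0..1}) (\<lambda>x. \<bar>deriv F x\<bar> powr p)"
    by (rule integrable_cong_AE_imp)
  then show "in_Lp p (lebesgue_on {0..1}) (deriv F)" using meas by (simp add: in_Lp_def)
qed

end

section \<open>Maps of the circle\<close>

lemma to_circle_eq_iff: "to_circle x = to_circle y \<longleftrightarrow> x - y \<in> \<int>"
  by (rule circle.abs_eq_iff)

lemma to_circle_rep [simp]: "to_circle (rep_circle t) = t"
  by (rule Quotient3_abs_rep[OF Quotient3_circle])

lemma to_circle_frac: "to_circle (frac x) = to_circle x"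
  by (simp add: to_circle_eq_iff frac_def)

lemma continuous_on_to_circle: "continuous_on UNIV to_circle"
  by (simp add: continuous_on_open_vimage open_circle_def)

lemma circle_char_to_circle: "circle_char k (to_circle x) = ee (of_int k * x)"
  by (simp add: circle_char.abs_eq ee_def cis_conv_exp mult_ac)

lemma periodic_of_int:
  fixes F :: "real \<Rightarrow> real"
  assumes "\<And>x. F (x + 1) = F x + 1" shows "F (x + of_int k) = F x + of_int k"
proof (induction k rule: int_induct[of _ 0])
  case (step1 i)
  then show ?case using assms[of "x + of_int i"] by (simp add: add.assoc)
next
  case (step2 i)
  then show ?case using assms[of "x + of_int (i - 1)"] by simp
qed simp

text \<open>Evaluates one representative of t; if F (x + 1) = F x + 1, the choice does not
  matter.\<close>

definition circle_map :: "(real \<Rightarrow> real) \<Rightarrow> circle \<Rightarrow> circle" where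
  "circle_map F t = to_circle (F (rep_circle t))"

lemma circle_map_to_circle:
  assumes "\<And>x. F (x + 1) = F x + 1" shows "circle_map F (to_circle x) = to_circle (F x)"
proof -
  have "rep_circle (to_circle x) - x \<in> \<int>" by (simp flip: to_circle_eq_iff)
  then obtain k where "rep_circle (to_circle x) - x = of_int k" by (rule Ints_cases)
  then have "rep_circle (to_circle x) = x + of_int k" by simp
  then show ?thesis
    using periodic_of_int[of F x k] assms by (simp add: circle_map_def to_circle_eq_iff)
qed

lemma continuous_on_circle_map:
  assumes per: "\<And>x. F (x + 1) = F x + 1" and F: "continuous_on UNIV F"
  shows "continuous_on UNIV (circle_map F)"
proof -
  have "to_circle -` (circle_map F -` U) = F -` (to_circle -` U)" for U
    by (auto simp: circle_map_to_circle[of F, OF per])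
  then show ?thesis
    using F by (simp add: continuous_on_open_vimage open_circle_def)
qed

text \<open>An increasing map onto the line has no jumps. For \<open>lift\<close> and its inverse
  this replaces a gluing argument at the integers.\<close>

lemma mono_surj_continuous:
  fixes F :: "real \<Rightarrow> real"
  assumes "strict_mono F" "surj F" shows "continuous_on UNIV F"
  by (intro continuous_onI_mono) (use assms in \<open>auto simp: strict_mono_less_eq\<close>)

lemma circle_map_homeomorphism:
  assumes per: "\<And>x. F (x + 1) = F x + 1" and F: "strict_mono F" "surj F"
  shows "homeomorphism UNIV UNIV (circle_map F) (circle_map (inv F))"
proof -
  have inj: "inj F" using F(1) by (rule strict_mono_imp_inj_on)
  have inv: "inv F (F x) = x" "F (inv F x) = x" for x
    using inj F(2) by (simp_all add: surj_f_inv_f)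
  have per': "inv F (x + 1) = inv F x + 1" for x
    using inv(1)[of "inv F x + 1"] per[of "inv F x"] inv(2)[of x] by simp
  have mono': "strict_mono (inv F)"
    by (rule strict_monoI) (metis inv(2) F(1) strict_mono_less)
  have surj': "surj (inv F)" using inj by (rule inj_imp_surj_inv)
  have 1: "circle_map (inv F) (circle_map F t) = t" for t
    using circle_map_to_circle[of "inv F" "F (rep_circle t)", OF per'] inv by (simp add: circle_map_def[of F])
  have 2: "circle_map F (circle_map (inv F) t) = t" for t
    using circle_map_to_circle[of F "inv F (rep_circle t)", OF per] inv by (simp add: circle_map_def[of "inv F"])
  have "surj (circle_map F)" "surj (circle_map (inv F))"
    by (rule surjI, rule 2, rule surjI, rule 1)
  then show ?thesis
    unfolding homeomorphism_def
    using 1 2 continuous_on_circle_map[of F, OF per mono_surj_continuous[OF F]] continuous_on_circle_map[of "inv F", OF per' mono_surj_continuous[OF mono' surj']]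
    by simp
qed

section \<open>Partial sums as Dirichlet integrals\<close>

lemma fourier_partial_sum_dirichlet:
  fixes G :: "real \<Rightarrow> real"
  assumes G: "\<And>x. g (to_circle x) = of_real (G x)" "continuous_on {0..1} G"
  shows "fourier_partial_sum g r (to_circle x) = integral {0..1} (\<lambda>y. of_real (G y) * dirichlet r (x - y))"
proof -
  have coeff: "fourier_coeff g k = integral {0..1} (\<lambda>y. of_real (G y) * ee (of_int (- k) * y))" for k
    unfolding fourier_coeff_def circle_char_to_circle G(1)
    by (intro set_lebesgue_integral_eq_integral(2) set_integrable_subset[OF absolutely_integrable_continuous_real]) (auto intro!: continuous_intros G(2) absolutely_integrable_continuous_real)
  have int: "(\<lambda>y. of_real (G y) * ee (of_int (- k) * y) * ee (of_int k * x)) integrable_on {0..1}" for k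
    by (intro integrable_continuous_interval continuous_intros G(2))
  have "fourier_partial_sum g r (to_circle x)
      = (\<Sum>k\<in>{- int r..int r}. integral {0..1} (\<lambda>y. of_real (G y) * ee (of_int (- k) * y) * ee (of_int k * x)))"
    unfolding fourier_partial_sum_def circle_char_to_circle coeff by (simp only: integral_mult_left)
  also have "\<dots> = integral {0..1} (\<lambda>y. \<Sum>k\<in>{- int r..int r}. of_real (G y) * ee (of_int (- k) * y) * ee (of_int k * x))"
    by (rule Henstock_Kurzweil_Integration.integral_sum[symmetric]) (simp, rule int)
  also have "\<dots> = integral {0..1} (\<lambda>y. of_real (G y) * dirichlet r (x - y))"
  proof -
    have "ee (of_int (- k) * y) * ee (of_int k * x) = ee (of_int k * (x - y))" for k y
      unfolding ee_add[symmetric] by (simp add: algebra_simps)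
    then show ?thesis by (simp only: dirichlet_def sum_distrib_left mult.assoc)
  qed
  finally show ?thesis .
qed

lemma integral_ee_of_int: "integral {0..1} (\<lambda>y. ee (of_int k * y)) = (if k = 0 then 1 else 0)"
proof (cases "k = 0")
  case False
  let ?c = "2 * of_real pi * \<i> * of_real (of_int k) :: complex"
  let ?F = "\<lambda>t. ee (of_int k * t) / ?c"
  have "((\<lambda>t. ee (of_int k * t)) has_integral (?F 1 - ?F 0)) {0..1}"
  proof (rule fundamental_theorem_of_calculus)
    fix t :: real
    show "(?F has_vector_derivative ee (of_int k * t)) (at t within {0..1})"
      using has_vector_derivative_mult_right[OF ee_vector_derivative[of "of_int k" t "{0..1}"], of "1 / ?c"]
        False by (simp add: divide_simps mult_ac)
  qed simp
  then have "integral {0..1} (\<lambda>y. ee (of_int k * y)) = ?F 1 - ?F 0" by (rule integral_unique)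
  then show ?thesis using False by simp
qed simp

lemma integral_dirichlet: "integral {0..1} (\<lambda>y. dirichlet r (x - y)) = 1"
proof -
  have e: "ee (of_int k * (x - y)) = ee (of_int k * x) * ee (of_int (- k) * y)" for k y
    unfolding ee_add[symmetric] by (simp add: algebra_simps)
  have "integral {0..1} (\<lambda>y. dirichlet r (x - y))
      = (\<Sum>k\<in>{- int r..int r}. integral {0..1} (\<lambda>y. ee (of_int k * x) * ee (of_int (- k) * y)))"
    unfolding dirichlet_def e
    by (rule Henstock_Kurzweil_Integration.integral_sum) (auto intro!: integrable_continuous_interval continuous_intros)
  also have "\<dots> = (\<Sum>k\<in>{- int r..int r}. if k = 0 then 1 else 0)"
    unfolding integral_mult_right integral_ee_of_int by (intro sum.cong refl) auto
  finally show ?thesis by simp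
qed

text \<open>The Dirichlet kernel has integral 1, so the value at x may be moved under the
  integral.\<close>

lemma fourier_partial_sum_minus:
  fixes G :: "real \<Rightarrow> real"
  assumes G: "\<And>x. g (to_circle x) = of_real (G x)" "continuous_on {0..1} G"
  shows "fourier_partial_sum g r (to_circle x) - g (to_circle x)
     = integral {0..1} (\<lambda>y. of_real (G y - G x) * dirichlet r (x - y))"
proof -
  have i: "(\<lambda>y. of_real (G y) * dirichlet r (x - y)) integrable_on {0..1}" "(\<lambda>y. dirichlet r (x - y)) integrable_on {0..1}"
    by (intro integrable_continuous_interval continuous_intros G(2))+
  have "integral {0..1} (\<lambda>y. of_real (G y - G x) * dirichlet r (x - y))
     = integral {0..1} (\<lambda>y. of_real (G y) * dirichlet r (x - y)) - of_real (G x) * integral {0..1} (\<lambda>y. dirichlet r (x - y))"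
    by (simp add: left_diff_distrib Henstock_Kurzweil_Integration.integral_diff i integrable_on_mult_right)
  then show ?thesis by (simp add: fourier_partial_sum_dirichlet[OF G] G(1) integral_dirichlet)
qed

section \<open>The periodic lift of the limit map\<close>

context limit_grid begin

definition lift :: "real \<Rightarrow> real" where
  "lift x = h (frac x) + of_int \<lfloor>x\<rfloor>"

lemma lift_add_1: "lift (x + 1) = lift x + 1"
  by (simp add: lift_def frac_1_eq)

lemma lift_eq_h: "y \<in> {0..1} \<Longrightarrow> lift y = h y"
proof -
  assume y: "y \<in> {0..1}"
  show ?thesis
  proof (cases "y = 1")
    case False
    then have "\<lfloor>y\<rfloor> = 0" using y by (simp add: floor_eq_iff)
    then show ?thesis by (simp add: lift_def frac_def)
  qed (simp add: lift_def frac_def h_0 h_1)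
qed

lemma lift_strict_mono: "strict_mono lift"
proof (rule strict_monoI)
  fix x y :: real assume xy: "x < y"
  show "lift x < lift y"
  proof (cases "\<lfloor>x\<rfloor> = \<lfloor>y\<rfloor>")
    case True
    then have "frac x < frac y" using xy by (simp add: frac_def)
    then have "h (frac x) < h (frac y)"
      using frac_ge_0[of x] frac_lt_1[of y] by (intro h_strict_mono) auto
    then show ?thesis using True by (simp add: lift_def)
  next
    case False
    then have "\<lfloor>x\<rfloor> + 1 \<le> \<lfloor>y\<rfloor>" using floor_mono[of x y] xy by simp
    then have f: "of_int \<lfloor>x\<rfloor> + 1 \<le> (of_int \<lfloor>y\<rfloor> :: real)" by (metis of_int_1 of_int_add of_int_le_iff)
    have "h (frac x) < 1" using h_strict_mono[of "frac x" 1] frac_ge_0[of x] frac_lt_1[of x] h_1 by simp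
    moreover have "0 \<le> h (frac y)" using h_range[of "frac y"] frac_ge_0[of y] frac_lt_1[of y] by simp
    ultimately show ?thesis using f by (simp add: lift_def)
  qed
qed

lemma lift_surj: "surj lift"
proof (subst surj_def, rule allI)
  fix z :: real
  obtain y where y: "0 \<le> y" "y \<le> 1" "h y = frac z"
    using IVT'[of h 0 "frac z" 1] continuous_on_h h_0 h_1 frac_ge_0[of z] frac_lt_1[of z] by auto
  then have "lift (y + of_int \<lfloor>z\<rfloor>) = z"
    using periodic_of_int[of lift y "\<lfloor>z\<rfloor>", OF lift_add_1] lift_eq_h[of y] by (simp add: frac_def)
  then show "\<exists>x. z = lift x" by (metis)
qed

lemma lift_mono: "x \<le> y \<Longrightarrow> lift x \<le> lift y"
  using lift_strict_mono by (simp add: strict_mono_less_eq)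

lemma continuous_on_lift: "continuous_on UNIV lift"
  by (rule mono_surj_continuous[OF lift_strict_mono lift_surj])

lemma lift_absolutely_continuous:
  assumes dens: "\<And>n. (\<Sum>k<2 ^ n. (1 / (2 ^ n * len n k)) ^ a) \<le> 2 * 2 ^ n" and a: "1 \<le> a"
  shows "circle_absolutely_continuous (circle_map lift)"
proof -
  have "absolutely_continuous_on {0..1} lift"
    unfolding absolutely_continuous_on_def
  proof (intro allI impI)
    fix \<epsilon> :: real assume "0 < \<epsilon>"
    then obtain \<delta> where \<delta>: "0 < \<delta>" and H: "\<And>D. finite D \<Longrightarrow> (\<forall>(a, b)\<in>D. a \<le> b \<and> {a..b} \<subseteq> {0..1}) \<Longrightarrow>
        pairwise (\<lambda>(a, b) (c, d). {a<..<b} \<inter> {c<..<d} = {}) D \<Longrightarrow> (\<Sum>(a, b)\<in>D. b - a) < \<delta> \<Longrightarrow>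
        (\<Sum>(a, b)\<in>D. \<bar>h b - h a\<bar>) < \<epsilon>"
      using h_absolutely_continuous[OF dens a] unfolding absolutely_continuous_on_def by meson
    show "\<exists>\<delta>>0. \<forall>D. finite D \<longrightarrow> (\<forall>(a, b)\<in>D. a \<le> b \<and> {a..b} \<subseteq> {0..1}) \<longrightarrow>
        pairwise (\<lambda>(a, b) (c, d). {a<..<b} \<inter> {c<..<d} = {}) D \<longrightarrow> (\<Sum>(a, b)\<in>D. b - a) < \<delta> \<longrightarrow>
        (\<Sum>(a, b)\<in>D. \<bar>lift b - lift a\<bar>) < \<epsilon>"
    proof (intro exI[of _ \<delta>] conjI \<delta> allI impI)
      fix D :: "(real \<times> real) set"
      assume D: "finite D" "\<forall>(a, b)\<in>D. a \<le> b \<and> {a..b} \<subseteq> {0..1}"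
        "pairwise (\<lambda>(a, b) (c, d). {a<..<b} \<inter> {c<..<d} = {}) D" "(\<Sum>(a, b)\<in>D. b - a) < \<delta>"
      have "(\<Sum>(a, b)\<in>D. \<bar>lift b - lift a\<bar>) = (\<Sum>(a, b)\<in>D. \<bar>h b - h a\<bar>)"
      proof (intro sum.cong refl)
        fix x assume x: "x \<in> D"
        then have "fst x \<in> {0..1}" "snd x \<in> {0..1}" using D(2) by auto
        then show "(case x of (a, b) \<Rightarrow> \<bar>lift b - lift a\<bar>) = (case x of (a, b) \<Rightarrow> \<bar>h b - h a\<bar>)"
          by (simp add: split_def lift_eq_h)
      qed
      then show "(\<Sum>(a, b)\<in>D. \<bar>lift b - lift a\<bar>) < \<epsilon>" using H[OF D] by simp
    qed
  qed
  then show ?thesis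
    unfolding circle_absolutely_continuous_def is_circle_lift_def
    using continuous_on_lift circle_map_to_circle[of lift, OF lift_add_1] by blast
qed

end

text \<open>One grid serves all requirements: a \<ge> 1 for absolute continuity and a + 1 \<ge> p
  for the derivative. Since \<open>h\<close> maps cells into the matching dyadic intervals, f
  composed with the lift satisfies the oscillatory estimate.\<close>

lemma exists_homeomorphism:
  fixes f :: "circle \<Rightarrow> real"
  assumes f: "continuous_on UNIV f" and p: "0 < p"
  shows "\<exists>\<phi> \<psi> :: circle \<Rightarrow> circle. homeomorphism UNIV UNIV \<phi> \<psi> \<and> circle_absolutely_continuous \<phi> \<and>
     fourier_series_converges_uniformly (\<lambda>t. complex_of_real (f (\<phi> t))) \<and> circle_deriv_in_Lp p \<phi>"
proof -
  define f0 where "f0 x = f (to_circle x)" for x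
  have f0: "continuous_on UNIV f0"
    unfolding f0_def[abs_def] using continuous_on_compose2[OF f continuous_on_to_circle] by simp
  obtain M0 where M0: "\<forall>x\<in>{0..1}. \<bar>f0 x\<bar> \<le> M0"
    using compact_imp_bounded[OF compact_continuous_image[OF continuous_on_subset[OF f0] compact_Icc[of 0 1]]]
    by (auto simp: bounded_iff)
  \<comment> \<open>The cascade needs values bounded by 1; the maximum with 1 keeps the division
    safe when f vanishes.\<close>
  define M where "M = max M0 1"
  have M: "1 \<le> M" by (simp add: M_def)
  have f0M: "\<bar>f0 x\<bar> \<le> M" for x
  proof -
    have "f0 x = f0 (frac x)" by (simp add: f0_def to_circle_frac)
    moreover have "frac x \<in> {0..1}" using frac_lt_1[of x] by (simp add: less_imp_le)
    ultimately show ?thesis using M0 by (simp add: M_def le_max_iff_disj)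
  qed
  define g0 where "g0 x = f0 x / M" for x
  have g0: "continuous_on UNIV g0" "\<And>x. \<bar>g0 x\<bar> \<le> 1"
    unfolding g0_def[abs_def] using f0 f0M M by (auto intro!: continuous_intros simp: abs_divide divide_le_eq)
  obtain a :: nat where a: "1 \<le> a" "p \<le> real (Suc a)"
  proof -
    obtain a :: nat where "p \<le> real a" using real_arch_simple by blast
    then show ?thesis using that[of "Suc a"] by simp
  qed
  obtain K where K: "K > 0" and fin: "\<And>N v. \<forall>k. \<bar>v k\<bar> \<le> 1 \<Longrightarrow> \<exists>xs. xs 0 = real \<and> (\<forall>d. dyadic_grid d (xs d)) \<and>
     (\<forall>d. \<exists>p. xs (Suc d) = refine p (xs d)) \<and>
     (\<forall>d. (\<Sum>k<2 ^ d. (1 / (2 ^ d * blen (xs d) 0 k)) ^ a) \<le> 2 * 2 ^ d) \<and>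
     (\<forall>n\<le>N. \<forall>k \<mu>. 0 < \<mu> \<longrightarrow> norm (step_ft v (xs N) (N - n) k \<mu>)
        \<le> K * (\<mu> * blen (xs n) 0 k) powr (- 1 / 32) * blen (xs n) 0 k)"
    using finite_stage[of a] by blast
  obtain X where X: "limit_grid X" and dens0: "\<forall>n. (\<Sum>k<2 ^ n. (1 / (2 ^ n * (X n (Suc k) - X n k))) ^ a) \<le> 2 * 2 ^ n"
    and osc0: "\<forall>G. continuous_on {0..1} G \<longrightarrow>
       (\<forall>n k y. k < 2 ^ n \<longrightarrow> y \<in> {X n k..X n (Suc k)} \<longrightarrow> (\<exists>z\<in>{real k / 2 ^ n..real (Suc k) / 2 ^ n}. G y = g0 z)) \<longrightarrow>
       (\<forall>n k \<mu>. k < 2 ^ n \<longrightarrow> 0 < \<mu> \<longrightarrow> norm (integral {X n k..X n (Suc k)} (\<lambda>y. of_real (G y) * ee (\<mu> * y)))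
          \<le> K * (\<mu> * (X n (Suc k) - X n k)) powr (- 1 / 32) * (X n (Suc k) - X n k))"
    using exists_limit_grid[OF K g0 fin] by blast
  interpret limit_grid X by (rule X)
  have dens: "(\<Sum>k<2 ^ n. (1 / (2 ^ n * len n k)) ^ a) \<le> 2 * 2 ^ n" for n using dens0 by (simp add: len_def)
  define \<phi> where "\<phi> = circle_map lift"
  define G where "G x = f0 (lift x)" for x
  have \<phi>: "\<phi> (to_circle x) = to_circle (lift x)" for x
    unfolding \<phi>_def by (rule circle_map_to_circle[of lift, OF lift_add_1])
  have G: "complex_of_real (f (\<phi> (to_circle x))) = of_real (G x)" for x by (simp add: \<phi> G_def f0_def)
  have Gc: "continuous_on {0..1} G"
    unfolding G_def[abs_def] by (rule continuous_on_compose2[OF f0 continuous_on_subset[OF continuous_on_lift]]) auto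
  have per: "G 0 = G 1"
  proof -
    have "to_circle (lift 0) = to_circle (lift 1)"
      using lift_add_1[of 0] unfolding to_circle_eq_iff by simp
    then show ?thesis by (simp only: G_def f0_def)
  qed
  have osc: "norm (integral {X n k..X n (Suc k)} (\<lambda>y. of_real (G y) * ee (\<mu> * y)))
       \<le> (M * K) * (\<mu> * len n k) powr (- 1 / 32) * len n k" if k: "k < 2 ^ n" and \<mu>: "0 < \<mu>" for n k \<mu>
  proof -
    have "continuous_on {0..1} (\<lambda>y. G y / M)" using M by (intro continuous_intros Gc) auto
    moreover have "\<exists>z\<in>{real k / 2 ^ n..real (Suc k) / 2 ^ n}. G y / M = g0 z"
      if k: "k < 2 ^ n" and y: "y \<in> {X n k..X n (Suc k)}" for n k y
    \<comment> \<open>\<open>h_between\<close> places the image of a point of the cell in the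
      matching dyadic interval.\<close>
    proof (rule bexI[of _ "h y"])
      have "y \<in> {0..1}" using y X_le[of 0 k n] X_le[of "Suc k" "2 ^ n" n] k X_first[of n] X_last[of n] by auto
      then show "G y / M = g0 (h y)" by (simp add: G_def g0_def lift_eq_h)
      show "h y \<in> {real k / 2 ^ n..real (Suc k) / 2 ^ n}" using h_between[of n k y] k y by auto
    qed
    ultimately have "norm (integral {X n k..X n (Suc k)} (\<lambda>y. of_real (G y / M) * ee (\<mu> * y)))
          \<le> K * (\<mu> * len n k) powr (- 1 / 32) * len n k"
      using osc0 k \<mu> unfolding len_def by blast
    moreover have "integral {X n k..X n (Suc k)} (\<lambda>y. of_real (G y) * ee (\<mu> * y))
        = of_real M * integral {X n k..X n (Suc k)} (\<lambda>y. of_real (G y / M) * ee (\<mu> * y))"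
    proof -
      have "complex_of_real (G y) * ee (\<mu> * y) = of_real M * (of_real (G y / M) * ee (\<mu> * y))" for y using M by simp
      then show ?thesis by (simp only: integral_mult_right)
    qed
    moreover have "norm (of_real M * z) \<le> (M * K) * b * c" if "norm z \<le> K * b * c" for z :: complex and b c :: real
      using mult_left_mono[OF that, of M] M by (simp add: norm_mult mult.assoc)
    ultimately show ?thesis by presburger
  qed
  have MK: "0 \<le> M * K" using M K by simp
  have conv: "fourier_series_converges_uniformly (\<lambda>t. complex_of_real (f (\<phi> t)))"
    unfolding fourier_series_converges_uniformly_def uniformly_convergent_on_def
  proof (rule exI, rule uniform_limitI)
    fix \<epsilon> :: real assume \<epsilon>: "0 < \<epsilon>"
    then have "0 < \<epsilon> / 2" by simp
    obtain r0 where r0: "\<And>r x. r0 \<le> r \<Longrightarrow> x \<in> {0..1} \<Longrightarrow> norm (integral {0..1} (\<lambda>y. of_real (G y - G x) * dirichlet r (x - y))) \<le> \<epsilon> / 2"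
      by (rule dirichlet_integral_converges[OF Gc per MK osc \<open>0 < \<epsilon> / 2\<close>]) (assumption | rule that, blast)+
    show "\<forall>\<^sub>F r in sequentially. \<forall>t\<in>UNIV. dist (fourier_partial_sum (\<lambda>t. complex_of_real (f (\<phi> t))) r t) (complex_of_real (f (\<phi> t))) < \<epsilon>"
      unfolding eventually_sequentially
    proof (intro exI allI impI ballI)
      fix r t assume r: "r0 \<le> r"
      define x where "x = frac (rep_circle t)"
      have t: "t = to_circle x" by (simp add: x_def to_circle_frac)
      have x: "x \<in> {0..1}" using frac_lt_1[of "rep_circle t"] by (simp add: x_def less_imp_le)
      have "dist (fourier_partial_sum (\<lambda>t. complex_of_real (f (\<phi> t))) r t) (complex_of_real (f (\<phi> t))) \<le> \<epsilon> / 2"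
        unfolding t dist_norm fourier_partial_sum_minus[OF G Gc] by (rule r0[OF r x])
      then show "dist (fourier_partial_sum (\<lambda>t. complex_of_real (f (\<phi> t))) r t) (complex_of_real (f (\<phi> t))) < \<epsilon>" using \<epsilon> by simp
    qed
  qed
  have "circle_deriv_in_Lp p \<phi>"
    unfolding circle_deriv_in_Lp_def is_circle_lift_def
    using deriv_in_Lp[of lift, OF lift_mono continuous_on_lift lift_eq_h dens p a(2)] continuous_on_lift \<phi> by blast
  moreover have "circle_absolutely_continuous \<phi>"
    unfolding \<phi>_def by (rule lift_absolutely_continuous[OF dens a(1)])
  moreover have "homeomorphism UNIV UNIV \<phi> (circle_map (inv lift))"
    unfolding \<phi>_def by (rule circle_map_homeomorphism[of lift, OF lift_add_1 lift_strict_mono lift_surj])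
  ultimately show ?thesis using conv by blast
qed

theorem theorem2:
  fixes f :: "circle \<Rightarrow> real"
  assumes "continuous_on UNIV f"
  shows "(\<exists>\<phi> \<psi> :: circle \<Rightarrow> circle.
            homeomorphism UNIV UNIV \<phi> \<psi> \<and>
            circle_absolutely_continuous \<phi> \<and>
            fourier_series_converges_uniformly (\<lambda>t. complex_of_real (f (\<phi> t)))) \<and>
         (\<forall>p::real. p > 0 \<longrightarrow>
            (\<exists>\<phi> \<psi> :: circle \<Rightarrow> circle.
               homeomorphism UNIV UNIV \<phi> \<psi> \<and>
               circle_absolutely_continuous \<phi> \<and>
               fourier_series_converges_uniformly (\<lambda>t. complex_of_real (f (\<phi> t))) \<and>
               circle_deriv_in_Lp p \<phi>))"
proof (intro conjI allI impI)
  \<comment> \<open>The first claim follows from the case p = 1.\<close>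
  show "\<exists>\<phi> \<psi> :: circle \<Rightarrow> circle. homeomorphism UNIV UNIV \<phi> \<psi> \<and> circle_absolutely_continuous \<phi> \<and>
      fourier_series_converges_uniformly (\<lambda>t. complex_of_real (f (\<phi> t)))"
    using exists_homeomorphism[OF assms zero_less_one] by blast
qed (rule exists_homeomorphism[OF assms])

end
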